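(* Let $\{e_A\mid A\in\Xi_{N,2r}\}$ be the natural basis of the $\boldsymbol q$-Schur algebra $S_{\boldsymbol q,1}^{\jmath}(n,r)$ of type $B$ and $\{\phi_{\check{\mathbb A}}\mid\check{\mathbb A}\in\check\Xi(n,r)\}$ the natural basis of the $\boldsymbol q$-Schur algebra $S^{\kappa}_{\boldsymbol q}(n,r)$ of type $D$ (identified with $S^{D}_{\boldsymbol q}(n,r)$), both over $\mathbb Z[\boldsymbol q]$. Let $h\in[1,n]$, and let $A,B,C\in\Xi_{N,2r}$ be such that $B-E^\theta_{h,h+1}$ and $C-E^\theta_{h+1,h}$ are diagonal matrices. Suppose that in $S_{\boldsymbol q,1}^{\jmath}(n,r)$ $$e_Be_A=\delta_{\mathrm{co}(B),\mathrm{ro}(A)}\sum_{1\le p\le N}g_{h,A,p}\,e_{{}_hA_p},\qquad e_Ce_A=\delta_{\mathrm{co}(C),\mathrm{ro}(A)}\sum_{1\le p\le N}g'_{h,A,\overline p}\,e_{{}_hA_{\overline p}}$$ with $g_{h,A,p},g'_{h,A,\overline p}\in\mathbb Z[\boldsymbol q]$ (where $e_{A'}:=0$ if $A'\notin\Xi_{N,2r}$). Let $\check{\mathbb A},\check{\mathbb B},\check{\mathbb C}\in\check\Xi(n,r)$ be elements associated with $A,B,C$ respectively (where $\dot M$ is associated with $M$ if the central entry of $M$ is nonzero, and ${}^{\varepsilon}M^{\varepsilon'}$ with $\varepsilon\varepsilon'=\mathrm{sgn}(M)$ is associated with $M$ if the central entry of $M$ is $0$). Then every nonzero structure constant appearing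 in the expansion of $\phi_{\check{\mathbb B}}\phi_{\check{\mathbb A}}$ in the basis $\{\phi_{\check{\mathbb A}'}\}$ is one of the $g_{h,A,p}$ $(1\le p\le N)$, and every nonzero structure constant appearing in the expansion of $\phi_{\check{\mathbb C}}\phi_{\check{\mathbb A}}$ is one of the $g'_{h,A,\overline p}$ or $\tfrac12g'_{h,A,\overline p}$ $(1\le p\le N)$.
   Context: Let $n\ge1$, $r\ge4$, $N=2n+1$, $[a,b]=\{x\in\mathbb Z:a\le x\le b\}$, $\mathcal A=\mathbb Z[\boldsymbol q]$ with $\boldsymbol q$ an indeterminate. Type $B$. $W$ is the group of permutations $w$ of $[1,2r]$ with $w(i)+w(2r+1-i)=2r+1$ for all $i$ (Weyl group of type $B_r$), with Coxeter generators $s_i=(i,i+1)(2r-i,2r+1-i)$ ($1\le i<r$) and $s_r=(r,r+1)$. $H=H_{\boldsymbol q,1}$ is the $\mathcal A$-algebra generated by $T_1,\dots,T_r$ with relations $T_iT_j=T_jT_i$ ($|i-j|\ge2$), $T_jT_{j+1}T_j=T_{j+1}T_jT_{j+1}$ ($1\le j<r-1$), $T_{r-1}T_rT_{r-1}T_r=T_rT_{r-1}T_rT_{r-1}$, $T_i^2=(\boldsymbol q-1)T_i+\boldsymbol q$ ($i<r$), $T_r^2=1$; it has $\mathcal A$-basis $\{T_w\}_{w\in W}$, $T_w=T_{i_1}\cdots T_{i_l}$ for a reduced expression $w=s_{i_1}\cdots s_{i_l}$. $\Lambda(n+1,r)=\{\lambda\in\mathbb N^{n+1}:\sum\lambda_i=r\}$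 and $\widehat\lambda=(\lambda_1,\dots,\lambda_n,2\lambda_{n+1},\lambda_n,\dots,\lambda_1)$. $W_\lambda$ is generated by the $s_j$, $j\in[1,r]$, with $j\notin\{\lambda_1+\dots+\lambda_i: i\in[1,n]\}$; $x_\lambda=\sum_{w\in W_\lambda}T_w$. $S^{\jmath}_{\boldsymbol q,1}(n,r)=S^{B}_{\boldsymbol q,1}(n,r)=\mathrm{End}_H(\bigoplus_{\lambda\in\Lambda(n+1,r)}x_\lambda H)$ (product is composition). $\Xi_{N,2r}$ is the set of $N\times N$ matrices $A=(a_{i,j})$ over $\mathbb N$ with $a_{i,j}=a_{N+1-i,N+1-j}$ and $\sum a_{i,j}=2r$; $\mathrm{ro}(A)$, $\mathrm{co}(A)$ are the vectors of row sums and column sums. For $\lambda\in\Lambda(n+1,r)$ let $R_i^{\widehat\lambda}$ ($1\le i\le N$) be the consecutive intervals of lengths $\widehat\lambda_i$ partitioning $[1,2r]$. The map $(\lambda,d,\mu)\mapsto(|R_i^{\widehat\lambda}\cap dR_j^{\widehat\mu}|)_{i,j}$, with $\lambda,\mu\in\Lambda(n+1,r)$ and $d$ a minimal length representative of a $W_\lambda$-$W_\mu$ double coset, is a bijection onto $\Xi_{N,2r}$; if $A$ is the image of $(\lambda,d,\mu)$ then $\mathrm{ro}(A)=\widehat\lambda$, $\mathrm{co}(A)=\widehat\mu$, $d_A:=d$, and $e_A\in S^{\jmath}_{\boldsymbol q,1}(n,r)$ is given by $e_A(x_\nu h)=\delta_{\mu,\nu}\big(\sum_{w\in W_\lambda dW_\mu}T_w\big)h$.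 $E^\theta_{i,j}=E_{i,j}+E_{N+1-i,N+1-j}$ with $E_{i,j}$ matrix units; ${}_hA_p=A+E^\theta_{h,p}-E^\theta_{h+1,p}$ and ${}_hA_{\overline p}=A-E^\theta_{h,p}+E^\theta_{h+1,p}$. Type $D$. $\check W\le W$ is the subgroup of $w$ such that $\#\{i\in[1,r]:w(i)>r\}$ is even (Weyl group of type $D_r$), with Coxeter generators $s_1,\dots,s_{r-1},s_rs_{r-1}s_r$; $\check H\subset H$ is the subalgebra generated by $T_1,\dots,T_{r-1},T_rT_{r-1}T_r$, with basis $\{T_w\}_{w\in\check W}$. $S^{\kappa}_{\boldsymbol q}(n,r)=\mathrm{End}_{\check H}(\bigoplus_{\lambda}x_\lambda H|_{\check H})$. $\Lambda^{D}(n,r)$ consists of symbols $\lambda^\bullet$ for $\lambda\in\Lambda(n+1,r)$ with $\lambda_{n+1}\ne0$, and $\lambda^+,\lambda^-$ for $\lambda$ with $\lambda_{n+1}=0$; $\check W_{\lambda^\bullet}=W_\lambda\cap\check W$, $\check W_{\lambda^+}=W_\lambda$, $\check W_{\lambda^-}=s_rW_\lambda s_r$. For $\alpha\in\Lambda^{D}(n,r)$, $\check x_\alpha=\sum_{w\in\check W_\alpha}T_w$, and $S^{D}_{\boldsymbol q}(n,r)=\mathrm{End}_{\check H}(\bigoplus_{\alpha\in\Lambda^{D}(n,r)}\check x_\alpha\check H)$. The algebras $S^\kappa_{\boldsymbol q}(n,r)$ and $S^{D}_{\boldsymbol q}(n,r)$ are identified via the $\check H$-isomorphisms $x_\lambda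 H=x_\lambda\check H\oplus x_\lambda T_r\check H\cong\check x_{\lambda^+}\check H\oplus\check x_{\lambda^-}\check H$ ($\lambda_{n+1}=0$, the second summand by left multiplication by $T_r$) and $x_\lambda H=(1+T_r)\check x_{\lambda^\bullet}\check H\cong\check x_{\lambda^\bullet}\check H$ ($\lambda_{n+1}\neq0$). For $\alpha,\beta\in\Lambda^{D}(n,r)$ and $d$ the minimal length representative (for $\check W$) of a $\check W_\alpha$-$\check W_\beta$ double coset in $\check W$, $\phi^d_{\alpha,\beta}(\check x_\gamma h)=\delta_{\beta,\gamma}\sum_{w\in\check W_\alpha d\check W_\beta}T_wh$. For $A\in\Xi_{N,2r}$, $\mathrm{sgn}(A)\in\{+,-\}$ is $+$ iff $\sum_{i\in[1,n],\,j\in[n+2,N]}a_{i,j}$ is even; signs multiply as usual. $\check\Xi(n,r)$ is the set of symbols $\dot A$ for $A\in\Xi_{N,2r}$ with $a_{n+1,n+1}\ne0$ and ${}^{\varepsilon}A^{\varepsilon'}$ for $A\in\Xi_{N,2r}$ with $a_{n+1,n+1}=0$, $\varepsilon,\varepsilon'\in\{+,-\}$, $\varepsilon\varepsilon'=\mathrm{sgn}(A)$. With $\mathrm{ro}(A)=\widehat\lambda$, $\mathrm{co}(A)=\widehat\mu$, put $\lambda^{[\varepsilon]}=\lambda^\varepsilon$ if $\lambda_{n+1}=0$, $\lambda^{[\varepsilon]}=\lambda^\bullet$ if $\lambda_{n+1}\neq0$ (same for $\mu$), $s^{+}=1$, $s^{-}=s_r$. Then $\phi_{\dot A}=\phi^{d}_{\lambda^\bullet,\mu^\bullet}$,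 $d$ the minimal representative of $\check W_{\lambda^\bullet}d_A\check W_{\mu^\bullet}$ if $d_A\in\check W$, of $\check W_{\lambda^\bullet}s_rd_A\check W_{\mu^\bullet}$ if $d_A\notin\check W$; and $\phi_{{}^{\varepsilon}A^{\varepsilon'}}=\phi^{d}_{\lambda^{[\varepsilon]},\mu^{[\varepsilon']}}$, $d$ the minimal representative of $\check W_{\lambda^{[\varepsilon]}}s^{\varepsilon}d_As^{\varepsilon'}\check W_{\mu^{[\varepsilon']}}$. These elements form a basis. *)

theory Defs
  imports
    "HOL-Algebra.QuotRing"
    "HOL-Algebra.Generated_Groups"
    "HOL-Algebra.Generated_Rings"
    "HOL-Algebra.Module"
    "HOL-Library.Poly_Mapping"
    "HOL-Computational_Algebra.Polynomial"
    "HOL-Combinatorics.Permutations"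
begin

section \<open>The Weyl groups of type B and D\<close>

definition weylB :: "nat \<Rightarrow> (nat \<Rightarrow> nat) monoid" where
  "weylB r = \<lparr>carrier = {w. w permutes {1..2*r} \<and> (\<forall>i\<in>{1..2*r}. w i + w (2*r + 1 - i) = 2*r + 1)},
              monoid.mult = (\<circ>), one = id\<rparr>"

definition sB :: "nat \<Rightarrow> nat \<Rightarrow> nat \<Rightarrow> nat" where
  "sB r i = (if i = r then transpose r (r + 1)
             else transpose i (i + 1) \<circ> transpose (2*r - i) (2*r + 1 - i))"

definition weylD :: "nat \<Rightarrow> (nat \<Rightarrow> nat) set" where
  "weylD r = {w \<in> carrier (weylB r). even (card {i \<in> {1..r}. w i > r})}"

text \<open>In type D the generator with index \<open>r\<close> is \<open>s\<^sub>r s\<^sub>r\<^sub>-\<^sub>1 s\<^sub>r\<close>.\<close>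

definition sD :: "nat \<Rightarrow> nat \<Rightarrow> nat \<Rightarrow> nat" where
  "sD r i = (if i = r then sB r r \<circ> sB r (r - 1) \<circ> sB r r else sB r i)"

definition word_prod :: "(nat \<Rightarrow> nat \<Rightarrow> nat) \<Rightarrow> nat list \<Rightarrow> nat \<Rightarrow> nat" where
  "word_prod s ws = foldr (\<lambda>i w. s i \<circ> w) ws id"

definition cox_length :: "nat \<Rightarrow> (nat \<Rightarrow> nat \<Rightarrow> nat) \<Rightarrow> (nat \<Rightarrow> nat) \<Rightarrow> nat" where
  "cox_length r s w = (LEAST k. \<exists>ws \<in> lists {1..r}. length ws = k \<and> word_prod s ws = w)"

abbreviation "lenB r \<equiv> cox_length r (sB r)"
abbreviation "lenD r \<equiv> cox_length r (sD r)"

definition reduced_word :: "nat \<Rightarrow> nat list \<Rightarrow> (nat \<Rightarrow> nat) \<Rightarrow> bool" where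
  "reduced_word r ws w \<longleftrightarrow> ws \<in> lists {1..r} \<and> word_prod (sB r) ws = w \<and> length ws = lenB r w"

definition double_coset ::
  "nat \<Rightarrow> (nat \<Rightarrow> nat) set \<Rightarrow> (nat \<Rightarrow> nat) \<Rightarrow> (nat \<Rightarrow> nat) set \<Rightarrow> (nat \<Rightarrow> nat) set" where
  "double_coset r P d Q = (P #>\<^bsub>weylB r\<^esub> d) <#>\<^bsub>weylB r\<^esub> Q"

section \<open>The Hecke algebra with parameters \<open>(q, 1)\<close>\<close>

text \<open>Lists under concatenation form the free monoid, so that
  \<^typ>\<open>nat list \<Rightarrow>\<^sub>0 int poly\<close> is the free associative \<open>\<int>[q]\<close>-algebra on the letters \<^typ>\<open>nat\<close>.\<close>

instantiation list :: (type) monoid_add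
begin
definition "0 = []"
definition "xs + ys = xs @ ys"
instance by standard (simp_all add: zero_list_def plus_list_def)
end

type_synonym free = "nat list \<Rightarrow>\<^sub>0 int poly"

definition qq :: "int poly" where "qq = [:0, 1:]"

definition free_alg :: "nat \<Rightarrow> free ring" where
  "free_alg r = \<lparr>carrier = {f. Poly_Mapping.keys f \<subseteq> lists {1..r}}, monoid.mult = (*), one = 1, zero = 0, add = (+)\<rparr>"

abbreviation mon :: "int poly \<Rightarrow> nat list \<Rightarrow> free" where
  "mon a ws \<equiv> Poly_Mapping.single ws a"

definition hecke_rels :: "nat \<Rightarrow> free set" where
  "hecke_rels r =
     {mon 1 [i, j] - mon 1 [j, i] | i j. i \<in> {1..r} \<and> j \<in> {1..r} \<and> (i + 2 \<le> j \<or> j + 2 \<le> i)}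
   \<union> {mon 1 [j, j + 1, j] - mon 1 [j + 1, j, j + 1] | j. 1 \<le> j \<and> j + 1 < r}
   \<union> {mon 1 [r - 1, r, r - 1, r] - mon 1 [r, r - 1, r, r - 1]}
   \<union> {mon 1 [i, i] - (mon (qq - 1) [i] + mon qq []) | i. 1 \<le> i \<and> i < r}
   \<union> {mon 1 [r, r] - mon 1 []}"

type_synonym hecke = "free set"

definition hecke_ideal :: "nat \<Rightarrow> free set" where
  "hecke_ideal r = genideal (free_alg r) (hecke_rels r)"

definition heckeB :: "nat \<Rightarrow> hecke ring" where
  "heckeB r = free_alg r Quot hecke_ideal r"

definition scal :: "nat \<Rightarrow> int poly \<Rightarrow> hecke" where
  "scal r a = hecke_ideal r +>\<^bsub>free_alg r\<^esub> mon a []"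

definition Tgen :: "nat \<Rightarrow> nat \<Rightarrow> hecke" where
  "Tgen r i = hecke_ideal r +>\<^bsub>free_alg r\<^esub> mon 1 [i]"

definition Tw :: "nat \<Rightarrow> (nat \<Rightarrow> nat) \<Rightarrow> hecke" where
  "Tw r w = foldr (\<lambda>i x. Tgen r i \<otimes>\<^bsub>heckeB r\<^esub> x) (SOME ws. reduced_word r ws w) \<one>\<^bsub>heckeB r\<^esub>"

definition Tsum :: "nat \<Rightarrow> (nat \<Rightarrow> nat) set \<Rightarrow> hecke" where
  "Tsum r D = (\<Oplus>\<^bsub>heckeB r\<^esub>w\<in>D. Tw r w)"

definition Hcheck :: "nat \<Rightarrow> hecke set" where
  "Hcheck r = generate_ring (heckeB r) (range (scal r) \<union> Tgen r ` {1..<r} \<union>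
      {Tgen r r \<otimes>\<^bsub>heckeB r\<^esub> Tgen r (r - 1) \<otimes>\<^bsub>heckeB r\<^esub> Tgen r r})"

section \<open>Endomorphism algebras of direct sums of right modules inside the Hecke algebra\<close>

text \<open>For \<open>M i\<close> in the Hecke algebra (\<open>i\<close> in a finite set \<open>I\<close>) stable under right multiplication by
  a subalgebra \<open>K\<close>, elements of the external direct sum are extensional families; the
  \<open>K\<close>-endomorphisms form a \<open>\<int>[q]\<close>-algebra with composition as product.\<close>

definition dsum :: "'i set \<Rightarrow> ('i \<Rightarrow> hecke set) \<Rightarrow> ('i \<Rightarrow> hecke) set" where
  "dsum I M = (\<Pi>\<^sub>E i\<in>I. M i)"

definition dinj :: "nat \<Rightarrow> 'i set \<Rightarrow> 'i \<Rightarrow> hecke \<Rightarrow> 'i \<Rightarrow> hecke" where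
  "dinj r I i x = (\<lambda>j\<in>I. if j = i then x else \<zero>\<^bsub>heckeB r\<^esub>)"

definition End_alg ::
  "nat \<Rightarrow> hecke set \<Rightarrow> 'i set \<Rightarrow> ('i \<Rightarrow> hecke set) \<Rightarrow> (int poly, ('i \<Rightarrow> hecke) \<Rightarrow> 'i \<Rightarrow> hecke) module" where
  "End_alg r K I M =
    \<lparr>carrier = {\<phi> \<in> dsum I M \<rightarrow>\<^sub>E dsum I M.
        (\<forall>u\<in>dsum I M. \<forall>v\<in>dsum I M.
           \<phi> (\<lambda>i\<in>I. u i \<oplus>\<^bsub>heckeB r\<^esub> v i) = (\<lambda>i\<in>I. \<phi> u i \<oplus>\<^bsub>heckeB r\<^esub> \<phi> v i)) \<and>
        (\<forall>u\<in>dsum I M. \<forall>k\<in>K.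
           \<phi> (\<lambda>i\<in>I. u i \<otimes>\<^bsub>heckeB r\<^esub> k) = (\<lambda>i\<in>I. \<phi> u i \<otimes>\<^bsub>heckeB r\<^esub> k))},
     monoid.mult = compose (dsum I M),
     one = (\<lambda>u\<in>dsum I M. u),
     zero = (\<lambda>u\<in>dsum I M. \<lambda>i\<in>I. \<zero>\<^bsub>heckeB r\<^esub>),
     add = (\<lambda>\<phi> \<psi>. \<lambda>u\<in>dsum I M. \<lambda>i\<in>I. \<phi> u i \<oplus>\<^bsub>heckeB r\<^esub> \<psi> u i),
     module.smult = (\<lambda>a \<phi>. \<lambda>u\<in>dsum I M. \<lambda>i\<in>I. scal r a \<otimes>\<^bsub>heckeB r\<^esub> \<phi> u i)\<rparr>"

definition rmod :: "nat \<Rightarrow> hecke set \<Rightarrow> hecke \<Rightarrow> hecke set" where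
  "rmod r K x = (\<lambda>k. x \<otimes>\<^bsub>heckeB r\<^esub> k) ` K"

text \<open>The endomorphism of \<open>\<Oplus>\<^sub>i x\<^sub>i K\<close> with
  \<open>x\<^sub>k a \<mapsto> \<delta>\<^sub>j\<^sub>k (\<Sum>\<^sub>w\<^sub>\<in>\<^sub>D T\<^sub>w) a \<in> x\<^sub>i K\<close>.\<close>

definition basis_hom ::
  "nat \<Rightarrow> hecke set \<Rightarrow> 'i set \<Rightarrow> ('i \<Rightarrow> hecke) \<Rightarrow> 'i \<Rightarrow> (nat \<Rightarrow> nat) set \<Rightarrow> 'i
     \<Rightarrow> ('i \<Rightarrow> hecke) \<Rightarrow> 'i \<Rightarrow> hecke" where
  "basis_hom r K I x i D j =
    (THE \<phi>. \<phi> \<in> carrier (End_alg r K I (\<lambda>k. rmod r K (x k))) \<and>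
       (\<forall>k\<in>I. \<forall>a\<in>K. \<phi> (dinj r I k (x k \<otimes>\<^bsub>heckeB r\<^esub> a)) =
          dinj r I i (if k = j then Tsum r D \<otimes>\<^bsub>heckeB r\<^esub> a else \<zero>\<^bsub>heckeB r\<^esub>)))"

section \<open>Compositions and symmetric matrices\<close>

type_synonym weight = "nat \<Rightarrow> nat"
type_synonym mat = "nat \<Rightarrow> nat \<Rightarrow> int"

text \<open>Indices start at \<open>1\<close>; entries outside the index range are \<open>0\<close>. Matrices have
  integer entries so that \<open>A - E\<close> may leave the set of matrices over \<open>\<nat>\<close>.\<close>

definition Lam :: "nat \<Rightarrow> nat \<Rightarrow> weight set" where
  "Lam n r = {lam. (\<forall>i. i \<notin> {1..n + 1} \<longrightarrow> lam i = 0) \<and> (\<Sum>i=1..n + 1. lam i) = r}"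

definition hat :: "nat \<Rightarrow> weight \<Rightarrow> nat \<Rightarrow> nat" where
  "hat n lam i = (if i \<le> n then lam i else if i = n + 1 then 2 * lam (n + 1) else lam (2*n + 2 - i))"

definition Rint :: "nat \<Rightarrow> weight \<Rightarrow> nat \<Rightarrow> nat set" where
  "Rint n lam i = {(\<Sum>k=1..<i. hat n lam k) + 1 .. (\<Sum>k=1..i. hat n lam k)}"

definition Wpar :: "nat \<Rightarrow> nat \<Rightarrow> weight \<Rightarrow> (nat \<Rightarrow> nat) set" where
  "Wpar n r lam = generate (weylB r)
     (sB r ` {j \<in> {1..r}. j \<notin> (\<lambda>i. \<Sum>k=1..i. lam k) ` {1..n}})"

definition Xi :: "nat \<Rightarrow> nat \<Rightarrow> mat set" where
  "Xi n r = {A. (\<forall>i j. A i j \<ge> 0) \<and>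
     (\<forall>i j. i \<notin> {1..2*n + 1} \<or> j \<notin> {1..2*n + 1} \<longrightarrow> A i j = 0) \<and>
     (\<forall>i\<in>{1..2*n + 1}. \<forall>j\<in>{1..2*n + 1}. A i j = A (2*n + 2 - i) (2*n + 2 - j)) \<and>
     (\<Sum>i=1..2*n + 1. \<Sum>j=1..2*n + 1. A i j) = 2 * int r}"

definition ro :: "nat \<Rightarrow> mat \<Rightarrow> nat \<Rightarrow> int" where
  "ro n A = (\<lambda>i. \<Sum>j=1..2*n + 1. A i j)"

definition co :: "nat \<Rightarrow> mat \<Rightarrow> nat \<Rightarrow> int" where
  "co n A = (\<lambda>j. \<Sum>i=1..2*n + 1. A i j)"

definition Eunit :: "nat \<Rightarrow> nat \<Rightarrow> mat" where
  "Eunit i j = (\<lambda>k l. if k = i \<and> l = j then 1 else 0)"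

definition Eth :: "nat \<Rightarrow> nat \<Rightarrow> nat \<Rightarrow> mat" where
  "Eth n i j = (\<lambda>k l. Eunit i j k l + Eunit (2*n + 2 - i) (2*n + 2 - j) k l)"

definition diag_mat :: "mat \<Rightarrow> bool" where
  "diag_mat A \<longleftrightarrow> (\<forall>i j. i \<noteq> j \<longrightarrow> A i j = 0)"

definition upper :: "nat \<Rightarrow> nat \<Rightarrow> mat \<Rightarrow> nat \<Rightarrow> mat" where
  "upper n h A p = (\<lambda>k l. A k l + Eth n h p k l - Eth n (h + 1) p k l)"

definition lower :: "nat \<Rightarrow> nat \<Rightarrow> mat \<Rightarrow> nat \<Rightarrow> mat" where
  "lower n h A p = (\<lambda>k l. A k l - Eth n h p k l + Eth n (h + 1) p k l)"

definition min_repsB :: "nat \<Rightarrow> nat \<Rightarrow> weight \<Rightarrow> weight \<Rightarrow> (nat \<Rightarrow> nat) set" where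
  "min_repsB n r lam mu = {d \<in> carrier (weylB r).
     \<forall>w \<in> double_coset r (Wpar n r lam) d (Wpar n r mu). lenB r d \<le> lenB r w}"

definition triples :: "nat \<Rightarrow> nat \<Rightarrow> (weight \<times> (nat \<Rightarrow> nat) \<times> weight) set" where
  "triples n r = {(lam, d, mu). lam \<in> Lam n r \<and> mu \<in> Lam n r \<and> d \<in> min_repsB n r lam mu}"

definition triple_mat :: "nat \<Rightarrow> weight \<times> (nat \<Rightarrow> nat) \<times> weight \<Rightarrow> mat" where
  "triple_mat n = (\<lambda>(lam, d, mu) i j.
     if i \<in> {1..2*n + 1} \<and> j \<in> {1..2*n + 1} then int (card (Rint n lam i \<inter> d ` Rint n mu j)) else 0)"

text \<open>\<^const>\<open>triple_mat\<close> is a bijection from \<^const>\<open>triples\<close> onto \<^const>\<open>Xi\<close>.\<close>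

definition mat_triple :: "nat \<Rightarrow> nat \<Rightarrow> mat \<Rightarrow> weight \<times> (nat \<Rightarrow> nat) \<times> weight" where
  "mat_triple n r = the_inv_into (triples n r) (triple_mat n)"

definition row_wt :: "nat \<Rightarrow> nat \<Rightarrow> mat \<Rightarrow> weight" where
  "row_wt n r A = fst (mat_triple n r A)"

definition dmat :: "nat \<Rightarrow> nat \<Rightarrow> mat \<Rightarrow> nat \<Rightarrow> nat" where
  "dmat n r A = fst (snd (mat_triple n r A))"

definition col_wt :: "nat \<Rightarrow> nat \<Rightarrow> mat \<Rightarrow> weight" where
  "col_wt n r A = snd (snd (mat_triple n r A))"

section \<open>The \<open>q\<close>-Schur algebra of type B\<close>

definition xB :: "nat \<Rightarrow> nat \<Rightarrow> weight \<Rightarrow> hecke" where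
  "xB n r lam = Tsum r (Wpar n r lam)"

definition schurB :: "nat \<Rightarrow> nat \<Rightarrow> (int poly, (weight \<Rightarrow> hecke) \<Rightarrow> weight \<Rightarrow> hecke) module" where
  "schurB n r = End_alg r (carrier (heckeB r)) (Lam n r) (\<lambda>lam. rmod r (carrier (heckeB r)) (xB n r lam))"

definition eB :: "nat \<Rightarrow> nat \<Rightarrow> mat \<Rightarrow> (weight \<Rightarrow> hecke) \<Rightarrow> weight \<Rightarrow> hecke" where
  "eB n r A = (if A \<in> Xi n r
     then basis_hom r (carrier (heckeB r)) (Lam n r) (xB n r) (row_wt n r A)
            (double_coset r (Wpar n r (row_wt n r A)) (dmat n r A) (Wpar n r (col_wt n r A)))
            (col_wt n r A)
     else \<zero>\<^bsub>schurB n r\<^esub>)"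

section \<open>The \<open>q\<close>-Schur algebras of type D\<close>

text \<open>Signs are the integers \<open>1\<close> and \<open>-1\<close>.\<close>

datatype dweight = Bul weight | Sg int weight

definition LamD :: "nat \<Rightarrow> nat \<Rightarrow> dweight set" where
  "LamD n r = {Bul lam | lam. lam \<in> Lam n r \<and> lam (n + 1) \<noteq> 0}
            \<union> {Sg e lam | e lam. e \<in> {1, -1} \<and> lam \<in> Lam n r \<and> lam (n + 1) = 0}"

fun WparD :: "nat \<Rightarrow> nat \<Rightarrow> dweight \<Rightarrow> (nat \<Rightarrow> nat) set" where
  "WparD n r (Bul lam) = Wpar n r lam \<inter> weylD r"
| "WparD n r (Sg e lam) = (if e = 1 then Wpar n r lam else (\<lambda>w. sB r r \<circ> w \<circ> sB r r) ` Wpar n r lam)"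

definition xD :: "nat \<Rightarrow> nat \<Rightarrow> dweight \<Rightarrow> hecke" where
  "xD n r a = Tsum r (WparD n r a)"

definition schurD :: "nat \<Rightarrow> nat \<Rightarrow> (int poly, (dweight \<Rightarrow> hecke) \<Rightarrow> dweight \<Rightarrow> hecke) module" where
  "schurD n r = End_alg r (Hcheck r) (LamD n r) (\<lambda>a. rmod r (Hcheck r) (xD n r a))"

definition phiD ::
  "nat \<Rightarrow> nat \<Rightarrow> dweight \<Rightarrow> (nat \<Rightarrow> nat) \<Rightarrow> dweight \<Rightarrow> (dweight \<Rightarrow> hecke) \<Rightarrow> dweight \<Rightarrow> hecke" where
  "phiD n r a d b = basis_hom r (Hcheck r) (LamD n r) (xD n r) a
     (double_coset r (WparD n r a) d (WparD n r b)) b"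

text \<open>Minimality here refers to the length function of type D.\<close>

definition min_repD :: "nat \<Rightarrow> nat \<Rightarrow> dweight \<Rightarrow> (nat \<Rightarrow> nat) \<Rightarrow> dweight \<Rightarrow> nat \<Rightarrow> nat" where
  "min_repD n r a d b = arg_min_on (lenD r) (double_coset r (WparD n r a) d (WparD n r b))"

definition sgn_mat :: "nat \<Rightarrow> mat \<Rightarrow> int" where
  "sgn_mat n A = (if even (\<Sum>i=1..n. \<Sum>j=n + 2..2*n + 1. A i j) then 1 else -1)"

datatype dmatrix = Dot mat | Signed int mat int

definition XiD :: "nat \<Rightarrow> nat \<Rightarrow> dmatrix set" where
  "XiD n r = {Dot A | A. A \<in> Xi n r \<and> A (n + 1) (n + 1) \<noteq> 0}
           \<union> {Signed e A e' | e A e'. A \<in> Xi n r \<and> A (n + 1) (n + 1) = 0 \<and>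
                e \<in> {1, -1} \<and> e' \<in> {1, -1} \<and> e * e' = sgn_mat n A}"

fun underlying :: "dmatrix \<Rightarrow> mat" where
  "underlying (Dot A) = A"
| "underlying (Signed e A e') = A"

definition associated :: "nat \<Rightarrow> nat \<Rightarrow> dmatrix \<Rightarrow> mat \<Rightarrow> bool" where
  "associated n r X A \<longleftrightarrow> X \<in> XiD n r \<and> underlying X = A"

definition bracket :: "nat \<Rightarrow> weight \<Rightarrow> int \<Rightarrow> dweight" where
  "bracket n lam e = (if lam (n + 1) = 0 then Sg e lam else Bul lam)"

definition s_sign :: "nat \<Rightarrow> int \<Rightarrow> nat \<Rightarrow> nat" where
  "s_sign r e = (if e = 1 then id else sB r r)"

fun phi_mat :: "nat \<Rightarrow> nat \<Rightarrow> dmatrix \<Rightarrow> (dweight \<Rightarrow> hecke) \<Rightarrow> dweight \<Rightarrow> hecke" where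
  "phi_mat n r (Dot A) =
     (let a = Bul (row_wt n r A); b = Bul (col_wt n r A); d = dmat n r A
      in phiD n r a (min_repD n r a (if d \<in> weylD r then d else sB r r \<circ> d) b) b)"
| "phi_mat n r (Signed e A e') =
     (let a = bracket n (row_wt n r A) e; b = bracket n (col_wt n r A) e'
      in phiD n r a (min_repD n r a (s_sign r e \<circ> dmat n r A \<circ> s_sign r e') b) b)"

definition schurK :: "nat \<Rightarrow> nat \<Rightarrow> (int poly, (weight \<Rightarrow> hecke) \<Rightarrow> weight \<Rightarrow> hecke) module" where
  "schurK n r = End_alg r (Hcheck r) (Lam n r) (\<lambda>lam. rmod r (carrier (heckeB r)) (xB n r lam))"

text \<open>The isomorphism from the module of \<^const>\<open>schurD\<close> to that of \<^const>\<open>schurK\<close>, assembled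
  from \<open>x\<^sub>\<lambda> H = x\<^sub>\<lambda> K \<oplus> x\<^sub>\<lambda> T\<^sub>r K\<close> and \<open>x\<^sub>\<lambda> H = (1 + T\<^sub>r) x\<^sub>\<lambda>\<^sub>\<bullet> K\<close> with \<open>K\<close> the
  Hecke algebra of type D. As \<open>T\<^sub>r\<close> squares to \<open>1\<close>, left multiplication by \<open>T\<^sub>r\<close> is its own inverse.\<close>

definition ident :: "nat \<Rightarrow> nat \<Rightarrow> (dweight \<Rightarrow> hecke) \<Rightarrow> weight \<Rightarrow> hecke" where
  "ident n r u = (\<lambda>lam\<in>Lam n r.
     if lam (n + 1) = 0 then u (Sg 1 lam) \<oplus>\<^bsub>heckeB r\<^esub> (Tgen r r \<otimes>\<^bsub>heckeB r\<^esub> u (Sg (-1) lam))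
     else (\<one>\<^bsub>heckeB r\<^esub> \<oplus>\<^bsub>heckeB r\<^esub> Tgen r r) \<otimes>\<^bsub>heckeB r\<^esub> u (Bul lam))"

definition phiK :: "nat \<Rightarrow> nat \<Rightarrow> dmatrix \<Rightarrow> (weight \<Rightarrow> hecke) \<Rightarrow> weight \<Rightarrow> hecke" where
  "phiK n r X =
     (\<lambda>m\<in>dsum (Lam n r) (\<lambda>lam. rmod r (carrier (heckeB r)) (xB n r lam)).
        ident n r (phi_mat n r X
          (the_inv_into (dsum (LamD n r) (\<lambda>a. rmod r (Hcheck r) (xD n r a))) (ident n r) m)))"

text \<open>The coordinates of the product of two of the elements \<^const>\<open>phiK\<close> in the basis
  formed by these elements.\<close>

definition structure_constK :: "nat \<Rightarrow> nat \<Rightarrow> dmatrix \<Rightarrow> dmatrix \<Rightarrow> dmatrix \<Rightarrow> int poly" where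
  "structure_constK n r X Y =
     (THE c. c \<in> extensional (XiD n r) \<and>
        phiK n r X \<otimes>\<^bsub>schurK n r\<^esub> phiK n r Y =
          (\<Oplus>\<^bsub>schurK n r\<^esub>Z\<in>XiD n r. c Z \<odot>\<^bsub>schurK n r\<^esub> phiK n r Z))"

end

theory Submission
  imports Defs
begin

text \<open>
  Both sides of the comparison are read off coefficients in the Hecke algebra \<open>H\<close> of type B with
  respect to its basis \<open>T\<^sub>w\<close>. As \<open>T\<^sub>r\<close> has square \<open>1\<close>, the algebra \<open>H\<close> is graded by the sign
  \<open>par w\<close>, the parity of the number of positions \<open>k > r\<close> that \<open>w\<close> sends into \<open>{1..r}\<close>, and the Hecke
  algebra of type D is its even part (\<open>Hcheck_Kc\<close>). A homomorphism between two of the modules is left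
  multiplication by an element of \<open>H\<close>, so a product of two basis elements is described by one element
  \<open>z \<star> \<Sum>T\<^sub>w\<close>, the sum running over a double coset, and its structure constants are the coefficients
  of that element on the various double cosets (\<open>structure_const_value\<close>, \<open>B_constants\<close>).

  In type B the sum runs over the full double coset \<open>W\<^sub>\<lambda> d W\<^sub>\<gamma>\<close>, and \<open>z\<close> satisfies
  \<open>z x\<^sub>\<lambda> = \<Sum>T\<^sub>w\<close> over \<open>W\<^sub>\<alpha> W\<^sub>\<lambda>\<close>: the distinguished representative of a matrix next to a diagonal one is
  the identity. In type D every parabolic subgroup is, up to conjugation by \<open>s\<^sub>r\<close>, the even part
  \<open>HP \<lambda>\<close> of \<open>W\<^sub>\<lambda>\<close>, and after such a twist the same description holds with \<open>HP\<close> in place of \<open>W\<close>.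
  A full double coset is the union of at most four such smaller ones, obtained by multiplying with
  \<open>s\<^sub>r\<close> on the left and on the right, and their contributions to one coefficient can be compared
  (\<open>compare_coefficients\<close>). Contributions of the wrong parity vanish. A second contribution of
  the right parity, involving the translate of the given coset \<open>D\<close> by \<open>s\<^sub>r\<close>, can occur only if \<open>D\<close> sends no
  central position of \<open>\<gamma>\<close> to a central position of \<open>\<lambda>\<close>. It is zero unless some central position of \<open>\<gamma>\<close>
  reaches a central position of \<open>\<alpha>\<close>, and it then equals the first one, because \<open>s\<^sub>r\<close> on the left can be
  traded for \<open>s\<^sub>r\<close> on the right. So the constant of type B is the one of type D or twice that one, the
  factor two requiring that the central block of \<open>\<alpha>\<close> be not contained in that of \<open>\<lambda>\<close>. For the matrix
  \<open>B\<close> it is contained and only equality remains; for \<open>C\<close> it may be larger.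

  It remains to know that the coefficient of type B is a single \<open>g p\<close> and not a sum of several: the
  matrix of a double coset is determined by any of its elements (\<open>Xi_wmat_eq\<close>), and distinct \<open>p\<close>
  give distinct matrices. On the side of type D the double cosets attached to the signed matrices with
  given row and column symbols partition the Weyl group of type D (\<open>TZ_exists\<close>, \<open>TZ_unique\<close>).

  The basis \<open>T\<^sub>w\<close> of \<open>H\<close> is built from the presentation: reduced words of one element give one product
  (\<open>Tword_reduced_eq\<close>), and linear independence comes from an explicit representation on functions on
  the Weyl group (\<open>ract_rels\<close>).
\<close>

section \<open>Signed permutations\<close>

abbreviation WB :: "nat \<Rightarrow> (nat \<Rightarrow> nat) set" where
  "WB r \<equiv> carrier (weylB r)"

abbreviation mir :: "nat \<Rightarrow> nat \<Rightarrow> nat" where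
  "mir r k \<equiv> 2 * r + 1 - k"

abbreviation pinv :: "(nat \<Rightarrow> nat) \<Rightarrow> nat \<Rightarrow> nat" where
  "pinv w \<equiv> inv_into UNIV w"

lemma WB_iff: "w \<in> WB r \<longleftrightarrow> w permutes {1..2*r} \<and> (\<forall>i\<in>{1..2*r}. w i + w (mir r i) = 2*r + 1)"
  by (simp add: weylB_def)

lemma weylB_sel [simp]: "monoid.mult (weylB r) = (\<circ>)" "one (weylB r) = id"
  by (simp_all add: weylB_def)

lemma WB_permutes: "w \<in> WB r \<Longrightarrow> w permutes {1..2*r}"
  by (simp add: WB_iff)

lemma WB_range: "w \<in> WB r \<Longrightarrow> 1 \<le> k \<Longrightarrow> k \<le> 2*r \<Longrightarrow> 1 \<le> w k \<and> w k \<le> 2*r"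
  using permutes_in_image[of w "{1..2*r}" k] by (auto simp: WB_iff)

lemma WB_mir: "w \<in> WB r \<Longrightarrow> 1 \<le> k \<Longrightarrow> k \<le> 2*r \<Longrightarrow> w (mir r k) = mir r (w k)"
proof -
  assume a: "w \<in> WB r" "1 \<le> k" "k \<le> 2*r"
  then have "w k + w (mir r k) = 2*r + 1" by (auto simp: WB_iff)
  then show ?thesis by simp
qed

lemma WB_outside: "w \<in> WB r \<Longrightarrow> k \<notin> {1..2*r} \<Longrightarrow> w k = k"
  by (auto simp: WB_iff permutes_not_in)

lemma WB_inj: "w \<in> WB r \<Longrightarrow> inj w"
  using permutes_inj[OF WB_permutes] .

lemma WB_eq_iff: "w \<in> WB r \<Longrightarrow> w j = w k \<longleftrightarrow> j = k"
  using WB_inj by (auto dest: injD)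

lemma WB_id [simp]: "id \<in> WB r"
  by (auto simp: WB_iff permutes_id)

lemma WB_comp: "v \<in> WB r \<Longrightarrow> w \<in> WB r \<Longrightarrow> v o w \<in> WB r"
proof -
  assume a: "v \<in> WB r" "w \<in> WB r"
  have "v (w i) + v (w (mir r i)) = 2*r+1" if "i \<in> {1..2*r}" for i
  proof -
    have "w i \<in> {1..2*r}" using WB_range[OF a(2)] that by auto
    moreover have "w (mir r i) = mir r (w i)" using WB_mir[OF a(2)] that by auto
    ultimately show ?thesis using a(1) by (auto simp: WB_iff)
  qed
  then show ?thesis using a permutes_compose by (auto simp: WB_iff)
qed

lemma WB_inv: assumes "w \<in> WB r" shows "pinv w \<in> WB r"
proof -
  have p: "w permutes {1..2*r}" using assms by (rule WB_permutes)
  have "pinv w i + pinv w (mir r i) = 2*r+1" if i: "i \<in> {1..2*r}" for i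
  proof -
    define k where "k = pinv w i"
    have k: "w k = i" "k \<in> {1..2*r}"
      using p i permutes_inverses(1)[OF p] permutes_in_image[OF permutes_inv[OF p]] by (auto simp: k_def)
    have "w (mir r k) = mir r i" using WB_mir[OF assms] k by auto
    then have "pinv w (mir r i) = mir r k" using permutes_inverses(2)[OF p] by metis
    then show ?thesis using k by (auto simp: k_def)
  qed
  then show ?thesis using permutes_inv[OF p] by (auto simp: WB_iff)
qed

lemma WB_inv_comp [simp]:
  assumes "w \<in> WB r" shows "pinv w o w = id" "w o pinv w = id"
  using permutes_inv_o[OF WB_permutes[OF assms]] by simp_all

lemma WB_inv_app [simp]:
  assumes "w \<in> WB r" shows "pinv w (w k) = k" "w (pinv w k) = k"
  using permutes_inverses[OF WB_permutes[OF assms]] by simp_all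

lemma WB_inv_inv: "w \<in> WB r \<Longrightarrow> pinv (pinv w) = w"
  using permutes_inv_inv[OF WB_permutes] .

lemma WB_comp_inv: "v \<in> WB r \<Longrightarrow> w \<in> WB r \<Longrightarrow> pinv (v o w) = pinv w o pinv v"
  by (rule o_inv_distrib) (auto intro: permutes_bij[OF WB_permutes])

lemma group_weylB: "group (weylB r)"
proof (rule groupI)
  fix x assume x: "x \<in> WB r"
  show "\<exists>y\<in>WB r. y \<otimes>\<^bsub>weylB r\<^esub> x = \<one>\<^bsub>weylB r\<^esub>"
    using WB_inv[OF x] x by (intro bexI[of _ "pinv x"]) auto
qed (auto simp: WB_comp o_assoc)

lemma inv_weylB: assumes "w \<in> WB r" shows "inv\<^bsub>weylB r\<^esub> w = pinv w"
  using group.inv_equality[OF group_weylB, where y = "pinv w" and x = w] assms WB_inv[OF assms] by simp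

lemma finite_WB [simp]: "finite (WB r)"
  by (rule finite_subset[of _ "{w. w permutes {1..2*r}}"]) (auto simp: WB_iff finite_permutations)

lemma WB_eqI:
  assumes "v \<in> WB r" "w \<in> WB r" "\<And>k. 1 \<le> k \<Longrightarrow> k \<le> 2*r \<Longrightarrow> v k = w k" shows "v = w"
proof
  fix k show "v k = w k" using assms WB_outside[of v r k] WB_outside[of w r k] by (cases "k \<in> {1..2*r}") auto
qed

lemma sB_app:
  assumes "1 \<le> i" "i \<le> r"
  shows "sB r i k = (if k = i then i + 1 else if k = i + 1 then i
    else if k = 2*r - i then 2*r + 1 - i else if k = 2*r + 1 - i then 2*r - i else k)"
proof (cases "i = r")
  case True
  then show ?thesis by (simp add: sB_def transpose_def)
next
  case False
  then have "Suc i < 2*r - i" "2*r - i < 2*r + 1 - i" using assms by auto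
  with False show ?thesis by (simp add: sB_def transpose_def o_def)
qed

lemma double_minus_neq_Suc: "i \<le> r \<Longrightarrow> 2 * r - i \<noteq> Suc i" for i r :: nat
  by presburger

lemma sB_WB [simp]: assumes "1 \<le> i" "i \<le> r" shows "sB r i \<in> WB r"
proof -
  have "sB r i permutes {1..2*r}"
  proof (cases "i = r")
    case True then show ?thesis using assms by (auto simp: sB_def intro!: permutes_swap_id)
  next
    case False
    then show ?thesis using assms
      by (auto simp: sB_def intro!: permutes_compose permutes_swap_id)
  qed
  moreover have "sB r i k + sB r i (mir r k) = 2*r+1" if "k \<in> {1..2*r}" for k
  proof -
    define m where "m = 2*r - i"
    define n where "n = mir r k"
    have m: "i \<le> m" "m = i \<or> i + 2 \<le> m" "m + i = 2*r" "2*r - i = m" "2*r + 1 - i = Suc m"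
      using assms double_minus_neq_Suc[of i r] by (auto simp: m_def)
    have n: "n + k = 2*r + 1" "mir r k = n" using that by (auto simp: n_def)
    show ?thesis unfolding sB_app[OF assms] m(4,5) n(2)
      using m(1-3) n(1) by (simp split: if_splits) linarith+
  qed
  ultimately show ?thesis by (simp add: WB_iff)
qed

lemma sB_sB_app [simp]: assumes "1 \<le> i" "i \<le> r" shows "sB r i (sB r i k) = k"
  using assms double_minus_neq_Suc[of i r]
  by (cases "k = i"; cases "k = i + 1"; cases "k = 2*r - i"; cases "k = 2*r + 1 - i") (auto simp: sB_app)

lemma sB_sB [simp]: assumes "1 \<le> i" "i \<le> r" shows "sB r i o sB r i = id"
  using assms by (auto simp: fun_eq_iff)

lemma sB_comp_cancel [simp]: assumes "1 \<le> i" "i \<le> r"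
  shows "w o sB r i o sB r i = w" "sB r i o (sB r i o w) = w"
  using assms by (auto simp: fun_eq_iff)

lemma inv_sB [simp]: assumes "1 \<le> i" "i \<le> r" shows "pinv (sB r i) = sB r i"
  using inv_unique_comp[OF sB_sB sB_sB] assms by blast

lemma sB_at [simp]: assumes "1 \<le> i" "i \<le> r" shows "sB r i i = Suc i" "sB r i (Suc i) = i"
  using assms by (simp_all add: sB_app)

section \<open>Inversions and the length function\<close>

definition invs :: "nat \<Rightarrow> (nat \<Rightarrow> nat) \<Rightarrow> (nat \<times> nat) set" where
  "invs r w = {(i, j). 1 \<le> i \<and> i < j \<and> j \<le> 2*r \<and> w i > w j}"

text \<open>The second summand makes the statistic grow by two for the generator \<open>s\<^sub>r\<close>, too.\<close>

definition len2 :: "nat \<Rightarrow> (nat \<Rightarrow> nat) \<Rightarrow> nat" where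
  "len2 r w = card (invs r w) + card {i \<in> {1..r}. w i > r}"

lemma finite_invs [simp]: "finite (invs r w)"
  by (rule finite_subset[of _ "{1..2*r} \<times> {1..2*r}"]) (auto simp: invs_def)

text \<open>The symmetry of \<open>w\<close> turns the ascent at \<open>k\<close> into an ascent at the mirrored place.\<close>

lemma asc_mir:
  assumes "w \<in> WB r" "1 \<le> k" "k \<le> r" "w k < w (Suc k)"
  shows "w (2*r - k) < w (2*r + 1 - k)"
proof -
  have "w (mir r k) = mir r (w k)" "w (mir r (Suc k)) = mir r (w (Suc k))"
    using WB_mir[OF assms(1), of k] WB_mir[OF assms(1), of "Suc k"] assms by auto
  moreover have "w (Suc k) \<le> 2*r" using WB_range[OF assms(1), of "Suc k"] assms by auto
  moreover have "mir r (Suc k) = 2*r - k" by simp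
  ultimately show ?thesis using assms(4) by simp
qed

text \<open>For \<open>k < r\<close> the generator creates the two mirrored inversions at \<open>k\<close> and \<open>2r
  - k\<close> and permutes the others; for \<open>k = r\<close> it creates one inversion and one more
  element of \<open>{1..r}\<close> with a value above \<open>r\<close>. This is why twice the length is the
  convenient statistic.\<close>

lemma len2_asc:
  assumes w: "w \<in> WB r" and k: "1 \<le> k" "k \<le> r" and asc: "w k < w (Suc k)"
  shows "len2 r (w o sB r k) = len2 r w + 2"
proof -
  define s where "s = sB r k"
  define m where "m = 2*r - k"
  have m: "k \<le> m" "m = k \<or> k + 2 \<le> m" "m + k = 2*r" "2*r - k = m" "2*r + 1 - k = Suc m" "k = m \<longleftrightarrow> k = r"
    using k double_minus_neq_Suc[of k r] by (auto simp: m_def)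
  have s: "s j = (if j = k then Suc k else if j = Suc k then k
    else if j = m then Suc m else if j = Suc m then m else j)" for j
    using sB_app[OF k] m by (simp add: s_def)
  have sv: "s k = Suc k" "s (Suc k) = k" "s m = Suc m" "s (Suc m) = m"
    using m(2) by (auto simp: s)
  have ss: "s (s j) = j" for j using k by (simp add: s_def)
  define E where "E = {(k, Suc k), (m, Suc m)}"
  have asc': "w m < w (Suc m)" using asc_mir[OF w k asc] m by simp
  define f where "f = (\<lambda>(i, j). (s i, s j))"
  have ord: "s i < s j" if "i < j" "(i, j) \<notin> E" for i j
    using that m(1,2) unfolding s E_def by (simp split: if_splits) linarith+
  have rng: "1 \<le> s i \<and> s i \<le> 2*r" if "1 \<le> i" "i \<le> 2*r" for i
    using that k m by (auto simp: s)
  have Es: "(s i, s j) \<notin> E" if "i < j" for i j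
    using that m(1,2) unfolding s E_def by (auto split: if_splits)
  have eq: "invs r (w o s) = E \<union> f ` invs r w"
  proof (intro Set.set_eqI iffI)
    fix x assume x: "x \<in> invs r (w o s)"
    obtain i j where ij: "x = (i, j)" by (cases x)
    show "x \<in> E \<union> f ` invs r w"
    proof (cases "x \<in> E")
      case False
      have "(s i, s j) \<in> invs r w"
        using x ij ord[of i j] rng[of i] rng[of j] False by (auto simp: invs_def)
      then have "f (s i, s j) \<in> f ` invs r w" by blast
      then show ?thesis by (simp add: f_def ss ij)
    qed simp
  next
    fix x assume "x \<in> E \<union> f ` invs r w"
    then show "x \<in> invs r (w o s)"
    proof
      assume "x \<in> E"
      then show ?thesis using k m(1,3) asc asc' sv by (auto simp: E_def invs_def)
    next
      assume "x \<in> f ` invs r w"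
      then obtain i j where ij: "(i, j) \<in> invs r w" "x = (s i, s j)" by (auto simp: f_def)
      have "(i, j) \<notin> E" using ij asc asc' by (auto simp: E_def invs_def)
      then show ?thesis using ij ord[of i j] rng[of i] rng[of j] by (auto simp: invs_def ss)
    qed
  qed
  have "inj_on f (invs r w)" by (rule inj_onI) (auto simp: f_def, (metis ss)+)
  then have c1: "card (f ` invs r w) = card (invs r w)" by (rule card_image)
  have "E \<inter> f ` invs r w = {}" using Es by (auto simp: f_def invs_def)
  then have c2: "card (invs r (w o s)) = card E + card (invs r w)"
    unfolding eq using c1 by (subst card_Un_disjoint) (auto simp: E_def)
  show ?thesis
  proof (cases "k = r")
    case True
    have "w (mir r r) = mir r (w r)" using WB_mir[OF w, of r] k True by auto
    then have wr: "w r \<le> r" using asc True by (simp) 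
    then have "{i \<in> {1..r}. (w o s) i > r} = insert r {i \<in> {1..r}. w i > r}"
      using k True asc m \<open>w (mir r r) = mir r (w r)\<close> by (auto simp: s split: if_splits)
    moreover have "r \<notin> {i \<in> {1..r}. w i > r}" using wr by simp
    ultimately have "card {i \<in> {1..r}. (w o s) i > r} = Suc (card {i \<in> {1..r}. w i > r})" by simp
    moreover have "card E = 1" using True m(6) by (simp add: E_def)
    ultimately show ?thesis unfolding len2_def s_def[symmetric] using c2 by simp
  next
    case False
    have "{i \<in> {1..r}. (w o s) i > r} = s ` {i \<in> {1..r}. w i > r}"
    proof (intro Set.set_eqI iffI)
      fix x assume "x \<in> {i \<in> {1..r}. (w o s) i > r}"
      then have "s x \<in> {i \<in> {1..r}. w i > r}" using False k m(1-3) by (auto simp: s split: if_splits)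
      then show "x \<in> s ` {i \<in> {1..r}. w i > r}" using ss[of x] by (metis image_eqI)
    next
      fix x assume "x \<in> s ` {i \<in> {1..r}. w i > r}"
      then obtain i where i: "x = s i" "1 \<le> i" "i \<le> r" "r < w i" by auto
      have "1 \<le> s i \<and> s i \<le> r" using i False k m(1-3) by (auto simp: s split: if_splits)
      then show "x \<in> {i \<in> {1..r}. (w o s) i > r}" using i ss[of i] by auto
    qed
    moreover have "inj s" by (rule injI) (metis ss)
    ultimately have "card {i \<in> {1..r}. (w o s) i > r} = card {i \<in> {1..r}. w i > r}"
      using card_image[of s "{i \<in> {1..r}. w i > r}"] by (simp add: inj_on_def)
    moreover have "card E = 2" using False m(6) by (simp add: E_def)
    ultimately show ?thesis unfolding len2_def s_def[symmetric] using c2 by simp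
  qed
qed

lemma len2_desc:
  assumes w: "w \<in> WB r" and k: "1 \<le> k" "k \<le> r" and desc: "w (Suc k) < w k"
  shows "len2 r w = len2 r (w o sB r k) + 2"
proof -
  have "w o sB r k \<in> WB r" using w k by (intro WB_comp) auto
  moreover have "(w o sB r k) k < (w o sB r k) (Suc k)" using k desc by simp
  ultimately have "len2 r (w o sB r k o sB r k) = len2 r (w o sB r k) + 2"
    using len2_asc k by blast
  then show ?thesis using k by simp
qed

lemma WB_Suc_neq: "w \<in> WB r \<Longrightarrow> w k \<noteq> w (Suc k)"
  using WB_eq_iff by force

text \<open>Ascents at \<open>1, \<dots>, r\<close> propagate to all of \<open>{1..2*r}\<close> by symmetry, and an
  increasing permutation is trivial.\<close>

lemma increasing_imp_id:
  assumes w: "w \<in> WB r" and asc: "\<And>k. 1 \<le> k \<Longrightarrow> k \<le> r \<Longrightarrow> w k < w (Suc k)"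
  shows "w = id"
proof -
  have asc2: "w k < w (Suc k)" if "1 \<le> k" "k < 2*r" for k
  proof (cases "k \<le> r")
    case False
    then show ?thesis using asc_mir[OF w, of "2*r - k"] asc[of "2*r - k"] that by auto
  qed (use asc that in auto)
  have ge: "k \<le> w k" if "1 \<le> k" "k \<le> 2*r" for k
    using that
  proof (induction k)
    case (Suc k)
    then show ?case using asc2[of k] WB_range[OF w, of 1] by (cases "k = 0") auto
  qed simp
  show ?thesis
  proof (rule WB_eqI[OF w])
    fix k assume k: "1 \<le> k" "k \<le> 2*r"
    have "mir r k \<le> w (mir r k)" using ge[of "mir r k"] k by auto
    then show "w k = id k" using ge[of k] k WB_mir[OF w k] WB_range[OF w k] by auto
  qed simp
qed

lemma exists_descent:
  assumes "w \<in> WB r" "w \<noteq> id"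
  obtains k where "1 \<le> k" "k \<le> r" "w (Suc k) < w k"
proof -
  have "\<exists>k. 1 \<le> k \<and> k \<le> r \<and> \<not> w k < w (Suc k)" using increasing_imp_id assms by blast
  then show thesis using that WB_Suc_neq[OF assms(1)] by (metis linorder_neqE_nat)
qed

lemma word_prod_simps [simp]: "word_prod s [] = id" "word_prod s (i # ws) = s i o word_prod s ws"
  by (simp_all add: word_prod_def)

lemma word_prod_append: "word_prod s (us @ vs) = word_prod s us o word_prod s vs"
  by (induction us) (auto simp: o_assoc)

lemma word_prod_snoc: "word_prod s (ws @ [k]) = word_prod s ws o s k"
  unfolding word_prod_append by (simp only: word_prod_simps comp_id)

lemma word_prod_WB: "ws \<in> lists {1..r} \<Longrightarrow> word_prod (sB r) ws \<in> WB r"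
  by (induction ws) (auto simp: WB_comp)

lemma inv_word_prod: "ws \<in> lists {1..r} \<Longrightarrow> pinv (word_prod (sB r) ws) = word_prod (sB r) (rev ws)"
  by (induction ws) (auto simp: word_prod_append WB_comp_inv[of _ r] word_prod_WB simp flip: id_def)

lemma len2_step_le: assumes "w \<in> WB r" "1 \<le> k" "k \<le> r" shows "len2 r (w o sB r k) \<le> len2 r w + 2"
  using len2_asc[OF assms] len2_desc[OF assms] WB_Suc_neq[OF assms(1), of k]
  by (cases "w k < w (Suc k)") auto

lemma len2_id [simp]: "len2 r id = 0"
  by (auto simp: len2_def invs_def card_eq_0_iff)

lemma len2_word: "ws \<in> lists {1..r} \<Longrightarrow> len2 r (word_prod (sB r) ws) \<le> 2 * length ws"
proof (induction ws rule: rev_induct)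
  case (snoc k ws)
  then have "len2 r (word_prod (sB r) ws o sB r k) \<le> len2 r (word_prod (sB r) ws) + 2"
    by (intro len2_step_le word_prod_WB) auto
  moreover have "len2 r (word_prod (sB r) ws) \<le> 2 * length ws" using snoc by simp
  ultimately have "len2 r (word_prod (sB r) ws o sB r k) \<le> 2 * length (ws @ [k])" by simp
  then show ?case by (simp only: word_prod_snoc)
qed simp

text \<open>Sorting: every nontrivial element has a descent, and removing it lowers the statistic by two.\<close>

lemma exists_word:
  assumes "w \<in> WB r"
  shows "\<exists>ws\<in>lists {1..r}. word_prod (sB r) ws = w \<and> 2 * length ws = len2 r w"
  using assms
proof (induction "len2 r w" arbitrary: w rule: less_induct)
  case less
  show ?case
  proof (cases "w = id")
    case True
    then show ?thesis by (intro bexI[of _ "[]"]) auto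
  next
    case False
    then obtain k where k: "1 \<le> k" "k \<le> r" "w (Suc k) < w k" using exists_descent less.prems by blast
    have "len2 r w = len2 r (w o sB r k) + 2" using len2_desc less.prems k by blast
    moreover have "w o sB r k \<in> WB r" using less.prems k by (intro WB_comp) auto
    ultimately obtain ws where ws: "ws \<in> lists {1..r}" "word_prod (sB r) ws = w o sB r k"
      "2 * length ws = len2 r (w o sB r k)" using less.hyps[of "w o sB r k"] by auto
    then show ?thesis using k \<open>len2 r w = _\<close>
      by (intro bexI[of _ "ws @ [k]"]) (auto simp: word_prod_append)
  qed
qed

lemma len2_lenB: assumes "w \<in> WB r" shows "len2 r w = 2 * lenB r w"
proof -
  obtain ws where ws: "ws \<in> lists {1..r}" "word_prod (sB r) ws = w" "2 * length ws = len2 r w"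
    using exists_word assms by blast
  have "lenB r w = length ws" unfolding cox_length_def
  proof (rule Least_equality)
    show "\<exists>us\<in>lists {1..r}. length us = length ws \<and> word_prod (sB r) us = w" using ws by blast
    fix y assume "\<exists>us\<in>lists {1..r}. length us = y \<and> word_prod (sB r) us = w"
    then show "length ws \<le> y" using len2_word ws by fastforce
  qed
  then show ?thesis using ws by simp
qed

lemma exists_reduced_word: "w \<in> WB r \<Longrightarrow> \<exists>ws. reduced_word r ws w"
  using exists_word[of w r] len2_lenB[of w r] by (auto simp: reduced_word_def)

lemma lenB_le_word: "ws \<in> lists {1..r} \<Longrightarrow> lenB r (word_prod (sB r) ws) \<le> length ws"
  using len2_word[of ws r] len2_lenB[OF word_prod_WB] by fastforce

lemma lenB_asc:
  assumes "w \<in> WB r" "1 \<le> k" "k \<le> r" "w k < w (Suc k)"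
  shows "lenB r (w o sB r k) = Suc (lenB r w)"
proof -
  have "w o sB r k \<in> WB r" using assms by (intro WB_comp) auto
  then show ?thesis using len2_asc[OF assms] len2_lenB assms(1) by fastforce
qed

lemma lenB_desc:
  assumes "w \<in> WB r" "1 \<le> k" "k \<le> r" "w (Suc k) < w k"
  shows "lenB r w = Suc (lenB r (w o sB r k))"
proof -
  have "w o sB r k \<in> WB r" using assms by (intro WB_comp) auto
  then show ?thesis using len2_desc[OF assms] len2_lenB assms(1) by fastforce
qed

lemma lenB_inv: assumes "w \<in> WB r" shows "lenB r (pinv w) = lenB r w"
proof -
  have le: "lenB r (pinv v) \<le> lenB r v" if v: "v \<in> WB r" for v
  proof -
    obtain ws where "reduced_word r ws v" using exists_reduced_word[OF v] by blast
    then show ?thesis using lenB_le_word[of "rev ws" r] inv_word_prod[of ws r]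
      by (auto simp: reduced_word_def in_lists_conv_set)
  qed
  show ?thesis using le[OF assms] le[OF WB_inv[OF assms]] WB_inv_inv[OF assms] by simp
qed

lemma inv_left_mult: assumes "w \<in> WB r" "1 \<le> k" "k \<le> r" shows "pinv (sB r k o w) = pinv w o sB r k"
  using WB_comp_inv[of "sB r k" r w] assms by simp

lemma lenB_left_asc:
  assumes "w \<in> WB r" "1 \<le> k" "k \<le> r" "pinv w k < pinv w (Suc k)"
  shows "lenB r (sB r k o w) = Suc (lenB r w)"
  using lenB_asc[OF WB_inv[OF assms(1)] assms(2-4)] lenB_inv[OF assms(1)]
    lenB_inv[OF WB_comp[OF sB_WB[OF assms(2,3)] assms(1)]] inv_left_mult[OF assms(1-3)] by simp

lemma lenB_left_desc:
  assumes "w \<in> WB r" "1 \<le> k" "k \<le> r" "pinv w (Suc k) < pinv w k"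
  shows "lenB r w = Suc (lenB r (sB r k o w))"
  using lenB_desc[OF WB_inv[OF assms(1)] assms(2-4)] lenB_inv[OF assms(1)]
    lenB_inv[OF WB_comp[OF sB_WB[OF assms(2,3)] assms(1)]] inv_left_mult[OF assms(1-3)] by simp

lemma lenB_id [simp]: "lenB r id = 0"
  using len2_lenB[of id r] by simp

lemma lenB_0: assumes "w \<in> WB r" "lenB r w = 0" shows "w = id"
proof (rule ccontr)
  assume "w \<noteq> id"
  then obtain k where "1 \<le> k" "k \<le> r" "w (Suc k) < w k" using exists_descent assms(1) by blast
  then show False using lenB_desc[OF assms(1), of k] assms(2) by simp
qed

section \<open>The Hecke algebra and its standard basis\<close>

definition qpar :: "nat \<Rightarrow> nat \<Rightarrow> int poly" where
  "qpar r i = (if i = r then 1 else qq)"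

text \<open>The effect of right multiplication by \<open>T\<^sub>i\<close> on the coefficient function of an element.\<close>

definition rstep :: "nat \<Rightarrow> nat \<Rightarrow> ((nat \<Rightarrow> nat) \<Rightarrow> int poly) \<Rightarrow> (nat \<Rightarrow> nat) \<Rightarrow> int poly" where
  "rstep r i \<phi> y = (if y (Suc i) < y i then \<phi> (y o sB r i) + (qpar r i - 1) * \<phi> y
                  else qpar r i * \<phi> (y o sB r i))"

definition ract :: "nat \<Rightarrow> free \<Rightarrow> ((nat \<Rightarrow> nat) \<Rightarrow> int poly) \<Rightarrow> (nat \<Rightarrow> nat) \<Rightarrow> int poly" where
  "ract r f \<phi> y = (\<Sum>ws\<in>Poly_Mapping.keys f. Poly_Mapping.lookup f ws * fold (rstep r) ws \<phi> y)"

lemma rstep_add: "rstep r i (\<lambda>y. \<phi> y + \<psi> y) = (\<lambda>y. rstep r i \<phi> y + rstep r i \<psi> y)"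
  by (auto simp: rstep_def fun_eq_iff algebra_simps)

lemma rstep_scale: "rstep r i (\<lambda>y. a * \<phi> y) = (\<lambda>y. a * rstep r i \<phi> y)"
  by (auto simp: rstep_def fun_eq_iff algebra_simps)

lemma fold_rstep_add: "fold (rstep r) ws (\<lambda>y. \<phi> y + \<psi> y) = (\<lambda>y. fold (rstep r) ws \<phi> y + fold (rstep r) ws \<psi> y)"
  by (induction ws arbitrary: \<phi> \<psi>) (simp_all add: rstep_add)

lemma fold_rstep_scale: "fold (rstep r) ws (\<lambda>y. a * \<phi> y) = (\<lambda>y. a * fold (rstep r) ws \<phi> y)"
  by (induction ws arbitrary: \<phi>) (simp_all add: rstep_scale)

lemma ract_superset:
  assumes "finite A" "Poly_Mapping.keys f \<subseteq> A"
  shows "ract r f \<phi> y = (\<Sum>ws\<in>A. Poly_Mapping.lookup f ws * fold (rstep r) ws \<phi> y)"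
  unfolding ract_def by (rule sum.mono_neutral_left) (use assms in \<open>auto simp: in_keys_iff\<close>)

lemma ract_zero [simp]: "ract r 0 \<phi> y = 0"
  by (simp add: ract_def)

lemma ract_add: "ract r (f + g) \<phi> y = ract r f \<phi> y + ract r g \<phi> y"
proof -
  let ?A = "Poly_Mapping.keys f \<union> Poly_Mapping.keys g"
  have "ract r (f + g) \<phi> y = (\<Sum>ws\<in>?A. Poly_Mapping.lookup (f + g) ws * fold (rstep r) ws \<phi> y)"
    by (rule ract_superset) (use keys_add[of f g] in auto)
  also have "\<dots> = ract r f \<phi> y + ract r g \<phi> y"
    by (simp add: ract_superset[of ?A f] ract_superset[of ?A g] lookup_add distrib_right sum.distrib)
  finally show ?thesis .
qed

lemma ract_uminus: "ract r (- f) \<phi> y = - ract r f \<phi> y"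
  by (simp add: ract_def sum_negf)

lemma ract_diff: "ract r (f - g) \<phi> y = ract r f \<phi> y - ract r g \<phi> y"
  using ract_add[of r f "- g"] by (simp add: ract_uminus)

lemma ract_mon: "ract r (mon a ws) \<phi> y = a * fold (rstep r) ws \<phi> y"
  by (simp add: ract_def)

lemma ract_add_fun: "ract r f (\<lambda>y. \<phi> y + \<psi> y) = (\<lambda>y. ract r f \<phi> y + ract r f \<psi> y)"
  by (simp add: ract_def fun_eq_iff fold_rstep_add distrib_left sum.distrib)

lemma ract_scale_fun: "ract r f (\<lambda>y. a * \<phi> y) = (\<lambda>y. a * ract r f \<phi> y)"
  by (simp add: ract_def fun_eq_iff fold_rstep_scale sum_distrib_left mult.left_commute)

lemma free_induct [case_names sub zero add]:
  assumes "Poly_Mapping.keys f \<subseteq> S" "P 0"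
    and "\<And>f a ws. P f \<Longrightarrow> Poly_Mapping.keys f \<subseteq> S \<Longrightarrow> ws \<in> S \<Longrightarrow> P (f + mon a ws)"
  shows "P (f :: free)"
  using assms(1)
proof (induction f rule: update_induct)
  case const
  then show ?case using assms(2) by simp
next
  case (update f ws a)
  have eq: "Poly_Mapping.update ws a f = f + mon a ws"
    by (rule poly_mapping_eqI) (use update in \<open>auto simp: lookup_update lookup_add lookup_single in_keys_iff when_def\<close>)
  have "Poly_Mapping.keys (Poly_Mapping.update ws a f) = insert ws (Poly_Mapping.keys f)"
    using update by (auto simp: in_keys_iff lookup_update split: if_splits)
  then show ?case using update assms(3) unfolding eq by blast
qed

text \<open>A right action: the letters of a word are applied from left to right.\<close>

lemma ract_mult: "ract r (f * g) \<phi> = ract r g (ract r f \<phi>)"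
proof (induction f rule: free_induct[where S = UNIV])
  case (add f a us)
  have *: "ract r (mon a us * g) \<phi> = ract r g (ract r (mon a us) \<phi>)"
  proof (induction g rule: free_induct[where S = UNIV])
    case (add g b vs)
    then show ?case
      by (simp add: fun_eq_iff distrib_left ract_add mult_single ract_mon plus_list_def ract_mon[abs_def]
          fold_rstep_scale mult_ac)
  qed (simp_all add: fun_eq_iff)
  have "ract r (f + mon a us) \<phi> = (\<lambda>y. ract r f \<phi> y + ract r (mon a us) \<phi> y)"
    by (simp add: fun_eq_iff ract_add)
  then show ?case using add * by (simp add: fun_eq_iff distrib_right ract_add ract_add_fun)
qed (auto simp: fun_eq_iff ract_def fold_rstep_scale[of r _ 0 "\<lambda>_. 0", simplified])

lemma fold_rstep_zero:
  assumes "ws \<in> lists {1..r}" "\<And>y. y \<in> WB r \<Longrightarrow> \<phi> y = 0" "y \<in> WB r"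
  shows "fold (rstep r) ws \<phi> y = 0"
  using assms(1,2)
proof (induction ws arbitrary: \<phi>)
  case Nil
  then show ?case using assms(3) by simp
next
  case (Cons i ws)
  have i: "1 \<le> i" "i \<le> r" using Cons.hyps(1) by auto
  have "rstep r i \<phi> y = 0" if "y \<in> WB r" for y
  proof -
    have "y o sB r i \<in> WB r" using WB_comp[OF that sB_WB[OF i]] .
    then have "\<phi> (y o sB r i) = 0" by (rule Cons.prems)
    then show ?thesis using Cons.prems[OF that] by (simp add: rstep_def)
  qed
  then show ?case using Cons by simp
qed

subsection \<open>The operators satisfy the defining relations\<close>

lemma qpar_last [simp]: "qpar r r = 1"
  by (simp add: qpar_def)

text \<open>Exactly one of \<open>y\<close> and \<open>y \<circ> s\<^sub>i\<close> has a descent at \<open>i\<close>,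
  which gives the quadratic relation in either case.\<close>

lemma rstep_quadratic:
  assumes "y \<in> WB r" "1 \<le> i" "i \<le> r"
  shows "rstep r i (rstep r i \<phi>) y = (qpar r i - 1) * rstep r i \<phi> y + qpar r i * \<phi> y"
proof -
  have "(y o sB r i) i = y (Suc i)" "(y o sB r i) (Suc i) = y i" using assms by simp_all
  then show ?thesis using assms WB_Suc_neq[OF assms(1), of i]
    by (auto simp: rstep_def[of r i] algebra_simps)
qed

lemma sB_far:
  assumes "1 \<le> i" "i + 2 \<le> j" "j \<le> r"
  shows "sB r i j = j" "sB r i (Suc j) = Suc j" "sB r j i = i" "sB r j (Suc i) = Suc i"
  using assms by (auto simp: sB_app)

lemma sB_commute:
  assumes "1 \<le> i" "i + 2 \<le> j" "j \<le> r"
  shows "sB r i o sB r j = sB r j o sB r i"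
proof (rule WB_eqI[of _ r])
  fix k
  define m where "m = 2*r - i"
  define n where "n = 2*r - j"
  have mn: "i + 2 \<le> j" "j \<le> n" "n = j \<or> j + 2 \<le> n" "n + 2 \<le> m" "2*r - i = m" "2*r - j = n" "2*r + 1 - i = Suc m" "2*r + 1 - j = Suc n"
    using assms double_minus_neq_Suc[of j r] by (auto simp: m_def n_def)
  have i: "sB r i k = (if k = i then Suc i else if k = Suc i then i else if k = m then Suc m else if k = Suc m then m else k)" for k
    using sB_app[of i r k] assms mn by simp
  have j: "sB r j k = (if k = j then Suc j else if k = Suc j then j else if k = n then Suc n else if k = Suc n then n else k)" for k
    using sB_app[of j r k] assms mn by simp
  consider "k = i \<or> k = Suc i" | "k = m \<or> k = Suc m" | "k \<noteq> i" "k \<noteq> Suc i" "k \<noteq> m" "k \<noteq> Suc m" by blast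
  then show "(sB r i o sB r j) k = (sB r j o sB r i) k"
  proof cases
    case 1 then show ?thesis using mn(1-4) unfolding o_apply i j by auto
  next
    case 2 then show ?thesis using mn(1-4) unfolding o_apply i j by auto
  next
    case 3
    then have "sB r i k = k" by (simp add: i)
    moreover have "sB r j k \<noteq> i" "sB r j k \<noteq> Suc i" "sB r j k \<noteq> m" "sB r j k \<noteq> Suc m"
      using 3 mn(1-4) unfolding j by auto
    then have "sB r i (sB r j k) = sB r j k" by (simp add: i)
    ultimately show ?thesis by simp
  qed
qed (use assms in \<open>auto intro!: WB_comp\<close>)

lemma sB_braid:
  assumes "1 \<le> i" "Suc i < r"
  shows "sB r i o sB r (Suc i) o sB r i = sB r (Suc i) o sB r i o sB r (Suc i)"
proof (rule WB_eqI[of _ r])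
  fix k
  define m where "m = 2*r - Suc i"
  have mn: "i + 2 < m" "2*r - i = Suc m" "2*r - Suc i = m" "2*r + 1 - i = Suc (Suc m)" "2*r + 1 - Suc i = Suc m"
    using assms by (auto simp: m_def)
  have i: "sB r i k = (if k = i then Suc i else if k = Suc i then i else if k = Suc m then Suc (Suc m) else if k = Suc (Suc m) then Suc m else k)" for k
    using sB_app[of i r k] assms mn by simp
  have j: "sB r (Suc i) k = (if k = Suc i then Suc (Suc i) else if k = Suc (Suc i) then Suc i else if k = m then Suc m else if k = Suc m then m else k)" for k
    using sB_app[of "Suc i" r k] assms mn by simp
  consider "k = i" | "k = Suc i" | "k = Suc (Suc i)" | "k = m" | "k = Suc m" | "k = Suc (Suc m)" 
    | "k \<notin> {i, Suc i, Suc (Suc i), m, Suc m, Suc (Suc m)}" by blast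
  then show "(sB r i o sB r (Suc i) o sB r i) k = (sB r (Suc i) o sB r i o sB r (Suc i)) k"
    by cases (use mn(1) in \<open>simp_all add: i j\<close>)
qed (use assms in \<open>auto intro!: WB_comp\<close>)

lemma sB_braid4:
  assumes "2 \<le> r"
  shows "sB r (r - 1) o sB r r o sB r (r - 1) o sB r r = sB r r o sB r (r - 1) o sB r r o sB r (r - 1)"
proof (rule WB_eqI[of _ r])
  fix k
  define i where "i = r - 1"
  have mn: "r = Suc i" "1 \<le> i" using assms by (auto simp: i_def)
  have i: "sB r i k = (if k = i then Suc i else if k = Suc i then i else if k = Suc (Suc i) then Suc (Suc (Suc i)) else if k = Suc (Suc (Suc i)) then Suc (Suc i) else k)" for k
    using sB_app[of i r k] mn by simp
  have j: "sB r r k = (if k = Suc i then Suc (Suc i) else if k = Suc (Suc i) then Suc i else k)" for k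
    using sB_app[of r r k] mn by simp
  consider "k = i" | "k = Suc i" | "k = Suc (Suc i)" | "k = Suc (Suc (Suc i))" 
    | "k \<notin> {i, Suc i, Suc (Suc i), Suc (Suc (Suc i))}" by blast
  then show "(sB r (r - 1) o sB r r o sB r (r - 1) o sB r r) k = (sB r r o sB r (r - 1) o sB r r o sB r (r - 1)) k"
    unfolding i_def[symmetric] by cases (simp_all add: i j)
qed (use assms in \<open>auto intro!: WB_comp\<close>)

lemma rstep_commute:
  assumes "y \<in> WB r" "1 \<le> i" "i + 2 \<le> j" "j \<le> r"
  shows "rstep r i (rstep r j \<phi>) y = rstep r j (rstep r i \<phi>) y"
proof -
  have "y o sB r i o sB r j = y o sB r j o sB r i" for y :: "nat \<Rightarrow> nat"
    using sB_commute[OF assms(2-4)] by (simp add: o_assoc[symmetric])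
  then show ?thesis by (simp add: rstep_def sB_far[OF assms(2-4)] algebra_simps)
qed

text \<open>The three values \<open>y i\<close>, \<open>y (i + 1)\<close>, \<open>y (i + 2)\<close> determine all the
  case distinctions in \<open>rstep\<close>, so the relation is a polynomial identity for each of their
  orders.\<close>

lemma rstep_braid:
  assumes "y \<in> WB r" "1 \<le> i" "Suc i < r"
  shows "rstep r i (rstep r (Suc i) (rstep r i \<phi>)) y = rstep r (Suc i) (rstep r i (rstep r (Suc i) \<phi>)) y"
proof -
  define s where "s = sB r i"
  define t where "t = sB r (Suc i)"
  have st: "s i = Suc i" "s (Suc i) = i" "s (Suc (Suc i)) = Suc (Suc i)"
    "t i = i" "t (Suc i) = Suc (Suc i)" "t (Suc (Suc i)) = Suc i"
    using assms unfolding s_def t_def by (auto simp: sB_app)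
  have ss: "y o s o s = y" "y o t o t = y" for y :: "nat \<Rightarrow> nat"
    using assms by (simp_all add: s_def t_def)
  have br: "y o t o s o t = y o s o t o s" for y :: "nat \<Rightarrow> nat"
    using sB_braid[OF assms(2,3)] by (simp add: s_def t_def o_assoc[symmetric])
  have ne: "y i \<noteq> y (Suc i)" "y i \<noteq> y (Suc (Suc i))" "y (Suc i) \<noteq> y (Suc (Suc i))"
    using WB_eq_iff[OF assms(1)] by auto
  have q: "qpar r i = qq" "qpar r (Suc i) = qq" using assms by (auto simp: qpar_def)
  define a b c where "a = y i" and "b = y (Suc i)" and "c = y (Suc (Suc i))"
  have ne': "a \<noteq> b" "a \<noteq> c" "b \<noteq> c" using ne by (auto simp: a_def b_def c_def)
  note abc = a_def[symmetric] b_def[symmetric] c_def[symmetric]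
  consider "a < b" "b < c" | "a < c" "c < b" | "b < a" "a < c" | "b < c" "c < a" | "c < a" "a < b" | "c < b" "b < a"
    using ne' by linarith
  then show ?thesis
    unfolding rstep_def s_def[symmetric] t_def[symmetric] q
    by cases (simp_all add: st ss br abc algebra_simps)
qed

text \<open>The operator for \<open>r\<close> is a mere translation, as its parameter is \<open>1\<close>, and the
  symmetry of \<open>y\<close> identifies the comparisons made on the two sides.\<close>

lemma rstep_braid4:
  assumes "y \<in> WB r" "2 \<le> r"
  shows "rstep r r (rstep r (r - 1) (rstep r r (rstep r (r - 1) \<phi>))) y
       = rstep r (r - 1) (rstep r r (rstep r (r - 1) (rstep r r \<phi>))) y"
proof -
  obtain i where i: "r = Suc i" "1 \<le> i" using assms by (cases r) auto
  define s where "s = sB r i"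
  define t where "t = sB r r"
  have st: "s i = Suc i" "s (Suc i) = i" "s (Suc (Suc i)) = Suc (Suc (Suc i))" "s (Suc (Suc (Suc i))) = Suc (Suc i)"
    "t i = i" "t (Suc i) = Suc (Suc i)" "t (Suc (Suc i)) = Suc i" "t (Suc (Suc (Suc i))) = Suc (Suc (Suc i))"
    using i unfolding s_def t_def by (simp_all add: sB_app)
  have ss: "y o s o s = y" "y o t o t = y" for y :: "nat \<Rightarrow> nat"
    using assms i sB_comp_cancel[of i r y] sB_comp_cancel[of r r y] by (simp_all add: s_def t_def)
  have br: "y o s o t o s o t = y o t o s o t o s" for y :: "nat \<Rightarrow> nat"
    using sB_braid4[OF assms(2)] i by (simp add: s_def t_def o_assoc[symmetric])
  have mir1: "y (Suc (Suc i)) = 2*r + 1 - y (Suc i)" using WB_mir[OF assms(1), of "Suc i"] i by simp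
  have "mir r i = Suc (Suc (Suc i))" using i by simp
  moreover have "i \<le> 2*r" using i by simp
  ultimately have mir2: "y (Suc (Suc (Suc i))) = 2*r + 1 - y i" using WB_mir[OF assms(1), of i] i(2) by metis
  have rg: "1 \<le> y i" "y i \<le> 2*r" "1 \<le> y (Suc i)" "y (Suc i) \<le> 2*r"
    using WB_range[OF assms(1), of i] WB_range[OF assms(1), of "Suc i"] i by auto
  have c1: "(y (Suc (Suc (Suc i))) < y (Suc (Suc i))) = (y (Suc i) < y i)"
    unfolding mir1 mir2 using rg by linarith
  have c2: "(y (Suc (Suc (Suc i))) < y (Suc i)) = (y (Suc (Suc i)) < y i)"
    unfolding mir1 mir2 using rg by linarith
  have T: "rstep r r \<psi> = (\<lambda>y. \<psi> (y o t))" for \<psi> by (simp add: rstep_def fun_eq_iff t_def)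
  have r1: "r - 1 = i" using i by simp
  show ?thesis unfolding T r1 rstep_def[of r i] s_def[symmetric]
    by (simp add: st ss br c1 c2 algebra_simps)
qed

subsection \<open>The quotient construction\<close>

lemma keys_lists_mult:
  assumes "Poly_Mapping.keys f \<subseteq> lists S" "Poly_Mapping.keys g \<subseteq> lists S"
  shows "Poly_Mapping.keys ((f :: free) * g) \<subseteq> lists S"
  using keys_mult[of f g] assms by (fastforce simp: plus_list_def)

lemma free_alg_simps [simp]:
  "monoid.mult (free_alg r) = (*)" "one (free_alg r) = 1" "zero (free_alg r) = 0" "add (free_alg r) = (+)"
  by (simp_all add: free_alg_def)

lemma free_alg_carrier: "f \<in> carrier (free_alg r) \<longleftrightarrow> Poly_Mapping.keys f \<subseteq> lists {1..r}"
  by (simp add: free_alg_def)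

lemma ring_free_alg: "ring (free_alg r)"
proof (rule ringI)
  show "abelian_group (free_alg r)"
  proof (rule abelian_groupI)
    fix x y assume "x \<in> carrier (free_alg r)" "y \<in> carrier (free_alg r)"
    then show "x \<oplus>\<^bsub>free_alg r\<^esub> y \<in> carrier (free_alg r)"
      using keys_add[of x y] by (auto simp: free_alg_carrier)
  next
    fix x assume "x \<in> carrier (free_alg r)"
    then show "\<exists>y\<in>carrier (free_alg r). y \<oplus>\<^bsub>free_alg r\<^esub> x = \<zero>\<^bsub>free_alg r\<^esub>"
      by (intro bexI[of _ "- x"]) (auto simp: free_alg_carrier)
  qed (auto simp: free_alg_carrier ac_simps)
  show "Group.monoid (free_alg r)"
  proof (rule monoidI)
    fix x y assume "x \<in> carrier (free_alg r)" "y \<in> carrier (free_alg r)"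
    then show "x \<otimes>\<^bsub>free_alg r\<^esub> y \<in> carrier (free_alg r)"
      using keys_lists_mult[of x "{1..r}" y] by (simp add: free_alg_carrier)
  next
    show "\<one>\<^bsub>free_alg r\<^esub> \<in> carrier (free_alg r)" by (simp add: free_alg_carrier zero_list_def)
  qed (simp_all add: mult.assoc)
qed (auto simp: distrib_left distrib_right)

lemma mon_carrier: "ws \<in> lists {1..r} \<Longrightarrow> mon a ws \<in> carrier (free_alg r)"
  by (auto simp: free_alg_carrier)

lemma mon_mult: "mon a us * mon b vs = mon (a * b) (us @ vs)"
  by (simp add: mult_single plus_list_def)

lemma mon_one: "mon 1 [] = 1"
  by (metis single_one zero_list_def)

locale type_B =
  fixes r :: nat
  assumes rank: "2 \<le> r"
begin

abbreviation "W \<equiv> WB r"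
abbreviation "H \<equiv> heckeB r"
abbreviation "I \<equiv> hecke_ideal r"
abbreviation hmult (infixl "**" 70) where "x ** y \<equiv> x \<otimes>\<^bsub>heckeB r\<^esub> y"
abbreviation hadd (infixl "\<boxplus>" 65) where "x \<boxplus> y \<equiv> x \<oplus>\<^bsub>heckeB r\<^esub> y"

abbreviation hzero ("\<^bold>0") where "\<^bold>0 \<equiv> \<zero>\<^bsub>heckeB r\<^esub>"
abbreviation hone ("\<^bold>1") where "\<^bold>1 \<equiv> \<one>\<^bsub>heckeB r\<^esub>"
abbreviation "Tr \<equiv> Tgen r  r"

lemma hecke_rels_carrier: "hecke_rels r \<subseteq> carrier (free_alg r)"
proof -
  interpret F: ring "free_alg r" by (rule ring_free_alg)
  have [simp]: "f - g \<in> carrier (free_alg r)" if "f \<in> carrier (free_alg r)" "g \<in> carrier (free_alg r)" for f g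
    using that keys_diff[of f g] by (auto simp: free_alg_carrier)
  have [simp]: "f + g \<in> carrier (free_alg r)" if "f \<in> carrier (free_alg r)" "g \<in> carrier (free_alg r)" for f g
    using F.a_closed[OF that] by simp
  show ?thesis using rank by (auto simp: hecke_rels_def mon_carrier)
qed

lemma ideal_I: "ideal I (free_alg r)"
  unfolding hecke_ideal_def by (rule ring.genideal_ideal[OF ring_free_alg hecke_rels_carrier])

sublocale H: ring "heckeB r"
  unfolding heckeB_def by (rule ideal.quotient_is_ring[OF ideal_I])

lemma ract_rels:
  assumes "f \<in> hecke_rels r" "y \<in> W"
  shows "ract r f \<phi> y = 0"
proof -
  consider (far) i j where "f = mon 1 [i, j] - mon 1 [j, i]" "i \<in> {1..r}" "j \<in> {1..r}" "i + 2 \<le> j \<or> j + 2 \<le> i"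
    | (braid) j where "f = mon 1 [j, j + 1, j] - mon 1 [j + 1, j, j + 1]" "1 \<le> j" "j + 1 < r"
    | (braid4) "f = mon 1 [r - 1, r, r - 1, r] - mon 1 [r, r - 1, r, r - 1]"
    | (quad) i where "f = mon 1 [i, i] - (mon (qq - 1) [i] + mon qq [])" "1 \<le> i" "i < r"
    | (last) "f = mon 1 [r, r] - mon 1 []"
    using assms(1) unfolding hecke_rels_def by blast
  then show ?thesis
  proof cases
    case far
    then show ?thesis using rstep_commute[OF assms(2), of i j \<phi>] rstep_commute[OF assms(2), of j i \<phi>]
      by (auto simp: ract_diff ract_mon)
  next
    case braid
    then show ?thesis using rstep_braid[OF assms(2), of j \<phi>] by (simp add: ract_diff ract_mon)
  next
    case braid4
    then show ?thesis using rstep_braid4[OF assms(2) rank, of \<phi>] by (simp add: ract_diff ract_mon)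
  next
    case quad
    then show ?thesis using rstep_quadratic[OF assms(2), of i \<phi>]
      by (simp add: ract_diff ract_add ract_mon qpar_def)
  next
    case last
    then show ?thesis using rstep_quadratic[OF assms(2), of r \<phi>] rank by (simp add: ract_diff ract_mon)
  qed
qed

text \<open>The elements that act by zero on every function form an ideal, which contains the relations.\<close>

lemma ract_ideal:
  assumes "f \<in> I" "y \<in> W" shows "ract r f \<phi> y = 0"
proof -
  let ?J = "{f \<in> carrier (free_alg r). \<forall>\<phi>. \<forall>y\<in>W. ract r f \<phi> y = 0}"
  interpret F: ring "free_alg r" by (rule ring_free_alg)
  have z: "ract r x \<phi> y = 0" if "x \<in> carrier (free_alg r)" "\<forall>y\<in>W. \<phi> y = 0" "y \<in> W" for x \<phi> y
    unfolding ract_def using that fold_rstep_zero[of _ r \<phi> y]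
    by (intro sum.neutral) (auto simp: free_alg_carrier subset_iff)
  have "ideal ?J (free_alg r)"
  proof (rule idealI[OF ring_free_alg])
    show "subgroup ?J (add_monoid (free_alg r))"
    proof (rule group.subgroupI[OF F.add.is_group])
      fix a assume "a \<in> ?J"
      moreover then have "inv\<^bsub>add_monoid (free_alg r)\<^esub> a = - a"
        unfolding a_inv_def[symmetric] by (intro F.minus_equality) (auto simp: free_alg_carrier)
      ultimately show "inv\<^bsub>add_monoid (free_alg r)\<^esub> a \<in> ?J" by (auto simp: ract_uminus free_alg_carrier)
    next
      fix a b assume "a \<in> ?J" "b \<in> ?J"
      then show "a \<otimes>\<^bsub>add_monoid (free_alg r)\<^esub> b \<in> ?J"
        using F.a_closed[of a b] by (auto simp: ract_add)
    qed (auto simp: free_alg_carrier intro!: exI[of _ 0])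
  next
    fix a x assume a: "a \<in> ?J" "x \<in> carrier (free_alg r)"
    show "x \<otimes>\<^bsub>free_alg r\<^esub> a \<in> ?J" using a F.m_closed[of x a] by (auto simp: ract_mult)
    show "a \<otimes>\<^bsub>free_alg r\<^esub> x \<in> ?J" using a F.m_closed[of a x] z by (auto simp: ract_mult)
  qed
  moreover have "hecke_rels r \<subseteq> ?J" using hecke_rels_carrier ract_rels by auto
  ultimately have "I \<subseteq> ?J" unfolding hecke_ideal_def by (rule F.genideal_minimal)
  then show ?thesis using assms by blast
qed

definition hp :: "free \<Rightarrow> hecke" where "hp f = I +>\<^bsub>free_alg r\<^esub> f"

lemma hp_hom: "hp \<in> ring_hom (free_alg r) H"
  unfolding hp_def heckeB_def by (rule ideal.rcos_ring_hom[OF ideal_I])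

lemma hp_closed [simp]: "f \<in> carrier (free_alg r) \<Longrightarrow> hp f \<in> carrier H"
  using ring_hom_closed[OF hp_hom] .

lemma hp_mult: "f \<in> carrier (free_alg r) \<Longrightarrow> g \<in> carrier (free_alg r) \<Longrightarrow> hp (f * g) = hp f ** hp g"
  using ring_hom_mult[OF hp_hom, of f g] by simp

lemma hp_add: "f \<in> carrier (free_alg r) \<Longrightarrow> g \<in> carrier (free_alg r) \<Longrightarrow> hp (f + g) = hp f \<boxplus> hp g"
  using ring_hom_add[OF hp_hom, of f g] by simp

lemma hp_one: "hp 1 = \<^bold>1"
  using ring_hom_one[OF hp_hom] by simp

lemma hp_surj: "x \<in> carrier H \<Longrightarrow> \<exists>f\<in>carrier (free_alg r). x = hp f"
  by (auto simp: heckeB_def FactRing_def A_RCOSETS_def RCOSETS_def hp_def a_r_coset_def)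

lemma hp_self: "f \<in> carrier (free_alg r) \<Longrightarrow> f \<in> hp f"
proof -
  assume f: "f \<in> carrier (free_alg r)"
  interpret id: ideal I "free_alg r" by (rule ideal_I)
  show ?thesis unfolding hp_def using id.a_rcos_self[OF f] .
qed

lemma hp_memD: "g \<in> hp f \<Longrightarrow> \<exists>i\<in>I. g = i + f"
  by (auto simp: hp_def a_r_coset_def')

lemma hp_zero: "hp 0 = \<^bold>0"
proof -
  interpret F: ring "free_alg r" by (rule ring_free_alg)
  have z: "0 \<in> carrier (free_alg r)" using F.zero_closed by simp
  have "hp 0 \<boxplus> hp 0 = hp 0" using hp_add[OF z z] by simp
  then show ?thesis using hp_closed[OF z] H.add.l_cancel_one by blast
qed

lemma hp_eqI:
  assumes "f - g \<in> I" "f \<in> carrier (free_alg r)" "g \<in> carrier (free_alg r)" shows "hp f = hp g"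
proof -
  interpret F: ring "free_alg r" by (rule ring_free_alg)
  interpret id: ideal I "free_alg r" by (rule ideal_I)
  have "hp (f - g) = \<^bold>0"
    unfolding hp_def using id.a_rcos_const[OF assms(1)] by (simp add: heckeB_def FactRing_def)
  moreover have "f - g \<in> carrier (free_alg r)" using assms(1) id.a_subset by auto
  ultimately have "hp (f - g + g) = \<^bold>0 \<boxplus> hp g" using assms(3) by (subst hp_add) auto
  then show ?thesis using assms by simp
qed

end

context type_B
begin

definition Tword :: "nat list \<Rightarrow> hecke" where
  "Tword ws = foldr (\<lambda>i x. Tgen r i ** x) ws \<^bold>1"

lemma Tgen_hp: "Tgen r i = hp (mon 1 [i])"
  by (simp add: Tgen_def hp_def)

lemma scal_hp: "scal r a = hp (mon a [])"
  by (simp add: scal_def hp_def)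

lemma Tgen_closed [simp]: "1 \<le> i \<Longrightarrow> i \<le> r \<Longrightarrow> Tgen r i \<in> carrier H"
  unfolding Tgen_hp by (intro hp_closed mon_carrier) auto

lemma scal_closed [simp]: "scal r a \<in> carrier H"
  unfolding scal_hp by (intro hp_closed mon_carrier) auto

lemma Tword_hp: "ws \<in> lists {1..r} \<Longrightarrow> Tword ws = hp (mon 1 ws)"
proof (induction ws)
  case Nil
  then show ?case by (simp add: Tword_def mon_one hp_one)
next
  case (Cons i ws)
  then have "hp (mon 1 (i # ws)) = hp (mon 1 [i] * mon 1 ws)" by (simp add: mon_mult)
  also have "\<dots> = hp (mon 1 [i]) ** hp (mon 1 ws)"
    using Cons by (intro hp_mult mon_carrier) auto
  finally show ?case using Cons by (simp add: Tword_def Tgen_hp)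
qed

lemma Tword_closed [simp]: "ws \<in> lists {1..r} \<Longrightarrow> Tword ws \<in> carrier H"
  unfolding Tword_hp by (intro hp_closed mon_carrier)

lemma Tword_Nil [simp]: "Tword [] = \<^bold>1"
  by (simp add: Tword_def)

lemma Tword_Cons: "Tword (i # ws) = Tgen r i ** Tword ws"
  by (simp add: Tword_def)

lemma Tword_append: "us \<in> lists {1..r} \<Longrightarrow> vs \<in> lists {1..r} \<Longrightarrow> Tword (us @ vs) = Tword us ** Tword vs"
  by (induction us) (auto simp: Tword_Cons H.m_assoc)

lemma Tword_rel:
  assumes "mon 1 us - mon 1 vs \<in> hecke_rels r" "us \<in> lists {1..r}" "vs \<in> lists {1..r}"
  shows "Tword us = Tword vs"
proof -
  have "mon 1 us - mon 1 vs \<in> I"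
    using ring.genideal_self[OF ring_free_alg hecke_rels_carrier] assms(1) by (auto simp: hecke_ideal_def)
  then show ?thesis using assms by (simp add: Tword_hp mon_carrier hp_eqI)
qed

lemma scal_mult: "scal r (a * b) = scal r a ** scal r b"
  using hp_mult[OF mon_carrier mon_carrier, of "[]" "[]" a b] by (simp add: scal_hp mon_mult)

lemma scal_add: "scal r (a + b) = scal r a \<boxplus> scal r b"
  using hp_add[OF mon_carrier mon_carrier, of "[]" "[]" a b] by (simp add: scal_hp single_add)

lemma scal_one [simp]: "scal r 1 = \<^bold>1"
  by (simp add: scal_hp mon_one hp_one)

lemma scal_zero [simp]: "scal r 0 = \<^bold>0"
  by (simp add: scal_hp hp_zero)

lemma mon_comm: "mon a [] * f = f * mon a []"
  by (induction f rule: free_induct[where S = UNIV])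
    (auto simp: distrib_left distrib_right mult_single plus_list_def mult.commute)

lemma scal_comm: "x \<in> carrier H \<Longrightarrow> scal r a ** x = x ** scal r a"
proof -
  assume "x \<in> carrier H"
  then obtain f where f: "f \<in> carrier (free_alg r)" "x = hp f" using hp_surj by blast
  have "mon a [] \<in> carrier (free_alg r)" by (intro mon_carrier) auto
  then show ?thesis using f by (simp add: scal_hp flip: hp_mult add: mon_comm)
qed

lemma scal_left_comm:
  assumes "x \<in> carrier H" "y \<in> carrier H" shows "x ** (scal r a ** y) = scal r a ** (x ** y)"
proof -
  have "x ** (scal r a ** y) = (scal r a ** x) ** y" using assms by (simp add: H.m_assoc scal_comm)
  then show ?thesis using assms by (simp add: H.m_assoc)
qed

lemma Tgen_square:
  assumes "1 \<le> i" "i \<le> r"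
  shows "Tgen r i ** Tgen r i = (scal r (qpar r i - 1) ** Tgen r i) \<boxplus> scal r (qpar r i)"
proof -
  have c: "mon a [i] \<in> carrier (free_alg r)" "mon a [i, i] \<in> carrier (free_alg r)" "mon a [] \<in> carrier (free_alg r)" for a
    using assms by (auto intro!: mon_carrier)
  have c2: "mon (qpar r i - 1) [i] + mon (qpar r i) [] \<in> carrier (free_alg r)"
    using ring.ring_simprules(1)[OF ring_free_alg c(1) c(3)] by simp
  have "mon 1 [i, i] - (mon (qpar r i - 1) [i] + mon (qpar r i) []) \<in> hecke_rels r"
    using assms by (cases "i = r") (auto simp: hecke_rels_def qpar_def)
  then have "mon 1 [i, i] - (mon (qpar r i - 1) [i] + mon (qpar r i) []) \<in> I"
    using ring.genideal_self[OF ring_free_alg hecke_rels_carrier] by (auto simp: hecke_ideal_def)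
  then have "hp (mon 1 [i, i]) = hp (mon (qpar r i - 1) [i] + mon (qpar r i) [])"
    using c c2 by (intro hp_eqI) auto
  also have "\<dots> = hp (mon (qpar r i - 1) [i]) \<boxplus> hp (mon (qpar r i) [])" using c by (intro hp_add) auto
  also have "hp (mon (qpar r i - 1) [i]) = hp (mon (qpar r i - 1) [] * mon 1 [i])" by (simp add: mon_mult)
  also have "\<dots> = scal r (qpar r i - 1) ** Tgen r i" using c by (simp add: hp_mult scal_hp Tgen_hp)
  finally show ?thesis
    using hp_mult[OF c(1) c(1), of 1 1] by (simp add: Tgen_hp scal_hp mon_mult)
qed

lemma Tr_Tr [simp]: "Tr ** Tr = \<^bold>1"
  using Tgen_square[of r] rank by simp

lemma one_le_r [simp]: "1 \<le> r" "Suc 0 \<le> r"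
  using rank by auto

subsection \<open>Independence of the reduced word\<close>

lemma reduced_Cons_desc:
  assumes "w \<in> W" "1 \<le> i" "i \<le> r" "pinv w (Suc i) < pinv w i" "reduced_word r xs (sB r i o w)"
  shows "reduced_word r (i # xs) w"
  using assms lenB_left_desc[OF assms(1-4)] by (auto simp: reduced_word_def fun_eq_iff)

lemma reduced_ConsD:
  assumes "reduced_word r (i # xs) w"
  shows "1 \<le> i" "i \<le> r" "w \<in> W" "pinv w (Suc i) < pinv w i" "reduced_word r xs (sB r i o w)"
    "sB r i o w \<in> W" "lenB r w = Suc (lenB r (sB r i o w))"
proof -
  show i: "1 \<le> i" "i \<le> r" using assms by (auto simp: reduced_word_def)
  show w: "w \<in> W" using assms word_prod_WB[of "i # xs" r] by (auto simp: reduced_word_def)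
  have xs: "xs \<in> lists {1..r}" "sB r i o word_prod (sB r) xs = w" using assms by (auto simp: reduced_word_def)
  then have sw: "sB r i o w = word_prod (sB r) xs" using i by auto
  then have le: "lenB r (sB r i o w) \<le> length xs" using lenB_le_word xs by metis
  have len: "lenB r w = Suc (length xs)" using assms by (auto simp: reduced_word_def)
  show sW: "sB r i o w \<in> W" using i w by (intro WB_comp) auto
  have "pinv w (Suc i) \<noteq> pinv w i" using WB_Suc_neq[OF WB_inv[OF w]] by metis
  moreover have "\<not> pinv w i < pinv w (Suc i)" using lenB_left_asc[OF w i] le len by auto
  ultimately show d: "pinv w (Suc i) < pinv w i" by simp
  show "lenB r w = Suc (lenB r (sB r i o w))" using lenB_left_desc[OF w i d] .
  then show "reduced_word r xs (sB r i o w)" using len xs sw by (auto simp: reduced_word_def)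
qed

text \<open>Two distinct left descents \<open>i < j\<close> of \<open>w\<close> are the first letters of two reduced words of \<open>w\<close>
  which agree up to one braid relation: the longest element of the dihedral subgroup generated by
  the two reflections splits off on the left.\<close>

lemma two_descents:
  assumes w: "w \<in> W" and ij: "1 \<le> i" "i < j" "j \<le> r"
    and di: "pinv w (Suc i) < pinv w i" and dj: "pinv w (Suc j) < pinv w j"
  shows "\<exists>us vs. reduced_word r (i # us) w \<and> reduced_word r (j # vs) w \<and> Tword (i # us) = Tword (j # vs)"
proof -
  define v where "v = pinv w"
  have pv: "pinv (sB r k o x) = pinv x o sB r k" if "x \<in> W" "1 \<le> k" "k \<le> r" for k x
    using inv_left_mult that by blast
  have cl: "sB r k o x \<in> W" if "x \<in> W" "1 \<le> k" "k \<le> r" for k x using that by (intro WB_comp) auto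
  have ge1: "1 \<le> j" and ir: "i \<le> r" using ij by auto
  consider (far) "i + 2 \<le> j" | (braid) "j = Suc i" "j < r" | (last) "j = Suc i" "j = r" using ij by linarith
  then show ?thesis
  proof cases
    case far
    define x where "x = sB r j o (sB r i o w)"
    have x': "x = sB r i o (sB r j o w)" unfolding x_def using sB_commute[OF ij(1) far ij(3)] by (simp add: o_assoc)
    have xW: "x \<in> W" unfolding x_def using w ij by (intro cl) auto
    obtain xs where xs: "reduced_word r xs x" using exists_reduced_word[OF xW] by blast
    have f: "sB r i j = j" "sB r i (Suc j) = Suc j" "sB r j i = i" "sB r j (Suc i) = Suc i"
      using sB_far[OF ij(1) far ij(3)] by auto
    have "reduced_word r (j # xs) (sB r i o w)"
      by (rule reduced_Cons_desc) (use w ij dj xs f pv[OF w ij(1) ir] in \<open>auto simp: cl x_def\<close>)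
    then have 1: "reduced_word r (i # j # xs) w" by (rule reduced_Cons_desc[rotated -1]) (use w ij di in auto)
    have "reduced_word r (i # xs) (sB r j o w)"
      by (rule reduced_Cons_desc) (use w ij di xs f pv[OF w ge1 ij(3)] in \<open>auto simp: cl x'\<close>)
    then have 2: "reduced_word r (j # i # xs) w" by (rule reduced_Cons_desc[rotated -1]) (use w ij dj in auto)
    have "mon 1 [i, j] - mon 1 [j, i] \<in> hecke_rels r"
      unfolding hecke_rels_def using ij far ge1 ir by (intro UnI1 CollectI exI[of _ i] exI[of _ j]) auto
    then have "Tword [i, j] = Tword [j, i]" using ij by (intro Tword_rel) auto
    then have "Tword ([i, j] @ xs) = Tword ([j, i] @ xs)"
      using ij xs by (subst (1 2) Tword_append) (auto simp: reduced_word_def)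
    then show ?thesis using 1 2 by auto
  next
    case braid
    have s: "sB r i i = Suc i" "sB r i (Suc i) = i" "sB r i (Suc (Suc i)) = Suc (Suc i)"
      "sB r j i = i" "sB r j (Suc i) = Suc (Suc i)" "sB r j (Suc (Suc i)) = Suc i"
      using ij braid by (auto simp: sB_app)
    define x where "x = sB r i o (sB r j o (sB r i o w))"
    have x': "x = sB r j o (sB r i o (sB r j o w))"
      unfolding x_def using sB_braid[of i r] ij braid by (simp add: o_assoc)
    have xW: "x \<in> W" unfolding x_def using w ij by (intro cl) auto
    obtain xs where xs: "reduced_word r xs x" using exists_reduced_word[OF xW] by blast
    have v: "v (Suc i) < v i" "v (Suc (Suc i)) < v (Suc i)" using di dj braid by (auto simp: v_def)
    have p1: "pinv (sB r i o w) = v o sB r i" "pinv (sB r j o w) = v o sB r j"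
      using pv w ij by (auto simp: v_def)
    have p2: "pinv (sB r j o (sB r i o w)) = v o sB r i o sB r j" "pinv (sB r i o (sB r j o w)) = v o sB r j o sB r i"
      using pv[OF cl[OF w ij(1) ir] ge1 ij(3)] pv[OF cl[OF w ge1 ij(3)] ij(1) ir] p1 by auto
    have "reduced_word r (i # xs) (sB r j o (sB r i o w))"
      by (rule reduced_Cons_desc) (use w ij v xs s p2 in \<open>auto simp: cl x_def\<close>)
    then have "reduced_word r (j # i # xs) (sB r i o w)"
      by (rule reduced_Cons_desc[rotated -1]) (use w ij v xs s p1 braid in \<open>auto simp: cl\<close>)
    then have 1: "reduced_word r (i # j # i # xs) w" by (rule reduced_Cons_desc[rotated -1]) (use w ij di in auto)
    have "reduced_word r (j # xs) (sB r i o (sB r j o w))"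
      by (rule reduced_Cons_desc) (use w ij v xs s p2 braid in \<open>auto simp: cl x'\<close>)
    then have "reduced_word r (i # j # xs) (sB r j o w)"
      by (rule reduced_Cons_desc[rotated -1]) (use w ij v xs s p1 braid in \<open>auto simp: cl\<close>)
    then have 2: "reduced_word r (j # i # j # xs) w" by (rule reduced_Cons_desc[rotated -1]) (use w ij dj in auto)
    have "mon 1 [i, j, i] - mon 1 [j, i, j] \<in> hecke_rels r"
      unfolding hecke_rels_def using ij braid by (intro UnI1 UnI2 CollectI exI[of _ i]) auto
    then have "Tword [i, j, i] = Tword [j, i, j]" using ij by (intro Tword_rel) auto
    then have "Tword ([i, j, i] @ xs) = Tword ([j, i, j] @ xs)"
      using ij xs by (subst (1 2) Tword_append) (auto simp: reduced_word_def)
    then show ?thesis using 1 2 by auto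
  next
    case last
    have s: "sB r i i = Suc i" "sB r i (Suc i) = i" "sB r i (Suc (Suc i)) = Suc (Suc (Suc i))" "sB r i (Suc (Suc (Suc i))) = Suc (Suc i)"
      "sB r j i = i" "sB r j (Suc i) = Suc (Suc i)" "sB r j (Suc (Suc i)) = Suc i" "sB r j (Suc (Suc (Suc i))) = Suc (Suc (Suc i))"
      using ij last by (auto simp: sB_app)
    define x where "x = sB r j o (sB r i o (sB r j o (sB r i o w)))"
    have x': "x = sB r i o (sB r j o (sB r i o (sB r j o w)))"
      unfolding x_def using sB_braid4[of r] ij last by (simp add: o_assoc)
    have xW: "x \<in> W" unfolding x_def using w ij by (intro cl) auto
    obtain xs where xs: "reduced_word r xs x" using exists_reduced_word[OF xW] by blast
    have v: "v (Suc i) < v i" "v (Suc (Suc i)) < v (Suc i)" using di dj last by (auto simp: v_def)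
    have v3: "v (Suc (Suc (Suc i))) < v (Suc (Suc i))"
    proof -
      have "mir r i = Suc (Suc (Suc i))" "mir r (Suc i) = Suc (Suc i)" "Suc i \<le> 2*r" using last by auto
      then have "v (Suc (Suc (Suc i))) = mir r (v i)" "v (Suc (Suc i)) = mir r (v (Suc i))"
        using WB_mir[OF WB_inv[OF w], of i] WB_mir[OF WB_inv[OF w], of "Suc i"] ij ir unfolding v_def by auto
      then show ?thesis using v(1) WB_range[OF WB_inv[OF w], of i] ij ir by (simp add: v_def)
    qed
    have p1: "pinv (sB r i o w) = v o sB r i" "pinv (sB r j o w) = v o sB r j"
      using pv w ij by (auto simp: v_def)
    have p2: "pinv (sB r j o (sB r i o w)) = v o sB r i o sB r j" "pinv (sB r i o (sB r j o w)) = v o sB r j o sB r i"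
      using pv[OF cl[OF w ij(1) ir] ge1 ij(3)] pv[OF cl[OF w ge1 ij(3)] ij(1) ir] p1 by auto
    have p3: "pinv (sB r i o (sB r j o (sB r i o w))) = v o sB r i o sB r j o sB r i"
      "pinv (sB r j o (sB r i o (sB r j o w))) = v o sB r j o sB r i o sB r j"
      using pv[OF cl[OF cl[OF w ij(1) ir] ge1 ij(3)] ij(1) ir] pv[OF cl[OF cl[OF w ge1 ij(3)] ij(1) ir] ge1 ij(3)] p2 by auto
    have "reduced_word r (j # xs) (sB r i o (sB r j o (sB r i o w)))"
      by (rule reduced_Cons_desc) (use w ij v v3 xs s p3 last(1) in \<open>auto simp: cl x_def\<close>)
    then have "reduced_word r (i # j # xs) (sB r j o (sB r i o w))"
      by (rule reduced_Cons_desc[rotated -1]) (use w ij v v3 xs s p2 in \<open>auto simp: cl\<close>)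
    then have "reduced_word r (j # i # j # xs) (sB r i o w)"
      by (rule reduced_Cons_desc[rotated -1]) (use w ij v v3 xs s p1 last(1) in \<open>auto simp: cl\<close>)
    then have 1: "reduced_word r (i # j # i # j # xs) w" by (rule reduced_Cons_desc[rotated -1]) (use w ij di in auto)
    have "reduced_word r (i # xs) (sB r j o (sB r i o (sB r j o w)))"
      by (rule reduced_Cons_desc) (use w ij v v3 xs s p3 in \<open>auto simp: cl x'\<close>)
    then have "reduced_word r (j # i # xs) (sB r i o (sB r j o w))"
      by (rule reduced_Cons_desc[rotated -1]) (use w ij v v3 xs s p2 last(1) in \<open>auto simp: cl\<close>)
    then have "reduced_word r (i # j # i # xs) (sB r j o w)"
      by (rule reduced_Cons_desc[rotated -1]) (use w ij v v3 xs s p1 in \<open>auto simp: cl\<close>)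
    then have 2: "reduced_word r (j # i # j # i # xs) w" by (rule reduced_Cons_desc[rotated -1]) (use w ij dj in auto)
    have "mon 1 [i, j, i, j] - mon 1 [j, i, j, i] \<in> hecke_rels r"
      unfolding hecke_rels_def using ij last by auto
    then have "Tword [i, j, i, j] = Tword [j, i, j, i]" using ij by (intro Tword_rel) auto
    then have "Tword ([i, j, i, j] @ xs) = Tword ([j, i, j, i] @ xs)"
      using ij xs by (subst (1 2) Tword_append) (auto simp: reduced_word_def)
    then show ?thesis using 1 2 by auto
  qed
qed

text \<open>Matsumoto's theorem for this presentation. If the first letters of the two words agree, induction applies to
  the rest; otherwise \<open>two_descents\<close> supplies reduced words with these first letters and equal
  products.\<close>

lemma Tword_reduced_eq:
  assumes "reduced_word r us w" "reduced_word r vs w"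
  shows "Tword us = Tword vs"
  using assms
proof (induction "length us" arbitrary: us vs w rule: less_induct)
  case less
  have len: "length us = length vs" using less.prems by (auto simp: reduced_word_def)
  show ?case
  proof (cases us)
    case Nil
    then show ?thesis using len by simp
  next
    case (Cons i us')
    then obtain j vs' where vs: "vs = j # vs'" using len by (cases vs) auto
    have i: "reduced_word r (i # us') w" and j: "reduced_word r (j # vs') w" using less.prems Cons vs by auto
    note iD = reduced_ConsD[OF i] note jD = reduced_ConsD[OF j]
    have same: "Tword (k # xs) = Tword (k # ys)"
      if "reduced_word r (k # xs) w" "reduced_word r (k # ys) w" for k xs ys
    proof -
      have "length xs < length us" using that less.prems by (auto simp: reduced_word_def)
      then have "Tword xs = Tword ys"
        using less.hyps reduced_ConsD(5)[OF that(1)] reduced_ConsD(5)[OF that(2)] by blast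
      then show ?thesis by (simp add: Tword_Cons)
    qed
    consider "i = j" | "i < j" | "j < i" by linarith
    then show ?thesis
    proof cases
      case 1
      then have "reduced_word r (i # vs') w" using j by simp
      then show ?thesis using same[OF i] Cons vs 1 by blast
    next
      case 2
      then obtain xs ys where o: "reduced_word r (i # xs) w" "reduced_word r (j # ys) w" "Tword (i # xs) = Tword (j # ys)"
        using two_descents[of w i j] iD jD by blast
      show ?thesis using same[OF i o(1)] same[OF j o(2)] o(3) Cons vs by simp
    next
      case 3
      then obtain xs ys where o: "reduced_word r (j # xs) w" "reduced_word r (i # ys) w" "Tword (j # xs) = Tword (i # ys)"
        using two_descents[of w j i] iD jD by blast
      show ?thesis using same[OF i o(2)] same[OF j o(1)] o(3) Cons vs by simp
    qed
  qed
qed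

lemma Tw_reduced: "reduced_word r ws w \<Longrightarrow> Tw r w = Tword ws"
  using Tword_reduced_eq[of "SOME ws. reduced_word r ws w" w ws] someI[of "\<lambda>ws. reduced_word r ws w" ws]
  by (auto simp: Tw_def Tword_def)

lemma Tw_closed [simp]: assumes "w \<in> W" shows "Tw r w \<in> carrier H"
proof -
  obtain ws where ws: "reduced_word r ws w" using exists_reduced_word[OF assms] by blast
  then show ?thesis using Tw_reduced[OF ws] by (simp add: reduced_word_def)
qed

lemma Tgen_Tw:
  assumes "w \<in> W" "1 \<le> i" "i \<le> r" "pinv w i < pinv w (Suc i)"
  shows "Tgen r i ** Tw r w = Tw r (sB r i o w)"
proof -
  obtain ws where ws: "reduced_word r ws w" using exists_reduced_word[OF assms(1)] by blast
  then have "reduced_word r (i # ws) (sB r i o w)"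
    using assms lenB_left_asc[OF assms] by (auto simp: reduced_word_def)
  then show ?thesis using Tw_reduced ws by (metis Tword_Cons)
qed

lemma Tw_Tgen:
  assumes "w \<in> W" "1 \<le> i" "i \<le> r" "w i < w (Suc i)"
  shows "Tw r w ** Tgen r i = Tw r (w o sB r i)"
proof -
  obtain ws where ws: "reduced_word r ws w" using exists_reduced_word[OF assms(1)] by blast
  then have "reduced_word r (ws @ [i]) (w o sB r i)"
    using assms lenB_asc[OF assms] unfolding reduced_word_def word_prod_snoc by (auto simp del: o_apply)
  then have "Tw r (w o sB r i) = Tword (ws @ [i])" by (rule Tw_reduced)
  also have "\<dots> = Tword ws ** Tgen r i"
    using ws assms by (subst Tword_append) (auto simp: reduced_word_def Tword_Cons)
  finally show ?thesis using Tw_reduced ws by simp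
qed

lemma Tw_id [simp]: "Tw r id = \<^bold>1"
  using Tw_reduced[of "[]" id] by (simp add: reduced_word_def)

subsection \<open>Coefficients\<close>

text \<open>A representative in the free algebra acts on the coefficient function of the identity; the choice is
  irrelevant by \<open>ract_ideal\<close>. Outside of \<open>W\<close> the value is \<open>0\<close>.\<close>

definition cf :: "hecke \<Rightarrow> (nat \<Rightarrow> nat) \<Rightarrow> int poly" where
  "cf x w = (if w \<in> W then ract r (SOME f. f \<in> x) (\<lambda>y. if y = id then 1 else 0) w else 0)"

lemma cf_outside: "w \<notin> W \<Longrightarrow> cf x w = 0"
  by (simp add: cf_def)

lemma cf_hp:
  assumes "f \<in> carrier (free_alg r)" "w \<in> W"
  shows "cf (hp f) w = ract r f (\<lambda>y. if y = id then 1 else 0) w"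
proof -
  have "(SOME g. g \<in> hp f) \<in> hp f" using hp_self[OF assms(1)] by (rule someI)
  then obtain i where "i \<in> I" "(SOME g. g \<in> hp f) = i + f" using hp_memD by blast
  then show ?thesis using assms ract_ideal by (simp add: cf_def ract_add)
qed

lemma cf_add: assumes "x \<in> carrier H" "y \<in> carrier H" shows "cf (x \<boxplus> y) w = cf x w + cf y w"
proof (cases "w \<in> W")
  case True
  obtain f g where f: "f \<in> carrier (free_alg r)" "x = hp f" and g: "g \<in> carrier (free_alg r)" "y = hp g"
    using hp_surj assms by metis
  have "f + g \<in> carrier (free_alg r)" using ring.ring_simprules(1)[OF ring_free_alg f(1) g(1)] by simp
  then show ?thesis using f g True by (simp add: cf_hp ract_add flip: hp_add)
qed (simp add: cf_outside)

lemma cf_zero [simp]: "cf \<^bold>0 w = 0"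
  using cf_add[of "\<^bold>0" "\<^bold>0" w] by simp

lemma cf_scal: assumes "x \<in> carrier H" shows "cf (scal r a ** x) w = a * cf x w"
proof (cases "w \<in> W")
  case True
  obtain f where f: "f \<in> carrier (free_alg r)" "x = hp f" using hp_surj assms by metis
  have m: "mon a [] \<in> carrier (free_alg r)" by (intro mon_carrier) auto
  have "mon a [] * f \<in> carrier (free_alg r)" using ring.ring_simprules(5)[OF ring_free_alg m f(1)] by simp
  then have "cf (scal r a ** x) w = ract r (mon a [] * f) (\<lambda>y. if y = id then 1 else 0) w"
    using f True m by (simp add: scal_hp cf_hp flip: hp_mult)
  then show ?thesis using f True by (simp add: cf_hp ract_mult ract_mon[abs_def] ract_scale_fun)
qed (simp add: cf_outside)

text \<open>The functional \<open>cf\<close> is the representation applied to the delta function at the identity, and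
  right multiplication acts through it.\<close>

lemma cf_mult_Tgen:
  assumes "x \<in> carrier H" "1 \<le> i" "i \<le> r" "w \<in> W"
  shows "cf (x ** Tgen r i) w = rstep r i (cf x) w"
proof -
  obtain f where f: "f \<in> carrier (free_alg r)" "x = hp f" using hp_surj assms by metis
  have m: "mon 1 [i] \<in> carrier (free_alg r)" using assms by (intro mon_carrier) auto
  have "f * mon 1 [i] \<in> carrier (free_alg r)" using ring.ring_simprules(5)[OF ring_free_alg f(1) m] by simp
  then have "cf (x ** Tgen r i) w = ract r (f * mon 1 [i]) (\<lambda>y. if y = id then 1 else 0) w"
    using f assms m by (simp add: Tgen_hp cf_hp flip: hp_mult)
  also have "\<dots> = rstep r i (ract r f (\<lambda>y. if y = id then 1 else 0)) w" by (simp add: ract_mult ract_mon)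
  finally show ?thesis using f assms WB_comp[OF assms(4) sB_WB[OF assms(2,3)]] 
    by (simp add: rstep_def cf_hp)
qed

lemma cf_one: "w \<in> W \<Longrightarrow> cf \<^bold>1 w = (if w = id then 1 else 0)"
proof -
  assume w: "w \<in> W"
  have "mon 1 [] \<in> carrier (free_alg r)" by (intro mon_carrier) auto
  then have "cf (hp (mon 1 [])) w = (if w = id then 1 else 0)" using w by (subst cf_hp) (auto simp: ract_mon)
  then show ?thesis by (simp add: mon_one hp_one)
qed

text \<open>Along a reduced word each step is an ascent, where the operator moves a delta function.\<close>

lemma cf_Tw: assumes "v \<in> W" "w \<in> W" shows "cf (Tw r v) w = (if w = v then 1 else 0)"
  using assms
proof (induction "lenB r v" arbitrary: v w)
  case 0
  have v: "v = id" using lenB_0[OF 0(2)] 0(1) by metis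
  have T: "Tw r v = \<^bold>1" unfolding v by (rule Tw_id)
  show ?case unfolding T using cf_one[OF 0(3)] v by metis
next
  case (Suc n)
  then have "v \<noteq> id" by auto
  then obtain k where k: "1 \<le> k" "k \<le> r" "v (Suc k) < v k" using exists_descent Suc.prems(1) by blast
  define u where "u = v o sB r k"
  have u: "u \<in> W" unfolding u_def using Suc.prems k by (intro WB_comp) auto
  have vu: "v = u o sB r k" using k by (simp add: u_def)
  have asc: "u k < u (Suc k)" using k by (simp add: u_def)
  have n: "n = lenB r u" using lenB_desc[OF Suc.prems(1) k] Suc.hyps(2) by (simp add: u_def)
  have wk: "w o sB r k \<in> W" using Suc.prems k by (intro WB_comp) auto
  have eq: "w o sB r k = u \<longleftrightarrow> w = v" using k by (auto simp: vu)
  have "cf (Tw r v) w = rstep r k (cf (Tw r u)) w"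
    using cf_mult_Tgen[OF Tw_closed[OF u] k(1,2) Suc.prems(2)] Tw_Tgen[OF u k(1,2) asc] by (simp add: vu)
  also have "\<dots> = (if w = v then 1 else 0)"
    using Suc.hyps(1)[OF n u wk] Suc.hyps(1)[OF n u Suc.prems(2)] asc k unfolding rstep_def eq by auto
  finally show ?case .
qed

lemma finsum_closed' [simp]: "(\<And>i. i \<in> A \<Longrightarrow> f i \<in> carrier H) \<Longrightarrow> (\<Oplus>\<^bsub>H\<^esub>i\<in>A. f i) \<in> carrier H"
  by (rule H.finsum_closed) auto

lemma cf_finsum:
  assumes "finite A" "\<And>i. i \<in> A \<Longrightarrow> f i \<in> carrier H"
  shows "cf (\<Oplus>\<^bsub>H\<^esub>i\<in>A. f i) w = (\<Sum>i\<in>A. cf (f i) w)"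
  using assms
proof (induction A)
  case (insert a A)
  then have "(\<Oplus>\<^bsub>H\<^esub>i\<in>insert a A. f i) = f a \<boxplus> (\<Oplus>\<^bsub>H\<^esub>i\<in>A. f i)" by (intro H.finsum_insert) auto
  then show ?case using insert by (simp add: cf_add)
qed simp

definition mk :: "((nat \<Rightarrow> nat) \<Rightarrow> int poly) \<Rightarrow> hecke" where
  "mk c = (\<Oplus>\<^bsub>H\<^esub>w\<in>W. scal r (c w) ** Tw r w)"

lemma mk_closed [simp]: "mk c \<in> carrier H"
  unfolding mk_def by simp

lemma cf_mk: "cf (mk c) w = (if w \<in> W then c w else 0)"
proof (cases "w \<in> W")
  case True
  have "cf (mk c) w = (\<Sum>v\<in>W. c v * cf (Tw r v) w)" unfolding mk_def by (simp add: cf_finsum cf_scal)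
  also have "\<dots> = (\<Sum>v\<in>W. if v = w then c v else 0)" using True by (intro sum.cong) (auto simp: cf_Tw)
  finally show ?thesis using True by simp
qed (simp add: cf_outside)

lemma mk_add: "mk c \<boxplus> mk d = mk (\<lambda>w. c w + d w)"
proof -
  have "mk (\<lambda>w. c w + d w) = (\<Oplus>\<^bsub>H\<^esub>w\<in>W. (scal r (c w) ** Tw r w) \<boxplus> (scal r (d w) ** Tw r w))"
    unfolding mk_def by (rule H.finsum_cong') (simp_all add: Pi_iff scal_add H.l_distr)
  also have "\<dots> = mk c \<boxplus> mk d" unfolding mk_def by (rule H.finsum_addf) (simp_all add: Pi_iff)
  finally show ?thesis by simp
qed

lemma mk_scal: "scal r a ** mk c = mk (\<lambda>w. a * c w)"
proof -
  have "scal r a ** mk c = (\<Oplus>\<^bsub>H\<^esub>w\<in>W. scal r a ** (scal r (c w) ** Tw r w))"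
    unfolding mk_def by (rule H.finsum_rdistr) (simp_all add: Pi_iff)
  also have "\<dots> = mk (\<lambda>w. a * c w)"
    unfolding mk_def by (rule H.finsum_cong') (simp_all add: Pi_iff scal_mult H.m_assoc)
  finally show ?thesis .
qed

lemma mk_zero: "mk (\<lambda>w. 0) = \<^bold>0"
  unfolding mk_def by (rule H.add.finprod_one_eqI) simp

lemma mk_finsum:
  assumes "finite A" shows "(\<Oplus>\<^bsub>H\<^esub>i\<in>A. mk (c i)) = mk (\<lambda>w. \<Sum>i\<in>A. c i w)"
  using assms
proof (induction A)
  case (insert a A)
  then have "(\<Oplus>\<^bsub>H\<^esub>i\<in>insert a A. mk (c i)) = mk (c a) \<boxplus> (\<Oplus>\<^bsub>H\<^esub>i\<in>A. mk (c i))" by (intro H.finsum_insert) auto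
  then show ?case using insert by (simp add: mk_add)
qed (simp add: mk_zero)

lemma mk_single: assumes "v \<in> W" shows "mk (\<lambda>w. if w = v then a else 0) = scal r a ** Tw r v"
proof -
  have "mk (\<lambda>w. if w = v then a else 0) = (\<Oplus>\<^bsub>H\<^esub>w\<in>W. if v = w then scal r a ** Tw r w else \<^bold>0)"
    unfolding mk_def by (intro H.finsum_cong') auto
  also have "\<dots> = scal r a ** Tw r v" using assms by (intro H.finsum_singleton) auto
  finally show ?thesis .
qed

lemma Tgen_Tw_mk:
  assumes "1 \<le> i" "i \<le> r" "w \<in> W" shows "\<exists>c. Tgen r i ** Tw r w = mk c"
proof (cases "pinv w i < pinv w (Suc i)")
  case True
  then have "Tgen r i ** Tw r w = scal r 1 ** Tw r (sB r i o w)"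
    using Tgen_Tw assms WB_comp[of "sB r i" r w] by simp
  also have "\<dots> = mk (\<lambda>v. if v = sB r i o w then 1 else 0)" using assms WB_comp[of "sB r i" r w] by (subst mk_single) auto
  finally show ?thesis by blast
next
  case False
  define u where "u = sB r i o w"
  have u: "u \<in> W" using assms WB_comp by (auto simp: u_def)
  have "pinv u i < pinv u (Suc i)"
    using False WB_Suc_neq[OF WB_inv[OF assms(3)], of i] assms by (simp add: u_def inv_left_mult)
  then have w: "Tw r w = Tgen r i ** Tw r u" using Tgen_Tw[OF u] assms by (simp add: u_def)
  then have "Tgen r i ** Tw r w = (Tgen r i ** Tgen r i) ** Tw r u" using u assms by (simp add: H.m_assoc)
  also have "\<dots> = (scal r (qpar r i - 1) ** Tw r w) \<boxplus> (scal r (qpar r i) ** Tw r u)"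
    using u assms w by (simp add: Tgen_square H.l_distr H.m_assoc)
  finally show ?thesis using u assms by (simp add: mk_single[symmetric] mk_add) blast
qed

lemma Tgen_mk: assumes "1 \<le> i" "i \<le> r" shows "\<exists>d. Tgen r i ** mk c = mk d"
proof -
  obtain D where D: "\<And>w. w \<in> W \<Longrightarrow> Tgen r i ** Tw r w = mk (D w)" using Tgen_Tw_mk[OF assms] by metis
  have "Tgen r i ** mk c = (\<Oplus>\<^bsub>H\<^esub>w\<in>W. Tgen r i ** (scal r (c w) ** Tw r w))"
    unfolding mk_def using assms by (intro H.finsum_rdistr) auto
  also have "\<dots> = (\<Oplus>\<^bsub>H\<^esub>w\<in>W. mk (\<lambda>v. c w * D w v))"
    using assms by (intro H.finsum_cong')
      (simp_all add: Pi_iff mk_scal[symmetric] D[symmetric] scal_left_comm)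
  finally show ?thesis by (auto simp: mk_finsum)
qed

text \<open>The span of the \<open>T\<^sub>w\<close> is stable under left multiplication by the generators.\<close>

lemma ex_mk: assumes "x \<in> carrier H" shows "\<exists>c. x = mk c"
proof -
  have word: "\<exists>c. hp (mon a ws) = mk c" if "ws \<in> lists {1..r}" for a ws
    using that
  proof (induction ws)
    case Nil
    have "hp (mon a []) = scal r a ** Tw r id" by (simp add: scal_hp[symmetric])
    then show ?case using mk_single[OF WB_id] by metis
  next
    case (Cons i ws)
    have "hp (mon a (i # ws)) = hp (mon 1 [i] * mon a ws)" by (simp add: mon_mult)
    also have "\<dots> = Tgen r i ** hp (mon a ws)" unfolding Tgen_hp using Cons by (intro hp_mult mon_carrier) auto
    finally show ?case using Cons Tgen_mk by auto
  qed
  obtain f where f: "f \<in> carrier (free_alg r)" "x = hp f" using hp_surj assms by metis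
  have "\<exists>c. hp f = mk c"
    using f(1)[unfolded free_alg_carrier]
  proof (induction f rule: free_induct[where S = "lists {1..r}"])
    case sub
    then show ?case using f(1) by (simp add: free_alg_carrier)
  next
    case zero
    then show ?case using mk_zero hp_zero by metis
  next
    case (add f a ws)
    obtain c where "hp f = mk c" using add by blast
    moreover obtain d where "hp (mon a ws) = mk d" using word add by blast
    moreover have "hp (f + mon a ws) = hp f \<boxplus> hp (mon a ws)"
      using add by (intro hp_add mon_carrier) (auto simp: free_alg_carrier)
    ultimately show ?case by (auto simp: mk_add)
  qed
  then show ?thesis using f by simp
qed

lemma mk_cf: assumes "x \<in> carrier H" shows "mk (cf x) = x"
proof -
  obtain c where c: "x = mk c" using ex_mk assms by blast
  have "mk (cf x) = mk c" unfolding mk_def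
    by (rule H.finsum_cong') (simp_all add: Pi_iff c cf_mk)
  then show ?thesis using c by simp
qed

lemma cf_eqI:
  assumes "x \<in> carrier H" "y \<in> carrier H" "\<And>w. w \<in> W \<Longrightarrow> cf x w = cf y w" shows "x = y"
proof -
  have "cf x = cf y" using assms(3) cf_outside by (metis ext)
  then show ?thesis using mk_cf assms(1,2) by metis
qed

lemma cf_mult:
  assumes "x \<in> carrier H" "y \<in> carrier H"
  shows "cf (x ** y) w = (\<Sum>u\<in>W. \<Sum>v\<in>W. cf x u * cf y v * cf (Tw r u ** Tw r v) w)"
proof -
  have "x ** y = (\<Oplus>\<^bsub>H\<^esub>u\<in>W. scal r (cf x u) ** Tw r u) ** y"
    using mk_cf[OF assms(1)] by (simp add: mk_def)
  also have "\<dots> = (\<Oplus>\<^bsub>H\<^esub>u\<in>W. scal r (cf x u) ** (Tw r u ** y))"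
  proof -
    have "(\<Oplus>\<^bsub>H\<^esub>u\<in>W. scal r (cf x u) ** Tw r u) ** y = (\<Oplus>\<^bsub>H\<^esub>u\<in>W. (scal r (cf x u) ** Tw r u) ** y)"
      using assms by (intro H.finsum_ldistr) (simp_all add: Pi_iff)
    also have "\<dots> = (\<Oplus>\<^bsub>H\<^esub>u\<in>W. scal r (cf x u) ** (Tw r u ** y))"
      using assms by (intro H.finsum_cong') (simp_all add: Pi_iff H.m_assoc)
    finally show ?thesis .
  qed
  finally have 1: "cf (x ** y) w = (\<Sum>u\<in>W. cf x u * cf (Tw r u ** y) w)"
    using assms by (simp add: cf_finsum cf_scal)
  have "cf (Tw r u ** y) w = (\<Sum>v\<in>W. cf y v * cf (Tw r u ** Tw r v) w)" if u: "u \<in> W" for u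
  proof -
    have "Tw r u ** y = Tw r u ** (\<Oplus>\<^bsub>H\<^esub>v\<in>W. scal r (cf y v) ** Tw r v)"
      using mk_cf[OF assms(2)] by (simp add: mk_def)
    also have "\<dots> = (\<Oplus>\<^bsub>H\<^esub>v\<in>W. Tw r u ** (scal r (cf y v) ** Tw r v))"
      using u by (intro H.finsum_rdistr) (simp_all add: Pi_iff)
    also have "\<dots> = (\<Oplus>\<^bsub>H\<^esub>v\<in>W. scal r (cf y v) ** (Tw r u ** Tw r v))"
      using u by (intro H.finsum_cong') (simp_all add: Pi_iff scal_left_comm)
    finally show ?thesis using u by (simp add: cf_finsum cf_scal)
  qed
  then show ?thesis unfolding 1 by (simp add: sum_distrib_left mult.assoc)
qed

text \<open>Left multiplication is known on the basis from the left descents of \<open>w\<close>, and the general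
  coefficient follows by linearity, sorting the terms into \<open>w\<close> and \<open>s\<^sub>i \<circ>
  w\<close>.\<close>

lemma cf_Tgen_mult:
  assumes x: "x \<in> carrier H" and i: "1 \<le> i" "i \<le> r" and w: "w \<in> W"
  shows "cf (Tgen r i ** x) w = (if pinv w (Suc i) < pinv w i then cf x (sB r i o w) + (qpar r i - 1) * cf x w
    else qpar r i * cf x (sB r i o w))"
proof -
  have ord: "pinv (sB r i o v) = pinv v o sB r i" if "v \<in> W" for v using inv_left_mult that i by blast
  have sw: "sB r i o w \<in> W" using w i by (intro WB_comp) auto
  have T: "cf (Tgen r i ** Tw r v) w = (if v = sB r i o w then (if pinv w (Suc i) < pinv w i then 1 else qpar r i) else 0)
     + (if v = w then (if pinv w (Suc i) < pinv w i then qpar r i - 1 else 0) else 0)" if v: "v \<in> W" for v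
  proof (cases "pinv v i < pinv v (Suc i)")
    case True
    have sv: "sB r i o v \<in> W" using v i by (intro WB_comp) auto
    have "cf (Tgen r i ** Tw r v) w = (if w = sB r i o v then 1 else 0)"
      using Tgen_Tw[OF v i True] cf_Tw[OF sv w] by simp
    moreover have "w = sB r i o v \<longleftrightarrow> v = sB r i o w" using i by auto
    moreover have "pinv (sB r i o v) (Suc i) < pinv (sB r i o v) i" using True ord[OF v] i by simp
    moreover have "sB r i o v \<noteq> v" using calculation(3) True by fastforce
    ultimately show ?thesis using True by auto
  next
    case False
    define u where "u = sB r i o v"
    have u: "u \<in> W" unfolding u_def using v i by (intro WB_comp) auto
    have vu: "v = sB r i o u" using i by (simp add: u_def)
    have ne: "pinv v (Suc i) < pinv v i" using False WB_Suc_neq[OF WB_inv[OF v], of i] by linarith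
    have ua: "pinv u i < pinv u (Suc i)" using ne ord[OF v] i by (simp add: u_def)
    have Tv: "Tw r v = Tgen r i ** Tw r u" using Tgen_Tw[OF u i ua] vu by simp
    then have "Tgen r i ** Tw r v = (Tgen r i ** Tgen r i) ** Tw r u" using u i by (simp add: H.m_assoc)
    also have "\<dots> = (scal r (qpar r i - 1) ** Tw r v) \<boxplus> (scal r (qpar r i) ** Tw r u)"
      using u i Tv by (simp add: Tgen_square H.l_distr H.m_assoc)
    finally have "cf (Tgen r i ** Tw r v) w = (qpar r i - 1) * (if w = v then 1 else 0) + qpar r i * (if w = u then 1 else 0)"
      using u v w by (simp add: cf_add cf_scal cf_Tw)
    moreover have "w = u \<longleftrightarrow> v = sB r i o w" using i sB_comp_cancel(2)[of i r] unfolding vu by metis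
    moreover have "u \<noteq> v" using ua ne by auto
    ultimately show ?thesis using ne ua by auto
  qed
  have "Tgen r i ** x = Tgen r i ** (\<Oplus>\<^bsub>H\<^esub>v\<in>W. scal r (cf x v) ** Tw r v)"
    using mk_cf[OF x] by (simp add: mk_def)
  also have "\<dots> = (\<Oplus>\<^bsub>H\<^esub>v\<in>W. scal r (cf x v) ** (Tgen r i ** Tw r v))"
  proof -
    have "Tgen r i ** (\<Oplus>\<^bsub>H\<^esub>v\<in>W. scal r (cf x v) ** Tw r v) = (\<Oplus>\<^bsub>H\<^esub>v\<in>W. Tgen r i ** (scal r (cf x v) ** Tw r v))"
      using i by (intro H.finsum_rdistr) (simp_all add: Pi_iff)
    also have "\<dots> = (\<Oplus>\<^bsub>H\<^esub>v\<in>W. scal r (cf x v) ** (Tgen r i ** Tw r v))"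
      using i by (intro H.finsum_cong') (simp_all add: Pi_iff scal_left_comm)
    finally show ?thesis .
  qed
  finally have "cf (Tgen r i ** x) w = (\<Sum>v\<in>W. cf x v * cf (Tgen r i ** Tw r v) w)"
    using i by (simp add: cf_finsum cf_scal)
  also have "\<dots> = (\<Sum>v\<in>W. (if v = sB r i o w then cf x v * (if pinv w (Suc i) < pinv w i then 1 else qpar r i) else 0)
     + (if v = w then cf x v * (if pinv w (Suc i) < pinv w i then qpar r i - 1 else 0) else 0))"
    by (intro sum.cong refl) (auto simp: T algebra_simps)
  also have "\<dots> = cf x (sB r i o w) * (if pinv w (Suc i) < pinv w i then 1 else qpar r i)
      + cf x w * (if pinv w (Suc i) < pinv w i then qpar r i - 1 else 0)"
    using sw w by (simp add: sum.distrib)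
  finally show ?thesis by (auto simp: algebra_simps)
qed

lemma Tsum_closed [simp]: "D \<subseteq> W \<Longrightarrow> Tsum r D \<in> carrier H"
  unfolding Tsum_def by (intro finsum_closed') auto

lemma cf_Tsum: assumes "D \<subseteq> W" shows "cf (Tsum r D) w = (if w \<in> D then 1 else 0)"
proof (cases "w \<in> W")
  case True
  have fin: "finite D" using finite_subset[OF assms finite_WB] .
  have "cf (Tsum r D) w = (\<Sum>v\<in>D. cf (Tw r v) w)" unfolding Tsum_def using assms fin by (intro cf_finsum) auto
  also have "\<dots> = (\<Sum>v\<in>D. if v = w then 1 else 0)" using assms True by (intro sum.cong) (auto simp: cf_Tw)
  finally show ?thesis using fin by simp
qed (use assms in \<open>auto simp: cf_outside\<close>)

end

section \<open>Block structure and parabolic subgroups\<close>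

definition psum :: "nat \<Rightarrow> weight \<Rightarrow> nat \<Rightarrow> nat" where
  "psum n lam i = (\<Sum>k=1..i. hat n lam k)"

definition blk :: "nat \<Rightarrow> weight \<Rightarrow> nat \<Rightarrow> nat" where
  "blk n lam k = (LEAST i. k \<le> psum n lam i)"

locale type_B_schur = type_B +
  fixes n :: nat
  assumes n_pos: "1 \<le> n"
begin

abbreviation "rowW \<equiv> row_wt n  r"
abbreviation "colW \<equiv> col_wt n  r"
abbreviation "dm \<equiv> dmat n  r"

lemma psum_0 [simp]: "psum n lam 0 = 0"
  by (simp add: psum_def)

lemma psum_Suc: "psum n lam (Suc i) = psum n lam i + hat n lam (Suc i)"
  by (simp add: psum_def)

lemma psum_mono: "i \<le> j \<Longrightarrow> psum n lam i \<le> psum n lam j"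
  unfolding psum_def by (rule sum_mono2) auto

lemma hat_mirror: "1 \<le> i \<Longrightarrow> i \<le> 2*n + 1 \<Longrightarrow> hat n lam (2*n + 2 - i) = hat n lam i"
  by (auto simp: hat_def)

lemma psum_le_n: "i \<le> n \<Longrightarrow> psum n lam i = (\<Sum>k=1..i. lam k)"
  unfolding psum_def by (intro sum.cong) (auto simp: hat_def)

lemma psum_split: "i \<le> 2*n + 1 \<Longrightarrow> psum n lam (2*n + 1) = psum n lam (2*n + 1 - i) + psum n lam i"
proof (induction i)
  case (Suc i)
  have "2*n + 1 - i = Suc (2*n + 1 - Suc i)" using Suc.prems by simp
  then have "psum n lam (2*n + 1 - i) = psum n lam (2*n + 1 - Suc i) + hat n lam (2*n + 1 - i)"
    using psum_Suc by metis
  moreover have "hat n lam (2*n + 1 - i) = hat n lam (Suc i)" using hat_mirror[of "Suc i"] Suc.prems by simp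
  ultimately show ?case using Suc by (simp add: psum_Suc)
qed simp

lemma psum_n: assumes "lam \<in> Lam n r" shows "psum n lam n + lam (n + 1) = r"
  using assms by (simp add: psum_le_n Lam_def)

lemma psum_total: assumes "lam \<in> Lam n r" shows "psum n lam (2*n + 1) = 2*r"
proof -
  have "psum n lam (2*n + 1) = psum n lam (Suc n) + psum n lam n" using psum_split[of n lam] by simp
  also have "psum n lam (Suc n) = psum n lam n + 2 * lam (n + 1)" by (simp add: psum_Suc hat_def)
  finally show ?thesis using psum_n[OF assms] by simp
qed

lemma blk_le: assumes "lam \<in> Lam n r" "k \<le> 2*r" shows "k \<le> psum n lam (blk n lam k)" "blk n lam k \<le> 2*n + 1"
  unfolding blk_def using assms psum_total[OF assms(1)]
  by (auto intro: LeastI[of "\<lambda>i. k \<le> psum n lam i" "2*n+1"] Least_le)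

lemma blk_iff:
  assumes "lam \<in> Lam n r" "1 \<le> k" "k \<le> 2*r"
  shows "blk n lam k = i \<longleftrightarrow> 1 \<le> i \<and> psum n lam (i - 1) < k \<and> k \<le> psum n lam i"
proof
  assume i: "blk n lam k = i"
  have 1: "k \<le> psum n lam i" using blk_le assms i by auto
  then have "i \<noteq> 0" using assms by (intro notI) simp
  moreover have "\<not> k \<le> psum n lam (i - 1)" using not_less_Least[of "i - 1" "\<lambda>i. k \<le> psum n lam i"] i \<open>i \<noteq> 0\<close>
    by (auto simp: blk_def)
  ultimately show "1 \<le> i \<and> psum n lam (i - 1) < k \<and> k \<le> psum n lam i" using 1 by auto
next
  assume i: "1 \<le> i \<and> psum n lam (i - 1) < k \<and> k \<le> psum n lam i"
  show "blk n lam k = i" unfolding blk_def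
  proof (rule Least_equality)
    fix j assume "k \<le> psum n lam j"
    then show "i \<le> j" using i psum_mono[of j "i - 1" lam] by (cases "j \<le> i - 1") auto
  qed (use i in simp)
qed

lemma blk_range: assumes "lam \<in> Lam n r" "1 \<le> k" "k \<le> 2*r" shows "1 \<le> blk n lam k" "blk n lam k \<le> 2*n + 1"
  using blk_iff[OF assms, of "blk n lam k"] blk_le[OF assms(1,3)] by auto

lemma blk_mono: assumes "lam \<in> Lam n r" "1 \<le> k" "k \<le> l" "l \<le> 2*r" shows "blk n lam k \<le> blk n lam l"
  unfolding blk_def by (rule Least_le) (use blk_le(1)[OF assms(1,4)] assms in \<open>auto simp: blk_def\<close>)

lemma Rint_psum: "1 \<le> i \<Longrightarrow> Rint n lam i = {psum n lam (i - 1) + 1..psum n lam i}"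
proof -
  assume "1 \<le> i"
  then have "{1..<i} = {1..i - 1}" by auto
  then show ?thesis by (simp add: Rint_def psum_def)
qed

lemma Rint_blk:
  assumes "lam \<in> Lam n r" "i \<in> {1..2*n + 1}"
  shows "Rint n lam i = {k \<in> {1..2*r}. blk n lam k = i}"
proof -
  have le: "psum n lam i \<le> 2*r" using psum_mono[of i "2*n+1" lam] psum_total[OF assms(1)] assms by auto
  have i: "1 \<le> i" using assms by auto
  show ?thesis unfolding Rint_psum[OF i]
  proof (intro Set.set_eqI)
    fix k show "k \<in> {psum n lam (i - 1) + 1..psum n lam i} \<longleftrightarrow> k \<in> {k \<in> {1..2*r}. blk n lam k = i}"
      using le i blk_iff[OF assms(1), of k i] by (cases "1 \<le> k \<and> k \<le> 2*r") auto
  qed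
qed

lemma blk_mir:
  assumes "lam \<in> Lam n r" "1 \<le> k" "k \<le> 2*r" shows "blk n lam (mir r k) = 2*n + 2 - blk n lam k"
proof -
  define i where "i = blk n lam k"
  have i: "1 \<le> i" "i \<le> 2*n + 1" "psum n lam (i - 1) < k" "k \<le> psum n lam i"
    using blk_range[OF assms] blk_iff[OF assms, of i] by (auto simp: i_def)
  have 1: "psum n lam (2*n + 1 - i) = 2*r - psum n lam i" "psum n lam i \<le> 2*r"
    using psum_split[OF i(2), of lam] psum_total[OF assms(1)] by auto
  have 2: "psum n lam (2*n + 2 - i) = 2*r - psum n lam (i - 1)" "psum n lam (i - 1) \<le> 2*r"
    using psum_split[of "i - 1" lam] psum_total[OF assms(1)] i by (auto simp: Suc_diff_le)
  have "blk n lam (mir r k) = 2*n + 2 - i"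
    by (subst blk_iff[OF assms(1)]) (use i 1 2 assms in auto)
  then show ?thesis by (simp add: i_def)
qed

definition Jset :: "weight \<Rightarrow> nat set" where
  "Jset lam = {k \<in> {1..r}. blk n lam k = blk n lam (Suc k)}"

lemma Jset_range: "k \<in> Jset lam \<Longrightarrow> 1 \<le> k \<and> k \<le> r \<and> blk n lam (Suc k) = blk n lam k"
  by (auto simp: Jset_def)

text \<open>A break between two positions \<open>k\<close> and \<open>k + 1\<close> with \<open>k \<le> r\<close> occurs
  precisely at a partial sum of \<open>\<lambda>\<close>; for \<open>k = r\<close> this means that the
  central block is empty.\<close>

lemma Jset_eq:
  assumes "lam \<in> Lam n r"
  shows "{j \<in> {1..r}. j \<notin> (\<lambda>i. \<Sum>k=1..i. lam k) ` {1..n}} = Jset lam"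
proof -
  have im: "(\<lambda>i. \<Sum>k=1..i. lam k) ` {1..n} = psum n lam ` {1..n}"
    by (intro image_cong) (auto simp: psum_le_n)
  have "k \<in> psum n lam ` {1..n} \<longleftrightarrow> blk n lam k \<noteq> blk n lam (Suc k)" if k: "1 \<le> k" "k \<le> r" for k
  proof
    assume "k \<in> psum n lam ` {1..n}"
    then obtain i where i: "k = psum n lam i" "1 \<le> i" "i \<le> n" by auto
    then have "blk n lam k \<le> i" using k unfolding blk_def by (intro Least_le) auto
    moreover have "blk n lam (Suc k) \<noteq> blk n lam k"
    proof
      assume e: "blk n lam (Suc k) = blk n lam k"
      then have "Suc k \<le> psum n lam (blk n lam k)" using blk_le(1)[OF assms, of "Suc k"] k rank by auto
      then show False using psum_mono[OF calculation, of lam] i by simp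
    qed
    ultimately show "blk n lam k \<noteq> blk n lam (Suc k)" by simp
  next
    assume ne: "blk n lam k \<noteq> blk n lam (Suc k)"
    define i where "i = blk n lam k"
    have r2: "k \<le> 2*r" "Suc k \<le> 2*r" using k rank by auto
    have i: "1 \<le> i" "psum n lam (i - 1) < k" "k \<le> psum n lam i" using blk_iff[OF assms k(1) r2(1), of i] by (auto simp: i_def)
    have "\<not> Suc k \<le> psum n lam i" using blk_iff[OF assms _ r2(2), of i] i ne by (auto simp: i_def)
    then have ki: "k = psum n lam i" using i by simp
    show "k \<in> psum n lam ` {1..n}"
    proof (cases "i \<le> n")
      case False
      then have "psum n lam n \<le> psum n lam (i - 1)" by (intro psum_mono) auto
      then have "psum n lam n < k" using i by simp
      then have pos: "lam (n + 1) \<noteq> 0" using psum_n[OF assms] k by auto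
      have "psum n lam (Suc n) \<le> psum n lam i" using False by (intro psum_mono) auto
      moreover have "psum n lam (Suc n) = psum n lam n + 2 * lam (n + 1)" by (simp add: psum_Suc hat_def)
      ultimately show ?thesis using ki k pos psum_n[OF assms] by simp
    qed (use ki i in auto)
  qed
  then show ?thesis unfolding im Jset_def by auto
qed

text \<open>The parabolic subgroup \<open>W\<^sub>\<lambda>\<close> as the stabilizer of the partition into intervals.\<close>

definition PB :: "weight \<Rightarrow> (nat \<Rightarrow> nat) set" where
  "PB lam = {w \<in> W. \<forall>k\<in>{1..2*r}. blk n lam (w k) = blk n lam k}"

lemma PB_W: "w \<in> PB lam \<Longrightarrow> w \<in> W"
  by (simp add: PB_def)

lemma PB_blk: "w \<in> PB lam \<Longrightarrow> 1 \<le> k \<Longrightarrow> k \<le> 2*r \<Longrightarrow> blk n lam (w k) = blk n lam k"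
  by (simp add: PB_def)

lemma PB_id [simp]: "id \<in> PB lam"
  by (simp add: PB_def)

lemma PB_comp: assumes "v \<in> PB lam" "w \<in> PB lam" shows "v o w \<in> PB lam"
  using assms WB_range[of w r] WB_comp[of v r w] by (auto simp: PB_def)

lemma PB_inv: assumes "w \<in> PB lam" shows "pinv w \<in> PB lam"
proof -
  have w: "w \<in> W" using assms PB_W by blast
  have "blk n lam (pinv w k) = blk n lam k" if "k \<in> {1..2*r}" for k
    using PB_blk[OF assms, of "pinv w k"] WB_range[OF WB_inv[OF w], of k] that w by simp
  then show ?thesis using WB_inv[OF w] by (simp add: PB_def)
qed

lemma Jset_PB:
  assumes "lam \<in> Lam n r" "k \<in> Jset lam" shows "sB r k \<in> PB lam"
proof -
  have k: "1 \<le> k" "k \<le> r" "blk n lam (Suc k) = blk n lam k" using assms Jset_range by auto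
  have "blk n lam (mir r k) = 2*n + 2 - blk n lam k" "blk n lam (mir r (Suc k)) = 2*n + 2 - blk n lam (Suc k)"
    using blk_mir[OF assms(1), of k] blk_mir[OF assms(1), of "Suc k"] k by auto
  moreover have "mir r (Suc k) = 2*r - k" by simp
  ultimately have "blk n lam (2*r - k) = blk n lam (2*r + 1 - k)" using k(3) by metis
  then show ?thesis using k by (auto simp: PB_def sB_app)
qed

lemma PB_descent:
  assumes "lam \<in> Lam n r" "w \<in> PB lam" "1 \<le> k" "k \<le> r" "w (Suc k) < w k"
  shows "k \<in> Jset lam"
proof -
  have w: "w \<in> W" using assms PB_W by blast
  have "blk n lam (w (Suc k)) \<le> blk n lam (w k)"
    using blk_mono[OF assms(1), of "w (Suc k)" "w k"] WB_range[OF w, of k] WB_range[OF w, of "Suc k"] assms by auto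
  then have "blk n lam (Suc k) \<le> blk n lam k"
    using PB_blk[OF assms(2), of k] PB_blk[OF assms(2), of "Suc k"] assms by auto
  moreover have "blk n lam k \<le> blk n lam (Suc k)" using blk_mono[OF assms(1), of k "Suc k"] assms by auto
  ultimately show ?thesis using assms by (auto simp: Jset_def)
qed

lemma PB_exists_descent:
  assumes "lam \<in> Lam n r" "w \<in> PB lam" "w \<noteq> id"
  obtains k where "k \<in> Jset lam" "w (Suc k) < w k"
  using exists_descent[OF PB_W[OF assms(2)] assms(3)] PB_descent[OF assms(1,2)] by metis

lemma PB_word:
  assumes "lam \<in> Lam n r" "w \<in> PB lam"
  shows "\<exists>ws\<in>lists (Jset lam). word_prod (sB r) ws = w"
  using assms(2)
proof (induction "lenB r w" arbitrary: w rule: less_induct)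
  case less
  show ?case
  proof (cases "w = id")
    case True
    then show ?thesis by (intro bexI[of _ "[]"]) auto
  next
    case False
    then obtain k where k: "k \<in> Jset lam" "w (Suc k) < w k" using PB_exists_descent assms(1) less.prems by blast
    have kr: "1 \<le> k" "k \<le> r" using Jset_range k by auto
    have "w o sB r k \<in> PB lam" using PB_comp less.prems Jset_PB assms(1) k by blast
    moreover have "lenB r (w o sB r k) < lenB r w" using lenB_desc[OF PB_W[OF less.prems] kr k(2)] by simp
    ultimately obtain ws where ws: "ws \<in> lists (Jset lam)" "word_prod (sB r) ws = w o sB r k"
      using less.hyps by blast
    have "word_prod (sB r) (ws @ [k]) = w" unfolding word_prod_snoc ws using kr by simp
    then show ?thesis using ws k by (intro bexI[of _ "ws @ [k]"]) auto
  qed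
qed

text \<open>An element preserving the blocks which is not the identity has a descent inside a block, so it is a product
  of the generators in \<open>Jset lam\<close>.\<close>

lemma Wpar_PB: assumes "lam \<in> Lam n r" shows "Wpar n r lam = PB lam"
proof
  show "Wpar n r lam \<subseteq> PB lam" unfolding Wpar_def Jset_eq[OF assms]
  proof
    fix w assume "w \<in> generate (weylB r) (sB r ` Jset lam)"
    then show "w \<in> PB lam"
    proof (induction w rule: generate.induct)
      case one
      show ?case unfolding weylB_sel by (rule PB_id)
    next
      case (inv h)
      then have "h \<in> PB lam" using Jset_PB[OF assms] by auto
      then show ?case using PB_inv inv_weylB PB_W by metis
    next
      case (eng h1 h2)
      then show ?case unfolding weylB_sel using PB_comp by blast
    qed (use Jset_PB[OF assms] in auto)
  qed
  show "PB lam \<subseteq> Wpar n r lam"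
  proof
    fix w assume "w \<in> PB lam"
    then obtain ws where ws: "ws \<in> lists (Jset lam)" "word_prod (sB r) ws = w" using PB_word assms by blast
    have "word_prod (sB r) ws \<in> generate (weylB r) (sB r ` Jset lam)" using ws(1)
    proof (induction ws)
      case Nil
      then show ?case using generate.one[of "weylB r" "sB r ` Jset lam"] unfolding weylB_sel word_prod_simps .
    next
      case (Cons k ws)
      then have "sB r k \<in> generate (weylB r) (sB r ` Jset lam)" by (intro generate.incl) simp
      then show ?case using generate.eng[of "sB r k" "weylB r" "sB r ` Jset lam" "word_prod (sB r) ws"] Cons
        unfolding weylB_sel word_prod_simps by blast
    qed
    then show "w \<in> Wpar n r lam" unfolding Wpar_def Jset_eq[OF assms] using ws by simp
  qed
qed

subsection \<open>Minimal coset representatives\<close>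

definition Inc :: "weight \<Rightarrow> (nat \<Rightarrow> nat) set" where
  "Inc lam = {u \<in> W. \<forall>k\<in>Jset lam. u k < u (Suc k)}"

lemma Inc_W: "u \<in> Inc lam \<Longrightarrow> u \<in> W"
  by (simp add: Inc_def)

lemma Inc_step:
  assumes "lam \<in> Lam n r" "u \<in> Inc lam" "1 \<le> k" "Suc k \<le> 2*r" "blk n lam k = blk n lam (Suc k)"
  shows "u k < u (Suc k)"
proof (cases "k \<le> r")
  case True
  then show ?thesis using assms by (auto simp: Inc_def Jset_def)
next
  case False
  define m where "m = 2*r - k"
  have m: "1 \<le> m" "m \<le> r" "mir r k = Suc m" "mir r (Suc k) = m" "2*r - m = k" using False assms by (auto simp: m_def)
  have "blk n lam (Suc m) = blk n lam m"
    using blk_mir[OF assms(1), of k] blk_mir[OF assms(1), of "Suc k"] m assms by auto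
  then have "u m < u (Suc m)" using assms m by (auto simp: Inc_def Jset_def)
  then show ?thesis using asc_mir[OF Inc_W[OF assms(2)] m(1,2)] m assms by auto
qed

lemma Inc_strict:
  assumes "lam \<in> Lam n r" "u \<in> Inc lam" "1 \<le> k" "k < l" "l \<le> 2*r" "blk n lam k = blk n lam l"
  shows "u k < u l"
proof -
  have "Suc k \<le> l" using assms by simp
  then show ?thesis using assms(5,6)
proof (induction l rule: dec_induct)
  case base
  then show ?case using Inc_step assms by simp
next
  case (step l)
  have "blk n lam k \<le> blk n lam l" "blk n lam l \<le> blk n lam (Suc l)"
    using blk_mono[OF assms(1), of k l] blk_mono[OF assms(1), of l "Suc l"] step assms by auto
  then have "blk n lam l = blk n lam k" "blk n lam l = blk n lam (Suc l)" using step by auto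
  then show ?case using Inc_step[OF assms(1,2), of l] step assms by auto
qed
qed

text \<open>A shortest element of a coset has no descent inside a block.\<close>

lemma Inc_exists:
  assumes "lam \<in> Lam n r" "w \<in> W"
  shows "\<exists>u\<in>Inc lam. \<exists>v\<in>PB lam. w = u o v"
proof -
  define C where "C = (\<lambda>p. w o p) ` PB lam"
  have "\<exists>u. u \<in> C \<and> (\<forall>y. y \<in> C \<longrightarrow> lenB r u \<le> lenB r y)"
    by (rule ex_has_least_nat[of "\<lambda>u. u \<in> C" w "lenB r"]) (auto simp: C_def intro!: image_eqI[of _ _ id])
  then obtain u where u: "u \<in> C" "\<And>y. y \<in> C \<Longrightarrow> lenB r u \<le> lenB r y" by blast
  obtain p where p: "p \<in> PB lam" "u = w o p" using u(1) by (auto simp: C_def)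
  have uW: "u \<in> W" using p assms(2) WB_comp PB_W by blast
  have "u k < u (Suc k)" if k: "k \<in> Jset lam" for k
  proof (rule ccontr)
    assume "\<not> u k < u (Suc k)"
    then have "u (Suc k) < u k" using WB_Suc_neq[OF uW, of k] by simp
    then have "lenB r (u o sB r k) < lenB r u" using lenB_desc[OF uW] k Jset_range by fastforce
    moreover have "u o sB r k \<in> C" unfolding C_def p(2) o_assoc[symmetric]
      using PB_comp[OF p(1) Jset_PB[OF assms(1) k]] by blast
    ultimately show False using u(2) by (meson not_less)
  qed
  then have "u \<in> Inc lam" using uW by (simp add: Inc_def)
  moreover have "w = u o pinv p" using p PB_W[OF p(1)] by (simp add: o_assoc[symmetric])
  ultimately show ?thesis using PB_inv[OF p(1)] by blast
qed

lemma Inc_unique: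
  assumes "lam \<in> Lam n r" "u \<in> Inc lam" "u o v \<in> Inc lam" "v \<in> PB lam"
  shows "v = id"
proof (rule ccontr)
  assume "v \<noteq> id"
  then obtain k where k: "k \<in> Jset lam" "v (Suc k) < v k" using PB_exists_descent assms by blast
  have kr: "1 \<le> k" "k \<le> r" "blk n lam (Suc k) = blk n lam k" using Jset_range k by auto
  have v: "v \<in> W" using PB_W assms by blast
  have b: "blk n lam (v (Suc k)) = blk n lam (v k)"
    using PB_blk[OF assms(4), of k] PB_blk[OF assms(4), of "Suc k"] kr by auto
  have "u (v (Suc k)) < u (v k)"
    using Inc_strict[OF assms(1,2) _ k(2) _ b] WB_range[OF v, of k] WB_range[OF v, of "Suc k"] kr by auto
  moreover have "u (v k) < u (v (Suc k))" using assms(3) k(1) by (auto simp: Inc_def)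
  ultimately show False by simp
qed

text \<open>Lengths add in the product of a minimal coset representative with an element of the parabolic subgroup: each
  letter of a reduced word of the latter is an ascent.\<close>

lemma Tw_mult_Inc:
  assumes "lam \<in> Lam n r" "u \<in> Inc lam" "v \<in> PB lam"
  shows "Tw r u ** Tw r v = Tw r (u o v)"
  using assms(3)
proof (induction "lenB r v" arbitrary: v rule: less_induct)
  case less
  show ?case
  proof (cases "v = id")
    case True
    have e: "Tw r v = \<^bold>1" unfolding True by (rule Tw_id)
    show ?thesis unfolding e using True Inc_W[OF assms(2)] by simp
  next
    case False
    then obtain k where k: "k \<in> Jset lam" "v (Suc k) < v k" using PB_exists_descent assms(1) less.prems by blast
    have kr: "1 \<le> k" "k \<le> r" "blk n lam (Suc k) = blk n lam k" using Jset_range k by auto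
    define v' where "v' = v o sB r k"
    have v': "v' \<in> PB lam" "v' \<in> W" unfolding v'_def using PB_comp less.prems Jset_PB assms(1) k PB_W by blast+
    have vv: "v = v' o sB r k" using kr by (simp add: v'_def)
    have len: "lenB r v' < lenB r v" using lenB_desc[OF PB_W[OF less.prems] kr(1,2) k(2)] by (simp add: v'_def)
    have asc: "v' k < v' (Suc k)" using k kr by (simp add: v'_def)
    have b: "blk n lam (v' k) = blk n lam (v' (Suc k))"
      using PB_blk[OF v'(1), of k] PB_blk[OF v'(1), of "Suc k"] kr by auto
    have uW: "u \<in> W" using Inc_W assms by blast
    have uv: "u o v' \<in> W" using WB_comp[OF uW v'(2)] .
    have asc2: "(u o v') k < (u o v') (Suc k)"
      using Inc_strict[OF assms(1,2) _ asc _ b] WB_range[OF v'(2), of k] WB_range[OF v'(2), of "Suc k"] kr by auto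
    have "Tw r u ** Tw r v = Tw r u ** (Tw r v' ** Tgen r k)"
      using Tw_Tgen[OF v'(2) kr(1,2) asc] by (simp add: vv)
    also have "\<dots> = Tw r (u o v') ** Tgen r k"
      using less.hyps[OF len v'(1)] uW v' kr by (simp add: H.m_assoc[symmetric])
    also have "\<dots> = Tw r (u o v)"
      using Tw_Tgen[OF uv kr(1,2) asc2] by (simp only: vv o_assoc)
    finally show ?thesis .
  qed
qed

section \<open>Double cosets and matrices\<close>

lemma double_coset_eq: "double_coset r P d Q = {p o d o q | p q. p \<in> P \<and> q \<in> Q}"
  by (auto simp: double_coset_def r_coset_def set_mult_def)

text \<open>The matrix of intersection cardinalities of the two partitions, for an arbitrary \<open>w\<close>.\<close>

definition wmat :: "weight \<Rightarrow> (nat \<Rightarrow> nat) \<Rightarrow> weight \<Rightarrow> nat \<Rightarrow> nat \<Rightarrow> nat" where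
  "wmat lam w mu i j = card {k \<in> {1..2*r}. blk n mu k = j \<and> blk n lam (w k) = i}"

lemma triple_mat_wmat:
  assumes "lam \<in> Lam n r" "mu \<in> Lam n r" "w \<in> W"
  shows "triple_mat n (lam, w, mu) = (\<lambda>i j. if i \<in> {1..2*n + 1} \<and> j \<in> {1..2*n + 1} then int (wmat lam w mu i j) else 0)"
proof -
  have "card (Rint n lam i \<inter> w ` Rint n mu j) = wmat lam w mu i j"
    if "i \<in> {1..2*n + 1}" "j \<in> {1..2*n + 1}" for i j
  proof -
    have "Rint n lam i \<inter> w ` Rint n mu j = w ` {k \<in> {1..2*r}. blk n mu k = j \<and> blk n lam (w k) = i}"
      using that Rint_blk[OF assms(1)] Rint_blk[OF assms(2)] WB_range[OF assms(3)] by auto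
    moreover have "inj_on w {k \<in> {1..2*r}. blk n mu k = j \<and> blk n lam (w k) = i}"
      using WB_inj[OF assms(3)] by (meson inj_on_subset subset_UNIV)
    ultimately show ?thesis by (simp add: card_image wmat_def)
  qed
  then show ?thesis by (auto simp: triple_mat_def fun_eq_iff)
qed

lemma wmat_outside:
  assumes "lam \<in> Lam n r" "mu \<in> Lam n r" "w \<in> W" "i \<notin> {1..2*n + 1} \<or> j \<notin> {1..2*n + 1}"
  shows "wmat lam w mu i j = 0"
proof -
  have "{k \<in> {1..2*r}. blk n mu k = j \<and> blk n lam (w k) = i} = {}"
    using blk_range[OF assms(1)] blk_range[OF assms(2)] WB_range[OF assms(3)] assms(4) by fastforce
  then show ?thesis by (simp only: wmat_def card.empty)
qed

lemma triple_mat_wmat':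
  assumes "lam \<in> Lam n r" "mu \<in> Lam n r" "w \<in> W"
  shows "triple_mat n (lam, w, mu) i j = int (wmat lam w mu i j)"
  using triple_mat_wmat[OF assms] wmat_outside[OF assms] by simp

text \<open>Elements of the two parabolic subgroups permute the positions inside the blocks.\<close>

lemma wmat_double_coset:
  assumes "lam \<in> Lam n r" "mu \<in> Lam n r" "w \<in> W" "p \<in> PB lam" "q \<in> PB mu"
  shows "wmat lam (p o w o q) mu = wmat lam w mu"
proof (intro ext)
  fix i j
  have q: "q \<in> W" using PB_W assms by blast
  have "q ` {k \<in> {1..2*r}. blk n mu k = j \<and> blk n lam ((p o w o q) k) = i}
      = {k \<in> {1..2*r}. blk n mu k = j \<and> blk n lam (w k) = i}" (is "q ` ?A = ?B")
  proof (intro Set.set_eqI iffI)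
    fix x assume "x \<in> q ` ?A"
    then obtain k where k: "x = q k" "1 \<le> k" "k \<le> 2*r" "blk n mu k = j" "blk n lam (p (w (q k))) = i" by auto
    have "1 \<le> q k" "q k \<le> 2*r" using WB_range[OF q] k by auto
    then show "x \<in> ?B" using k PB_blk[OF assms(5)] PB_blk[OF assms(4), of "w (q k)"] WB_range[OF assms(3), of "q k"] by auto
  next
    fix x assume x: "x \<in> ?B"
    define k where "k = pinv q x"
    have k: "x = q k" "1 \<le> k" "k \<le> 2*r" using q WB_range[OF WB_inv[OF q], of x] x by (auto simp: k_def)
    then have "k \<in> ?A" using x PB_blk[OF assms(5), of k] PB_blk[OF assms(4), of "w x"] WB_range[OF assms(3), of x] by auto
    then show "x \<in> q ` ?A" using k by blast
  qed
  moreover have "inj_on q ?A" using WB_inj[OF q] by (meson inj_on_subset subset_UNIV)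
  ultimately show "wmat lam (p o w o q) mu i j = wmat lam w mu i j"
    unfolding wmat_def using card_image by fastforce
qed

text \<open>The fibres of a monotone function are consecutive, so their sizes fix where each of them ends.\<close>

lemma monotone_fibres_unique:
  fixes f g :: "nat \<Rightarrow> nat"
  assumes "finite S"
    and "\<And>x y. x \<in> S \<Longrightarrow> y \<in> S \<Longrightarrow> x \<le> y \<Longrightarrow> f x \<le> f y" "\<And>x y. x \<in> S \<Longrightarrow> y \<in> S \<Longrightarrow> x \<le> y \<Longrightarrow> g x \<le> g y"
    and "\<And>i. card {x \<in> S. f x = i} = card {x \<in> S. g x = i}" and "x \<in> S"
  shows "f x = g x"
proof -
  have low: "card {x \<in> S. f x < i} = card {x \<in> S. g x < i}" for i
  proof (induction i)
    case (Suc i)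
    have *: "{x \<in> S. h x < Suc i} = {x \<in> S. h x < i} \<union> {x \<in> S. h x = i}" for h :: "nat \<Rightarrow> nat" by auto
    have "card {x \<in> S. h x < Suc i} = card {x \<in> S. h x < i} + card {x \<in> S. h x = i}" for h :: "nat \<Rightarrow> nat"
      unfolding * using assms(1) by (subst card_Un_disjoint) auto
    then show ?case using Suc assms(4) by simp
  qed simp
  have le: "a x \<le> b x" if x: "x \<in> S" and b: "\<And>x y. x \<in> S \<Longrightarrow> y \<in> S \<Longrightarrow> x \<le> y \<Longrightarrow> b x \<le> b y"
    and a: "\<And>x y. x \<in> S \<Longrightarrow> y \<in> S \<Longrightarrow> x \<le> y \<Longrightarrow> a x \<le> a y"
    and c: "\<And>i. card {x \<in> S. a x < i} = card {x \<in> S. b x < i}" for a b :: "nat \<Rightarrow> nat" and x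
  proof (rule ccontr)
    assume "\<not> a x \<le> b x"
    then have lt: "b x < a x" by simp
    have "{y \<in> S. a y < a x} \<subset> {y \<in> S. b y < a x}"
    proof
      show "{y \<in> S. a y < a x} \<subseteq> {y \<in> S. b y < a x}"
      proof
        fix y assume y: "y \<in> {y \<in> S. a y < a x}"
        then have "y \<le> x" using a[OF x] by (metis (mono_tags, lifting) mem_Collect_eq linorder_not_le nat_le_linear)
        then have "b y \<le> b x" using b x y by auto
        then show "y \<in> {y \<in> S. b y < a x}" using y lt by auto
      qed
      show "{y \<in> S. a y < a x} \<noteq> {y \<in> S. b y < a x}" using x lt by auto
    qed
    then have "card {y \<in> S. a y < a x} < card {y \<in> S. b y < a x}" using assms(1) by (intro psubset_card_mono) auto
    then show False using c by simp
  qed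
  show ?thesis
  proof (rule antisym)
    show "f x \<le> g x" by (rule le[where a = f and b = g]) (use assms(2,3,5) low in blast)+
    show "g x \<le> f x" by (rule le[where a = g and b = f]) (use assms(2,3,5) low in metis)+
  qed
qed

lemma increasing_unique:
  fixes f g :: "nat \<Rightarrow> nat"
  assumes "finite S" "\<And>x y. x \<in> S \<Longrightarrow> y \<in> S \<Longrightarrow> x < y \<Longrightarrow> f x < f y" "\<And>x y. x \<in> S \<Longrightarrow> y \<in> S \<Longrightarrow> x < y \<Longrightarrow> g x < g y"
    and "f ` S = g ` S" "x \<in> S"
  shows "f x = g x"
proof (rule monotone_fibres_unique[OF assms(1), where f = f and g = g])
  show "f x \<le> f y" if "x \<in> S" "y \<in> S" "x \<le> y" for x y using assms(2)[of x y] that by (cases "x = y") auto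
  show "g x \<le> g y" if "x \<in> S" "y \<in> S" "x \<le> y" for x y using assms(3)[of x y] that by (cases "x = y") auto
  have *: "card {x \<in> S. h x = i} = (if i \<in> h ` S then 1 else 0)"
    if "\<And>x y. x \<in> S \<Longrightarrow> y \<in> S \<Longrightarrow> x < y \<Longrightarrow> h x < h y" for h :: "nat \<Rightarrow> nat" and i
  proof (cases "i \<in> h ` S")
    case True
    then obtain z where z: "z \<in> S" "h z = i" by auto
    have "x = z" if "x \<in> S" "h x = i" for x using that z \<open>\<And>x y. x \<in> S \<Longrightarrow> y \<in> S \<Longrightarrow> x < y \<Longrightarrow> h x < h y\<close>
      by (metis less_irrefl linorder_neqE_nat)
    then have "{x \<in> S. h x = i} = {z}" using z by blast
    then show ?thesis using True by simp
  next
    case False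
    then have "{x \<in> S. h x = i} = {}" by auto
    then show ?thesis using False by (simp only: card.empty if_False)
  qed
  show "card {x \<in> S. f x = i} = card {x \<in> S. g x = i}" for i
    using *[of f i] *[of g i] assms(2-4) by simp
qed (use assms in auto)

text \<open>A representative which is increasing on the blocks of both sides can be read off its matrix:
  on a block of \<open>\<mu>\<close> the block number of its value is a monotone function with prescribed fibres,
  and on a block of \<open>\<lambda>\<close> its inverse is the increasing bijection onto a prescribed set.\<close>

lemma distinguished_unique:
  assumes lam: "lam \<in> Lam n r" and mu: "mu \<in> Lam n r"
    and d: "d \<in> Inc mu" "pinv d \<in> Inc lam" and e: "e \<in> Inc mu" "pinv e \<in> Inc lam"
    and eq: "wmat lam d mu = wmat lam e mu"
  shows "d = e"
proof -
  have dW: "d \<in> W" and eW: "e \<in> W" using d e Inc_W by auto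
  have b: "blk n lam (d k) = blk n lam (e k)" if k: "1 \<le> k" "k \<le> 2*r" for k
  proof (rule monotone_fibres_unique[where S = "{l \<in> {1..2*r}. blk n mu l = blk n mu k}" and f = "\<lambda>k. blk n lam (d k)" and g = "\<lambda>k. blk n lam (e k)"])
    have m: "blk n lam (h x) \<le> blk n lam (h y)" if h: "h \<in> Inc mu"
      and xy: "x \<in> {l \<in> {1..2*r}. blk n mu l = blk n mu k}" "y \<in> {l \<in> {1..2*r}. blk n mu l = blk n mu k}" "x \<le> y" for h x y
    proof -
      have "h x \<le> h y" using Inc_strict[OF mu h, of x y] xy by (cases "x = y") auto
      then show ?thesis using blk_mono[OF lam, of "h x" "h y"] WB_range[OF Inc_W[OF h]] xy by auto
    qed
    show "blk n lam (d x) \<le> blk n lam (d y)" if "x \<in> {l \<in> {1..2*r}. blk n mu l = blk n mu k}" "y \<in> {l \<in> {1..2*r}. blk n mu l = blk n mu k}" "x \<le> y" for x y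
      using m[OF d(1)] that by blast
    show "blk n lam (e x) \<le> blk n lam (e y)" if "x \<in> {l \<in> {1..2*r}. blk n mu l = blk n mu k}" "y \<in> {l \<in> {1..2*r}. blk n mu l = blk n mu k}" "x \<le> y" for x y
      using m[OF e(1)] that by blast
    show "card {x \<in> {l \<in> {1..2*r}. blk n mu l = blk n mu k}. blk n lam (d x) = i} = card {x \<in> {l \<in> {1..2*r}. blk n mu l = blk n mu k}. blk n lam (e x) = i}" for i
      using fun_cong[OF fun_cong[OF eq, of i], of "blk n mu k"] by (simp add: wmat_def conj_ac Collect_conj_eq Int_ac)
  qed (use k in auto)
  have "pinv d m = pinv e m" if m: "1 \<le> m" "m \<le> 2*r" for m
  proof (rule increasing_unique[where S = "{l \<in> {1..2*r}. blk n lam l = blk n lam m}" and f = "pinv d" and g = "pinv e"])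
    show "pinv d x < pinv d y" if "x \<in> {l \<in> {1..2*r}. blk n lam l = blk n lam m}" "y \<in> {l \<in> {1..2*r}. blk n lam l = blk n lam m}" "x < y" for x y
      using Inc_strict[OF lam d(2), of x y] that by auto
    show "pinv e x < pinv e y" if "x \<in> {l \<in> {1..2*r}. blk n lam l = blk n lam m}" "y \<in> {l \<in> {1..2*r}. blk n lam l = blk n lam m}" "x < y" for x y
      using Inc_strict[OF lam e(2), of x y] that by auto
    have im: "pinv h ` {l \<in> {1..2*r}. blk n lam l = i} = {k \<in> {1..2*r}. blk n lam (h k) = i}" if h: "h \<in> W" for h i
    proof (intro Set.set_eqI iffI)
      fix x assume "x \<in> pinv h ` {l \<in> {1..2*r}. blk n lam l = i}"
      then show "x \<in> {k \<in> {1..2*r}. blk n lam (h k) = i}" using h WB_range[OF WB_inv[OF h]] by auto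
    next
      fix x assume x: "x \<in> {k \<in> {1..2*r}. blk n lam (h k) = i}"
      then have "h x \<in> {l \<in> {1..2*r}. blk n lam l = i}" "x = pinv h (h x)" using h WB_range[OF h] by auto
      then show "x \<in> pinv h ` {l \<in> {1..2*r}. blk n lam l = i}" by blast
    qed
    show "pinv d ` {l \<in> {1..2*r}. blk n lam l = blk n lam m} = pinv e ` {l \<in> {1..2*r}. blk n lam l = blk n lam m}"
      unfolding im[OF dW] im[OF eW] using b by auto
  qed (use m in auto)
  then have "pinv d = pinv e" using WB_eqI[OF WB_inv[OF dW] WB_inv[OF eW]] by blast
  then show ?thesis using WB_inv_inv dW eW by metis
qed

text \<open>A descent inside a block, on either side, would give a shorter element of the double coset.\<close>

lemma min_repsB_Inc:
  assumes lam: "lam \<in> Lam n r" and mu: "mu \<in> Lam n r" and d: "d \<in> min_repsB n r lam mu"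
  shows "d \<in> W" "d \<in> Inc mu" "pinv d \<in> Inc lam"
proof -
  show dW: "d \<in> W" using d by (simp add: min_repsB_def)
  have min: "lenB r d \<le> lenB r (p o d o q)" if "p \<in> PB lam" "q \<in> PB mu" for p q
    using d that by (auto simp: min_repsB_def double_coset_eq Wpar_PB lam mu)
  have "d k < d (Suc k)" if k: "k \<in> Jset mu" for k
  proof (rule ccontr)
    assume "\<not> d k < d (Suc k)"
    then have "d (Suc k) < d k" using WB_Suc_neq[OF dW, of k] by simp
    then have "lenB r (d o sB r k) < lenB r d" using lenB_desc[OF dW] k Jset_range by fastforce
    then show False using min[OF PB_id Jset_PB[OF mu k]] by simp
  qed
  then show "d \<in> Inc mu" using dW by (simp add: Inc_def)
  have "pinv d k < pinv d (Suc k)" if k: "k \<in> Jset lam" for k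
  proof (rule ccontr)
    assume "\<not> pinv d k < pinv d (Suc k)"
    then have "pinv d (Suc k) < pinv d k" using WB_Suc_neq[OF WB_inv[OF dW], of k] by simp
    then have "lenB r (sB r k o d) < lenB r d" using lenB_left_desc[OF dW] k Jset_range by fastforce
    then show False using min[OF Jset_PB[OF lam k] PB_id] by simp
  qed
  then show "pinv d \<in> Inc lam" using WB_inv[OF dW] by (simp add: Inc_def)
qed

lemma min_repsB_exists:
  assumes lam: "lam \<in> Lam n r" and mu: "mu \<in> Lam n r" and w: "w \<in> W"
  shows "\<exists>d\<in>min_repsB n r lam mu. \<exists>p\<in>PB lam. \<exists>q\<in>PB mu. d = p o w o q"
proof -
  define C where "C = {p o w o q | p q. p \<in> PB lam \<and> q \<in> PB mu}"
  have "\<exists>u. u \<in> C \<and> (\<forall>y. y \<in> C \<longrightarrow> lenB r u \<le> lenB r y)"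
    by (rule ex_has_least_nat[of "\<lambda>u. u \<in> C" w "lenB r"])
      (auto simp: C_def intro!: exI[of _ id])
  then obtain d where d: "d \<in> C" "\<And>y. y \<in> C \<Longrightarrow> lenB r d \<le> lenB r y" by blast
  obtain p q where pq: "p \<in> PB lam" "q \<in> PB mu" "d = p o w o q" using d(1) by (auto simp: C_def)
  have "d \<in> W" unfolding pq using pq w PB_W WB_comp by metis
  moreover have "p' o d o q' \<in> C" if "p' \<in> PB lam" "q' \<in> PB mu" for p' q'
  proof -
    have "p' o d o q' = (p' o p) o w o (q o q')" by (simp add: pq o_assoc)
    then show ?thesis using PB_comp that pq unfolding C_def by blast
  qed
  ultimately have "d \<in> min_repsB n r lam mu" using d(2)
    by (auto simp: min_repsB_def double_coset_eq Wpar_PB lam mu)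
  then show ?thesis using pq by blast
qed

text \<open>Both double cosets have a minimal representative, which the matrix determines.\<close>

lemma same_wmat_double_coset:
  assumes lam: "lam \<in> Lam n r" and mu: "mu \<in> Lam n r" and w: "w \<in> W" and v: "v \<in> W"
    and eq: "wmat lam w mu = wmat lam v mu"
  shows "\<exists>p\<in>PB lam. \<exists>q\<in>PB mu. v = p o w o q"
proof -
  obtain d p q where d: "d \<in> min_repsB n r lam mu" "p \<in> PB lam" "q \<in> PB mu" "d = p o w o q"
    using min_repsB_exists[OF lam mu w] by blast
  obtain e p' q' where e: "e \<in> min_repsB n r lam mu" "p' \<in> PB lam" "q' \<in> PB mu" "e = p' o v o q'"
    using min_repsB_exists[OF lam mu v] by blast
  have "wmat lam d mu = wmat lam w mu" unfolding d(4) by (rule wmat_double_coset[OF lam mu w d(2,3)])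
  moreover have "wmat lam e mu = wmat lam v mu" unfolding e(4) by (rule wmat_double_coset[OF lam mu v e(2,3)])
  ultimately have deq: "wmat lam d mu = wmat lam e mu" using eq by simp
  note dI = min_repsB_Inc[OF lam mu d(1)] and eI = min_repsB_Inc[OF lam mu e(1)]
  have de: "d = e" by (rule distinguished_unique[OF lam mu dI(2,3) eI(2,3) deq])
  have "v = pinv p' o (p' o v o q') o pinv q'"
    using PB_W[OF e(2)] PB_W[OF e(3)] by (simp add: fun_eq_iff)
  also have "p' o v o q' = p o w o q" using de d(4) e(4) by simp
  also have "pinv p' o (p o w o q) o pinv q' = (pinv p' o p) o w o (q o pinv q')" by (simp only: o_assoc)
  finally show ?thesis using PB_comp PB_inv d e by blast
qed

end

\<comment> \<open>Sums over \<open>{1..2*n + 1}\<close> stay in closed form.\<close>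
declare sum.cl_ivl_Suc [simp del]

lemma card_fibres:
  assumes "finite K" "finite T" "\<And>k. k \<in> K \<Longrightarrow> b k \<in> T"
  shows "(\<Sum>j\<in>T. card {k \<in> K. b k = j}) = card K"
  using sum.group[OF assms(1,2), of b "\<lambda>_. 1 :: nat"] assms(3) by (auto simp: image_subset_iff)

text \<open>The rank of an element in a finite strict linear order.\<close>

locale finite_order =
  fixes X :: "'a set" and L :: "'a \<Rightarrow> 'a \<Rightarrow> bool"
  assumes fin: "finite X"
    and irr: "\<And>x. x \<in> X \<Longrightarrow> \<not> L x x"
    and tr: "\<And>x y z. x \<in> X \<Longrightarrow> y \<in> X \<Longrightarrow> z \<in> X \<Longrightarrow> L x y \<Longrightarrow> L y z \<Longrightarrow> L x z"
    and tot: "\<And>x y. x \<in> X \<Longrightarrow> y \<in> X \<Longrightarrow> x \<noteq> y \<Longrightarrow> L x y \<or> L y x"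
begin

definition rk :: "'a \<Rightarrow> nat" where "rk x = Suc (card {y \<in> X. L y x})"

lemma rk_less: assumes "x \<in> X" "y \<in> X" "L x y" shows "rk x < rk y"
proof -
  have "{z \<in> X. L z x} \<subset> {z \<in> X. L z y}"
  proof
    show "{z \<in> X. L z x} \<subseteq> {z \<in> X. L z y}" using tr assms by blast
    show "{z \<in> X. L z x} \<noteq> {z \<in> X. L z y}" using assms irr by blast
  qed
  then show ?thesis unfolding rk_def using fin by (simp add: psubset_card_mono)
qed

lemma rk_range: assumes "x \<in> X" shows "1 \<le> rk x" "rk x \<le> card X"
proof -
  have "{y \<in> X. L y x} \<subset> X" using assms irr by blast
  then show "1 \<le> rk x" "rk x \<le> card X" unfolding rk_def using psubset_card_mono[OF fin] by (auto simp: Suc_le_eq)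
qed

lemma rk_bij: "bij_betw rk X {1..card X}"
proof -
  have inj: "inj_on rk X"
  proof (rule inj_onI)
    fix x y assume "x \<in> X" "y \<in> X" "rk x = rk y"
    then show "x = y" using rk_less[of x y] rk_less[of y x] tot[of x y] by auto
  qed
  have "rk ` X \<subseteq> {1..card X}" using rk_range by auto
  moreover have "card (rk ` X) = card {1..card X}" using card_image[OF inj] by simp
  ultimately have "rk ` X = {1..card X}" by (intro card_subset_eq) auto
  then show ?thesis using inj by (simp add: bij_betw_def)
qed

lemma rk_reverse:
  assumes t: "bij_betw t X X" "\<And>x y. x \<in> X \<Longrightarrow> y \<in> X \<Longrightarrow> L (t x) (t y) \<longleftrightarrow> L y x" and x: "x \<in> X"
  shows "rk (t x) = card X + 1 - rk x"
proof -
  have tX: "t y \<in> X" if "y \<in> X" for y using t(1) that bij_betwE by blast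
  have "{y \<in> X. L y (t x)} = t ` {y \<in> X. L x y}"
  proof (intro Set.set_eqI iffI)
    fix y assume y: "y \<in> {y \<in> X. L y (t x)}"
    then obtain z where z: "z \<in> X" "y = t z" using t(1) by (auto simp: bij_betw_def)
    then show "y \<in> t ` {y \<in> X. L x y}" using y t(2)[OF z(1) x] by auto
  next
    fix y assume "y \<in> t ` {y \<in> X. L x y}"
    then show "y \<in> {y \<in> X. L y (t x)}" using t(2)[OF _ x] tX by auto
  qed
  moreover have "inj_on t {y \<in> X. L x y}" using t(1) by (auto simp: bij_betw_def inj_on_def)
  ultimately have c: "card {y \<in> X. L y (t x)} = card {y \<in> X. L x y}" by (simp add: card_image)
  have u: "X = insert x ({y \<in> X. L x y} \<union> {y \<in> X. L y x})" using tot x by blast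
  have d: "{y \<in> X. L x y} \<inter> {y \<in> X. L y x} = {}" using tr irr x by blast
  have "card X = Suc (card ({y \<in> X. L x y} \<union> {y \<in> X. L y x}))"
    by (subst u, subst card_insert_disjoint) (use fin irr x in auto)
  also have "\<dots> = Suc (card {y \<in> X. L x y} + card {y \<in> X. L y x})"
    using fin d by (subst card_Un_disjoint) auto
  finally show ?thesis using c by (simp add: rk_def)
qed

end

context type_B_schur
begin

definition cen :: "weight \<Rightarrow> nat set" where
  "cen lam = {k \<in> {1..2*r}. blk n lam k = n + 1}"

lemma cen_mir: "lam \<in> Lam n r \<Longrightarrow> k \<in> cen lam \<Longrightarrow> mir r k \<in> cen lam"
  using blk_mir[of lam k] by (auto simp: cen_def)

lemma blk_low: assumes "lam \<in> Lam n r" "1 \<le> k" "k \<le> 2*r" "blk n lam k \<le> n" shows "k \<le> r"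
proof (rule ccontr)
  assume k: "\<not> k \<le> r"
  then have "blk n lam (mir r k) \<le> blk n lam k" using blk_mono[OF assms(1), of "mir r k" k] assms by auto
  then show False using blk_mir[OF assms(1-3)] assms(4) by simp
qed

lemma blk_high: assumes "lam \<in> Lam n r" "1 \<le> k" "k \<le> 2*r" "n + 2 \<le> blk n lam k" shows "r < k"
proof (rule ccontr)
  assume k: "\<not> r < k"
  then have "blk n lam k \<le> blk n lam (mir r k)" using blk_mono[OF assms(1), of k "mir r k"] assms by auto
  then show False using blk_mir[OF assms(1-3)] assms(4) by simp
qed

lemma cen_r_iff: assumes "lam \<in> Lam n r"
  shows "lam (n + 1) \<noteq> 0 \<longleftrightarrow> r \<in> Jset lam" "lam (n + 1) \<noteq> 0 \<longleftrightarrow> r \<in> cen lam" "lam (n + 1) = 0 \<Longrightarrow> cen lam = {}"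
proof -
  have p: "psum n lam (Suc n) = psum n lam n + 2 * lam (n + 1)" by (simp add: psum_Suc hat_def)
  note pn = psum_n[OF assms]
  have m: "blk n lam (Suc r) = 2*n + 2 - blk n lam r" using blk_mir[OF assms, of r] rank by simp
  have J: "r \<in> Jset lam \<longleftrightarrow> blk n lam r = n + 1" unfolding Jset_def using m blk_range[OF assms, of r] rank by auto
  have c: "r \<in> cen lam \<longleftrightarrow> blk n lam r = n + 1" using rank by (auto simp: cen_def)
  have "lam (n + 1) \<noteq> 0 \<longleftrightarrow> blk n lam r = n + 1" using blk_iff[OF assms, of r "n + 1"] p pn rank by auto
  then show "lam (n + 1) \<noteq> 0 \<longleftrightarrow> r \<in> Jset lam" "lam (n + 1) \<noteq> 0 \<longleftrightarrow> r \<in> cen lam" using J c by auto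
  show "cen lam = {}" if z: "lam (n + 1) = 0"
  proof -
    have "blk n lam k \<noteq> n + 1" if "1 \<le> k" "k \<le> 2*r" for k using blk_iff[OF assms that, of "n + 1"] p z by auto
    then show ?thesis by (auto simp: cen_def)
  qed
qed

subsection \<open>Row and column sums\<close>

lemma card_block: assumes "lam \<in> Lam n r" "i \<in> {1..2*n + 1}" shows "card {k \<in> {1..2*r}. blk n lam k = i} = hat n lam i"
proof -
  have "psum n lam i = psum n lam (i - 1) + hat n lam i" using psum_Suc[of lam "i - 1"] assms by auto
  then show ?thesis using Rint_blk[OF assms] Rint_psum[of i lam] assms by auto
qed

lemma wmat_row_sum:
  assumes "lam \<in> Lam n r" "mu \<in> Lam n r" "w \<in> W" "i \<in> {1..2*n + 1}"
  shows "(\<Sum>j=1..2*n + 1. wmat lam w mu i j) = hat n lam i"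
proof -
  have "(\<Sum>j=1..2*n + 1. wmat lam w mu i j) = (\<Sum>j=1..2*n + 1. card {k \<in> {k \<in> {1..2*r}. blk n lam (w k) = i}. blk n mu k = j})"
    unfolding wmat_def by (intro sum.cong arg_cong[where f = card]) auto
  also have "\<dots> = card {k \<in> {1..2*r}. blk n lam (w k) = i}"
    using blk_range[OF assms(2)] by (intro card_fibres) auto
  also have "\<dots> = card (w ` {k \<in> {1..2*r}. blk n lam (w k) = i})"
    using WB_inj[OF assms(3)] by (intro card_image[symmetric]) (meson inj_on_subset subset_UNIV)
  also have "w ` {k \<in> {1..2*r}. blk n lam (w k) = i} = {k \<in> {1..2*r}. blk n lam k = i}"
  proof (intro Set.set_eqI iffI)
    fix x assume "x \<in> w ` {k \<in> {1..2*r}. blk n lam (w k) = i}"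
    then show "x \<in> {k \<in> {1..2*r}. blk n lam k = i}" using WB_range[OF assms(3)] by auto
  next
    fix x assume x: "x \<in> {k \<in> {1..2*r}. blk n lam k = i}"
    then have "x = w (pinv w x)" "pinv w x \<in> {k \<in> {1..2*r}. blk n lam (w k) = i}"
      using assms(3) WB_range[OF WB_inv[OF assms(3)], of x] by auto
    then show "x \<in> w ` {k \<in> {1..2*r}. blk n lam (w k) = i}" by blast
  qed
  finally show ?thesis using card_block assms by simp
qed

lemma wmat_col_sum:
  assumes "lam \<in> Lam n r" "mu \<in> Lam n r" "w \<in> W" "j \<in> {1..2*n + 1}"
  shows "(\<Sum>i=1..2*n + 1. wmat lam w mu i j) = hat n mu j"
proof -
  have "(\<Sum>i=1..2*n + 1. wmat lam w mu i j) = (\<Sum>i=1..2*n + 1. card {k \<in> {k \<in> {1..2*r}. blk n mu k = j}. blk n lam (w k) = i})"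
    unfolding wmat_def by (intro sum.cong arg_cong[where f = card]) auto
  also have "\<dots> = card {k \<in> {1..2*r}. blk n mu k = j}"
    using blk_range[OF assms(1)] WB_range[OF assms(3)] by (intro card_fibres) auto
  finally show ?thesis using card_block assms by simp
qed

lemma Lam_eqI:
  assumes "lam \<in> Lam n r" "mu \<in> Lam n r" "\<And>i. i \<in> {1..2*n + 1} \<Longrightarrow> hat n lam i = hat n mu i"
  shows "lam = mu"
proof
  fix i
  consider "i \<in> {1..n}" | "i = n + 1" | "i \<notin> {1..n + 1}" by fastforce
  then show "lam i = mu i"
  proof cases
    case 1 then show ?thesis using assms(3)[of i] by (auto simp: hat_def)
  next
    case 2 then show ?thesis using assms(3)[of i] by (auto simp: hat_def)
  next
    case 3 then show ?thesis using assms(1,2) by (auto simp: Lam_def)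
  qed
qed

subsection \<open>Every symmetric matrix comes from a double coset\<close>

lemma XiD:
  assumes "A \<in> Xi n r"
  shows "A i j \<ge> 0" "i \<notin> {1..2*n + 1} \<or> j \<notin> {1..2*n + 1} \<Longrightarrow> A i j = 0"
    "i \<in> {1..2*n + 1} \<Longrightarrow> j \<in> {1..2*n + 1} \<Longrightarrow> A (2*n + 2 - i) (2*n + 2 - j) = A i j"
    "(\<Sum>i=1..2*n + 1. \<Sum>j=1..2*n + 1. A i j) = 2 * int r"
proof -
  note x = assms[unfolded Xi_def mem_Collect_eq]
  show "A i j \<ge> 0" using conjunct1[OF x] by blast
  show "i \<notin> {1..2*n + 1} \<or> j \<notin> {1..2*n + 1} \<Longrightarrow> A i j = 0" using conjunct1[OF conjunct2[OF x]] by blast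
  show "A (2*n + 2 - i) (2*n + 2 - j) = A i j" if "i \<in> {1..2*n + 1}" "j \<in> {1..2*n + 1}"
    by (rule sym, rule bspec[OF bspec[OF conjunct1[OF conjunct2[OF conjunct2[OF x]]] that(1)] that(2)])
  show "(\<Sum>i=1..2*n + 1. \<Sum>j=1..2*n + 1. A i j) = 2 * int r" using conjunct2[OF conjunct2[OF conjunct2[OF x]]] .
qed

text \<open>The central row sum is even because the central row is symmetric and, by the total \<open>2r\<close>, its
  central entry is even.\<close>

lemma ex_weight:
  assumes "A \<in> Xi n r"
  shows "\<exists>lam\<in>Lam n r. \<forall>i\<in>{1..2*n + 1}. int (hat n lam i) = (\<Sum>j=1..2*n + 1. A i j)"
proof -
  define R where "R i = (\<Sum>j=1..2*n + 1. A i j)" for i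
  have nonneg: "R i \<ge> 0" for i unfolding R_def using XiD(1)[OF assms] by (intro sum_nonneg)
  have sym: "R (2*n + 2 - i) = R i" if "i \<in> {1..2*n + 1}" for i
  proof -
    have "R i = (\<Sum>j=1..2*n + 1. A (2*n + 2 - i) (2*n + 2 - j))"
      unfolding R_def using XiD(3)[OF assms that] by (intro sum.cong) simp_all
    also have "\<dots> = R (2*n + 2 - i)" unfolding R_def
      by (rule sum.reindex_bij_witness[of _ "\<lambda>j. 2*n + 2 - j" "\<lambda>j. 2*n + 2 - j"]) auto
    finally show ?thesis by simp
  qed
  have tot: "(\<Sum>i=1..2*n + 1. R i) = 2 * int r" using XiD(4)[OF assms] by (simp add: R_def)
  have split: "(\<Sum>i=1..2*n + 1. R i) = 2 * (\<Sum>i=1..n. R i) + R (n + 1)"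
  proof -
    have "{1..2*n + 1} = {1..n} \<union> {n + 1} \<union> {n + 2..2*n + 1}" by auto
    then have "(\<Sum>i=1..2*n + 1. R i) = (\<Sum>i=1..n. R i) + R (n + 1) + (\<Sum>i=n + 2..2*n + 1. R i)"
      by (simp only:) (subst sum.union_disjoint; auto)+
    moreover have "(\<Sum>i=n + 2..2*n + 1. R i) = (\<Sum>i=1..n. R (2*n + 2 - i))"
      by (rule sum.reindex_bij_witness[of _ "\<lambda>j. 2*n + 2 - j" "\<lambda>j. 2*n + 2 - j"]) auto
    moreover have "(\<Sum>i=1..n. R (2*n + 2 - i)) = (\<Sum>i=1..n. R i)" by (intro sum.cong sym) auto
    ultimately show ?thesis by simp
  qed
  define lam where "lam = (\<lambda>i. if i \<in> {1..n} then nat (R i) else if i = n + 1 then nat (R i div 2) else 0)"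
  have mid: "2 * int (lam (n + 1)) = R (n + 1)"
  proof -
    have "even (R (n + 1))" using tot split by presburger
    then show ?thesis using nonneg[of "n + 1"] by (auto simp: lam_def)
  qed
  have low: "int (lam i) = R i" if "i \<in> {1..n}" for i using that nonneg by (simp add: lam_def)
  have "int (\<Sum>i=1..n + 1. lam i) = int r"
  proof -
    have "2 * int (\<Sum>i=1..n + 1. lam i) = 2 * (\<Sum>i=1..n. int (lam i)) + 2 * int (lam (n + 1))" by (simp add: sum.cl_ivl_Suc)
    also have "\<dots> = 2 * (\<Sum>i=1..n. R i) + R (n + 1)" using mid low by simp
    finally show ?thesis using tot split by simp
  qed
  then have "(\<Sum>i=1..n + 1. lam i) = r" by (simp only: of_nat_eq_iff)
  moreover have "\<forall>i. i \<notin> {1..n + 1} \<longrightarrow> lam i = 0" by (auto simp: lam_def)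
  ultimately have lam: "lam \<in> Lam n r" unfolding Lam_def by blast
  have "int (hat n lam i) = R i" if i: "i \<in> {1..2*n + 1}" for i
  proof -
    consider "i \<le> n" | "i = n + 1" | "n + 1 < i" by linarith
    then show ?thesis
    proof cases
      case 3
      then have "2*n + 2 - i \<in> {1..n}" using i by auto
      then show ?thesis using 3 low[of "2*n + 2 - i"] sym[OF i] by (simp add: hat_def)
    qed (use i low[of i] mid in \<open>auto simp: hat_def\<close>)
  qed
  then show ?thesis using lam unfolding R_def by blast
qed

lemma Xi_transpose: "A \<in> Xi n r \<Longrightarrow> (\<lambda>i j. A j i) \<in> Xi n r"
proof -
  assume A: "A \<in> Xi n r"
  have "(\<Sum>i=1..2*n + 1. \<Sum>j=1..2*n + 1. A j i) = 2 * int r"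
    using XiD(4)[OF A] sum.swap[of A "{1..2*n + 1}" "{1..2*n + 1}"] by simp
  moreover have "\<forall>i\<in>{1..2*n + 1}. \<forall>j\<in>{1..2*n + 1}. A j i = A (2*n + 2 - j) (2*n + 2 - i)"
    using XiD(3)[OF A] by metis
  ultimately show ?thesis unfolding Xi_def mem_Collect_eq using XiD(1)[OF A] XiD(2)[OF A]
    by (intro conjI allI impI) auto
qed

lemma psum_card:
  assumes "lam \<in> Lam n r" "finite X" "\<And>i. i \<in> {1..2*n + 1} \<Longrightarrow> card {x \<in> X. c x = i} = hat n lam i" "\<And>x. x \<in> X \<Longrightarrow> 1 \<le> c x" "i \<le> 2*n + 1"
  shows "card {x \<in> X. c x \<le> i} = psum n lam i"
  using assms(5)
proof (induction i)
  case 0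
  have "{x \<in> X. c x \<le> 0} = {}" using assms(4) by force
  then show ?case by (simp only: card.empty psum_0)
next
  case (Suc i)
  have "{x \<in> X. c x \<le> Suc i} = {x \<in> X. c x \<le> i} \<union> {x \<in> X. c x = Suc i}" by auto
  then have "card {x \<in> X. c x \<le> Suc i} = card {x \<in> X. c x \<le> i} + card {x \<in> X. c x = Suc i}"
    using assms(2) by (simp only:) (subst card_Un_disjoint; auto)
  then show ?case using Suc assms(3)[of "Suc i"] by (simp add: psum_Suc)
qed

lemma (in finite_order) rk_between:
  fixes c :: "'a \<Rightarrow> nat"
  assumes "\<And>x y. x \<in> X \<Longrightarrow> y \<in> X \<Longrightarrow> c x < c y \<Longrightarrow> L x y" "x \<in> X"
  shows "card {y \<in> X. c y \<le> c x - 1} < rk x \<or> c x = 0" "rk x \<le> card {y \<in> X. c y \<le> c x}"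
proof -
  show "card {y \<in> X. c y \<le> c x - 1} < rk x \<or> c x = 0"
  proof (cases "c x = 0")
    case False
    then have "{y \<in> X. c y \<le> c x - 1} \<subseteq> {y \<in> X. L y x}" using assms by fastforce
    then show ?thesis unfolding rk_def using fin card_mono[of "{y \<in> X. L y x}"] by (simp add: less_Suc_eq_le)
  qed simp
  have "insert x {y \<in> X. L y x} \<subseteq> {y \<in> X. c y \<le> c x}"
  proof
    fix y assume "y \<in> insert x {y \<in> X. L y x}"
    then consider "y = x" | "y \<in> X" "L y x" by auto
    then show "y \<in> {y \<in> X. c y \<le> c x}"
    proof cases
      case 2
      have "\<not> c x < c y" using assms(1)[OF assms(2) 2(1)] 2 tr irr assms(2) by blast
      then show ?thesis using 2 by simp
    qed (use assms in simp)
  qed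
  then have "card (insert x {y \<in> X. L y x}) \<le> card {y \<in> X. c y \<le> c x}" using fin by (intro card_mono) auto
  moreover have "x \<notin> {y \<in> X. L y x}" using irr assms by blast
  ultimately show "rk x \<le> card {y \<in> X. c y \<le> c x}" unfolding rk_def using fin by simp
qed

text \<open>The cells of a matrix, sorted once by rows and once by columns: comparing the two
  enumerations gives a permutation with that matrix, and turning the matrix by a half turn reverses
  both orders, so the permutation is symmetric.\<close>

lemma ex_wmat:
  assumes A: "A \<in> Xi n r"
  shows "\<exists>lam\<in>Lam n r. \<exists>mu\<in>Lam n r. \<exists>w\<in>W. \<forall>i j. A i j = int (wmat lam w mu i j)"
proof -
  let ?N = "{1..2*n + 1}"
  obtain lam where lam: "lam \<in> Lam n r" "\<And>i. i \<in> ?N \<Longrightarrow> int (hat n lam i) = (\<Sum>j\<in>?N. A i j)"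
    using ex_weight[OF A] by blast
  obtain mu where mu: "mu \<in> Lam n r" "\<And>j. j \<in> ?N \<Longrightarrow> int (hat n mu j) = (\<Sum>i\<in>?N. A i j)"
    using ex_weight[OF Xi_transpose[OF A]] by blast
  define a where "a = (\<lambda>i j. nat (A i j))"
  have Aa: "A i j = int (a i j)" for i j using XiD(1)[OF A] by (simp add: a_def)
  have asym: "a (2*n + 2 - i) (2*n + 2 - j) = a i j" if "i \<in> ?N" "j \<in> ?N" for i j
    using XiD(3)[OF A that] by (simp add: a_def)
  define X where "X = {(i, j, k). i \<in> ?N \<and> j \<in> ?N \<and> k < a i j}"
  define row where "row = (\<lambda>x :: nat \<times> nat \<times> nat. fst x)"
  define col where "col = (\<lambda>x :: nat \<times> nat \<times> nat. fst (snd x))"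
  define lay where "lay = (\<lambda>x :: nat \<times> nat \<times> nat. snd (snd x))"
  have XS: "X = (SIGMA i:?N. SIGMA j:?N. {..<a i j})" by (auto simp: X_def)
  have finX: "finite X" unfolding XS by auto
  have inX: "x \<in> X \<longleftrightarrow> row x \<in> ?N \<and> col x \<in> ?N \<and> lay x < a (row x) (col x)" for x
    by (cases x) (auto simp: X_def row_def col_def lay_def)
  have rowX: "\<And>x. x \<in> X \<Longrightarrow> row x \<in> ?N" and colX: "\<And>x. x \<in> X \<Longrightarrow> col x \<in> ?N" using inX by blast+
  have eqX: "x = y \<longleftrightarrow> row x = row y \<and> col x = col y \<and> lay x = lay y" for x y
    by (cases x; cases y) (auto simp: row_def col_def lay_def)
  have cell: "card {x \<in> X. row x = i \<and> col x = j} = a i j" if "i \<in> ?N" "j \<in> ?N" for i j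
  proof -
    have "{x \<in> X. row x = i \<and> col x = j} = (\<lambda>k. (i, j, k)) ` {..<a i j}"
      using that by (auto simp: X_def row_def col_def)
    then show ?thesis by (simp add: card_image inj_on_def)
  qed
  have rowc: "card {x \<in> X. row x = i} = hat n lam i" if i: "i \<in> ?N" for i
  proof -
    have "card {x \<in> X. row x = i} = (\<Sum>j\<in>?N. card {x \<in> {x \<in> X. row x = i}. col x = j})"
      using finX rowX colX by (intro card_fibres[symmetric]) auto
    also have "\<dots> = (\<Sum>j\<in>?N. a i j)" using i cell by (intro sum.cong) auto
    finally have "int (card {x \<in> X. row x = i}) = int (hat n lam i)" using lam(2)[OF i] by (simp add: Aa)
    then show ?thesis by simp
  qed
  have colc: "card {x \<in> X. col x = j} = hat n mu j" if j: "j \<in> ?N" for j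
  proof -
    have "card {x \<in> X. col x = j} = (\<Sum>i\<in>?N. card {x \<in> {x \<in> X. col x = j}. row x = i})"
      using finX rowX colX by (intro card_fibres[symmetric]) auto
    also have "\<dots> = (\<Sum>i\<in>?N. a i j)"
    proof (intro sum.cong refl)
      fix i assume i: "i \<in> ?N"
      have "{x \<in> {x \<in> X. col x = j}. row x = i} = {x \<in> X. row x = i \<and> col x = j}" by auto
      then show "card {x \<in> {x \<in> X. col x = j}. row x = i} = a i j" using cell[OF i j] by simp
    qed
    finally have "int (card {x \<in> X. col x = j}) = int (hat n mu j)" using mu(2)[OF j] by (simp add: Aa)
    then show ?thesis by simp
  qed
  have cX: "card X = 2*r"
  proof -
    have "card X = (\<Sum>i\<in>?N. card {x \<in> X. row x = i})" using finX rowX colX by (intro card_fibres[symmetric]) auto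
    also have "\<dots> = psum n lam (2*n + 1)" unfolding psum_def using rowc by (intro sum.cong) auto
    finally show ?thesis using psum_total lam by simp
  qed
  define L1 where "L1 = (\<lambda>x y. row x < row y \<or> row x = row y \<and> (col x < col y \<or> col x = col y \<and> lay x < lay y))"
  define L2 where "L2 = (\<lambda>x y. col x < col y \<or> col x = col y \<and> (row x < row y \<or> row x = row y \<and> lay x < lay y))"
  interpret o1: finite_order X L1
    by standard (use finX eqX in \<open>auto simp: L1_def\<close>)
  interpret o2: finite_order X L2
    by standard (use finX eqX in \<open>auto simp: L2_def\<close>)
  define t where "t = (\<lambda>x. (2*n + 2 - row x, 2*n + 2 - col x, a (row x) (col x) - 1 - lay x))"
  have tval: "row (t x) = 2*n + 2 - row x" "col (t x) = 2*n + 2 - col x" "lay (t x) = a (row x) (col x) - 1 - lay x" for x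
    by (auto simp: t_def row_def col_def lay_def)
  have tX: "t x \<in> X" if "x \<in> X" for x
    using that asym[of "row x" "col x"] unfolding inX tval by auto
  have tt: "t (t x) = x" if "x \<in> X" for x
    unfolding eqX tval using that asym[of "row x" "col x"] inX[of x] by auto
  have tbij: "bij_betw t X X" by (rule bij_betwI[of _ _ _ t]) (use tX tt in auto)
  have d: "(2*n + 2 - p = 2*n + 2 - q) = (p = q)" "(2*n + 2 - p < 2*n + 2 - q) = (q < p)" if "p \<in> ?N" "q \<in> ?N" for p q
    using that by auto
  have dlay: "a (row x) (col x) - 1 - lay x < a (row y) (col y) - 1 - lay y \<longleftrightarrow> lay y < lay x"
    if "x \<in> X" "y \<in> X" "row x = row y" "col x = col y" for x y
    using that inX[of x] inX[of y] by auto
  have r1: "L1 (t x) (t y) \<longleftrightarrow> L1 y x" if "x \<in> X" "y \<in> X" for x y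
    unfolding L1_def tval d[OF rowX[OF that(1)] rowX[OF that(2)]] d[OF colX[OF that(1)] colX[OF that(2)]]
    using dlay[OF that] by (cases "row x = row y"; cases "col x = col y") simp_all
  have r2: "L2 (t x) (t y) \<longleftrightarrow> L2 y x" if "x \<in> X" "y \<in> X" for x y
    unfolding L2_def tval d[OF rowX[OF that(1)] rowX[OF that(2)]] d[OF colX[OF that(1)] colX[OF that(2)]]
    using dlay[OF that] by (cases "row x = row y"; cases "col x = col y") simp_all
  note b1 = o1.rk_bij[unfolded cX] and b2 = o2.rk_bij[unfolded cX]
  define g where "g = inv_into X o2.rk"
  have g: "g k \<in> X" "o2.rk (g k) = k" if "1 \<le> k" "k \<le> 2*r" for k
  proof -
    have "k \<in> o2.rk ` X" using b2 that by (auto simp: bij_betw_def)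
    then show "g k \<in> X" "o2.rk (g k) = k" unfolding g_def by (auto intro: inv_into_into f_inv_into_f)
  qed
  have g2: "g (o2.rk x) = x" if "x \<in> X" for x
    unfolding g_def using b2 that by (auto simp: bij_betw_def)
  define w where "w = (\<lambda>k. if 1 \<le> k \<and> k \<le> 2*r then o1.rk (g k) else k)"
  have wW: "w \<in> W"
  proof -
    have "bij_betw (o1.rk o g) {1..2*r} {1..2*r}"
      using bij_betw_trans[OF bij_betw_inv_into[OF b2] b1] by (simp add: g_def)
    then have "bij_betw w {1..2*r} {1..2*r}" by (rule bij_betw_cong[THEN iffD1, rotated]) (auto simp: w_def)
    then have "w permutes {1..2*r}" by (rule bij_imp_permutes) (auto simp: w_def)
    moreover have "w k + w (mir r k) = 2*r + 1" if k: "k \<in> {1..2*r}" for k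
    proof -
      have gk: "g k \<in> X" "o2.rk (g k) = k" using g k by auto
      have "o2.rk (t (g k)) = mir r k" using o2.rk_reverse[OF tbij r2 gk(1)] gk cX by simp
      then have "g (mir r k) = t (g k)" using g2[OF tX[OF gk(1)]] by simp
      then have "w (mir r k) = o1.rk (t (g k))" using k by (auto simp: w_def)
      also have "\<dots> = 2*r + 1 - o1.rk (g k)" using o1.rk_reverse[OF tbij r1 gk(1)] cX by simp
      finally show ?thesis using k o1.rk_range[OF gk(1)] cX by (auto simp: w_def)
    qed
    ultimately show ?thesis by (simp add: WB_iff)
  qed
  have bl1: "blk n lam (o1.rk x) = row x" if x: "x \<in> X" for x
  proof -
    have rx: "row x \<in> ?N" using x inX by blast
    have pc: "card {y \<in> X. row y \<le> i} = psum n lam i" if "i \<le> 2*n + 1" for i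
      by (rule psum_card[OF lam(1) finX rowc _ that]) (use inX in auto)
    have mono: "\<And>x y. x \<in> X \<Longrightarrow> y \<in> X \<Longrightarrow> row x < row y \<Longrightarrow> L1 x y" by (simp add: L1_def)
    have "card {y \<in> X. row y \<le> row x - 1} < o1.rk x \<or> row x = 0" "o1.rk x \<le> card {y \<in> X. row y \<le> row x}"
      using o1.rk_between[of row x, OF mono x] by simp_all
    then have "psum n lam (row x - 1) < o1.rk x" "o1.rk x \<le> psum n lam (row x)"
      using pc[of "row x - 1"] pc[of "row x"] rx by auto
    then show ?thesis using blk_iff[OF lam(1)] o1.rk_range[OF x] rx cX by auto
  qed
  have bl2: "blk n mu (o2.rk x) = col x" if x: "x \<in> X" for x
  proof -
    have rx: "col x \<in> ?N" using x inX by blast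
    have pc: "card {y \<in> X. col y \<le> i} = psum n mu i" if "i \<le> 2*n + 1" for i
      by (rule psum_card[OF mu(1) finX colc _ that]) (use inX in auto)
    have mono: "\<And>x y. x \<in> X \<Longrightarrow> y \<in> X \<Longrightarrow> col x < col y \<Longrightarrow> L2 x y" by (simp add: L2_def)
    have "card {y \<in> X. col y \<le> col x - 1} < o2.rk x \<or> col x = 0" "o2.rk x \<le> card {y \<in> X. col y \<le> col x}"
      using o2.rk_between[of col x, OF mono x] by simp_all
    then have "psum n mu (col x - 1) < o2.rk x" "o2.rk x \<le> psum n mu (col x)"
      using pc[of "col x - 1"] pc[of "col x"] rx by auto
    then show ?thesis using blk_iff[OF mu(1)] o2.rk_range[OF x] rx cX by auto
  qed
  have "A i j = int (wmat lam w mu i j)" for i j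
  proof (cases "i \<in> ?N \<and> j \<in> ?N")
    case True
    have "{k \<in> {1..2*r}. blk n mu k = j \<and> blk n lam (w k) = i} = o2.rk ` {x \<in> X. row x = i \<and> col x = j}"
    proof (intro Set.set_eqI iffI)
      fix k assume k: "k \<in> {k \<in> {1..2*r}. blk n mu k = j \<and> blk n lam (w k) = i}"
      then have "g k \<in> X" "o2.rk (g k) = k" using g by auto
      moreover have "col (g k) = j" "row (g k) = i"
        using bl1[of "g k"] bl2[of "g k"] calculation k by (auto simp: w_def)
      ultimately show "k \<in> o2.rk ` {x \<in> X. row x = i \<and> col x = j}" by force
    next
      fix k assume "k \<in> o2.rk ` {x \<in> X. row x = i \<and> col x = j}"
      then obtain x where x: "x \<in> X" "row x = i" "col x = j" "k = o2.rk x" by auto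
      then show "k \<in> {k \<in> {1..2*r}. blk n mu k = j \<and> blk n lam (w k) = i}"
        using o2.rk_range[OF x(1)] g2[OF x(1)] bl1[OF x(1)] bl2[OF x(1)] cX by (auto simp: w_def)
    qed
    moreover have "inj_on o2.rk {x \<in> X. row x = i \<and> col x = j}"
      using b2 by (auto simp: bij_betw_def inj_on_def)
    ultimately have "wmat lam w mu i j = a i j" using cell True by (simp add: wmat_def card_image)
    then show ?thesis by (simp add: Aa)
  next
    case False
    then show ?thesis using A wmat_outside[OF lam(1) mu(1) wW, of i j] XiD(2)[OF A, of i j] by auto
  qed
  then show ?thesis using lam(1) mu(1) wW by blast
qed

lemma triple_mat_inj: "inj_on (triple_mat n) (triples n r)"
proof (rule inj_onI)
  fix x y assume x: "x \<in> triples n r" and y: "y \<in> triples n r" and eq: "triple_mat n x = triple_mat n y"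
  obtain lam d mu where xx: "x = (lam, d, mu)" by (cases x)
  obtain lam' d' mu' where yy: "y = (lam', d', mu')" by (cases y)
  have l: "lam \<in> Lam n r" "mu \<in> Lam n r" "d \<in> min_repsB n r lam mu" using x by (auto simp: triples_def xx)
  have l': "lam' \<in> Lam n r" "mu' \<in> Lam n r" "d' \<in> min_repsB n r lam' mu'" using y by (auto simp: triples_def yy)
  note dI = min_repsB_Inc[OF l] and dI' = min_repsB_Inc[OF l']
  have m: "wmat lam d mu i j = wmat lam' d' mu' i j" for i j
    using fun_cong[OF fun_cong[OF eq, of i], of j] l l' dI(1) dI'(1) by (simp add: xx yy triple_mat_wmat')
  have "lam = lam'" using wmat_row_sum[OF l(1,2) dI(1)] wmat_row_sum[OF l'(1,2) dI'(1)] m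
    by (intro Lam_eqI[OF l(1) l'(1)]) simp
  moreover have "mu = mu'" using wmat_col_sum[OF l(1,2) dI(1)] wmat_col_sum[OF l'(1,2) dI'(1)] m
    by (intro Lam_eqI[OF l(2) l'(2)]) simp
  moreover have "d = d'"
  proof (rule distinguished_unique[OF l(1,2) dI(2,3)])
    show "d' \<in> Inc mu" "pinv d' \<in> Inc lam" using dI'(2,3) calculation by auto
    show "wmat lam d mu = wmat lam d' mu" using m calculation by blast
  qed
  ultimately show "x = y" by (simp add: xx yy)
qed

lemma mat_triple_props:
  assumes A: "A \<in> Xi n r"
  shows "rowW A \<in> Lam n r" "colW A \<in> Lam n r" "dm A \<in> min_repsB n r (rowW A) (colW A)"
    "\<And>i j. A i j = int (wmat (rowW A) (dm A) (colW A) i j)"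
proof -
  obtain lam mu w where 1: "lam \<in> Lam n r" "mu \<in> Lam n r" "w \<in> W" "\<And>i j. A i j = int (wmat lam w mu i j)"
    using ex_wmat[OF A] by blast
  obtain d p q where d: "d \<in> min_repsB n r lam mu" "p \<in> PB lam" "q \<in> PB mu" "d = p o w o q"
    using min_repsB_exists[OF 1(1-3)] by blast
  have "wmat lam d mu = wmat lam w mu" unfolding d(4) by (rule wmat_double_coset[OF 1(1-3) d(2,3)])
  then have "triple_mat n (lam, d, mu) = A"
    using triple_mat_wmat'[OF 1(1,2) min_repsB_Inc(1)[OF 1(1,2) d(1)]] 1(4) by (simp add: fun_eq_iff)
  moreover have t: "(lam, d, mu) \<in> triples n r" using 1 d by (simp add: triples_def)
  ultimately have "mat_triple n r A = (lam, d, mu)"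
    unfolding mat_triple_def using the_inv_into_f_eq[OF triple_mat_inj] by blast
  then have "rowW A = lam" "dm A = d" "colW A = mu" by (simp_all add: row_wt_def dmat_def col_wt_def)
  then show "rowW A \<in> Lam n r" "colW A \<in> Lam n r" "dm A \<in> min_repsB n r (rowW A) (colW A)"
    "\<And>i j. A i j = int (wmat (rowW A) (dm A) (colW A) i j)"
    using 1 d \<open>wmat lam d mu = wmat lam w mu\<close> by auto
qed

lemma ro_hat: assumes "A \<in> Xi n r" "i \<in> {1..2*n + 1}" shows "ro n A i = int (hat n (rowW A) i)"
proof -
  note m = mat_triple_props[OF assms(1)]
  have "ro n A i = int (\<Sum>j=1..2*n + 1. wmat (rowW A) (dm A) (colW A) i j)"
    unfolding ro_def of_nat_sum using m(4) by (intro sum.cong) auto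
  then show ?thesis using wmat_row_sum[OF m(1,2) min_repsB_Inc(1)[OF m(1-3)] assms(2)] by (simp flip: of_nat_sum)
qed

lemma co_hat: assumes "A \<in> Xi n r" "i \<in> {1..2*n + 1}" shows "co n A i = int (hat n (colW A) i)"
proof -
  note m = mat_triple_props[OF assms(1)]
  have "co n A i = int (\<Sum>j=1..2*n + 1. wmat (rowW A) (dm A) (colW A) j i)"
    unfolding co_def of_nat_sum using m(4) by (intro sum.cong) auto
  then show ?thesis using wmat_col_sum[OF m(1,2) min_repsB_Inc(1)[OF m(1-3)] assms(2)] by (simp flip: of_nat_sum)
qed

lemma co_ro_iff:
  assumes "A \<in> Xi n r" "B \<in> Xi n r"
  shows "co n B = ro n A \<longleftrightarrow> colW B = rowW A"
proof
  assume "co n B = ro n A"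
  then show "colW B = rowW A"
    using co_hat[OF assms(2)] ro_hat[OF assms(1)] mat_triple_props[OF assms(1)] mat_triple_props[OF assms(2)]
    by (intro Lam_eqI) (auto simp: fun_eq_iff)
next
  assume e: "colW B = rowW A"
  show "co n B = ro n A"
  proof
    fix i show "co n B i = ro n A i"
    proof (cases "i \<in> {1..2*n + 1}")
      case True
      then show ?thesis using co_hat[OF assms(2)] ro_hat[OF assms(1)] e by simp
    next
      case False
      then have "A i j = 0" "B j i = 0" for j using XiD(2)[OF assms(1)] XiD(2)[OF assms(2)] by auto
      then show ?thesis by (simp add: co_def ro_def)
    qed
  qed
qed

subsection \<open>The matrices next to diagonal ones\<close>

lemma sum_Eunit1: "finite S \<Longrightarrow> (\<Sum>j\<in>S. Eunit a b i j) = (if i = a \<and> b \<in> S then 1 else 0)"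
  by (auto simp: Eunit_def intro!: sum.neutral)

lemma sum_Eunit2: "finite S \<Longrightarrow> (\<Sum>i\<in>S. Eunit a b i j) = (if j = b \<and> a \<in> S then 1 else 0)"
  by (auto simp: Eunit_def intro!: sum.neutral)

lemma near_diag_psum:
  assumes al: "al \<in> Lam n r" and lam: "lam \<in> Lam n r" and h: "h \<in> {1..n}"
    and row: "\<And>i. i \<in> {1..2*n + 1} \<Longrightarrow> (\<Sum>j=1..2*n + 1. B i j) = int (hat n al i)"
    and col: "\<And>j. j \<in> {1..2*n + 1} \<Longrightarrow> (\<Sum>i=1..2*n + 1. B i j) = int (hat n lam j)"
    and diag: "diag_mat (\<lambda>i j. B i j - Eth n h (h + 1) i j)" and i: "i \<le> 2*n + 1"
  shows "int (psum n al i) = int (psum n lam i) + (if i = h then 1 else 0) - (if i = 2*n + 1 - h then 1 else 0)"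
proof -
  let ?N = "{1..2*n + 1}"
  have BE: "B i j = (if i = j then B i i - Eth n h (h + 1) i i else 0) + Eth n h (h + 1) i j" for i j
    using diag by (auto simp: diag_mat_def)
  have E: "(\<Sum>j\<in>?N. Eth n h (h + 1) i j) = (if i = h then 1 else 0) + (if i = 2*n + 2 - h then 1 else 0)"
    "(\<Sum>j\<in>?N. Eth n h (h + 1) j i) = (if i = h + 1 then 1 else 0) + (if i = 2*n + 1 - h then 1 else 0)" for i
    using h by (auto simp: Eth_def sum.distrib sum_Eunit1 sum_Eunit2)
  have d: "int (hat n al k) - int (hat n lam k) = (if k = h then 1 else 0) + (if k = 2*n + 2 - h then 1 else 0)
      - (if k = h + 1 then 1 else 0) - (if k = 2*n + 1 - h then 1 else 0)" if k: "k \<in> ?N" for k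
  proof -
    have "(\<Sum>j\<in>?N. B k j) = (B k k - Eth n h (h + 1) k k) + (\<Sum>j\<in>?N. Eth n h (h + 1) k j)"
      by (subst BE) (use k in \<open>simp add: sum.distrib sum.delta\<close>)
    moreover have "(\<Sum>j\<in>?N. B j k) = (B k k - Eth n h (h + 1) k k) + (\<Sum>j\<in>?N. Eth n h (h + 1) j k)"
      by (subst BE) (use k in \<open>simp add: sum.distrib sum.delta'\<close>)
    ultimately show ?thesis using row[OF k] col[OF k] unfolding E by simp
  qed
  show ?thesis using i
  proof (induction i)
    case 0
    then show ?case using h by auto
  next
    case (Suc i)
    then have IH: "int (psum n al i) = int (psum n lam i) + (if i = h then 1 else 0) - (if i = 2*n + 1 - h then 1 else 0)" by simp
    have "int (psum n al (Suc i)) = int (psum n al i) + int (hat n al (Suc i))"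
      "int (psum n lam (Suc i)) = int (psum n lam i) + int (hat n lam (Suc i))" by (simp_all add: psum_Suc)
    moreover obtain m where m: "2*n + 1 - h = m" "2*n + 2 - h = Suc m" "h < m" using h by auto
    ultimately show ?case using IH d[of "Suc i"] Suc.prems h unfolding m(1,2) by (auto split: if_splits)
  qed
qed

text \<open>The partial sums of the two weights differ by one at \<open>h\<close> and at its mirror image only, so the
  intervals of the two partitions meet as the matrix prescribes.\<close>

lemma near_diag_wmat:
  assumes al: "al \<in> Lam n r" and lam: "lam \<in> Lam n r" and h: "h \<in> {1..n}"
    and row: "\<And>i. i \<in> {1..2*n + 1} \<Longrightarrow> (\<Sum>j=1..2*n + 1. B i j) = int (hat n al i)"
    and col: "\<And>j. j \<in> {1..2*n + 1} \<Longrightarrow> (\<Sum>i=1..2*n + 1. B i j) = int (hat n lam j)"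
    and diag: "diag_mat (\<lambda>i j. B i j - Eth n h (h + 1) i j)"
    and ij: "i \<in> {1..2*n + 1}" "j \<in> {1..2*n + 1}"
  shows "int (wmat al id lam i j) = B i j"
proof -
  let ?N = "{1..2*n + 1}"
  note ps = near_diag_psum[OF al lam h row col diag]
  have supp: "b = a \<or> (b = h + 1 \<and> a = h) \<or> (b = 2*n + 1 - h \<and> a = 2*n + 2 - h)"
    if k: "1 \<le> k" "k \<le> 2*r" "blk n lam k = b" "blk n al k = a" for k a b
  proof -
    have b: "1 \<le> b" "b \<le> 2*n + 1" "psum n lam (b - 1) < k" "k \<le> psum n lam b"
      using blk_iff[OF lam k(1,2), of b] blk_range[OF lam k(1,2)] k by auto
    have blka: "a = c" if "1 \<le> c" "psum n al (c - 1) < k" "k \<le> psum n al c" for c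
      using blk_iff[OF al k(1,2), of c] k that by auto
    consider "psum n al (b - 1) < k" "k \<le> psum n al b" | "psum n al b < k" | "k \<le> psum n al (b - 1)" by linarith
    then show ?thesis
    proof cases
      case 1 then show ?thesis using blka b by auto
    next
      case 2
      then have bb: "b = 2*n + 1 - h" using ps[of b] b by (auto split: if_splits)
      have "psum n lam b \<le> psum n lam (Suc b)" by (rule psum_mono) simp
      moreover have "Suc b \<le> 2*n + 1" "Suc b \<noteq> h" "Suc b \<noteq> 2*n + 1 - h" using bb h by auto
      then have "int (psum n al (Suc b)) = int (psum n lam (Suc b))" using ps[of "Suc b"] by simp
      ultimately have "a = Suc b" using 2 b by (intro blka) auto
      then show ?thesis using bb h by auto
    next
      case 3
      have "b - 1 \<le> 2*n + 1" using b by simp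
      then have bb: "b - 1 = h" using ps[of "b - 1"] b 3 by (simp split: if_splits)
      have "psum n lam (h - 1) \<le> psum n lam h" by (rule psum_mono) simp
      moreover have "h - 1 \<le> 2*n + 1" "h - 1 \<noteq> h" "h - 1 \<noteq> 2*n + 1 - h" using h by auto
      then have "int (psum n al (h - 1)) = int (psum n lam (h - 1))" using ps[of "h - 1"] by simp
      ultimately have "a = h" using 3 b bb h by (intro blka) auto
      then show ?thesis using bb b by auto
    qed
  qed
  define V where "V = (\<lambda>i j. int (wmat al id lam i j))"
  have V0: "V i j = 0" if "i \<noteq> j" "\<not> (i = h \<and> j = h + 1)" "\<not> (i = 2*n + 2 - h \<and> j = 2*n + 1 - h)" for i j
  proof -
    have "{k \<in> {1..2*r}. blk n lam k = j \<and> blk n al (id k) = i} = {}" using supp that by fastforce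
    then show ?thesis by (simp only: V_def wmat_def card.empty of_nat_0)
  qed
  have B0: "B i j = 0" if "i \<noteq> j" "\<not> (i = h \<and> j = h + 1)" "\<not> (i = 2*n + 2 - h \<and> j = 2*n + 1 - h)" for i j
    using diag that h by (auto simp: diag_mat_def Eth_def Eunit_def split: if_splits)
  have Vr: "(\<Sum>j\<in>?N. V i j) = (\<Sum>j\<in>?N. B i j)" if "i \<in> ?N" for i
    using wmat_row_sum[OF al lam WB_id that] row[OF that] by (simp add: V_def flip: of_nat_sum)
  have Vc: "(\<Sum>i\<in>?N. V i j) = (\<Sum>i\<in>?N. B i j)" if "j \<in> ?N" for j
    using wmat_col_sum[OF al lam WB_id that] col[OF that] by (simp add: V_def flip: of_nat_sum)
  have single: "(\<Sum>j\<in>?N. f j) = f i" if "i \<in> ?N" "\<And>j. j \<in> ?N \<Longrightarrow> j \<noteq> i \<Longrightarrow> f j = 0" for f :: "nat \<Rightarrow> int" and i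
    using that by (subst sum.remove[of _ i]) auto
  have double: "(\<Sum>j\<in>?N. f j) = f i + f i'" if "i \<in> ?N" "i' \<in> ?N" "i \<noteq> i'" "\<And>j. j \<in> ?N \<Longrightarrow> j \<noteq> i \<Longrightarrow> j \<noteq> i' \<Longrightarrow> f j = 0" for f :: "nat \<Rightarrow> int" and i i'
    using that by (subst sum.remove[of _ i], simp, simp, subst sum.remove[of _ i']) auto
  have dg: "V i i = B i i" if i: "i \<in> ?N" for i
  proof (cases "i = h \<or> i = 2*n + 2 - h")
    case True
    have np: "\<not> (k = h \<and> i = h + 1)" "\<not> (k = 2*n + 2 - h \<and> i = 2*n + 1 - h)" if "k \<noteq> i" for k
      using True h that by auto
    have "(\<Sum>k\<in>?N. V k i) = V i i" by (rule single[OF i]) (use np V0 in blast)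
    moreover have "(\<Sum>k\<in>?N. B k i) = B i i" by (rule single[OF i]) (use np B0 in blast)
    ultimately show ?thesis using Vc[OF i] by simp
  next
    case False
    have "(\<Sum>k\<in>?N. V i k) = V i i" by (rule single[OF i]) (use False V0 in auto)
    moreover have "(\<Sum>k\<in>?N. B i k) = B i i" by (rule single[OF i]) (use False B0 in auto)
    ultimately show ?thesis using Vr[OF i] by simp
  qed
  have "V i j = B i j"
  proof (cases "i = j")
    case True then show ?thesis using dg ij by simp
  next
    case False
    show ?thesis
    proof (cases "(i = h \<and> j = h + 1) \<or> (i = 2*n + 2 - h \<and> j = 2*n + 1 - h)")
      case True
      have np: "\<not> (i = h \<and> k = h + 1)" "\<not> (i = 2*n + 2 - h \<and> k = 2*n + 1 - h)" if "k \<noteq> j" for k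
        using True h that by auto
      have "(\<Sum>k\<in>?N. V i k) = V i i + V i j" by (rule double[OF ij False]) (use np V0 in metis)
      moreover have "(\<Sum>k\<in>?N. B i k) = B i i + B i j" by (rule double[OF ij False]) (use np B0 in metis)
      ultimately show ?thesis using Vr[OF ij(1)] dg[OF ij(1)] by simp
    next
      case False2: False
      then show ?thesis using V0 B0 False by auto
    qed
  qed
  then show ?thesis by (simp add: V_def)
qed

lemma wmat_transpose: assumes "w \<in> W" shows "wmat lam (pinv w) mu i j = wmat mu w lam j i"
proof -
  have "{k \<in> {1..2*r}. blk n mu k = j \<and> blk n lam (pinv w k) = i} = w ` {k \<in> {1..2*r}. blk n lam k = i \<and> blk n mu (w k) = j}"
  proof (intro Set.set_eqI iffI)
    fix x assume x: "x \<in> {k \<in> {1..2*r}. blk n mu k = j \<and> blk n lam (pinv w k) = i}"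
    then have "x = w (pinv w x)" "pinv w x \<in> {k \<in> {1..2*r}. blk n lam k = i \<and> blk n mu (w k) = j}"
      using assms WB_range[OF WB_inv[OF assms], of x] by auto
    then show "x \<in> w ` {k \<in> {1..2*r}. blk n lam k = i \<and> blk n mu (w k) = j}" by blast
  qed (use assms WB_range[OF assms] in auto)
  moreover have "inj_on w {k \<in> {1..2*r}. blk n lam k = i \<and> blk n mu (w k) = j}"
    using WB_inj[OF assms] by (meson inj_on_subset subset_UNIV)
  ultimately show ?thesis by (simp add: wmat_def card_image)
qed

lemma dmat_unit:
  assumes A: "A \<in> Xi n r" and eq: "\<And>i j. i \<in> {1..2*n + 1} \<Longrightarrow> j \<in> {1..2*n + 1} \<Longrightarrow> A i j = int (wmat (rowW A) id (colW A) i j)"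
  shows "dm A = id"
proof -
  note m = mat_triple_props[OF A]
  note d = min_repsB_Inc[OF m(1-3)]
  have "wmat (rowW A) id (colW A) i j = wmat (rowW A) (dm A) (colW A) i j" for i j
    using eq[of i j] m(4)[of i j] wmat_outside[OF m(1,2) WB_id, of i j] wmat_outside[OF m(1,2) d(1), of i j]
    by (cases "i \<in> {1..2*n + 1} \<and> j \<in> {1..2*n + 1}") auto
  then obtain p q where pq: "p \<in> PB (rowW A)" "q \<in> PB (colW A)" "id = p o dm A o q"
    using same_wmat_double_coset[OF m(1,2) d(1) WB_id] by (metis ext)
  have "lenB r (dm A) \<le> lenB r (p o dm A o q)"
    using m(3) pq(1,2) by (auto simp: min_repsB_def double_coset_eq Wpar_PB m)
  then have "lenB r (dm A) \<le> lenB r id" unfolding pq(3)[symmetric] .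
  then show ?thesis using lenB_0[OF d(1)] by simp
qed

lemma dmat_upper_diag:
  assumes "B \<in> Xi n r" "h \<in> {1..n}" "diag_mat (\<lambda>i j. B i j - Eth n h (h + 1) i j)"
  shows "dm B = id" "cen (rowW B) \<subseteq> cen (colW B)" "sgn_mat n B = 1"
proof -
  note m = mat_triple_props[OF assms(1)]
  have row: "i \<in> {1..2*n + 1} \<Longrightarrow> (\<Sum>j=1..2*n + 1. B i j) = int (hat n (rowW B) i)" for i
    using ro_hat[OF assms(1), of i] by (simp add: ro_def)
  have col: "i \<in> {1..2*n + 1} \<Longrightarrow> (\<Sum>j=1..2*n + 1. B j i) = int (hat n (colW B) i)" for i
    using co_hat[OF assms(1), of i] by (simp add: co_def)
  show "dm B = id"
    using near_diag_wmat[OF m(1,2) assms(2) row col assms(3)] by (intro dmat_unit[OF assms(1)]) auto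
  show "cen (rowW B) \<subseteq> cen (colW B)"
  proof
    fix k assume k: "k \<in> cen (rowW B)"
    then have k1: "1 \<le> k" "k \<le> 2*r" "blk n (rowW B) k = n + 1" by (auto simp: cen_def)
    have "psum n (rowW B) n < k" "k \<le> psum n (rowW B) (Suc n)" using blk_iff[OF m(1) k1(1,2), of "n + 1"] k1 by auto
    moreover have "psum n (colW B) n \<le> psum n (rowW B) n" "psum n (rowW B) (Suc n) \<le> psum n (colW B) (Suc n)"
      using near_diag_psum[OF m(1,2) assms(2) row col assms(3), of n] near_diag_psum[OF m(1,2) assms(2) row col assms(3), of "Suc n"] assms(2)
      by (auto split: if_splits)
    ultimately have "blk n (colW B) k = n + 1" using blk_iff[OF m(2) k1(1,2), of "n + 1"] by auto
    then show "k \<in> cen (colW B)" using k1 by (simp add: cen_def)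
  qed
  have "B i j = 0" if "i \<in> {1..n}" "j \<in> {n + 2..2*n + 1}" for i j
    using assms(2,3) that by (auto simp: diag_mat_def Eth_def Eunit_def split: if_splits)
  then show "sgn_mat n B = 1" by (simp add: sgn_mat_def)
qed

lemma dmat_lower_diag:
  assumes "C \<in> Xi n r" "h \<in> {1..n}" "diag_mat (\<lambda>i j. C i j - Eth n (h + 1) h i j)"
  shows "dm C = id" "sgn_mat n C = 1"
proof -
  note m = mat_triple_props[OF assms(1)]
  have row: "i \<in> {1..2*n + 1} \<Longrightarrow> (\<Sum>j=1..2*n + 1. C i j) = int (hat n (rowW C) i)" for i
    using ro_hat[OF assms(1), of i] by (simp add: ro_def)
  have col: "i \<in> {1..2*n + 1} \<Longrightarrow> (\<Sum>j=1..2*n + 1. C j i) = int (hat n (colW C) i)" for i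
    using co_hat[OF assms(1), of i] by (simp add: co_def)
  have E: "Eth n h (h + 1) i j = Eth n (h + 1) h j i" for i j by (auto simp: Eth_def Eunit_def)
  have "diag_mat (\<lambda>i j. C j i - Eth n h (h + 1) i j)" using assms(3) by (auto simp: diag_mat_def E[simplified])
  then have "int (wmat (colW C) id (rowW C) i j) = C j i" if "i \<in> {1..2*n + 1}" "j \<in> {1..2*n + 1}" for i j
    using near_diag_wmat[OF m(2,1) assms(2), of "\<lambda>i j. C j i"] row col that by blast
  moreover have "wmat (colW C) id (rowW C) i j = wmat (rowW C) id (colW C) j i" for i j
    using wmat_transpose[OF WB_id] by (metis inv_id)
  ultimately show "dm C = id" by (intro dmat_unit[OF assms(1)]) metis
  have "C i j = 0" if "i \<in> {1..n}" "j \<in> {n + 2..2*n + 1}" for i j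
    using assms(2,3) that by (auto simp: diag_mat_def Eth_def Eunit_def split: if_splits)
  then show "sgn_mat n C = 1" by (simp add: sgn_mat_def)
qed

section \<open>Signs\<close>

text \<open>With \<open>S\<close> the set of all positions this is the parity; with \<open>S\<close> a central block it
  distinguishes double cosets of type D with the same matrix.\<close>

definition sgnS :: "nat set \<Rightarrow> (nat \<Rightarrow> nat) \<Rightarrow> int" where
  "sgnS S w = (\<Prod>k\<in>{k \<in> S. r < k}. if w k \<le> r then - 1 else 1)"

definition par :: "(nat \<Rightarrow> nat) \<Rightarrow> int" where "par = sgnS {1..2*r}"
abbreviation "sg \<equiv> sB r r"
abbreviation "cj w \<equiv> sg o  w o sg"

text \<open>Each pair \<open>{k, 2r + 1 - k}\<close> is represented by its larger element; \<open>v\<close> permutes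
  these pairs, and the signs picked up by \<open>v\<close> and by \<open>w\<close> multiply.\<close>

lemma sgnS_comp:
  assumes S: "S \<subseteq> {1..2*r}" "\<And>k. k \<in> S \<Longrightarrow> mir r k \<in> S"
    and v: "v \<in> W" "\<And>k. k \<in> S \<Longrightarrow> v k \<in> S" and w: "w \<in> W"
  shows "sgnS S (w o v) = sgnS S w * sgnS S v"
proof -
  define P where "P = {k \<in> S. r < k}"
  define \<pi> where "\<pi> = (\<lambda>k. if r < v k then v k else mir r (v k))"
  have fin: "finite P" unfolding P_def using finite_subset[OF S(1)] by simp
  have rng: "1 \<le> k \<and> k \<le> 2*r" if "k \<in> S" for k using S(1) that by auto
  have \<pi>P: "\<pi> k \<in> P" if "k \<in> P" for k
  proof -
    have "v k \<in> S" using that v(2) by (simp add: P_def)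
    then show ?thesis using S(2)[of "v k"] rng[of "v k"] by (auto simp: P_def \<pi>_def)
  qed
  have inj: "inj_on \<pi> P"
  proof (rule inj_onI)
    fix k l assume k: "k \<in> P" and l: "l \<in> P" and eq: "\<pi> k = \<pi> l"
    have kl: "k \<in> S" "l \<in> S" "r < k" "r < l" using k l by (auto simp: P_def)
    have "v k = v l \<or> v k = mir r (v l)"
      using eq rng[OF v(2)[OF kl(1)]] rng[OF v(2)[OF kl(2)]] unfolding \<pi>_def by (auto split: if_splits)
    moreover have "v (mir r l) = mir r (v l)" using WB_mir[OF v(1)] rng[OF kl(2)] by blast
    ultimately have "k = l \<or> k = mir r l" using WB_eq_iff[OF v(1)] by metis
    then show "k = l" using kl rng[OF kl(2)] by auto
  qed
  have bij: "bij_betw \<pi> P P"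
    unfolding bij_betw_def using inj \<pi>P fin endo_inj_surj[OF fin _ inj] by auto
  have eq: "(if (w o v) k \<le> r then - 1 else 1 :: int) = (if w (\<pi> k) \<le> r then - 1 else 1) * (if v k \<le> r then - 1 else 1)"
    if k: "k \<in> P" for k
  proof (cases "r < v k")
    case False
    have vk: "1 \<le> v k \<and> v k \<le> 2*r" using k v(2) rng by (auto simp: P_def)
    have "w (\<pi> k) = mir r (w (v k))" using False WB_mir[OF w, of "v k"] vk by (simp add: \<pi>_def)
    then show ?thesis using False WB_range[OF w, of "v k"] vk by auto
  qed (simp add: \<pi>_def)
  have "sgnS S (w o v) = (\<Prod>k\<in>P. (if w (\<pi> k) \<le> r then - 1 else 1) * (if v k \<le> r then - 1 else 1))"
    unfolding sgnS_def P_def[symmetric] by (rule prod.cong) (use eq in auto)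
  also have "\<dots> = (\<Prod>k\<in>P. if w (\<pi> k) \<le> r then - 1 else 1) * sgnS S v"
    unfolding sgnS_def P_def[symmetric] by (rule prod.distrib)
  also have "(\<Prod>k\<in>P. if w (\<pi> k) \<le> r then - 1 else (1::int)) = sgnS S w"
    unfolding sgnS_def P_def[symmetric] using prod.reindex_bij_betw[OF bij, of "\<lambda>k. if w k \<le> r then - 1 else 1"] .
  finally show ?thesis .
qed

lemma sgnS_card: assumes "finite S" shows "sgnS S w = (- 1) ^ card {k \<in> S. r < k \<and> w k \<le> r}"
proof -
  have f: "finite {k \<in> S. r < k}" using assms by simp
  have "sgnS S w = (\<Prod>k\<in>{k \<in> S. r < k} \<inter> {k. w k \<le> r}. - 1) * (\<Prod>k\<in>{k \<in> S. r < k} \<inter> - {k. w k \<le> r}. 1)"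
    unfolding sgnS_def using prod.If_cases[OF f, of "\<lambda>k. w k \<le> r" "\<lambda>_. - 1 :: int" "\<lambda>_. 1"] by simp
  also have "{k \<in> S. r < k} \<inter> {k. w k \<le> r} = {k \<in> S. r < k \<and> w k \<le> r}" by auto
  finally show ?thesis by simp
qed

lemma sgnS_cases: assumes "finite S" shows "sgnS S w = 1 \<or> sgnS S w = - 1"
  unfolding sgnS_card[OF assms] by (metis neg_one_even_power neg_one_odd_power)

lemma par_comp: "v \<in> W \<Longrightarrow> w \<in> W \<Longrightarrow> par (w o v) = par w * par v"
  unfolding par_def using WB_range[of v r] by (intro sgnS_comp) auto

lemma par_cases: "par w = 1 \<or> par w = - 1"
  unfolding par_def by (rule sgnS_cases) simp

lemma par_id [simp]: "par id = 1"
  unfolding par_def sgnS_def by (intro prod.neutral) auto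

lemma par_inv: "w \<in> W \<Longrightarrow> par (pinv w) = par w"
  using par_comp[of w "pinv w"] WB_inv[of w r] par_cases[of w] par_cases[of "pinv w"] by auto

lemma par_sB: assumes "1 \<le> k" "k \<le> r" shows "par (sB r k) = (if k = r then - 1 else 1)"
proof (cases "k = r")
  case True
  have "{l \<in> {1..2*r}. r < l \<and> sB r k l \<le> r} = {Suc r}" using assms True by (auto simp: sB_app split: if_splits)
  then show ?thesis using True by (simp add: par_def sgnS_card)
next
  case False
  have "{l \<in> {1..2*r}. r < l \<and> sB r k l \<le> r} = {}" using assms False by (auto simp: sB_app split: if_splits)
  then show ?thesis using False by (simp only: par_def sgnS_card finite_atLeastAtMost card.empty power_0 if_False)
qed

lemma par_sg [simp]: "par sg = - 1"
  using par_sB[of r] by simp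

lemma sg_W [simp]: "sg \<in> W"
  by simp

lemma sg_sg [simp]: "sg (sg k) = k" "sg o sg = id" "w o sg o sg = w" "sg o (sg o w) = w"
  using sB_sB_app[of r r k] sB_sB[of r r] sB_comp_cancel[of r r w] by auto

lemma weylD_par: "weylD r = {w \<in> W. par w = 1}"
proof -
  have "even (card {i \<in> {1..r}. w i > r}) \<longleftrightarrow> par w = 1" if w: "w \<in> W" for w
  proof -
    have "{i \<in> {1..r}. w i > r} = mir r ` {k \<in> {1..2*r}. r < k \<and> w k \<le> r}"
    proof (intro Set.set_eqI iffI)
      fix x assume x: "x \<in> {i \<in> {1..r}. w i > r}"
      then have "mir r x \<in> {k \<in> {1..2*r}. r < k \<and> w k \<le> r}" using WB_mir[OF w, of x] by auto
      moreover have "x = mir r (mir r x)" using x by auto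
      ultimately show "x \<in> mir r ` {k \<in> {1..2*r}. r < k \<and> w k \<le> r}" by blast
    next
      fix x assume "x \<in> mir r ` {k \<in> {1..2*r}. r < k \<and> w k \<le> r}"
      then show "x \<in> {i \<in> {1..r}. w i > r}" using WB_mir[OF w] by auto
    qed
    moreover have "inj_on (mir r) {k \<in> {1..2*r}. r < k \<and> w k \<le> r}" by (rule inj_onI) auto
    ultimately have "card {i \<in> {1..r}. w i > r} = card {k \<in> {1..2*r}. r < k \<and> w k \<le> r}" by (simp add: card_image)
    then show ?thesis unfolding par_def sgnS_card[OF finite_atLeastAtMost] by (auto simp: minus_one_power_iff)
  qed
  then show ?thesis by (auto simp: weylD_def)
qed

text \<open>The parabolic subgroup of type D attached to \<open>lam\<close>, up to conjugation by
  \<open>s\<^sub>r\<close>.\<close>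

definition HP :: "weight \<Rightarrow> (nat \<Rightarrow> nat) set" where
  "HP lam = {w \<in> PB lam. par w = 1}"

lemma HP_PB: "w \<in> HP lam \<Longrightarrow> w \<in> PB lam" and HP_W: "w \<in> HP lam \<Longrightarrow> w \<in> W" and HP_par: "w \<in> HP lam \<Longrightarrow> par w = 1"
  by (auto simp: HP_def PB_W)

lemma HP_Wpar: "lam \<in> Lam n r \<Longrightarrow> Wpar n r lam \<inter> weylD r = HP lam"
  by (auto simp: Wpar_PB weylD_par HP_def PB_W)

lemma HP_id [simp]: "id \<in> HP lam"
  by (simp add: HP_def)

lemma HP_comp: "v \<in> HP lam \<Longrightarrow> w \<in> HP lam \<Longrightarrow> v o w \<in> HP lam"
  using PB_comp par_comp PB_W by (auto simp: HP_def)

lemma HP_inv: "w \<in> HP lam \<Longrightarrow> pinv w \<in> HP lam"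
  using PB_inv par_inv PB_W by (auto simp: HP_def)

lemma sg_PB: "lam \<in> Lam n r \<Longrightarrow> r \<in> Jset lam \<Longrightarrow> sg \<in> PB lam"
  by (rule Jset_PB)

lemma HP_conj: assumes "lam \<in> Lam n r" "r \<in> Jset lam" "w \<in> HP lam" shows "cj w \<in> HP lam"
proof -
  have "cj w \<in> PB lam" using PB_comp sg_PB assms HP_PB by blast
  moreover have "par (cj w) = 1"
    using par_comp[of sg "sg o w"] par_comp[of w sg] HP_W[OF assms(3)] HP_par[OF assms(3)] WB_comp[of sg r w] by simp
  ultimately show ?thesis by (simp add: HP_def)
qed

text \<open>A block other than the central one lies on one side of the middle.\<close>

lemma noncen_le_iff:
  assumes "lam \<in> Lam n r" "w \<in> PB lam" "1 \<le> k" "k \<le> 2*r" "k \<notin> cen lam"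
  shows "w k \<le> r \<longleftrightarrow> k \<le> r"
proof -
  have b: "blk n lam (w k) = blk n lam k" using PB_blk assms by blast
  have rg: "1 \<le> w k" "w k \<le> 2*r" using WB_range[OF PB_W[OF assms(2)]] assms by auto
  have "blk n lam k \<noteq> n + 1" using assms by (auto simp: cen_def)
  then consider "blk n lam k \<le> n" | "n + 2 \<le> blk n lam k" by linarith
  then show ?thesis
  proof cases
    case 1
    then show ?thesis using blk_low[OF assms(1,3,4)] blk_low[OF assms(1) rg] b by auto
  next
    case 2
    then show ?thesis using blk_high[OF assms(1,3,4)] blk_high[OF assms(1) rg] b by auto
  qed
qed

lemma cen_empty_iff: "lam \<in> Lam n r \<Longrightarrow> cen lam = {} \<longleftrightarrow> r \<notin> Jset lam"
  using cen_r_iff[of lam] by blast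

text \<open>Without a central block no position can change sides.\<close>

lemma PB_noncentral: assumes "lam \<in> Lam n r" "r \<notin> Jset lam" shows "PB lam = HP lam"
proof -
  have "par w = 1" if w: "w \<in> PB lam" for w
    unfolding par_def sgnS_def
  proof (rule prod.neutral, intro ballI)
    fix k assume "k \<in> {k \<in> {1..2*r}. r < k}"
    then show "(if w k \<le> r then - 1 else 1 :: int) = 1"
      using noncen_le_iff[OF assms(1) w, of k] cen_empty_iff[OF assms(1)] assms(2) by auto
  qed
  then show ?thesis by (auto simp: HP_def)
qed

lemma PB_central:
  assumes "lam \<in> Lam n r" "r \<in> Jset lam"
  shows "w \<in> PB lam \<longleftrightarrow> w \<in> HP lam \<or> sg o w \<in> HP lam" "w \<in> PB lam \<longleftrightarrow> w \<in> HP lam \<or> w o sg \<in> HP lam"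
proof -
  have s: "sg \<in> PB lam" using sg_PB assms by blast
  have 1: "sg o w \<in> PB lam \<longleftrightarrow> w \<in> PB lam" for w using PB_comp[OF s, of w] PB_comp[OF s, of "sg o w"] by auto
  have 2: "w o sg \<in> PB lam \<longleftrightarrow> w \<in> PB lam" for w using PB_comp[OF _ s, of w] PB_comp[OF _ s, of "w o sg"] by auto
  have p: "par (sg o w) = - par w" "par (w o sg) = - par w" if "w \<in> W" for w using par_comp that by auto
  show "w \<in> PB lam \<longleftrightarrow> w \<in> HP lam \<or> sg o w \<in> HP lam"
    unfolding HP_def using 1[of w] p[of w] par_cases[of w] PB_W by auto
  show "w \<in> PB lam \<longleftrightarrow> w \<in> HP lam \<or> w o sg \<in> HP lam"
    unfolding HP_def using 2[of w] p[of w] par_cases[of w] PB_W by auto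
qed

section \<open>Factorizations in the Hecke algebra\<close>

lemma Tr_closed [simp]: "Tr \<in> carrier H"
  by simp

lemma cf_Tr_left: "x \<in> carrier H \<Longrightarrow> w \<in> W \<Longrightarrow> cf (Tr ** x) w = cf x (sg o w)"
  by (subst cf_Tgen_mult) auto

lemma cf_Tr_right: "x \<in> carrier H \<Longrightarrow> w \<in> W \<Longrightarrow> cf (x ** Tr) w = cf x (w o sg)"
  by (subst cf_mult_Tgen) (auto simp: rstep_def)

lemma Tr_Tw: assumes "w \<in> W" shows "Tr ** Tw r w = Tw r (sg o w)" "Tw r w ** Tr = Tw r (w o sg)"
proof -
  have W: "sg o w \<in> W" "w o sg \<in> W" using assms WB_comp by auto
  have e: "sg o v = w \<longleftrightarrow> v = sg o w" "v o sg = w \<longleftrightarrow> v = w o sg" for v using sg_sg(3,4) by metis+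
  show "Tr ** Tw r w = Tw r (sg o w)"
    using assms W WB_comp[OF sg_W] by (intro cf_eqI) (simp_all add: cf_Tr_left cf_Tw e)
  show "Tw r w ** Tr = Tw r (w o sg)"
    using assms W WB_comp[OF _ sg_W] by (intro cf_eqI) (simp_all add: cf_Tr_right cf_Tw e)
qed

text \<open>If \<open>W\<close> is a product \<open>U V\<close> with additive multiplication of the
  \<open>T\<^sub>w\<close>, an element with coefficients constant on the cosets \<open>u V\<close> is a
  multiple of the sum over \<open>V\<close>.\<close>

lemma factor_gen:
  assumes UV: "U \<subseteq> W" "V \<subseteq> W" and mult: "\<And>u v. u \<in> U \<Longrightarrow> v \<in> V \<Longrightarrow> Tw r u ** Tw r v = Tw r (u o v)"
    and bij: "bij_betw (\<lambda>(u, v). u o v) (U \<times> V) W"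
    and x: "x \<in> carrier H" and inv: "\<And>u v. u \<in> U \<Longrightarrow> v \<in> V \<Longrightarrow> cf x (u o v) = cf x u"
  shows "x = mk (\<lambda>u. if u \<in> U then cf x u else 0) ** Tsum r V"
proof (rule cf_eqI)
  fix w assume w: "w \<in> W"
  have uvW: "u o v \<in> W" if "u \<in> U" "v \<in> V" for u v using that UV WB_comp by blast
  have "cf (mk (\<lambda>u. if u \<in> U then cf x u else 0) ** Tsum r V) w
      = (\<Sum>u\<in>W. \<Sum>v\<in>W. (if u \<in> U then cf x u else 0) * (if v \<in> V then 1 else 0) * cf (Tw r u ** Tw r v) w)"
    using UV by (subst cf_mult) (auto simp: cf_mk cf_Tsum intro!: sum.cong)
  also have "\<dots> = (\<Sum>u\<in>U. \<Sum>v\<in>W. cf x u * (if v \<in> V then 1 else 0) * cf (Tw r u ** Tw r v) w)"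
    using UV by (intro sum.mono_neutral_cong_right) auto
  also have "\<dots> = (\<Sum>u\<in>U. \<Sum>v\<in>V. cf x u * cf (Tw r u ** Tw r v) w)"
    using UV by (intro sum.cong refl sum.mono_neutral_cong_right) auto
  also have "\<dots> = (\<Sum>u\<in>U. \<Sum>v\<in>V. (\<lambda>y. if y = w then cf x y else 0) (u o v))"
    by (intro sum.cong refl) (auto simp: mult cf_Tw[OF uvW w] inv)
  also have "\<dots> = (\<Sum>p\<in>U \<times> V. (\<lambda>y. if y = w then cf x y else 0) ((\<lambda>(u, v). u o v) p))"
    unfolding sum.cartesian_product by (rule sum.cong) auto
  also have "\<dots> = (\<Sum>y\<in>W. if y = w then cf x y else 0)"
    by (rule sum.reindex_bij_betw[OF bij])
  finally show "cf x w = cf (mk (\<lambda>u. if u \<in> U then cf x u else 0) ** Tsum r V) w" using w by simp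
qed (use x UV in auto)

lemma PB_bij: assumes lam: "lam \<in> Lam n r" shows "bij_betw (\<lambda>(u, v). u o v) (Inc lam \<times> PB lam) W"
proof (rule bij_betwI')
  fix p q assume p: "p \<in> Inc lam \<times> PB lam" and q: "q \<in> Inc lam \<times> PB lam"
  obtain u v where uv: "p = (u, v)" "u \<in> Inc lam" "v \<in> PB lam" using p by auto
  obtain u' v' where uv': "q = (u', v')" "u' \<in> Inc lam" "v' \<in> PB lam" using q by auto
  have "u = u' \<and> v = v'" if e: "u o v = u' o v'"
  proof -
    have vW: "v \<in> W" "v' \<in> W" using uv uv' PB_W by auto
    have u': "u' = u o (v o pinv v')"
    proof -
      have "u' = u' o (v' o pinv v')" using vW by simp
      also have "\<dots> = (u o v) o pinv v'" using e by (simp only: o_assoc)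
      finally show ?thesis by (simp only: o_assoc)
    qed
    have "v o pinv v' = id" using Inc_unique[OF lam uv(2)] u' uv' uv PB_comp[OF uv(3) PB_inv[OF uv'(3)]] by simp
    then have "u' = u" using u' by simp
    moreover have "v = (v o pinv v') o v'" using vW by (simp add: o_assoc[symmetric])
    ultimately show ?thesis using \<open>v o pinv v' = id\<close> by simp
  qed
  then show "((\<lambda>(u, v). u o v) p = (\<lambda>(u, v). u o v) q) = (p = q)" by (auto simp: uv uv')
next
  fix p assume "p \<in> Inc lam \<times> PB lam"
  then show "(\<lambda>(u, v). u o v) p \<in> W" using Inc_W PB_W WB_comp by auto
next
  fix w assume "w \<in> W"
  then obtain u v where "u \<in> Inc lam" "v \<in> PB lam" "w = u o v" using Inc_exists[OF lam] by blast
  then show "\<exists>p\<in>Inc lam \<times> PB lam. w = (\<lambda>(u, v). u o v) p" by (intro bexI[of _ "(u, v)"]) auto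
qed

text \<open>Representatives for the cosets of \<open>HP lam\<close>.\<close>

definition hInc :: "weight \<Rightarrow> (nat \<Rightarrow> nat) set" where
  "hInc lam = {u \<in> W. u \<in> Inc lam \<or> (r \<in> Jset lam \<and> u o sg \<in> Inc lam)}"

text \<open>Multiplication by \<open>T\<^sub>r\<close> is translation by \<open>s\<^sub>r\<close> on the basis, so one
  extra factor \<open>s\<^sub>r\<close> does not disturb the product.\<close>

lemma hInc_mult:
  assumes lam: "lam \<in> Lam n r" and u: "u \<in> hInc lam" and v: "v \<in> PB lam"
  shows "Tw r u ** Tw r v = Tw r (u o v)"
proof (cases "u \<in> Inc lam")
  case True
  then show ?thesis using Tw_mult_Inc lam v by blast
next
  case False
  then have us: "r \<in> Jset lam" "u o sg \<in> Inc lam" "u \<in> W" using u by (auto simp: hInc_def)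
  have W: "u o sg \<in> W" "v \<in> W" using us Inc_W PB_W v by auto
  have sv: "sg o v \<in> PB lam" using PB_comp sg_PB us lam v by blast
  have "Tw r u = Tw r (u o sg) ** Tr" using Tr_Tw(2)[OF W(1)] by simp
  then have "Tw r u ** Tw r v = Tw r (u o sg) ** Tw r (sg o v)"
    using W Tr_Tw(1)[OF W(2)] by (simp add: H.m_assoc)
  also have "\<dots> = Tw r ((u o sg) o (sg o v))" using Tw_mult_Inc[OF lam us(2) sv] .
  also have "(u o sg) o (sg o v) = u o v" by (simp add: fun_eq_iff)
  finally show ?thesis .
qed

text \<open>The even part of a parabolic subgroup with a central block has index two, and \<open>s\<^sub>r\<close>
  represents the other coset.\<close>

lemma hInc_bij: assumes lam: "lam \<in> Lam n r" shows "bij_betw (\<lambda>(u, v). u o v) (hInc lam \<times> HP lam) W"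
proof (cases "r \<in> Jset lam")
  case False
  then have "hInc lam = Inc lam" using Inc_W by (auto simp: hInc_def)
  then show ?thesis using PB_bij[OF lam] PB_noncentral[OF lam False] by simp
next
  case True
  have uniq: "u = u' \<and> v = v'" if "u \<in> Inc lam" "v \<in> PB lam" "u' \<in> Inc lam" "v' \<in> PB lam" "u o v = u' o v'" for u v u' v'
    using PB_bij[OF lam] that by (auto simp: bij_betw_def inj_on_def)
  have norm: "\<exists>u0 v0 s. u0 \<in> Inc lam \<and> v0 \<in> PB lam \<and> s \<in> {id, sg} \<and> u = u0 o s \<and> v0 = s o v \<and> par v0 = par s"
    if "u \<in> hInc lam" "v \<in> HP lam" for u v
  proof (cases "u \<in> Inc lam")
    case T: True
    then show ?thesis using that HP_PB HP_par by (intro exI[of _ u] exI[of _ v] exI[of _ id]) auto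
  next
    case F: False
    then have "u o sg \<in> Inc lam" using that by (auto simp: hInc_def)
    moreover have "sg o v \<in> PB lam" using PB_comp sg_PB lam True HP_PB that by blast
    moreover have "par (sg o v) = par sg" using par_comp[OF HP_W[OF that(2)] sg_W] HP_par that by simp
    ultimately show ?thesis by (intro exI[of _ "u o sg"] exI[of _ "sg o v"] exI[of _ sg]) auto
  qed
  show ?thesis
  proof (rule bij_betwI')
    fix p q assume p: "p \<in> hInc lam \<times> HP lam" and q: "q \<in> hInc lam \<times> HP lam"
    obtain u v where uv: "p = (u, v)" "u \<in> hInc lam" "v \<in> HP lam" using p by auto
    obtain u' v' where uv': "q = (u', v')" "u' \<in> hInc lam" "v' \<in> HP lam" using q by auto
    have "u = u' \<and> v = v'" if e: "u o v = u' o v'"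
    proof -
      obtain u0 v0 s where 0: "u0 \<in> Inc lam" "v0 \<in> PB lam" "s \<in> {id, sg}" "u = u0 o s" "v0 = s o v" "par v0 = par s" using norm uv by blast
      obtain u1 v1 s' where 1: "u1 \<in> Inc lam" "v1 \<in> PB lam" "s' \<in> {id, sg}" "u' = u1 o s'" "v1 = s' o v'" "par v1 = par s'" using norm uv' by blast
      have "u0 o v0 = u1 o v1" unfolding 0(5) 1(5) using e 0(4) 1(4) by (simp add: o_assoc)
      then have *: "u0 = u1" "v0 = v1" using uniq 0 1 by blast+
      then have "par s = par s'" using 0 1 by simp
      then have ss: "s = s'" using 0(3) 1(3) par_sg par_id by auto
      have "s o s = id" using 0(3) by auto
      then have vv: "v = s o v0" "v' = s' o v1" unfolding 0(5) 1(5) using ss by (simp_all add: o_assoc)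
      have "v = v'" unfolding vv ss *(2) ..
      moreover have "u = u'" unfolding 0(4) 1(4) *(1) ss ..
      ultimately show ?thesis by simp
    qed
    then show "((\<lambda>(u, v). u o v) p = (\<lambda>(u, v). u o v) q) = (p = q)" by (auto simp: uv uv')
  next
    fix p assume "p \<in> hInc lam \<times> HP lam"
    then show "(\<lambda>(u, v). u o v) p \<in> W" using HP_W WB_comp by (auto simp: hInc_def)
  next
    fix w assume "w \<in> W"
    then obtain u v where uv: "u \<in> Inc lam" "v \<in> PB lam" "w = u o v" using Inc_exists[OF lam] by blast
    show "\<exists>p\<in>hInc lam \<times> HP lam. w = (\<lambda>(u, v). u o v) p"
    proof (cases "v \<in> HP lam")
      case T: True
      then show ?thesis using uv Inc_W by (intro bexI[of _ "(u, v)"]) (auto simp: hInc_def)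
    next
      case F: False
      then have "sg o v \<in> HP lam" using PB_central(1)[OF lam True] uv by blast
      moreover have "u o sg \<in> hInc lam" using uv Inc_W WB_comp True by (auto simp: hInc_def)
      moreover have "w = (u o sg) o (sg o v)" using uv(3) by (simp add: fun_eq_iff)
      ultimately show ?thesis by (intro bexI[of _ "(u o sg, sg o v)"]) auto
    qed
  qed
qed

lemma HP_subset: "HP lam \<subseteq> W" "PB lam \<subseteq> W" "hInc lam \<subseteq> W" "Inc lam \<subseteq> W"
  by (auto simp: HP_W PB_W hInc_def Inc_W)

lemma factor_right:
  assumes lam: "lam \<in> Lam n r" and x: "x \<in> carrier H" and inv: "\<And>u v. u \<in> W \<Longrightarrow> v \<in> HP lam \<Longrightarrow> cf x (u o v) = cf x u"
  shows "\<exists>z\<in>carrier H. x = z ** Tsum r (HP lam) \<and> (\<forall>w. cf z w = (if w \<in> hInc lam then cf x w else 0))"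
proof -
  let ?z = "mk (\<lambda>u. if u \<in> hInc lam then cf x u else 0)"
  have "x = ?z ** Tsum r (HP lam)"
    by (rule factor_gen[OF HP_subset(3,1) hInc_mult[OF lam _ HP_PB] hInc_bij[OF lam] x])
      (auto intro: inv subsetD[OF HP_subset(3)])
  moreover have "\<forall>w. cf ?z w = (if w \<in> hInc lam then cf x w else 0)" using cf_outside by (auto simp: cf_mk)
  ultimately show ?thesis using mk_closed by blast
qed

lemma factor_right_full:
  assumes lam: "lam \<in> Lam n r" and x: "x \<in> carrier H" and inv: "\<And>u v. u \<in> W \<Longrightarrow> v \<in> PB lam \<Longrightarrow> cf x (u o v) = cf x u"
  shows "\<exists>z\<in>carrier H. x = z ** Tsum r (PB lam)"
proof -
  let ?z = "mk (\<lambda>u. if u \<in> Inc lam then cf x u else 0)"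
  have "x = ?z ** Tsum r (PB lam)"
    by (rule factor_gen[OF HP_subset(4,2) Tw_mult_Inc[OF lam] PB_bij[OF lam] x])
      (auto intro: inv subsetD[OF HP_subset(4)])
  then show ?thesis using mk_closed by blast
qed

subsection \<open>The anti-automorphism inverting the basis\<close>

definition sta :: "hecke \<Rightarrow> hecke" where "sta x = mk (\<lambda>w. cf x (pinv w))"

lemma sta_closed [simp]: "sta x \<in> carrier H"
  by (simp add: sta_def)

lemma cf_sta: "w \<in> W \<Longrightarrow> cf (sta x) w = cf x (pinv w)"
  by (simp add: sta_def cf_mk)

lemma sta_sta: "x \<in> carrier H \<Longrightarrow> sta (sta x) = x"
  by (rule cf_eqI) (auto simp: cf_sta WB_inv WB_inv_inv)

lemma sta_Tgen_mult:
  assumes x: "x \<in> carrier H" and k: "1 \<le> k" "k \<le> r" shows "sta (Tgen r k ** x) = sta x ** Tgen r k"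
proof (rule cf_eqI)
  fix w assume w: "w \<in> W"
  have e: "pinv (w o sB r k) = sB r k o pinv w" using WB_comp_inv[OF w, of "sB r k"] k by simp
  have W: "w o sB r k \<in> W" "pinv w \<in> W" using WB_comp w k WB_inv by auto
  show "cf (sta (Tgen r k ** x)) w = cf (sta x ** Tgen r k) w"
    using x k w W by (simp add: cf_sta cf_Tgen_mult cf_mult_Tgen rstep_def e WB_inv_inv)
qed (use x k in auto)

lemma sta_Tw_mult:
  assumes "x \<in> carrier H" "u \<in> W" shows "sta (Tw r u ** x) = sta x ** Tw r (pinv u)"
  using assms(2)
proof (induction "lenB r u" arbitrary: u rule: less_induct)
  case less
  show ?case
  proof (cases "u = id")
    case True
    have e: "Tw r u = \<^bold>1" "Tw r (pinv u) = \<^bold>1" unfolding True inv_id by (rule Tw_id)+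
    show ?thesis unfolding e using assms by simp
  next
    case False
    then have "pinv u \<noteq> id" using WB_inv_inv[OF less.prems] by (metis inv_id)
    then obtain k where k: "1 \<le> k" "k \<le> r" "pinv u (Suc k) < pinv u k" using exists_descent WB_inv[OF less.prems] by blast
    define v where "v = sB r k o u"
    have v: "v \<in> W" using WB_comp less.prems k by (simp add: v_def)
    have uv: "u = sB r k o v" using k by (simp add: v_def)
    have pv: "pinv v = pinv u o sB r k" unfolding v_def using inv_left_mult less.prems k by blast
    have pu: "pinv u = pinv v o sB r k" using k by (simp add: pv)
    have asc: "pinv v k < pinv v (Suc k)" using k by (simp add: pv)
    have len: "lenB r v < lenB r u" using lenB_left_desc[OF less.prems k] by (simp add: v_def)
    have "Tw r u = Tgen r k ** Tw r v" using Tgen_Tw[OF v k(1,2) asc] uv by simp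
    then have "sta (Tw r u ** x) = sta (Tgen r k ** (Tw r v ** x))" using v k assms by (simp add: H.m_assoc)
    also have "\<dots> = (sta x ** Tw r (pinv v)) ** Tgen r k" using less.hyps[OF len v] v k assms by (simp add: sta_Tgen_mult)
    also have "\<dots> = sta x ** Tw r (pinv u)"
      using Tw_Tgen[OF WB_inv[OF v] k(1,2) asc] v k WB_inv[OF v] by (simp add: H.m_assoc pu)
    finally show ?thesis .
  qed
qed

lemma sta_Tw: "w \<in> W \<Longrightarrow> sta (Tw r w) = Tw r (pinv w)"
proof (rule cf_eqI)
  assume w: "w \<in> W"
  fix v assume v: "v \<in> W"
  have "pinv v = w \<longleftrightarrow> v = pinv w" using WB_inv_inv v w by metis
  then show "cf (sta (Tw r w)) v = cf (Tw r (pinv w)) v" using w v by (simp add: cf_sta cf_Tw WB_inv)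
qed (auto simp: WB_inv)

lemma bij_pinv: "bij_betw pinv W W"
  by (rule bij_betwI[of _ _ _ pinv]) (auto simp: WB_inv WB_inv_inv)

text \<open>The anti-automorphism carries statements about left multiplication to right multiplication.\<close>

lemma sta_mult:
  assumes x: "x \<in> carrier H" and y: "y \<in> carrier H" shows "sta (x ** y) = sta y ** sta x"
proof (rule cf_eqI)
  fix w assume w: "w \<in> W"
  have s: "cf (Tw r u ** Tw r v) (pinv w) = cf (Tw r (pinv v) ** Tw r (pinv u)) w" if "u \<in> W" "v \<in> W" for u v
    using sta_Tw_mult[OF Tw_closed[OF that(2)] that(1)] sta_Tw[OF that(2)] cf_sta[OF w] by metis
  have "cf (sta (x ** y)) w = (\<Sum>u\<in>W. \<Sum>v\<in>W. cf x u * cf y v * cf (Tw r (pinv v) ** Tw r (pinv u)) w)"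
    unfolding cf_sta[OF w] cf_mult[OF x y] by (intro sum.cong refl) (simp add: s)
  also have "\<dots> = (\<Sum>v\<in>W. \<Sum>u\<in>W. cf x u * cf y v * cf (Tw r (pinv v) ** Tw r (pinv u)) w)" by (rule sum.swap)
  also have "\<dots> = (\<Sum>v\<in>W. \<Sum>u\<in>W. cf y v * cf x u * cf (Tw r (pinv v) ** Tw r (pinv u)) w)" by (simp add: mult.commute)
  also have "\<dots> = (\<Sum>v\<in>W. (\<lambda>v. \<Sum>u\<in>W. cf y (pinv v) * cf x (pinv u) * cf (Tw r v ** Tw r u) w) (pinv v))"
  proof (rule sum.cong[OF refl])
    fix v assume v: "v \<in> W"
    have "(\<Sum>u\<in>W. cf y v * cf x u * cf (Tw r (pinv v) ** Tw r (pinv u)) w)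
        = (\<Sum>u\<in>W. (\<lambda>u. cf y v * cf x (pinv u) * cf (Tw r (pinv v) ** Tw r u) w) (pinv u))"
      by (intro sum.cong refl) (simp add: WB_inv_inv)
    also have "\<dots> = (\<Sum>u\<in>W. cf y v * cf x (pinv u) * cf (Tw r (pinv v) ** Tw r u) w)"
      by (rule sum.reindex_bij_betw[OF bij_pinv])
    finally show "(\<Sum>u\<in>W. cf y v * cf x u * cf (Tw r (pinv v) ** Tw r (pinv u)) w)
        = (\<lambda>v. \<Sum>u\<in>W. cf y (pinv v) * cf x (pinv u) * cf (Tw r v ** Tw r u) w) (pinv v)"
      using v by (simp add: WB_inv_inv)
  qed
  also have "\<dots> = (\<Sum>v\<in>W. \<Sum>u\<in>W. cf y (pinv v) * cf x (pinv u) * cf (Tw r v ** Tw r u) w)"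
    by (rule sum.reindex_bij_betw[OF bij_pinv])
  also have "\<dots> = cf (sta y ** sta x) w" by (subst cf_mult) (auto simp: cf_sta intro!: sum.cong)
  finally show "cf (sta (x ** y)) w = cf (sta y ** sta x) w" .
qed (use x y in auto)

lemma sta_Tsum:
  assumes "V \<subseteq> W" "\<And>v. v \<in> V \<Longrightarrow> pinv v \<in> V" shows "sta (Tsum r V) = Tsum r V"
proof (rule cf_eqI)
  fix w assume w: "w \<in> W"
  have "pinv w \<in> V \<longleftrightarrow> w \<in> V" using assms(2) WB_inv_inv[OF w] by metis
  then show "cf (sta (Tsum r V)) w = cf (Tsum r V) w" using w assms by (simp add: cf_sta cf_Tsum)
qed (use assms in auto)

lemma factor_left:
  assumes lam: "lam \<in> Lam n r" and x: "x \<in> carrier H" and inv: "\<And>u v. u \<in> W \<Longrightarrow> v \<in> HP lam \<Longrightarrow> cf x (v o u) = cf x u"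
  shows "\<exists>z\<in>carrier H. x = Tsum r (HP lam) ** z \<and> (\<forall>w. cf z w \<noteq> 0 \<longrightarrow> cf x w \<noteq> 0)"
proof -
  have "cf (sta x) (u o v) = cf (sta x) u" if "u \<in> W" "v \<in> HP lam" for u v
    using that inv[of "pinv u" "pinv v"] HP_W HP_inv WB_inv WB_comp by (simp add: cf_sta WB_comp_inv[of _ r])
  then obtain z where z: "z \<in> carrier H" "sta x = z ** Tsum r (HP lam)" "\<forall>w. cf z w = (if w \<in> hInc lam then cf (sta x) w else 0)"
    using factor_right[OF lam sta_closed, of x] by blast
  have "x = sta (z ** Tsum r (HP lam))" using z(2) sta_sta[OF x] by simp
  also have "\<dots> = Tsum r (HP lam) ** sta z"
    using z(1) HP_subset HP_inv by (simp add: sta_mult sta_Tsum)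
  finally have xx: "x = Tsum r (HP lam) ** sta z" .
  have "cf x w \<noteq> 0" if "cf (sta z) w \<noteq> 0" for w
  proof -
    have w: "w \<in> W" using that cf_outside by blast
    then have "cf (sta x) (pinv w) \<noteq> 0" using that z(3) by (auto simp: cf_sta split: if_splits)
    then show ?thesis using w by (simp add: cf_sta WB_inv WB_inv_inv)
  qed
  then show ?thesis using xx sta_closed by blast
qed

lemma factor_left_full:
  assumes lam: "lam \<in> Lam n r" and x: "x \<in> carrier H" and inv: "\<And>u v. u \<in> W \<Longrightarrow> v \<in> PB lam \<Longrightarrow> cf x (v o u) = cf x u"
  shows "\<exists>z\<in>carrier H. x = Tsum r (PB lam) ** z"
proof -
  have "cf (sta x) (u o v) = cf (sta x) u" if "u \<in> W" "v \<in> PB lam" for u v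
    using that inv[of "pinv u" "pinv v"] PB_W PB_inv WB_inv WB_comp by (simp add: cf_sta WB_comp_inv[of _ r])
  then obtain z where z: "z \<in> carrier H" "sta x = z ** Tsum r (PB lam)"
    using factor_right_full[OF lam sta_closed, of x] by blast
  have "x = sta (z ** Tsum r (PB lam))" using z(2) sta_sta[OF x] by simp
  also have "\<dots> = Tsum r (PB lam) ** sta z"
    using z(1) HP_subset PB_inv by (simp add: sta_mult sta_Tsum)
  finally show ?thesis using sta_closed by blast
qed

subsection \<open>Invariance of coefficients\<close>

text \<open>Comparing coefficients in \<open>T\<^sub>k x = q x\<close> at \<open>w\<close> and \<open>s\<^sub>k
  w\<close>: the factor \<open>q\<close> cancels.\<close>

lemma left_inv_step:
  assumes x: "x \<in> carrier H" and k: "1 \<le> k" "k < r" and q: "Tgen r k ** x = scal r qq ** x" and w: "w \<in> W"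
  shows "cf x (sB r k o w) = cf x w"
proof -
  have W: "sB r k o w \<in> W" using w k WB_comp by auto
  have *: "cf x (sB r k o w) = cf x w" if w: "w \<in> W" and d: "pinv w (Suc k) < pinv w k" for w
  proof -
    have "cf (Tgen r k ** x) w = cf x (sB r k o w) + (qq - 1) * cf x w"
      using cf_Tgen_mult[OF x, of k w] k w d by (simp add: qpar_def)
    moreover have "cf (Tgen r k ** x) w = qq * cf x w" using q cf_scal x by simp
    ultimately show ?thesis by (simp add: algebra_simps)
  qed
  show ?thesis
  proof (cases "pinv w (Suc k) < pinv w k")
    case False
    then have "pinv w k < pinv w (Suc k)" using WB_Suc_neq[OF WB_inv[OF w], of k] by linarith
    then have "pinv (sB r k o w) (Suc k) < pinv (sB r k o w) k" using inv_left_mult[OF w] k by simp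
    then show ?thesis using *[OF W] k by simp
  qed (use * w in blast)
qed

lemma Tgen_xhat:
  assumes lam: "lam \<in> Lam n r" and k: "k \<in> Jset lam" "k < r"
  shows "Tgen r k ** Tsum r (HP lam) = scal r qq ** Tsum r (HP lam)"
proof (rule cf_eqI)
  fix w assume w: "w \<in> W"
  have kr: "1 \<le> k" "k \<le> r" using k by (auto simp: Jset_def)
  have s: "sB r k \<in> HP lam" using Jset_PB[OF lam k(1)] par_sB[OF kr] k by (simp add: HP_def)
  have "sB r k o w \<in> HP lam \<longleftrightarrow> w \<in> HP lam" using HP_comp[OF s, of w] HP_comp[OF s, of "sB r k o w"] kr by auto
  then show "cf (Tgen r k ** Tsum r (HP lam)) w = cf (scal r qq ** Tsum r (HP lam)) w"
    using k kr w HP_subset by (auto simp: cf_Tgen_mult cf_scal cf_Tsum qpar_def)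
qed (use k HP_subset in \<open>auto simp: Jset_def\<close>)

text \<open>The even part of the parabolic subgroup is stable under conjugation by \<open>s\<^sub>r\<close>.\<close>

lemma Tr_xhat:
  assumes lam: "lam \<in> Lam n r" and k: "r \<in> Jset lam"
  shows "Tr ** Tsum r (HP lam) = Tsum r (HP lam) ** Tr"
proof (rule cf_eqI)
  fix w assume w: "w \<in> W"
  have "sg o w \<in> HP lam \<longleftrightarrow> w o sg \<in> HP lam"
    using HP_conj[OF lam k, of "sg o w"] HP_conj[OF lam k, of "w o sg"] by (auto simp: o_assoc)
  then show "cf (Tr ** Tsum r (HP lam)) w = cf (Tsum r (HP lam) ** Tr) w"
    using w HP_subset by (simp add: cf_Tr_left cf_Tr_right cf_Tsum)
qed (use HP_subset in auto)

text \<open>Moving the letters \<open>s\<^sub>r\<close> of a word to the end, each passage replaces \<open>g\<close> by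
  its translate under \<open>s\<^sub>r\<close>; their number has the parity of the element.\<close>

lemma word_invariance:
  assumes ws: "ws \<in> lists (Jset lam)"
    and g: "\<And>k w. k \<in> Jset lam \<Longrightarrow> k < r \<Longrightarrow> w \<in> W \<Longrightarrow> g (sB r k o w) = g w"
    and g': "\<And>k w. k \<in> Jset lam \<Longrightarrow> k < r \<Longrightarrow> r \<in> Jset lam \<Longrightarrow> w \<in> W \<Longrightarrow> g (sg o (sB r k o w)) = g (sg o w)"
    and w: "w \<in> W"
  shows "g (word_prod (sB r) ws o w) = (if par (word_prod (sB r) ws) = 1 then g w else g (sg o w))"
  using ws g g'
proof (induction ws arbitrary: g)
  case Nil
  show ?case unfolding word_prod_simps id_o par_id by simp
next
  case (Cons k ws)
  have k: "k \<in> Jset lam" "1 \<le> k" "k \<le> r" using Cons.hyps Jset_range by auto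
  have wsW: "word_prod (sB r) ws \<in> W" using Cons.hyps Jset_range by (intro word_prod_WB) auto
  have vW: "word_prod (sB r) ws o w \<in> W" using WB_comp wsW w by blast
  have e: "word_prod (sB r) (k # ws) o w = sB r k o (word_prod (sB r) ws o w)" by (simp only: word_prod_simps o_assoc)
  have p: "par (word_prod (sB r) (k # ws)) = par (sB r k) * par (word_prod (sB r) ws)"
    unfolding word_prod_simps using par_comp[OF wsW sB_WB[OF k(2,3)]] .
  show ?case
  proof (cases "k = r")
    case False
    then have "k < r" using k by simp
    then show ?thesis unfolding e p using Cons.prems(1)[OF k(1) _ vW] Cons.IH[OF Cons.prems] par_sB[OF k(2,3)] by simp
  next
    case True
    have J: "r \<in> Jset lam" using k True by simp
    define h where "h = (\<lambda>w. g (sg o w))"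
    have "h (word_prod (sB r) ws o w) = (if par (word_prod (sB r) ws) = 1 then h w else h (sg o w))"
    proof (rule Cons.IH)
      fix k w assume k: "k \<in> Jset lam" "k < r" "w \<in> W"
      show "h (sB r k o w) = h w" unfolding h_def using Cons.prems(2)[OF k(1,2) J k(3)] .
      show "h (sg o (sB r k o w)) = h (sg o w)" unfolding h_def sg_sg(4) using Cons.prems(1)[OF k] .
    qed
    then have "g (sB r k o (word_prod (sB r) ws o w)) = (if par (sB r k) * par (word_prod (sB r) ws) = 1 then g w else g (sg o w))"
      unfolding h_def sg_sg(4) using True par_cases[of "word_prod (sB r) ws"] by (auto simp del: o_apply)
    then show ?thesis unfolding e p .
  qed
qed

text \<open>The even part of \<open>W\<^sub>\<lambda>\<close> is not generated by a subset of the
  \<open>s\<^sub>k\<close>, so the invariance is checked along a word in all the generators of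
  \<open>W\<^sub>\<lambda>\<close>, with \<open>word_invariance\<close> keeping track of
  \<open>s\<^sub>r\<close>.\<close>

lemma left_invariant:
  assumes lam: "lam \<in> Lam n r" and x: "x \<in> carrier H" and p: "p \<in> HP lam" and w: "w \<in> W"
  shows "cf (Tsum r (HP lam) ** x) (p o w) = cf (Tsum r (HP lam) ** x) w"
proof -
  let ?y = "Tsum r (HP lam) ** x"
  have c: "Tsum r (HP lam) \<in> carrier H" "?y \<in> carrier H" using HP_subset x by auto
  obtain ws where ws: "ws \<in> lists (Jset lam)" "word_prod (sB r) ws = p" using PB_word[OF lam HP_PB[OF p]] by blast
  have 1: "cf ?y (sB r k o w) = cf ?y w" if "k \<in> Jset lam" "k < r" "w \<in> W" for k w
  proof (rule left_inv_step[OF c(2)])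
    show "1 \<le> k" using that Jset_range by blast
    then show "Tgen r k ** ?y = scal r qq ** ?y"
      using Tgen_xhat[OF lam that(1,2)] c x that by (simp add: H.m_assoc[symmetric])
  qed (use that in auto)
  have 2: "cf ?y (sg o (sB r k o w)) = cf ?y (sg o w)" if "k \<in> Jset lam" "k < r" "r \<in> Jset lam" "w \<in> W" for k w
  proof -
    have k: "1 \<le> k" using that Jset_range by blast
    have y': "Tr ** ?y = Tsum r (HP lam) ** (Tr ** x)"
      using Tr_xhat[OF lam that(3)] c x by (simp add: H.m_assoc[symmetric])
    have "cf (Tr ** ?y) (sB r k o w) = cf (Tr ** ?y) w"
    proof (rule left_inv_step)
      show "Tgen r k ** (Tr ** ?y) = scal r qq ** (Tr ** ?y)"
        unfolding y' using Tgen_xhat[OF lam that(1,2)] c x that k by (simp add: H.m_assoc[symmetric])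
    qed (use that k c in auto)
    then show ?thesis using cf_Tr_left[OF c(2)] that WB_comp[of "sB r k" r w] k by simp
  qed
  have "cf ?y (word_prod (sB r) ws o w) = (if par (word_prod (sB r) ws) = 1 then cf ?y w else cf ?y (sg o w))"
    by (rule word_invariance[OF ws(1) 1 2 w])
  then show ?thesis unfolding ws(2) using HP_par[OF p] by simp
qed

lemma right_invariant:
  assumes lam: "lam \<in> Lam n r" and x: "x \<in> carrier H" and p: "p \<in> HP lam" and w: "w \<in> W"
  shows "cf (x ** Tsum r (HP lam)) (w o p) = cf (x ** Tsum r (HP lam)) w"
proof -
  have c: "Tsum r (HP lam) \<in> carrier H" using HP_subset by auto
  have s: "sta (x ** Tsum r (HP lam)) = Tsum r (HP lam) ** sta x"
    using x c HP_subset HP_inv by (simp add: sta_mult sta_Tsum)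
  have e: "cf (x ** Tsum r (HP lam)) v = cf (Tsum r (HP lam) ** sta x) (pinv v)" if "v \<in> W" for v
    using cf_sta[OF WB_inv[OF that], of "x ** Tsum r (HP lam)"] s WB_inv_inv[OF that] by simp
  have pW: "p \<in> W" using HP_W p by blast
  show ?thesis
    unfolding e[OF WB_comp[OF w pW]] e[OF w] WB_comp_inv[OF w pW]
    by (rule left_invariant[OF lam sta_closed HP_inv[OF p] WB_inv[OF w]])
qed

subsection \<open>Supports of products\<close>

lemma cf_mult_nz:
  assumes "x \<in> carrier H" "y \<in> carrier H" "cf (x ** y) w \<noteq> 0"
  obtains u v where "u \<in> W" "v \<in> W" "cf x u \<noteq> 0" "cf y v \<noteq> 0" "cf (Tw r u ** Tw r v) w \<noteq> 0"
proof -
  have "\<exists>u\<in>W. \<exists>v\<in>W. cf x u * cf y v * cf (Tw r u ** Tw r v) w \<noteq> 0"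
  proof (rule ccontr)
    assume "\<not> ?thesis"
    then have "cf (x ** y) w = 0" unfolding cf_mult[OF assms(1,2)] by (intro sum.neutral ballI) blast
    then show False using assms by simp
  qed
  then show thesis using that by auto
qed

text \<open>By the multiplication rule each letter of \<open>u\<close> is either kept or dropped; a letter
  \<open>s\<^sub>r\<close> is never dropped because its parameter is \<open>1\<close>.\<close>

lemma Tw_mult_support:
  assumes al: "al \<in> Lam n r" and u: "u \<in> PB al" and w: "w \<in> W" and nz: "cf (Tw r u ** Tw r w) y \<noteq> 0"
  shows "\<exists>p\<in>PB al. y = p o w \<and> par p = par u"
  using u nz
proof (induction "lenB r u" arbitrary: u y rule: less_induct)
  case less
  have yW: "y \<in> W" using less.prems(2) cf_outside by blast
  show ?case
  proof (cases "u = id")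
    case True
    have e: "Tw r u = \<^bold>1" unfolding True by (rule Tw_id)
    have "y = w" using less.prems(2) unfolding e using w yW by (simp add: cf_Tw split: if_splits)
    then show ?thesis using True by (intro bexI[of _ id]) auto
  next
    case False
    have uW: "u \<in> W" using PB_W less.prems by blast
    then have "pinv u \<noteq> id" using WB_inv_inv False by (metis inv_id)
    then obtain k where k: "k \<in> Jset al" "pinv u (Suc k) < pinv u k" using PB_exists_descent[OF al PB_inv[OF less.prems(1)]] by blast
    have kr: "1 \<le> k" "k \<le> r" using Jset_range k by auto
    define v where "v = sB r k o u"
    have v: "v \<in> PB al" "v \<in> W" using PB_comp[OF Jset_PB[OF al k(1)] less.prems(1)] PB_W by (auto simp: v_def)
    have uv: "u = sB r k o v" using kr by (simp add: v_def)
    have asc: "pinv v k < pinv v (Suc k)" unfolding v_def inv_left_mult[OF uW kr] using k kr by simp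
    have len: "lenB r v < lenB r u" using lenB_left_desc[OF uW kr k(2)] by (simp add: v_def)
    have "Tw r u = Tgen r k ** Tw r v" using Tgen_Tw[OF v(2) kr asc] uv by simp
    then have T: "Tw r u ** Tw r w = Tgen r k ** (Tw r v ** Tw r w)" using v w kr by (simp add: H.m_assoc)
    have parv: "par u = par (sB r k) * par v" using par_comp[OF v(2) sB_WB[OF kr]] uv by simp
    have "cf (Tw r v ** Tw r w) (sB r k o y) \<noteq> 0 \<or> (cf (Tw r v ** Tw r w) y \<noteq> 0 \<and> k \<noteq> r)"
      using less.prems(2) cf_Tgen_mult[of "Tw r v ** Tw r w" k y] v w kr yW unfolding T by (auto split: if_splits)
    then show ?thesis
    proof
      assume "cf (Tw r v ** Tw r w) (sB r k o y) \<noteq> 0"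
      then obtain p where p: "p \<in> PB al" "sB r k o y = p o w" "par p = par v" using less.hyps[OF len v(1)] by blast
      have "y = sB r k o (sB r k o y)" using kr by simp
      also have "\<dots> = (sB r k o p) o w" unfolding p(2) by (simp only: o_assoc)
      finally have "y = (sB r k o p) o w" .
      moreover have "sB r k o p \<in> PB al" using PB_comp[OF Jset_PB[OF al k(1)] p(1)] .
      moreover have "par (sB r k o p) = par u" using par_comp[OF PB_W[OF p(1)] sB_WB[OF kr]] p(3) parv by simp
      ultimately show ?thesis by blast
    next
      assume *: "cf (Tw r v ** Tw r w) y \<noteq> 0 \<and> k \<noteq> r"
      then obtain p where p: "p \<in> PB al" "y = p o w" "par p = par v" using less.hyps[OF len v(1)] by blast
      then show ?thesis using parv par_sB[OF kr] * by auto
    qed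
  qed
qed

text \<open>The case in which the parabolic subgroup is all of \<open>W\<close>: the grading of the algebra by parity.\<close>

lemma Tw_mult_par:
  assumes "u \<in> W" "w \<in> W" "cf (Tw r u ** Tw r w) y \<noteq> 0"
  shows "par y = par u * par w"
proof -
  define al :: weight where "al = (\<lambda>i. if i = n + 1 then r else 0)"
  have al: "al \<in> Lam n r" by (auto simp: Lam_def al_def sum.cl_ivl_Suc)
  have p0: "psum n al n = 0" unfolding psum_le_n[OF order_refl] by (simp add: al_def)
  have "blk n al k = n + 1" if "1 \<le> k" "k \<le> 2*r" for k
    using blk_iff[OF al that, of "n + 1"] that p0 psum_Suc[of al n] by (simp add: hat_def al_def)
  then have "PB al = W" using WB_range by (auto simp: PB_def)
  then obtain p where "p \<in> W" "y = p o w" "par p = par u" using Tw_mult_support[OF al, of u w y] assms by auto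
  then show ?thesis using par_comp assms(2) by simp
qed

section \<open>Double cosets in types B and D\<close>

abbreviation "DHat lam w mu \<equiv> double_coset r (HP lam) w (HP mu)"
abbreviation "DFull lam w mu \<equiv> double_coset r (PB lam) w (PB mu)"

lemma dcI: "p \<in> P \<Longrightarrow> q \<in> Q \<Longrightarrow> p o w o q \<in> double_coset r P w Q"
  by (auto simp: double_coset_eq)

lemma dcE: assumes "d \<in> double_coset r P w Q" obtains p q where "p \<in> P" "q \<in> Q" "d = p o w o q"
  using assms by (auto simp: double_coset_eq)

lemma DHat_W: "w \<in> W \<Longrightarrow> DHat lam w mu \<subseteq> W"
  by (auto simp: double_coset_eq intro!: WB_comp dest: HP_W)

lemma DFull_W: "w \<in> W \<Longrightarrow> DFull lam w mu \<subseteq> W"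
  by (auto simp: double_coset_eq intro!: WB_comp dest: PB_W)

lemma DHat_self: "w \<in> DHat lam w mu" and DFull_self: "w \<in> DFull lam w mu"
  using dcI[OF HP_id HP_id] dcI[OF PB_id PB_id] by (metis id_o comp_id)+

lemma DHat_par: assumes "w \<in> W" "d \<in> DHat lam w mu" shows "par d = par w"
proof -
  obtain p q where pq: "p \<in> HP lam" "q \<in> HP mu" "d = p o w o q" using assms(2) by (rule dcE)
  have W: "p \<in> W" "q \<in> W" "p o w \<in> W" using HP_W pq WB_comp assms by auto
  show ?thesis unfolding pq(3) using par_comp[OF W(2,3)] par_comp[OF assms(1) W(1)] HP_par pq by simp
qed

lemma DHat_trans: assumes "p \<in> HP lam" "q \<in> HP mu" "d \<in> DHat lam w mu" shows "p o d o q \<in> DHat lam w mu"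
proof -
  obtain p' q' where pq: "p' \<in> HP lam" "q' \<in> HP mu" "d = p' o w o q'" using assms(3) by (rule dcE)
  have "p o d o q = (p o p') o w o (q' o q)" by (simp only: pq(3) o_assoc)
  then show ?thesis using dcI[OF HP_comp[OF assms(1) pq(1)] HP_comp[OF pq(2) assms(2)]] by simp
qed

lemma DFull_trans: assumes "p \<in> PB lam" "q \<in> PB mu" "d \<in> DFull lam w mu" shows "p o d o q \<in> DFull lam w mu"
proof -
  obtain p' q' where pq: "p' \<in> PB lam" "q' \<in> PB mu" "d = p' o w o q'" using assms(3) by (rule dcE)
  have "p o d o q = (p o p') o w o (q' o q)" by (simp only: pq(3) o_assoc)
  then show ?thesis using dcI[OF PB_comp[OF assms(1) pq(1)] PB_comp[OF pq(2) assms(2)]] by simp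
qed

lemma HP_cancel: assumes "p \<in> HP lam" "q \<in> HP mu" shows "pinv p o (p o d o q) o pinv q = d"
  using HP_W[OF assms(1)] HP_W[OF assms(2)] by (simp add: fun_eq_iff)

lemma PB_cancel: assumes "p \<in> PB lam" "q \<in> PB mu" shows "pinv p o (p o d o q) o pinv q = d"
  using PB_W[OF assms(1)] PB_W[OF assms(2)] by (simp add: fun_eq_iff)

lemma DHat_sub: assumes "d \<in> DHat lam w mu" shows "DHat lam d mu \<subseteq> DHat lam w mu"
  using DHat_trans[OF _ _ assms] by (auto elim!: dcE)

lemma DHat_sym: assumes "d \<in> DHat lam w mu" shows "w \<in> DHat lam d mu"
proof -
  obtain p q where pq: "p \<in> HP lam" "q \<in> HP mu" "d = p o w o q" using assms by (rule dcE)
  have "w = pinv p o d o pinv q" unfolding pq(3) HP_cancel[OF pq(1,2)] ..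
  then show ?thesis using dcI[OF HP_inv[OF pq(1)] HP_inv[OF pq(2)], of d] by simp
qed

lemma DHat_eq: assumes "d \<in> DHat lam w mu" shows "DHat lam d mu = DHat lam w mu"
  using DHat_sub[OF assms] DHat_sub[OF DHat_sym[OF assms]] by blast

lemma DFull_sub: assumes "d \<in> DFull lam w mu" shows "DFull lam d mu \<subseteq> DFull lam w mu"
  using DFull_trans[OF _ _ assms] by (auto elim!: dcE)

lemma DFull_sym: assumes "d \<in> DFull lam w mu" shows "w \<in> DFull lam d mu"
proof -
  obtain p q where pq: "p \<in> PB lam" "q \<in> PB mu" "d = p o w o q" using assms by (rule dcE)
  have "w = pinv p o d o pinv q" unfolding pq(3) PB_cancel[OF pq(1,2)] ..
  then show ?thesis using dcI[OF PB_inv[OF pq(1)] PB_inv[OF pq(2)], of d] by simp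
qed

lemma DFull_eq: assumes "d \<in> DFull lam w mu" shows "DFull lam d mu = DFull lam w mu"
  using DFull_sub[OF assms] DFull_sub[OF DFull_sym[OF assms]] by blast

lemma DHat_left_iff: assumes "p \<in> HP lam" shows "p o d \<in> DHat lam w mu \<longleftrightarrow> d \<in> DHat lam w mu"
proof
  assume "p o d \<in> DHat lam w mu"
  then have "pinv p o (p o d) o id \<in> DHat lam w mu" by (rule DHat_trans[OF HP_inv[OF assms] HP_id])
  moreover have "pinv p o (p o d) o id = d" using HP_W[OF assms] by (simp add: fun_eq_iff)
  ultimately show "d \<in> DHat lam w mu" by simp
next
  assume "d \<in> DHat lam w mu"
  then show "p o d \<in> DHat lam w mu" using DHat_trans[OF assms HP_id, of d] by simp
qed

lemma DHat_right_iff: assumes "q \<in> HP mu" shows "d o q \<in> DHat lam w mu \<longleftrightarrow> d \<in> DHat lam w mu"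
proof
  assume "d o q \<in> DHat lam w mu"
  then have "id o (d o q) o pinv q \<in> DHat lam w mu" by (rule DHat_trans[OF HP_id HP_inv[OF assms]])
  moreover have "id o (d o q) o pinv q = d" using HP_W[OF assms] by (simp add: fun_eq_iff)
  ultimately show "d \<in> DHat lam w mu" by simp
next
  assume "d \<in> DHat lam w mu"
  then show "d o q \<in> DHat lam w mu" using DHat_trans[OF HP_id assms, of d] by simp
qed

lemma DFull_left_iff: assumes "p \<in> PB lam" shows "p o d \<in> DFull lam w mu \<longleftrightarrow> d \<in> DFull lam w mu"
proof
  assume "p o d \<in> DFull lam w mu"
  then have "pinv p o (p o d) o id \<in> DFull lam w mu" by (rule DFull_trans[OF PB_inv[OF assms] PB_id])
  moreover have "pinv p o (p o d) o id = d" using PB_W[OF assms] by (simp add: fun_eq_iff)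
  ultimately show "d \<in> DFull lam w mu" by simp
next
  assume "d \<in> DFull lam w mu"
  then show "p o d \<in> DFull lam w mu" using DFull_trans[OF assms PB_id, of d] by simp
qed

lemma DFull_right_iff: assumes "q \<in> PB mu" shows "d o q \<in> DFull lam w mu \<longleftrightarrow> d \<in> DFull lam w mu"
proof
  assume "d o q \<in> DFull lam w mu"
  then have "id o (d o q) o pinv q \<in> DFull lam w mu" by (rule DFull_trans[OF PB_id PB_inv[OF assms]])
  moreover have "id o (d o q) o pinv q = d" using PB_W[OF assms] by (simp add: fun_eq_iff)
  ultimately show "d \<in> DFull lam w mu" by simp
next
  assume "d \<in> DFull lam w mu"
  then show "d o q \<in> DFull lam w mu" using DFull_trans[OF PB_id assms, of d] by simp
qed

text \<open>The signs available on one side: the reflection \<open>s\<^sub>r\<close> is at hand exactly when there is a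
  central block.\<close>

definition Ssg :: "weight \<Rightarrow> (nat \<Rightarrow> nat) set" where
  "Ssg lam = (if r \<in> Jset lam then {id, sg} else {id})"

lemma Ssg_cases: "s \<in> Ssg lam \<Longrightarrow> s = id \<or> (s = sg \<and> r \<in> Jset lam)"
  by (auto simp: Ssg_def split: if_splits)

lemma Ssg_PB: "lam \<in> Lam n r \<Longrightarrow> s \<in> Ssg lam \<Longrightarrow> s \<in> PB lam"
  using Ssg_cases sg_PB by fastforce

text \<open>The even part has index one or two in the parabolic subgroup, with representatives in \<open>Ssg
  lam\<close>.\<close>

lemma PB_Ssg:
  assumes lam: "lam \<in> Lam n r" and p: "p \<in> PB lam"
  shows "\<exists>s\<in>Ssg lam. \<exists>q\<in>HP lam. p = s o q" "\<exists>s\<in>Ssg lam. \<exists>q\<in>HP lam. p = q o s"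
proof -
  have "(\<exists>s\<in>Ssg lam. \<exists>q\<in>HP lam. p = s o q) \<and> (\<exists>s\<in>Ssg lam. \<exists>q\<in>HP lam. p = q o s)"
  proof (cases "p \<in> HP lam")
    case True
    moreover have "id \<in> Ssg lam" by (simp add: Ssg_def)
    ultimately show ?thesis by (metis id_o comp_id)
  next
    case False
    then have J: "r \<in> Jset lam" using PB_noncentral lam p by blast
    then have "sg o p \<in> HP lam" "p o sg \<in> HP lam" using PB_central lam p False by blast+
    moreover have "p = sg o (sg o p)" "p = (p o sg) o sg" by simp_all
    moreover have "sg \<in> Ssg lam" using J by (simp add: Ssg_def)
    ultimately show ?thesis by blast
  qed
  then show "\<exists>s\<in>Ssg lam. \<exists>q\<in>HP lam. p = s o q" "\<exists>s\<in>Ssg lam. \<exists>q\<in>HP lam. p = q o s" by blast+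
qed

lemma DFull_cases:
  assumes lam: "lam \<in> Lam n r" and mu: "mu \<in> Lam n r" and d: "d \<in> DFull lam w mu"
  shows "\<exists>s\<in>Ssg lam. \<exists>t\<in>Ssg mu. \<exists>d'\<in>DHat lam w mu. d = s o d' o t"
proof -
  obtain p q where pq: "p \<in> PB lam" "q \<in> PB mu" "d = p o w o q" using d by (rule dcE)
  obtain s p' where s: "s \<in> Ssg lam" "p' \<in> HP lam" "p = s o p'" using PB_Ssg(1)[OF lam pq(1)] by blast
  obtain t q' where t: "t \<in> Ssg mu" "q' \<in> HP mu" "q = q' o t" using PB_Ssg(2)[OF mu pq(2)] by blast
  have "d = s o (p' o w o q') o t" by (simp only: pq(3) s(3) t(3) o_assoc)
  then show ?thesis using s t dcI[OF s(2) t(2)] by blast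
qed

lemma DHat_DFull: "d \<in> DHat lam w mu \<Longrightarrow> d \<in> DFull lam w mu"
  by (auto elim!: dcE intro!: dcI HP_PB)

lemma DFull_sandwich:
  assumes "lam \<in> Lam n r" "mu \<in> Lam n r" "s \<in> Ssg lam" "t \<in> Ssg mu" "d \<in> DHat lam w mu"
  shows "s o d o t \<in> DFull lam w mu"
  using DFull_trans[OF Ssg_PB[OF assms(1,3)] Ssg_PB[OF assms(2,4)] DHat_DFull[OF assms(5)]] .

lemma par_sandwich:
  assumes "lam \<in> Lam n r" "mu \<in> Lam n r" "s \<in> Ssg lam" "t \<in> Ssg mu" "d \<in> W"
  shows "par (s o d o t) = par s * par d * par t"
  using par_comp[of t "s o d"] par_comp[of d s] PB_W[OF Ssg_PB[OF assms(1,3)]] PB_W[OF Ssg_PB[OF assms(2,4)]] assms(5) WB_comp[of s r d]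
  by simp

lemma sg_conj_DHat:
  assumes lam: "lam \<in> Lam n r" and mu: "mu \<in> Lam n r" and J: "r \<in> Jset lam" "r \<in> Jset mu"
    and d: "d \<in> DHat lam w mu"
  shows "cj d \<in> DHat lam (cj w) mu"
proof -
  obtain p q where pq: "p \<in> HP lam" "q \<in> HP mu" "d = p o w o q" using d by (rule dcE)
  have "cj d = (cj p) o (cj w) o (cj q)" by (simp add: pq(3) fun_eq_iff)
  then show ?thesis using dcI[OF HP_conj[OF lam J(1) pq(1)] HP_conj[OF mu J(2) pq(2)], of "cj w"] by simp
qed

subsection \<open>The sign on the central block\<close>

lemma cen_range: "k \<in> cen lam \<Longrightarrow> 1 \<le> k \<and> k \<le> 2*r"
  by (auto simp: cen_def)

lemma PB_cen: "u \<in> PB lam \<Longrightarrow> k \<in> cen lam \<longleftrightarrow> 1 \<le> k \<and> k \<le> 2*r \<and> u k \<in> cen lam"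
  using PB_blk[of u lam k] WB_range[OF PB_W[of u lam], of k] by (auto simp: cen_def)

text \<open>Only central positions contribute to the parity of an element of the parabolic subgroup.\<close>

lemma csg_right:
  assumes ga: "ga \<in> Lam n r" and v: "v \<in> PB ga" and y: "y \<in> W"
  shows "sgnS (cen ga) (y o v) = sgnS (cen ga) y * par v"
proof -
  have "sgnS (cen ga) v = par v"
    unfolding par_def sgnS_def
  proof (rule prod.mono_neutral_left)
    show "\<forall>k\<in>{k \<in> {1..2*r}. r < k} - {k \<in> cen ga. r < k}. (if v k \<le> r then - 1 else 1 :: int) = 1"
    proof
      fix k assume "k \<in> {k \<in> {1..2*r}. r < k} - {k \<in> cen ga. r < k}"
      then show "(if v k \<le> r then - 1 else 1 :: int) = 1" using noncen_le_iff[OF ga v, of k] by auto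
    qed
  qed (auto simp: cen_def)
  moreover have "sgnS (cen ga) (y o v) = sgnS (cen ga) y * sgnS (cen ga) v"
  proof (rule sgnS_comp[OF _ cen_mir[OF ga] PB_W[OF v] _ y])
    show "cen ga \<subseteq> {1..2*r}" by (auto simp: cen_def)
    show "v k \<in> cen ga" if "k \<in> cen ga" for k using PB_cen[OF v, of k] that by blast
  qed
  ultimately show ?thesis by simp
qed

text \<open>The noncentral blocks of \<open>\<alpha>\<close> are not moved across the middle.\<close>

lemma csg_left:
  assumes al: "al \<in> Lam n r" and u: "u \<in> PB al" and y: "y \<in> W" and dis: "\<And>k. k \<in> cen ga \<Longrightarrow> y k \<notin> cen al"
  shows "sgnS (cen ga) (u o y) = sgnS (cen ga) y"
  unfolding sgnS_def
proof (rule prod.cong[OF refl])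
  fix k assume "k \<in> {k \<in> cen ga. r < k}"
  then have k: "k \<in> cen ga" "1 \<le> y k" "y k \<le> 2*r" using WB_range[OF y, of k] by (auto simp: cen_def)
  then show "(if (u o y) k \<le> r then - 1 else 1 :: int) = (if y k \<le> r then - 1 else 1)"
    using noncen_le_iff[OF al u k(2,3) dis[OF k(1)]] by simp
qed

lemma csg_nz: "sgnS (cen ga) y \<noteq> - sgnS (cen ga) y"
proof -
  have "finite (cen ga)" by (simp add: cen_def)
  then show ?thesis using sgnS_cases[of "cen ga" y] by auto
qed

lemma transp_PB:
  assumes mu: "mu \<in> Lam n r" and k: "k \<in> cen mu"
  shows "transpose k (mir r k) \<in> PB mu" "par (transpose k (mir r k)) = - 1"
proof -
  let ?t = "transpose k (mir r k)"
  have kr: "1 \<le> k" "k \<le> 2*r" "blk n mu k = n + 1" using k by (auto simp: cen_def)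
  have m: "mir r k \<in> {1..2*r}" "blk n mu (mir r k) = n + 1" using cen_mir[OF mu k] kr by (auto simp: cen_def)
  have "?t permutes {1..2*r}" using kr m by (intro permutes_swap_id) auto
  moreover have "?t i + ?t (mir r i) = 2*r + 1" if "i \<in> {1..2*r}" for i
    using that kr by (auto simp: transpose_def)
  ultimately have W: "?t \<in> W" by (simp add: WB_iff)
  then show "?t \<in> PB mu" using kr m by (auto simp: PB_def transpose_def)
  have "{l \<in> {1..2*r}. r < l \<and> ?t l \<le> r} = {if r < k then k else mir r k}"
    using kr by (auto simp: transpose_def)
  then show "par ?t = - 1" by (simp add: par_def sgnS_card)
qed

text \<open>If \<open>y\<close> maps some central position of \<open>\<gamma>\<close> to a central position of \<open>\<alpha>\<close>, the sign change at this
  position is the same on both sides of \<open>y\<close>, and a factor \<open>s\<^sub>r\<close> on the left can be traded for one on the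
  right.\<close>

lemma odd_stabiliser:
  assumes al: "al \<in> Lam n r" and ga: "ga \<in> Lam n r" and y: "y \<in> W" and k: "k \<in> cen ga" "y k \<in> cen al"
  shows "cj y \<in> DHat al y ga"
proof -
  define t where "t = transpose k (mir r k)"
  define t' where "t' = transpose (y k) (mir r (y k))"
  have J: "r \<in> Jset al" "r \<in> Jset ga" using cen_empty_iff al ga k by blast+
  note tP = transp_PB[OF ga k(1), folded t_def] and tP' = transp_PB[OF al k(2), folded t'_def]
  have ym: "y (mir r k) = mir r (y k)" using WB_mir[OF y] k(1) by (auto simp: cen_def)
  have ty: "t' (y (t x)) = y x" for x
    unfolding t_def t'_def ym[symmetric] by (auto simp: transpose_def WB_eq_iff[OF y])
  have "sg o t' \<in> HP al"
    using PB_comp[OF sg_PB[OF al J(1)] tP'(1)] par_comp[OF PB_W[OF tP'(1)] sg_W] tP'(2) by (simp add: HP_def)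
  moreover have "t o sg \<in> HP ga"
    using PB_comp[OF tP(1) sg_PB[OF ga J(2)]] par_comp[OF sg_W PB_W[OF tP(1)]] tP(2) by (simp add: HP_def)
  moreover have "cj y = (sg o t') o y o (t o sg)" using ty by (simp add: fun_eq_iff)
  ultimately show ?thesis using dcI by metis
qed

section \<open>Comparing products in types B and D\<close>

lemma cf_Tsum_sum:
  assumes z: "z \<in> carrier H" and D: "D \<subseteq> W"
  shows "cf (z ** Tsum r D) y = (\<Sum>d\<in>D. cf (z ** Tw r d) y)"
proof -
  have fin: "finite D" using finite_subset[OF D] by simp
  have c: "Tw r d \<in> carrier H" if "d \<in> D" for d using that D by auto
  have "z ** Tsum r D = (\<Oplus>\<^bsub>H\<^esub>d\<in>D. z ** Tw r d)"
    unfolding Tsum_def using fin z c by (intro H.finsum_rdistr) (auto simp: Pi_iff)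
  then show ?thesis using fin z c by (simp add: cf_finsum)
qed

lemma onep_left: "x \<in> carrier H \<Longrightarrow> w \<in> W \<Longrightarrow> cf ((\<^bold>1 \<boxplus> Tr) ** x) w = cf x w + cf x (sg o w)"
  by (simp add: H.l_distr cf_add cf_Tr_left)

lemma onep_right: "x \<in> carrier H \<Longrightarrow> w \<in> W \<Longrightarrow> cf (x ** (\<^bold>1 \<boxplus> Tr)) w = cf x w + cf x (w o sg)"
  by (simp add: H.r_distr cf_add cf_Tr_right)

lemma onep_closed [simp]: "\<^bold>1 \<boxplus> Tr \<in> carrier H"
  by simp

lemma par_sg_comp: "w \<in> W \<Longrightarrow> par (sg o w) = - par w" "w \<in> W \<Longrightarrow> par (w o sg) = - par w"
  using par_comp by auto

lemma xfull_hat: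
  assumes lam: "lam \<in> Lam n r" and J: "r \<in> Jset lam"
  shows "Tsum r (PB lam) = Tsum r (HP lam) ** (\<^bold>1 \<boxplus> Tr)"
    "Tsum r (PB lam) = (\<^bold>1 \<boxplus> Tr) ** Tsum r (HP lam)"
proof -
  show "Tsum r (PB lam) = Tsum r (HP lam) ** (\<^bold>1 \<boxplus> Tr)"
  proof (rule cf_eqI)
    fix w assume w: "w \<in> W"
    show "cf (Tsum r (PB lam)) w = cf (Tsum r (HP lam) ** (\<^bold>1 \<boxplus> Tr)) w"
      using PB_central(2)[OF lam J, of w] HP_subset w HP_par[of w lam] HP_par[of "w o sg" lam] par_sg_comp(2)[OF w]
      by (auto simp: onep_right cf_Tsum)
  qed (use HP_subset in auto)
  show "Tsum r (PB lam) = (\<^bold>1 \<boxplus> Tr) ** Tsum r (HP lam)"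
  proof (rule cf_eqI)
    fix w assume w: "w \<in> W"
    show "cf (Tsum r (PB lam)) w = cf ((\<^bold>1 \<boxplus> Tr) ** Tsum r (HP lam)) w"
      using PB_central(1)[OF lam J, of w] HP_subset w HP_par[of w lam] HP_par[of "sg o w" lam] par_sg_comp(1)[OF w]
      by (auto simp: onep_left cf_Tsum)
  qed (use HP_subset in auto)
qed

text \<open>A shortest element of \<open>p (W\<^sub>\<alpha> \<inter> W\<^sub>\<lambda>)\<close> has no descent inside a block of \<open>\<lambda>\<close>, so it is the
  minimal representative \<open>u\<close> of its coset.\<close>

lemma Inc_in_product:
  assumes al: "al \<in> Lam n r" and lam: "lam \<in> Lam n r" and u: "u \<in> Inc lam" and p: "p \<in> PB al" and q: "q \<in> PB lam"
    and e: "u = p o q"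
  shows "u \<in> PB al"
proof -
  define C where "C = {p o x | x. x \<in> PB al \<and> x \<in> PB lam}"
  have "\<exists>v. v \<in> C \<and> (\<forall>y. y \<in> C \<longrightarrow> lenB r v \<le> lenB r y)"
    by (rule ex_has_least_nat[of "\<lambda>u. u \<in> C" p "lenB r"]) (auto simp: C_def intro!: exI[of _ id])
  then obtain v where v: "v \<in> C" "\<And>y. y \<in> C \<Longrightarrow> lenB r v \<le> lenB r y" by blast
  obtain x where x: "x \<in> PB al" "x \<in> PB lam" "v = p o x" using v(1) by (auto simp: C_def)
  have vP: "v \<in> PB al" using PB_comp[OF p x(1)] x(3) by simp
  have vW: "v \<in> W" using PB_W[OF vP] .
  have "v k < v (Suc k)" if k: "k \<in> Jset lam" for k
  proof (cases "k \<in> Jset al")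
    case True
    have "v o sB r k = p o (x o sB r k)" by (simp only: x(3) o_assoc)
    then have "v o sB r k \<in> C" using PB_comp[OF x(1) Jset_PB[OF al True]] PB_comp[OF x(2) Jset_PB[OF lam k]] unfolding C_def by blast
    then have "lenB r v \<le> lenB r (v o sB r k)" using v(2) by blast
    moreover have "lenB r (v o sB r k) < lenB r v" if "v (Suc k) < v k" using lenB_desc[OF vW _ _ that] Jset_range[OF k] by simp
    ultimately show ?thesis using WB_Suc_neq[OF vW, of k] by (metis linorder_not_less linorder_neqE_nat)
  next
    case False
    have kr: "1 \<le> k" "k \<le> r" using Jset_range[OF k] by auto
    then have "blk n al k < blk n al (Suc k)" using False blk_mono[OF al, of k "Suc k"] by (auto simp: Jset_def)
    then have lt: "blk n al (v k) < blk n al (v (Suc k))" using PB_blk[OF vP, of k] PB_blk[OF vP, of "Suc k"] kr by auto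
    show ?thesis
    proof (rule ccontr)
      assume "\<not> v k < v (Suc k)"
      then have "blk n al (v (Suc k)) \<le> blk n al (v k)"
        using blk_mono[OF al, of "v (Suc k)" "v k"] WB_range[OF vW, of k] WB_range[OF vW, of "Suc k"] kr by auto
      then show False using lt by simp
    qed
  qed
  then have vI: "v \<in> Inc lam" using vW by (simp add: Inc_def)
  have xW: "x \<in> W" using PB_W x by blast
  have uv: "u = v o (pinv x o q)" unfolding e x(3) using xW by (simp add: fun_eq_iff)
  have "pinv x o q = id" by (rule Inc_unique[OF lam vI _ PB_comp[OF PB_inv[OF x(2)] q]]) (use u uv in simp)
  then have "u = v" using uv by simp
  then show ?thesis using vP by simp
qed

text \<open>A representative outside of \<open>Inc lam\<close> becomes increasing after multiplication by
  \<open>s\<^sub>r\<close>; the result lies in \<open>W\<^sub>\<alpha>\<close> and is odd, so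
  \<open>\<alpha>\<close> has a central block and \<open>s\<^sub>r\<close> belongs to
  \<open>W\<^sub>\<alpha>\<close>.\<close>

lemma hInc_in_product:
  assumes al: "al \<in> Lam n r" and lam: "lam \<in> Lam n r" and u: "u \<in> hInc lam" "u \<in> DHat al id lam"
  shows "u \<in> HP al"
proof -
  obtain p q where pq: "p \<in> HP al" "q \<in> HP lam" "u = p o id o q" using u(2) by (rule dcE)
  have uW: "u \<in> W" and paru: "par u = 1" using DHat_W[OF WB_id] u(2) DHat_par[OF WB_id u(2)] by auto
  show ?thesis
  proof (cases "u \<in> Inc lam")
    case True
    then have "u \<in> PB al" using Inc_in_product[OF al lam True HP_PB[OF pq(1)] HP_PB[OF pq(2)]] pq(3) by simp
    then show ?thesis using paru by (simp add: HP_def)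
  next
    case False
    then have us: "r \<in> Jset lam" "u o sg \<in> Inc lam" using u(1) by (auto simp: hInc_def)
    have "u o sg = p o (q o sg)" by (simp add: pq(3) o_assoc)
    then have P: "u o sg \<in> PB al"
      using Inc_in_product[OF al lam us(2) HP_PB[OF pq(1)] PB_comp[OF HP_PB[OF pq(2)] sg_PB[OF lam us(1)]]] by simp
    have "par (u o sg) = - 1" using par_sg_comp(2)[OF uW] paru by simp
    then have J: "r \<in> Jset al" using PB_noncentral[OF al] P HP_par by fastforce
    have "(u o sg) o sg \<in> PB al" using PB_comp[OF P sg_PB[OF al J]] .
    then show ?thesis using paru by (simp add: HP_def)
  qed
qed

text \<open>The sum over a double coset is invariant under right translations, so it is a multiple of the sum over the
  right subgroup; the quotient is supported on minimal representatives.\<close>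

lemma ex_quotient_hat:
  assumes lam: "lam \<in> Lam n r" and mu: "mu \<in> Lam n r" and w: "w \<in> W"
  shows "\<exists>z\<in>carrier H. z ** Tsum r (HP mu) = Tsum r (DHat lam w mu) \<and> (\<forall>u. cf z u \<noteq> 0 \<longrightarrow> u \<in> hInc mu \<and> u \<in> DHat lam w mu)"
proof -
  have c: "Tsum r (DHat lam w mu) \<in> carrier H" using DHat_W[OF w] by simp
  have "cf (Tsum r (DHat lam w mu)) (u o v) = cf (Tsum r (DHat lam w mu)) u" if "v \<in> HP mu" for u v
    using DHat_right_iff[OF that] DHat_W[OF w] by (simp add: cf_Tsum)
  then obtain z where z: "z \<in> carrier H" "Tsum r (DHat lam w mu) = z ** Tsum r (HP mu)"
    "\<forall>u. cf z u = (if u \<in> hInc mu then cf (Tsum r (DHat lam w mu)) u else 0)"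
    using factor_right[OF mu c] by blast
  have nz: "u \<in> DHat lam w mu" if "cf (Tsum r (DHat lam w mu)) u \<noteq> 0" for u
    using that cf_Tsum[OF DHat_W[OF w], where w = u] by (simp split: if_splits)
  have "u \<in> hInc mu \<and> u \<in> DHat lam w mu" if "cf z u \<noteq> 0" for u
    using that z(3)[rule_format, of u] nz[of u] by (simp split: if_splits)
  then show ?thesis using z(1) z(2)[symmetric] by blast
qed

lemma ex_coquotient_hat:
  assumes lam: "lam \<in> Lam n r" and mu: "mu \<in> Lam n r" and w: "w \<in> W"
  shows "\<exists>z\<in>carrier H. Tsum r (HP lam) ** z = Tsum r (DHat lam w mu) \<and> (\<forall>u. cf z u \<noteq> 0 \<longrightarrow> u \<in> DHat lam w mu)"
proof -
  have c: "Tsum r (DHat lam w mu) \<in> carrier H" using DHat_W[OF w] by simp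
  have "cf (Tsum r (DHat lam w mu)) (v o u) = cf (Tsum r (DHat lam w mu)) u" if "v \<in> HP lam" for u v
    using DHat_left_iff[OF that] DHat_W[OF w] by (simp add: cf_Tsum)
  then obtain z where z: "z \<in> carrier H" "Tsum r (DHat lam w mu) = Tsum r (HP lam) ** z"
    "\<forall>u. cf z u \<noteq> 0 \<longrightarrow> cf (Tsum r (DHat lam w mu)) u \<noteq> 0"
    using factor_left[OF lam c] by blast
  have nz: "u \<in> DHat lam w mu" if "cf (Tsum r (DHat lam w mu)) u \<noteq> 0" for u
    using that cf_Tsum[OF DHat_W[OF w], where w = u] by (simp split: if_splits)
  then show ?thesis using z(1) z(2)[symmetric] z(3) by blast
qed

lemma ex_quotient_full:
  assumes lam: "lam \<in> Lam n r" and mu: "mu \<in> Lam n r" and w: "w \<in> W"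
  shows "\<exists>z\<in>carrier H. z ** Tsum r (PB mu) = Tsum r (DFull lam w mu)"
proof -
  have c: "Tsum r (DFull lam w mu) \<in> carrier H" using DFull_W[OF w] by simp
  have "cf (Tsum r (DFull lam w mu)) (u o v) = cf (Tsum r (DFull lam w mu)) u" if "v \<in> PB mu" for u v
    using DFull_right_iff[OF that] DFull_W[OF w] by (simp add: cf_Tsum)
  then show ?thesis using factor_right_full[OF mu c] by metis
qed

lemma ex_coquotient_full:
  assumes lam: "lam \<in> Lam n r" and mu: "mu \<in> Lam n r" and w: "w \<in> W"
  shows "\<exists>z\<in>carrier H. Tsum r (PB lam) ** z = Tsum r (DFull lam w mu)"
proof -
  have c: "Tsum r (DFull lam w mu) \<in> carrier H" using DFull_W[OF w] by simp
  have "cf (Tsum r (DFull lam w mu)) (v o u) = cf (Tsum r (DFull lam w mu)) u" if "v \<in> PB lam" for u v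
    using DFull_left_iff[OF that] DFull_W[OF w] by (simp add: cf_Tsum)
  then show ?thesis using factor_left_full[OF lam c] by metis
qed

text \<open>Here \<open>F X\<close> is \<open>z\<close> times the sum over \<open>X\<close>. If \<open>\<lambda>\<close>
  has a central block or \<open>\<alpha>\<close> has none, the element \<open>z\<close> of the even
  situation also serves for the full double cosets; otherwise \<open>1 + T\<^sub>r\<close> times
  \<open>z\<close> does. In both cases the full coefficient is the even one plus one further term, coming
  from the translates of \<open>D\<close> by \<open>s\<^sub>r\<close>.\<close>

lemma compare_coefficients:
  assumes al: "al \<in> Lam n r" and lam: "lam \<in> Lam n r" and ga: "ga \<in> Lam n r" and w: "w \<in> W"
    and z: "z \<in> carrier H" "z ** Tsum r (HP lam) = Tsum r (DHat al id lam)" "\<And>u. cf z u \<noteq> 0 \<Longrightarrow> u \<in> HP al"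
    and zB: "zB \<in> carrier H" "zB ** Tsum r (PB lam) = Tsum r (DFull al id lam)"
    and nz: "cf (z ** Tsum r (DHat lam w ga)) y \<noteq> 0"
  shows "cf (zB ** Tsum r (DFull lam w ga)) y = cf (z ** Tsum r (DHat lam w ga)) y \<or>
    (\<not> cen al \<subseteq> cen lam \<and> cf (zB ** Tsum r (DFull lam w ga)) y = 2 * cf (z ** Tsum r (DHat lam w ga)) y)"
proof -
  define D where "D = DHat lam w ga"
  define DA where "DA = DFull lam w ga"
  define F where "F = (\<lambda>X. z ** Tsum r X)"
  have DW: "D \<subseteq> W" "DA \<subseteq> W" unfolding D_def DA_def using DHat_W DFull_W w by auto
  have yW: "y \<in> W" using nz cf_outside by blast
  have parD: "par d = par w" if "d \<in> D" for d using DHat_par[OF w] that by (simp add: D_def)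
  \<comment> \<open>Every term of the product stays in the coset of its right factor.\<close>
  have supp1: "\<exists>p\<in>HP al. y = p o d" if d: "d \<in> W" and nz: "cf (z ** Tw r d) y \<noteq> 0" for d y
  proof -
    obtain u v where uv: "u \<in> W" "v \<in> W" "cf z u \<noteq> 0" "cf (Tw r d) v \<noteq> 0" "cf (Tw r u ** Tw r v) y \<noteq> 0"
      using cf_mult_nz[OF z(1) Tw_closed[OF d] nz] .
    have "v = d" using uv(4) cf_Tw[OF d uv(2)] by (simp split: if_splits)
    moreover have "u \<in> HP al" using z(3) uv(3) by blast
    ultimately obtain p where "p \<in> PB al" "y = p o d" "par p = par u"
      using Tw_mult_support[OF al HP_PB d, of u y] uv(5) by blast
    then show ?thesis using HP_par[OF \<open>u \<in> HP al\<close>] by (auto simp: HP_def)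
  qed
  have supp: "\<exists>p\<in>HP al. \<exists>d\<in>X. y = p o d" if X: "X \<subseteq> W" and nz: "cf (F X) y \<noteq> 0" for X y
  proof -
    have "\<exists>d\<in>X. cf (z ** Tw r d) y \<noteq> 0"
    proof (rule ccontr)
      assume "\<not> ?thesis"
      then have "cf (F X) y = 0" unfolding F_def cf_Tsum_sum[OF z(1) X] by (intro sum.neutral) auto
      then show False using nz by simp
    qed
    then show ?thesis using supp1 X by blast
  qed
  have restrict: "cf (F X) y = cf (F {d \<in> X. par d = par y}) y" if X: "X \<subseteq> W" for X y
  proof -
    have X2: "{d \<in> X. par d = par y} \<subseteq> W" using X by auto
    have "cf (z ** Tw r d) y = 0" if d: "d \<in> X" "par d \<noteq> par y" for d
    proof (rule ccontr)
      assume "cf (z ** Tw r d) y \<noteq> 0"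
      then obtain p where p: "p \<in> HP al" "y = p o d" using supp1[of d y] subsetD[OF X d(1)] by metis
      then have "par y = par d" using par_comp[of d p] HP_W[OF p(1)] HP_par[OF p(1)] subsetD[OF X d(1)] by simp
      then show False using d by simp
    qed
    then show ?thesis unfolding F_def cf_Tsum_sum[OF z(1) X] cf_Tsum_sum[OF z(1) X2]
      using finite_subset[OF X finite_WB] by (intro sum.mono_neutral_right) auto
  qed
  obtain p0 d0 where p0: "p0 \<in> HP al" "d0 \<in> D" "y = p0 o d0" using supp[OF DW(1), of y] nz unfolding F_def D_def by blast
  have pary: "par y = par w"
    using par_comp[of d0 p0] p0 HP_W HP_par parD DW by auto
  obtain x1 where x1: "x1 \<in> carrier H" "Tsum r (HP lam) ** x1 = Tsum r D" using ex_coquotient_hat[OF lam ga w] by (auto simp: D_def)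
  obtain x2 where x2: "x2 \<in> carrier H" "x2 ** Tsum r (HP ga) = Tsum r D" using ex_quotient_hat[OF lam ga w] by (auto simp: D_def)
  obtain x3 where x3: "x3 \<in> carrier H" "Tsum r (HP al) ** x3 = Tsum r (DHat al id lam)" using ex_coquotient_hat[OF al lam WB_id] by auto
  obtain y1 where y1: "y1 \<in> carrier H" "Tsum r (PB lam) ** y1 = Tsum r DA" using ex_coquotient_full[OF lam ga w] by (auto simp: DA_def)
  have HPc [simp]: "Tsum r (HP lam) \<in> carrier H" "Tsum r (PB lam) \<in> carrier H" for lam using HP_subset by auto
  have Tc [simp]: "Tsum r D \<in> carrier H" "Tsum r DA \<in> carrier H" using DW by auto
  have Fc [simp]: "F X \<in> carrier H" if "X \<subseteq> W" for X using z(1) that by (simp add: F_def)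
  have FD1: "F D = Tsum r (HP al) ** (x3 ** x1)"
  proof -
    have "F D = (z ** Tsum r (HP lam)) ** x1" unfolding F_def x1(2)[symmetric] using z(1) x1(1) by (simp add: H.m_assoc)
    also have "\<dots> = (Tsum r (HP al) ** x3) ** x1" using z(2) x3(2) by simp
    finally show ?thesis using x3(1) x1(1) by (simp add: H.m_assoc)
  qed
  have FD2: "F D = (z ** x2) ** Tsum r (HP ga)" unfolding F_def x2(2)[symmetric] using z(1) x2(1) by (simp add: H.m_assoc)
  have inv: "cf (F D) (p o v o q) = cf (F D) v" if "p \<in> HP al" "q \<in> HP ga" "v \<in> W" for p q v
  proof -
    have "cf (F D) ((p o v) o q) = cf (F D) (p o v)"
      unfolding FD2 using right_invariant[OF ga _ that(2) WB_comp[OF HP_W[OF that(1)] that(3)]] z x2 by simp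
    also have "\<dots> = cf (F D) v" unfolding FD1 using left_invariant[OF al _ that(1,3)] x3 x1 by simp
    finally show ?thesis .
  qed
  have os_y: "cf (F D) (cj y) = cf (F D) y" if "k \<in> cen ga" "y k \<in> cen al" for k
    using odd_stabiliser[OF al ga yW that] inv yW by (auto elim!: dcE)
  have e: "zB ** Tsum r DA = z' ** Tsum r DA" if "z' \<in> carrier H" "z' ** Tsum r (PB lam) = Tsum r (DFull al id lam)" for z'
  proof -
    have "zB ** Tsum r DA = (zB ** Tsum r (PB lam)) ** y1" unfolding y1(2)[symmetric] using zB(1) y1(1) by (simp add: H.m_assoc)
    also have "\<dots> = (z' ** Tsum r (PB lam)) ** y1" using zB that by simp
    finally show ?thesis unfolding y1(2)[symmetric] using that(1) y1(1) by (simp add: H.m_assoc)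
  qed
  have hDB: "DHat al id lam \<subseteq> W" "DFull al id lam \<subseteq> W" using DHat_W DFull_W by auto
  have parhDB: "par v = 1" if "v \<in> DHat al id lam" for v using DHat_par[OF WB_id that] by simp
  \<comment> \<open>The coset \<open>D\<close> is stable under conjugation by \<open>s\<^sub>r\<close> in this situation, by \<open>odd_stabiliser\<close>.\<close>
  define os where "os \<longleftrightarrow> (\<exists>k\<in>cen ga. w k \<in> cen lam)"
  have dD: "d k \<notin> cen lam" if "\<not> os" "d \<in> D" "k \<in> cen ga" for d k
  proof -
    obtain p q where pq: "p \<in> HP lam" "q \<in> HP ga" "d = p o w o q" using \<open>d \<in> D\<close> unfolding D_def by (rule dcE)
    have "q k \<in> cen ga" using PB_cen[OF HP_PB[OF pq(2)], of k] that by blast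
    then have "w (q k) \<notin> cen lam" using that by (auto simp: os_def)
    moreover have "1 \<le> w (q k) \<and> w (q k) \<le> 2*r" using WB_range[OF w, of "q k"] cen_range[OF \<open>q k \<in> cen ga\<close>] by blast
    ultimately show ?thesis using PB_cen[OF HP_PB[OF pq(1)], of "w (q k)"] pq by auto
  qed
  \<comment> \<open>Otherwise the sign on the central block of \<open>\<gamma>\<close> is an invariant of the coset \<open>D\<close>.\<close>
  have csgD: "sgnS (cen ga) d = sgnS (cen ga) w" if "\<not> os" "d \<in> D" for d
  proof -
    obtain p q where pq: "p \<in> HP lam" "q \<in> HP ga" "d = p o w o q" using \<open>d \<in> D\<close> unfolding D_def by (rule dcE)
    have wq: "w o q \<in> W" using WB_comp w HP_W pq by blast
    have "(w o q) k \<notin> cen lam" if "k \<in> cen ga" for k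
      using that PB_cen[OF HP_PB[OF pq(2)], of k] \<open>\<not> os\<close> by (auto simp: os_def)
    then have "sgnS (cen ga) (p o (w o q)) = sgnS (cen ga) (w o q)" by (rule csg_left[OF lam HP_PB[OF pq(1)] wq])
    also have "\<dots> = sgnS (cen ga) w" using csg_right[OF ga HP_PB[OF pq(2)] w] HP_par[OF pq(2)] by simp
    finally show ?thesis by (simp only: pq(3) o_assoc)
  qed
  have csgp: "sgnS (cen ga) d = sgnS (cen ga) v"
    if "v = p o d" "p \<in> HP al" "v \<in> W" "\<And>k. k \<in> cen ga \<Longrightarrow> v k \<notin> cen al" for v p d
  proof -
    have "pinv p o v = d" unfolding that(1) using HP_W[OF that(2)] by (simp add: fun_eq_iff)
    then show ?thesis using csg_left[OF al PB_inv[OF HP_PB[OF that(2)]] that(3,4)] by simp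
  qed
  have result: ?thesis if "cf (zB ** Tsum r DA) y = cf (F D) y + extra" "extra = 0 \<or> (extra = cf (F D) y \<and> \<not> cen al \<subseteq> cen lam)" for extra
    using that unfolding D_def DA_def F_def by auto
  show ?thesis
  proof (cases "r \<in> Jset lam \<or> r \<notin> Jset al")
    case True
    have "z ** Tsum r (PB lam) = Tsum r (DFull al id lam)"
    proof (cases "r \<in> Jset lam")
      case J: True
      have "z ** Tsum r (PB lam) = Tsum r (DHat al id lam) ** (\<^bold>1 \<boxplus> Tr)"
        unfolding xfull_hat(1)[OF lam J] using z(1) z(2) by (simp flip: H.m_assoc)
      also have "\<dots> = Tsum r (DFull al id lam)"
      proof (rule cf_eqI)
        fix v assume v: "v \<in> W"
        have "v \<in> DFull al id lam \<longleftrightarrow> v \<in> DHat al id lam \<or> v o sg \<in> DHat al id lam"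
        proof
          assume "v \<in> DFull al id lam"
          then obtain s t d where st: "s \<in> Ssg al" "t \<in> Ssg lam" "d \<in> DHat al id lam" "v = s o d o t"
            using DFull_cases[OF al lam] by blast
          have t: "v \<in> DHat al id lam \<or> v o sg \<in> DHat al id lam" if "s = id"
            using Ssg_cases[OF st(2)] st(3,4) that by auto
          have s2: "v \<in> DHat al id lam \<or> v o sg \<in> DHat al id lam" if "s = sg" "r \<in> Jset al"
          proof -
            have "cj id = id" by simp
            then have c: "cj d \<in> DHat al id lam" using sg_conj_DHat[OF al lam that(2) J st(3)] by simp
            show ?thesis using Ssg_cases[OF st(2)] c st(4) that by auto
          qed
          show "v \<in> DHat al id lam \<or> v o sg \<in> DHat al id lam" using t s2 Ssg_cases[OF st(1)] by blast
        next
          assume "v \<in> DHat al id lam \<or> v o sg \<in> DHat al id lam"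
          then show "v \<in> DFull al id lam"
            using DHat_DFull[of v al id lam] DHat_DFull[of "v o sg" al id lam] DFull_right_iff[OF sg_PB[OF lam J], of v al id] by blast
        qed
        then show "cf (Tsum r (DHat al id lam) ** (\<^bold>1 \<boxplus> Tr)) v = cf (Tsum r (DFull al id lam)) v"
          using hDB v parhDB[of v] parhDB[of "v o sg"] par_sg_comp(2)[OF v] by (auto simp: onep_right cf_Tsum)
      qed (use hDB in auto)
      finally show ?thesis .
    next
      case J: False
      then have "PB lam = HP lam" "PB al = HP al" using PB_noncentral lam al True by auto
      then show ?thesis using z(2) by simp
    qed
    then have eF: "zB ** Tsum r DA = F DA" unfolding F_def using e z(1) by blast
    show ?thesis
    proof (cases "r \<in> Jset lam \<and> r \<in> Jset ga")
      case False
      have "{d \<in> DA. par d = par y} = D"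
      proof (intro Set.set_eqI iffI)
        fix d assume d: "d \<in> {d \<in> DA. par d = par y}"
        have dDA: "d \<in> DFull lam w ga" using d by (simp add: DA_def)
        obtain s t d' where st: "s \<in> Ssg lam" "t \<in> Ssg ga" "d' \<in> DHat lam w ga" "d = s o d' o t"
          using DFull_cases[OF lam ga dDA] by blast
        have "par s * par t = 1"
          using d par_sandwich[OF lam ga st(1,2)] parD[of d'] st(3,4) DW(1) pary par_cases[of w] by (auto simp: D_def)
        then have "s = id \<and> t = id" using Ssg_cases[OF st(1)] Ssg_cases[OF st(2)] False by auto
        then show "d \<in> D" using st by (simp add: D_def)
      next
        fix d assume "d \<in> D"
        then show "d \<in> {d \<in> DA. par d = par y}" using parD pary DHat_DFull by (auto simp: D_def DA_def)
      qed
      then have "cf (F DA) y = cf (F D) y" using restrict[OF DW(2), of y] by simp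
      then show ?thesis using eF by (intro result[of 0]) auto
    next
      case J: True
      \<comment> \<open>The only other part of the full double coset with the parity of \<open>y\<close>.\<close>
      define D2 where "D2 = (\<lambda>d. cj d) ` D"
      have D2W: "D2 \<subseteq> W" unfolding D2_def using DW(1) WB_comp by auto
      have "{d \<in> DA. par d = par y} = D \<union> D2"
      proof (intro Set.set_eqI iffI)
        fix d assume d: "d \<in> {d \<in> DA. par d = par y}"
        have dDA: "d \<in> DFull lam w ga" using d by (simp add: DA_def)
        obtain s t d' where st: "s \<in> Ssg lam" "t \<in> Ssg ga" "d' \<in> DHat lam w ga" "d = s o d' o t"
          using DFull_cases[OF lam ga dDA] by blast
        have "par s * par t = 1"
          using d par_sandwich[OF lam ga st(1,2)] parD[of d'] st(3,4) DW(1) pary par_cases[of w] by (auto simp: D_def)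
        then have "(s = id \<and> t = id) \<or> (s = sg \<and> t = sg)" using Ssg_cases[OF st(1)] Ssg_cases[OF st(2)] by auto
        then show "d \<in> D \<union> D2" using st by (auto simp: D_def D2_def)
      next
        fix d assume "d \<in> D \<union> D2"
        then have "\<exists>s d'. (s = id \<or> s = sg) \<and> d' \<in> D \<and> d = s o d' o s"
        proof
          assume "d \<in> D"
          moreover have "d = id o d o id" by simp
          ultimately show ?thesis by blast
        qed (auto simp: D2_def)
        then obtain s d' where s: "s = id \<or> s = sg" "d' \<in> D" "d = s o d' o s" by blast
        then have sS: "s \<in> Ssg lam" "s \<in> Ssg ga" using J by (auto simp: Ssg_def)
        have "par s * par s = 1" using s(1) by auto
        then have "par d = par y" using par_sandwich[OF lam ga sS, of d'] s(2,3) DW(1) parD pary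
          by (auto simp: algebra_simps)
        moreover have "d \<in> DA" using DFull_sandwich[OF lam ga sS] s by (simp add: D_def DA_def)
        ultimately show "d \<in> {d \<in> DA. par d = par y}" by simp
      qed
      then have FDA: "cf (F DA) y = cf (F (D \<union> D2)) y" using restrict[OF DW(2), of y] by simp
      show ?thesis
      proof (cases "D \<inter> D2 = {}")
        case False
        have D2e: "D2 = DHat lam (cj w) ga"
        proof (intro Set.set_eqI iffI)
          fix d assume "d \<in> D2"
          then show "d \<in> DHat lam (cj w) ga" using sg_conj_DHat[OF lam ga] J by (auto simp: D2_def D_def)
        next
          fix d assume d: "d \<in> DHat lam (cj w) ga"
          have "cj (cj w) = w" by (simp add: fun_eq_iff)
          then have "cj d \<in> D" using sg_conj_DHat[OF lam ga _ _ d] J by (simp add: D_def)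
          moreover have "d = cj (cj d)" by (simp add: fun_eq_iff)
          ultimately show "d \<in> D2" unfolding D2_def by blast
        qed
        obtain d where "d \<in> D" "d \<in> D2" using False by blast
        then have "D = D2" using DHat_eq[of d lam w ga] DHat_eq[of d lam "cj w" ga] unfolding D2e D_def by simp
        then show ?thesis using FDA eF by (intro result[of 0]) auto
      next
        case dis: True
        have "\<not> os"
        proof
          assume os
          then obtain k where "k \<in> cen ga" "w k \<in> cen lam" by (auto simp: os_def)
          then have "cj w \<in> D" using odd_stabiliser[OF lam ga w] by (simp add: D_def)
          moreover have "cj w \<in> D2" using DHat_self[of w lam ga] by (auto simp: D2_def D_def)
          ultimately show False using dis by blast
        qed
        have add: "cf (F (D \<union> D2)) y = cf (F D) y + cf (F D2) y"
          unfolding F_def using cf_Tsum_sum[OF z(1), of "D \<union> D2"] cf_Tsum_sum[OF z(1) DW(1)] cf_Tsum_sum[OF z(1) D2W] DW(1) D2W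
            sum.union_disjoint[OF finite_subset[OF DW(1) finite_WB] finite_subset[OF D2W finite_WB] dis]
          by simp
        show ?thesis
        proof (rule result[of "cf (F D2) y"])
          show "cf (zB ** Tsum r DA) y = cf (F D) y + cf (F D2) y" using eF FDA add by simp
          show "cf (F D2) y = 0 \<or> (cf (F D2) y = cf (F D) y \<and> \<not> cen al \<subseteq> cen lam)"
          proof (cases "cf (F D2) y = 0")
            case nz2: False
            obtain p2 c where p2: "p2 \<in> HP al" "c \<in> D2" "y = p2 o c" using supp[OF D2W nz2] by blast
            obtain d2 where d2: "d2 \<in> D" "c = cj d2" using p2(2) by (auto simp: D2_def)
            \<comment> \<open>Otherwise \<open>y\<close> would have the sign of \<open>D\<close> and the opposite sign of \<open>D2\<close> on the central block.\<close>
            have "\<exists>k\<in>cen ga. y k \<in> cen al"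
            proof (rule ccontr)
              assume "\<not> ?thesis"
              then have no: "y k \<notin> cen al" if "k \<in> cen ga" for k using that by blast
              have "sgnS (cen ga) d0 = sgnS (cen ga) y" by (rule csgp[OF p0(3,1) yW no])
              moreover have "sgnS (cen ga) c = sgnS (cen ga) y" by (rule csgp[OF p2(3,1) yW no])
              moreover have "sgnS (cen ga) c = - sgnS (cen ga) w"
              proof -
                have d2W: "d2 \<in> W" "d2 o sg \<in> W" using d2 DW WB_comp by auto
                have "(d2 o sg) k \<notin> cen lam" if "k \<in> cen ga" for k
                  using that PB_cen[OF sg_PB[OF ga], of k] J dD[OF \<open>\<not> os\<close> d2(1)] by auto
                then have "sgnS (cen ga) (sg o (d2 o sg)) = sgnS (cen ga) (d2 o sg)"
                  using J by (intro csg_left[OF lam sg_PB[OF lam] d2W(2)]) auto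
                also have "\<dots> = - sgnS (cen ga) d2" using csg_right[OF ga sg_PB[OF ga] d2W(1)] J by simp
                finally show ?thesis using csgD[OF \<open>\<not> os\<close> d2(1)] by (simp add: d2(2) o_assoc)
              qed
              ultimately show False using csgD[OF \<open>\<not> os\<close> p0(2)] csg_nz[of ga w] by simp
            qed
            then obtain k where k: "k \<in> cen ga" "y k \<in> cen al" by blast
            have Jal: "r \<in> Jset al" using cen_empty_iff[OF al] k by blast
            \<comment> \<open>The element \<open>z\<close> commutes with \<open>T\<^sub>r\<close> up to right multiplication by the sum over \<open>HP lam\<close>.\<close>
            have "F D2 = Tr ** F D ** Tr"
            proof -
              have conj: "Tsum r ((\<lambda>d. cj d) ` X) = Tr ** Tsum r X ** Tr" if X: "X \<subseteq> W" for X
              proof (rule cf_eqI)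
                have XW: "(\<lambda>d. cj d) ` X \<subseteq> W" using X WB_comp by auto
                then show "Tsum r ((\<lambda>d. cj d) ` X) \<in> carrier H" by simp
                fix v assume v: "v \<in> W"
                have "v \<in> (\<lambda>d. cj d) ` X \<longleftrightarrow> sg o v o sg \<in> X"
                proof
                  assume a: "cj v \<in> X"
                  show "v \<in> (\<lambda>d. cj d) ` X"
                  proof (rule image_eqI)
                    show "v = cj (cj v)" by (simp add: fun_eq_iff)
                  qed (rule a)
                qed (auto simp: o_assoc)
                then show "cf (Tsum r ((\<lambda>d. cj d) ` X)) v = cf (Tr ** Tsum r X ** Tr) v"
                  using X XW v WB_comp[OF v sg_W] by (simp add: cf_Tsum cf_Tr_left cf_Tr_right o_assoc)
              qed (use X in auto)
              have z3: "z ** (Tr ** Tsum r (HP lam)) = Tr ** (z ** Tsum r (HP lam))"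
              proof -
                have im: "(\<lambda>d. cj d) ` DHat al id lam = DHat al id lam"
                proof -
                  have ii: "cj id = id" by simp
                  have sub: "cj d \<in> DHat al id lam" if "d \<in> DHat al id lam" for d
                    using sg_conj_DHat[OF al lam Jal _ that] J unfolding ii by blast
                  have "d \<in> (\<lambda>d. cj d) ` DHat al id lam" if "d \<in> DHat al id lam" for d
                  proof (rule image_eqI)
                    show "d = cj (cj d)" by (simp add: fun_eq_iff)
                  qed (rule sub[OF that])
                  then show ?thesis using sub by blast
                qed
                have "z ** (Tr ** Tsum r (HP lam)) = z ** Tsum r (HP lam) ** Tr"
                  using Tr_xhat[OF lam] J z(1) by (simp add: H.m_assoc)
                also have "\<dots> = Tr ** Tsum r (DHat al id lam) ** Tr ** Tr"
                  unfolding z(2) using conj[OF hDB(1)] im by simp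
                also have "\<dots> = Tr ** Tsum r (DHat al id lam)" using hDB by (simp add: H.m_assoc)
                finally show ?thesis unfolding z(2) .
              qed
              have "F D2 = z ** (Tr ** (Tsum r (HP lam) ** x1) ** Tr)"
                unfolding F_def D2_def conj[OF DW(1)] x1(2) ..
              also have "\<dots> = z ** (Tr ** Tsum r (HP lam)) ** x1 ** Tr" using z(1) x1(1) by (simp add: H.m_assoc)
              also have "\<dots> = Tr ** (z ** (Tsum r (HP lam) ** x1)) ** Tr"
                unfolding z3 using z(1) x1(1) by (simp add: H.m_assoc)
              finally show ?thesis unfolding x1(2) F_def .
            qed
            then have "cf (F D2) y = cf (F D) (cj y)"
              using yW DW(1) WB_comp[OF yW sg_W] by (simp add: cf_Tr_left cf_Tr_right o_assoc)
            also have "\<dots> = cf (F D) y" using os_y k by blast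
            finally have "cf (F D2) y = cf (F D) y" .
            moreover have "\<not> cen al \<subseteq> cen lam"
            proof
              assume sub: "cen al \<subseteq> cen lam"
              have "y k = p0 (d0 k)" using p0 by simp
              moreover have "1 \<le> d0 k \<and> d0 k \<le> 2*r" using WB_range[of d0 r k] p0(2) DW k cen_range by blast
              ultimately have "d0 k \<in> cen al" using PB_cen[OF HP_PB[OF p0(1)], of "d0 k"] k by simp
              then show False using dD[OF \<open>\<not> os\<close> p0(2) k(1)] sub by blast
            qed
            ultimately show ?thesis by blast
          qed simp
        qed
      qed
    qed
  next
    case False
    then have Jl: "r \<notin> Jset lam" and Ja: "r \<in> Jset al" by auto
    have cl: "cen lam = {}" using cen_empty_iff[OF lam] Jl by blast
    have PBl: "PB lam = HP lam" using PB_noncentral[OF lam Jl] .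
    have "((\<^bold>1 \<boxplus> Tr) ** z) ** Tsum r (PB lam) = (\<^bold>1 \<boxplus> Tr) ** Tsum r (DHat al id lam)"
      unfolding PBl z(2)[symmetric] using z(1) by (simp add: H.m_assoc)
    also have "\<dots> = Tsum r (DFull al id lam)"
    proof (rule cf_eqI)
      fix v assume v: "v \<in> W"
      have "v \<in> DFull al id lam \<longleftrightarrow> v \<in> DHat al id lam \<or> sg o v \<in> DHat al id lam"
      proof
        assume "v \<in> DFull al id lam"
        then obtain s t d where st: "s \<in> Ssg al" "t \<in> Ssg lam" "d \<in> DHat al id lam" "v = s o d o t"
          using DFull_cases[OF al lam] by blast
        then show "v \<in> DHat al id lam \<or> sg o v \<in> DHat al id lam"
          using Ssg_cases[OF st(1)] Ssg_cases[OF st(2)] Jl by auto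
      next
        assume "v \<in> DHat al id lam \<or> sg o v \<in> DHat al id lam"
        then show "v \<in> DFull al id lam"
          using DHat_DFull[of v al id lam] DHat_DFull[of "sg o v" al id lam] DFull_left_iff[OF sg_PB[OF al Ja], of v id lam] by blast
      qed
      then show "cf ((\<^bold>1 \<boxplus> Tr) ** Tsum r (DHat al id lam)) v = cf (Tsum r (DFull al id lam)) v"
        using hDB v parhDB[of v] parhDB[of "sg o v"] par_sg_comp(1)[OF v] by (auto simp: onep_left cf_Tsum)
    qed (use hDB in auto)
    finally have "zB ** Tsum r DA = ((\<^bold>1 \<boxplus> Tr) ** z) ** Tsum r DA" by (intro e) (use z in auto)
    also have "\<dots> = (\<^bold>1 \<boxplus> Tr) ** F DA" unfolding F_def using z(1) by (simp add: H.m_assoc)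
    finally have e1: "cf (zB ** Tsum r DA) y = cf (F DA) y + cf (F DA) (sg o y)" using yW DW by (simp add: onep_left)
    \<comment> \<open>As \<open>s\<^sub>r\<close> is not in \<open>W\<^sub>\<lambda>\<close>, translation is possible on the right side only.\<close>
    have parts: "{d \<in> DA. par d = par w} = D" "{d \<in> DA. par d = - par w} = {d o sg | d. d \<in> D \<and> r \<in> Jset ga}"
    proof -
      have c: "d \<in> DA \<longleftrightarrow> d \<in> D \<or> (d o sg \<in> D \<and> r \<in> Jset ga)" for d
      proof
        assume d: "d \<in> DA"
        have dDA: "d \<in> DFull lam w ga" using d by (simp add: DA_def)
        obtain s t d' where st: "s \<in> Ssg lam" "t \<in> Ssg ga" "d' \<in> DHat lam w ga" "d = s o d' o t"
          using DFull_cases[OF lam ga dDA] by blast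
        then show "d \<in> D \<or> (d o sg \<in> D \<and> r \<in> Jset ga)"
          using Ssg_cases[OF st(1)] Ssg_cases[OF st(2)] Jl by (auto simp: D_def)
      next
        assume "d \<in> D \<or> (d o sg \<in> D \<and> r \<in> Jset ga)"
        then show "d \<in> DA"
          using DHat_DFull[of d lam w ga] DHat_DFull[of "d o sg" lam w ga] DFull_right_iff[OF sg_PB[OF ga], of d lam w]
          unfolding D_def DA_def by blast
      qed
      have pp: "par d = - par w" if "d o sg \<in> D" for d
      proof -
        have "(d o sg) o sg \<in> W" using that DW WB_comp[OF _ sg_W] by blast
        then have "d \<in> W" by simp
        then show ?thesis using parD[OF that] par_sg_comp(2) by fastforce
      qed
      have ne: "par w \<noteq> - par w" using par_cases[of w] by auto
      show "{d \<in> DA. par d = par w} = D" using c parD pp ne by auto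
      show "{d \<in> DA. par d = - par w} = {d o sg | d. d \<in> D \<and> r \<in> Jset ga}"
      proof (intro Set.set_eqI iffI)
        fix d assume "d \<in> {d \<in> DA. par d = - par w}"
        then have "d o sg \<in> D" "r \<in> Jset ga" using c[of d] parD[of d] ne by auto
        moreover have "d = (d o sg) o sg" by simp
        ultimately show "d \<in> {d o sg | d. d \<in> D \<and> r \<in> Jset ga}" by blast
      next
        fix d assume "d \<in> {d o sg | d. d \<in> D \<and> r \<in> Jset ga}"
        then obtain d' where "d = d' o sg" "d' \<in> D" "r \<in> Jset ga" by blast
        then show "d \<in> {d \<in> DA. par d = - par w}" using c[of d] pp[of d] by auto
      qed
    qed
    have syW: "sg o y \<in> W" using yW WB_comp by auto
    have first: "cf (F DA) y = cf (F D) y" using restrict[OF DW(2), of y] parts(1) pary by simp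
    have "par (sg o y) = - par w" using par_sg_comp(1)[OF yW] pary by simp
    then have second: "cf (F DA) (sg o y) = cf (F {d o sg | d. d \<in> D \<and> r \<in> Jset ga}) (sg o y)"
      using restrict[OF DW(2), of "sg o y"] parts(2) by simp
    show ?thesis
    proof (rule result[of "cf (F DA) (sg o y)"])
      show "cf (zB ** Tsum r DA) y = cf (F D) y + cf (F DA) (sg o y)" using e1 first by simp
      show "cf (F DA) (sg o y) = 0 \<or> (cf (F DA) (sg o y) = cf (F D) y \<and> \<not> cen al \<subseteq> cen lam)"
      proof (cases "r \<in> Jset ga")
        case F: False
        then have em: "{d o sg | d. d \<in> D \<and> r \<in> Jset ga} = {}" by auto
        have "cf (F DA) (sg o y) = cf (F {}) (sg o y)" using second unfolding em .
        also have "\<dots> = 0" unfolding F_def using cf_Tsum_sum[OF z(1), of "{}"] by simp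
        finally show ?thesis by simp
      next
        case Jg: True
        define Ds where "Ds = {d o sg | d. d \<in> D \<and> r \<in> Jset ga}"
        have DsW: "Ds \<subseteq> W" unfolding Ds_def using DW WB_comp[OF _ sg_W] by blast
        have "Tsum r Ds = Tsum r D ** Tr"
        proof (rule cf_eqI)
          fix v assume v: "v \<in> W"
          have "v \<in> Ds \<longleftrightarrow> v o sg \<in> D"
          proof
            assume "v o sg \<in> D"
            moreover have "v = (v o sg) o sg" by simp
            ultimately show "v \<in> Ds" unfolding Ds_def using Jg by blast
          qed (auto simp: Ds_def)
          then show "cf (Tsum r Ds) v = cf (Tsum r D ** Tr) v" using v DW DsW by (simp add: cf_Tsum cf_Tr_right)
        qed (use DW DsW in auto)
        then have "F Ds = F D ** Tr" unfolding F_def using z(1) by (simp add: H.m_assoc)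
        then have s1: "cf (F DA) (sg o y) = cf (F D) (cj y)"
          using second syW DW by (simp add: Ds_def cf_Tr_right)
        show ?thesis
        proof (cases "\<exists>k\<in>cen ga. y k \<in> cen al")
          case True
          then obtain k where k: "k \<in> cen ga" "y k \<in> cen al" by blast
          then have "\<not> cen al \<subseteq> cen lam" using cl by auto
          then show ?thesis using s1 os_y[OF k] by simp
        next
          case none: False
          have "cf (F D) (cj y) = 0"
          proof (rule ccontr)
            assume "cf (F D) (cj y) \<noteq> 0"
            then obtain p2 d2 where p2: "p2 \<in> HP al" "d2 \<in> D" "cj y = p2 o d2" using supp[OF DW(1)] by blast
            have no: "y k \<notin> cen al" if "k \<in> cen ga" for k using that none by blast
            have ysW: "y o sg \<in> W" "cj y \<in> W" using yW WB_comp by auto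
            have no2: "(y o sg) k \<notin> cen al" if "k \<in> cen ga" for k
              using that PB_cen[OF sg_PB[OF ga Jg], of k] no by auto
            have no3: "(cj y) k \<notin> cen al" if k: "k \<in> cen ga" for k
            proof -
              have "1 \<le> (y o sg) k \<and> (y o sg) k \<le> 2*r" using WB_range[OF ysW(1), of k] cen_range[OF k] by blast
              then show ?thesis using PB_cen[OF sg_PB[OF al Ja], of "(y o sg) k"] no2[OF k] by auto
            qed
            have "\<not> os" using cl by (simp add: os_def)
            have "sgnS (cen ga) d0 = sgnS (cen ga) y" by (rule csgp[OF p0(3,1) yW no])
            moreover have "sgnS (cen ga) d2 = sgnS (cen ga) (cj y)" by (rule csgp[OF p2(3,1) ysW(2) no3])
            moreover have "sgnS (cen ga) (sg o (y o sg)) = sgnS (cen ga) (y o sg)"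
              by (rule csg_left[OF al sg_PB[OF al Ja] ysW(1) no2])
            moreover have "sgnS (cen ga) (y o sg) = - sgnS (cen ga) y" using csg_right[OF ga sg_PB[OF ga Jg] yW] by simp
            ultimately show False
              using csgD[OF \<open>\<not> os\<close> p0(2)] csgD[OF \<open>\<not> os\<close> p2(2)] csg_nz[of ga w] by (simp add: o_assoc)
          qed
          then show ?thesis using s1 by simp
        qed
      qed
    qed
  qed
qed

section \<open>The Hecke algebra of type D\<close>

lemma even_mult:
  assumes "x \<in> carrier H" "y \<in> carrier H" "\<And>w. cf x w \<noteq> 0 \<Longrightarrow> par w = a" "\<And>w. cf y w \<noteq> 0 \<Longrightarrow> par w = b" "cf (x ** y) w \<noteq> 0"
  shows "par w = a * b"
proof -
  obtain u v where "u \<in> W" "v \<in> W" "cf x u \<noteq> 0" "cf y v \<noteq> 0" "cf (Tw r u ** Tw r v) w \<noteq> 0"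
    using cf_mult_nz[OF assms(1,2,5)] .
  then show ?thesis using Tw_mult_par assms(3,4) by simp
qed

text \<open>The even part of the Hecke algebra.\<close>

definition Kc :: "hecke set" where
  "Kc = {x \<in> carrier H. \<forall>w. cf x w \<noteq> 0 \<longrightarrow> par w = 1}"

lemma Kc_H: "x \<in> Kc \<Longrightarrow> x \<in> carrier H"
  by (simp add: Kc_def)

lemma Kc_mult: "x \<in> Kc \<Longrightarrow> y \<in> Kc \<Longrightarrow> x ** y \<in> Kc"
  using even_mult[of x y 1 1] by (auto simp: Kc_def)

lemma Kc_add: "x \<in> Kc \<Longrightarrow> y \<in> Kc \<Longrightarrow> x \<boxplus> y \<in> Kc"
  by (force simp: Kc_def cf_add)

lemma cf_uminus: assumes "x \<in> carrier H" shows "cf (\<ominus>\<^bsub>H\<^esub> x) w = - cf x w"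
  using cf_add[OF assms H.a_inv_closed[OF assms], of w] H.r_neg[OF assms] by (simp add: eq_neg_iff_add_eq_0 add.commute)

lemma Kc_uminus: "x \<in> Kc \<Longrightarrow> \<ominus>\<^bsub>H\<^esub> x \<in> Kc"
  by (auto simp: Kc_def cf_uminus)

lemma Kc_one: "\<^bold>1 \<in> Kc"
  using cf_outside cf_one by (auto simp: Kc_def split: if_splits) (metis cf_one cf_outside par_id)

lemma Kc_zero: "\<^bold>0 \<in> Kc"
  by (auto simp: Kc_def)

lemma Tgen_Tw_id: assumes "1 \<le> k" "k \<le> r" shows "Tgen r k = Tw r (sB r k)"
proof -
  have "pinv id k < pinv id (Suc k)" by simp
  then show ?thesis using Tgen_Tw[OF WB_id assms] assms by simp
qed

lemma Kc_Tw: "w \<in> W \<Longrightarrow> par w = 1 \<Longrightarrow> Tw r w \<in> Kc"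
  using cf_outside by (auto simp: Kc_def) (metis cf_Tw cf_outside)

lemma Kc_scal: "scal r a \<in> Kc"
proof -
  have "cf (scal r a) w = a * cf \<^bold>1 w" for w using cf_scal[of "\<^bold>1" a w] by simp
  then show ?thesis using Kc_one by (auto simp: Kc_def)
qed

lemma Tr_conj_mem:
  assumes k: "1 \<le> k" "k < r"
  shows "Tr ** Tgen r k ** Tr \<in> Hcheck r"
proof (cases "k = r - 1")
  case True
  then show ?thesis unfolding Hcheck_def by (intro generate_ring.incl) auto
next
  case False
  then have far: "k + 2 \<le> r" using k by auto
  have "mon 1 [k, r] - mon 1 [r, k] \<in> hecke_rels r"
    unfolding hecke_rels_def using k far by (intro UnI1 CollectI exI[of _ k] exI[of _ r]) auto
  then have "Tword [k, r] = Tword [r, k]" using k by (intro Tword_rel) auto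
  then have "Tgen r k ** Tr = Tr ** Tgen r k" using k by (simp add: Tword_Cons)
  then have "Tr ** Tgen r k ** Tr = Tgen r k"
  proof -
    assume c: "Tgen r k ** Tr = Tr ** Tgen r k"
    have "Tr ** Tgen r k ** Tr = Tr ** (Tr ** Tgen r k)" using k by (simp add: H.m_assoc c)
    also have "\<dots> = (Tr ** Tr) ** Tgen r k" using k by (simp only: H.m_assoc Tr_closed Tgen_closed less_imp_le)
    finally show ?thesis using k by simp
  qed
  then show ?thesis unfolding Hcheck_def using k by (auto intro!: generate_ring.incl)
qed

lemma Tword_mem:
  assumes "ws \<in> lists {1..r}"
  shows "if par (word_prod (sB r) ws) = 1 then Tword ws \<in> Hcheck r else Tr ** Tword ws \<in> Hcheck r"
  using assms
proof (induction ws)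
  case Nil
  have "par (word_prod (sB r) []) = 1" unfolding word_prod_simps by simp
  moreover have "Tword [] \<in> Hcheck r" unfolding Tword_Nil Hcheck_def by (rule generate_ring.one)
  ultimately show ?case by (simp only: refl if_True)
next
  case (Cons k ws)
  have k: "1 \<le> k" "k \<le> r" using Cons.hyps by auto
  have ws: "word_prod (sB r) ws \<in> W" using Cons.hyps by (intro word_prod_WB)
  have c: "Tword ws \<in> carrier H" using Cons.hyps by simp
  have p: "par (word_prod (sB r) (k # ws)) = par (sB r k) * par (word_prod (sB r) ws)"
    unfolding word_prod_simps using par_comp[OF ws sB_WB[OF k]] .
  show ?case
  proof (cases "k = r")
    case True
    have "Tr ** (Tr ** Tword ws) = Tword ws" using c by (simp add: H.m_assoc[symmetric])
    then show ?thesis unfolding p using Cons.IH True par_cases[of "word_prod (sB r) ws"] by (auto simp: Tword_Cons)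
  next
    case False
    then have k2: "k < r" using k by simp
    have Tk: "Tgen r k \<in> Hcheck r" unfolding Hcheck_def using k k2 by (auto intro!: generate_ring.incl)
    have m: "x ** y \<in> Hcheck r" if "x \<in> Hcheck r" "y \<in> Hcheck r" for x y
      using that unfolding Hcheck_def by (rule generate_ring.eng_mult)
    have "Tr ** (Tgen r k ** Tword ws) = (Tr ** Tgen r k ** Tr) ** (Tr ** Tword ws)"
    proof -
      have "(Tr ** Tgen r k ** Tr) ** (Tr ** Tword ws) = Tr ** (Tgen r k ** ((Tr ** Tr) ** Tword ws))"
        using c k by (simp only: H.m_assoc H.m_closed Tgen_closed one_le_r order_refl)
      then show ?thesis using c by simp
    qed
    then show ?thesis unfolding p using Cons.IH par_sB[OF k] False m[OF Tk] m[OF Tr_conj_mem[OF k(1) k2]]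
      by (auto simp: Tword_Cons)
  qed
qed

text \<open>For the nontrivial inclusion, a word whose product is even contains an even number of letters
  \<open>r\<close>; grouping them in pairs writes it in the generators \<open>T\<^sub>k\<close> and
  \<open>T\<^sub>r T\<^sub>k T\<^sub>r\<close>, and the latter equals \<open>T\<^sub>k\<close> unless
  \<open>k = r - 1\<close>.\<close>

lemma Hcheck_Kc: "Hcheck r = Kc"
proof
  show "Hcheck r \<subseteq> Kc"
  proof
    fix x assume "x \<in> Hcheck r"
    then show "x \<in> Kc" unfolding Hcheck_def
    proof (induction x rule: generate_ring.induct)
      case (incl x)
      have g: "Tgen r k \<in> Kc" if "1 \<le> k" "k < r" for k
        using that Tgen_Tw_id[of k] Kc_Tw[of "sB r k"] par_sB[of k] by simp
      have "Tr ** Tgen r (r - 1) ** Tr \<in> Kc"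
      proof -
        define s where "s = sB r (r - 1)"
        have r1: "1 \<le> r - 1" "r - 1 \<le> r" "r - 1 \<noteq> r" using rank by auto
        have s: "s \<in> W" "par s = 1" using par_sB[OF r1(1,2)] r1 by (auto simp: s_def)
        have "Tr ** Tgen r (r - 1) ** Tr = Tw r (cj s)"
          using Tgen_Tw_id[OF r1(1,2)] Tr_Tw(1)[OF s(1)] Tr_Tw(2)[of "sg o s"] WB_comp[OF sg_W s(1)] by (simp add: s_def)
        moreover have "par (cj s) = 1"
          using par_sg_comp(2)[of "sg o s"] par_sg_comp(1)[OF s(1)] s WB_comp[OF sg_W s(1)] by simp
        ultimately show ?thesis using Kc_Tw WB_comp[OF WB_comp[OF sg_W s(1)] sg_W] by simp
      qed
      then show ?case using incl g Kc_scal by auto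
    qed (use Kc_one Kc_mult Kc_add Kc_uminus in auto)
  qed
  have zero: "\<^bold>0 \<in> Hcheck r"
  proof -
    have "scal r 0 \<in> Hcheck r" unfolding Hcheck_def by (intro generate_ring.incl UnI1 rangeI)
    then show ?thesis by (simp only: scal_zero)
  qed
  show "Kc \<subseteq> Hcheck r"
  proof
    fix x assume x: "x \<in> Kc"
    have t: "scal r (cf x w) ** Tw r w \<in> Hcheck r" if w: "w \<in> W" for w
    proof (cases "cf x w = 0")
      case True
      then show ?thesis using w zero by simp
    next
      case False
      then have p: "par w = 1" using x by (simp add: Kc_def)
      obtain ws where ws: "reduced_word r ws w" using exists_reduced_word[OF w] by blast
      then have "Tword ws \<in> Hcheck r" using Tword_mem[of ws] p by (auto simp: reduced_word_def split: if_splits)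
      then have "Tw r w \<in> Hcheck r" using Tw_reduced[OF ws] by simp
      moreover have "scal r (cf x w) \<in> Hcheck r" unfolding Hcheck_def by (intro generate_ring.incl UnI1 rangeI)
      ultimately show ?thesis unfolding Hcheck_def by (intro generate_ring.eng_mult)
    qed
    have "(\<Oplus>\<^bsub>H\<^esub>w\<in>A. scal r (cf x w) ** Tw r w) \<in> Hcheck r" if "finite A" "A \<subseteq> W" for A
      using that
    proof (induction A)
      case empty
      then show ?case using zero by simp
    next
      case (insert a A)
      then have "(\<Oplus>\<^bsub>H\<^esub>w\<in>insert a A. scal r (cf x w) ** Tw r w)
          = (scal r (cf x a) ** Tw r a) \<boxplus> (\<Oplus>\<^bsub>H\<^esub>w\<in>A. scal r (cf x w) ** Tw r w)"
        by (intro H.finsum_insert) (auto simp: subset_iff)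
      moreover have "scal r (cf x a) ** Tw r a \<in> Hcheck r" "(\<Oplus>\<^bsub>H\<^esub>w\<in>A. scal r (cf x w) ** Tw r w) \<in> Hcheck r"
        using insert t by auto
      ultimately show ?case unfolding Hcheck_def by (simp add: generate_ring.eng_add)
    qed
    then have "mk (cf x) \<in> Hcheck r" unfolding mk_def by simp
    then show "x \<in> Hcheck r" using mk_cf[OF Kc_H[OF x]] by simp
  qed
qed

subsection \<open>The parity of distinguished representatives\<close>

text \<open>The distinguished representative is increasing on the central blocks, so by symmetry it moves no central
  position across the middle; the positions which it does move are counted by the corner of the matrix.\<close>

lemma par_dmat:
  assumes A: "A \<in> Xi n r" shows "par (dm A) = sgn_mat n A"
proof -
  define lam mu d where "lam = rowW A" and "mu = colW A" and "d = dm A"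
  note m = mat_triple_props[OF A, folded lam_def mu_def d_def]
  note dI = min_repsB_Inc[OF m(1-3)]
  define K where "K = {k \<in> {1..2*r}. n + 2 \<le> blk n mu k \<and> blk n lam (d k) \<le> n}"
  have "{k \<in> {1..2*r}. r < k \<and> d k \<le> r} = K"
  proof (intro Set.set_eqI iffI)
    fix k assume k: "k \<in> K"
    then have k1: "1 \<le> k" "k \<le> 2*r" "n + 2 \<le> blk n mu k" "blk n lam (d k) \<le> n" by (auto simp: K_def)
    then show "k \<in> {k \<in> {1..2*r}. r < k \<and> d k \<le> r}"
      using blk_high[OF m(2) k1(1-3)] blk_low[OF m(1) _ _ k1(4)] WB_range[OF dI(1) k1(1,2)] by auto
  next
    fix k assume "k \<in> {k \<in> {1..2*r}. r < k \<and> d k \<le> r}"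
    then have k: "1 \<le> k" "k \<le> 2*r" "r < k" "d k \<le> r" by auto
    have dk: "1 \<le> d k" "d k \<le> 2*r" using WB_range[OF dI(1) k(1,2)] by auto
    have dm: "d (mir r k) = mir r (d k)" using WB_mir[OF dI(1) k(1,2)] .
    have "n + 2 \<le> blk n mu k"
    proof (rule ccontr)
      assume "\<not> n + 2 \<le> blk n mu k"
      moreover have "\<not> blk n mu k \<le> n" using blk_low[OF m(2) k(1,2)] k by auto
      ultimately have b: "blk n mu k = n + 1" by simp
      then have "d (mir r k) < d k" using Inc_strict[OF m(2) dI(2), of "mir r k" k] blk_mir[OF m(2) k(1,2)] k by simp
      then show False using dm k dk by simp
    qed
    moreover have "blk n lam (d k) \<le> n"
    proof (rule ccontr)
      assume "\<not> blk n lam (d k) \<le> n"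
      moreover have "\<not> n + 2 \<le> blk n lam (d k)" using blk_high[OF m(1) dk] k by auto
      ultimately have b: "blk n lam (d k) = n + 1" by simp
      have "pinv d (d k) < pinv d (mir r (d k))"
        using Inc_strict[OF m(1) dI(3), of "d k" "mir r (d k)"] blk_mir[OF m(1) dk] b dk k by simp
      moreover have "pinv d (mir r (d k)) = mir r k" unfolding dm[symmetric] using dI(1) by simp
      ultimately have "k < mir r k" using dI(1) by simp
      then show False using k by simp
    qed
    ultimately show "k \<in> K" using k by (simp add: K_def)
  qed
  then have p: "par d = (- 1) ^ card K" by (simp add: par_def sgnS_card)
  have finK: "finite K" by (simp add: K_def)
  have "card K = (\<Sum>i=1..n. card {k \<in> K. blk n lam (d k) = i})"
    using finK blk_range(1)[OF m(1)] WB_range[OF dI(1)] by (intro card_fibres[symmetric]) (auto simp: K_def)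
  also have "\<dots> = (\<Sum>i=1..n. \<Sum>j=n + 2..2*n + 1. wmat lam d mu i j)"
  proof (rule sum.cong[OF refl])
    fix i assume i: "i \<in> {1..n}"
    have "card {k \<in> K. blk n lam (d k) = i} = (\<Sum>j=n + 2..2*n + 1. card {k \<in> {k \<in> K. blk n lam (d k) = i}. blk n mu k = j})"
      using finK blk_range(2)[OF m(2)] by (intro card_fibres[symmetric]) (auto simp: K_def)
    also have "\<dots> = (\<Sum>j=n + 2..2*n + 1. wmat lam d mu i j)"
      unfolding wmat_def using i by (intro sum.cong refl arg_cong[where f = card]) (auto simp: K_def)
    finally show "card {k \<in> K. blk n lam (d k) = i} = (\<Sum>j=n + 2..2*n + 1. wmat lam d mu i j)" .
  qed
  finally have "int (card K) = (\<Sum>i=1..n. \<Sum>j=n + 2..2*n + 1. A i j)" using m(4) by simp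
  then have "even (\<Sum>i=1..n. \<Sum>j=n + 2..2*n + 1. A i j) \<longleftrightarrow> even (card K)" by (metis even_of_nat)
  then show ?thesis unfolding d_def[symmetric] p sgn_mat_def by (simp add: minus_one_power_iff)
qed

end

section \<open>Endomorphisms of direct sums of right ideals\<close>

text \<open>The three endomorphism algebras have the same shape; they differ in the ring \<open>K\<close> that acts from
  the right and in the summands, for which only closure properties matter.\<close>

locale hecke_endo = type_B +
  fixes K :: "hecke set" and I :: "'i set" and M :: "'i \<Rightarrow> hecke set"
  assumes finI: "finite I" and K_H: "K \<subseteq> carrier H"
    and M_H: "\<And>i. i \<in> I \<Longrightarrow> M i \<subseteq> carrier H" and M_zero: "\<And>i. i \<in> I \<Longrightarrow> \<^bold>0 \<in> M i"
    and M_add: "\<And>i x y. i \<in> I \<Longrightarrow> x \<in> M i \<Longrightarrow> y \<in> M i \<Longrightarrow> x \<boxplus> y \<in> M i"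
    and M_mult: "\<And>i x k. i \<in> I \<Longrightarrow> x \<in> M i \<Longrightarrow> k \<in> K \<Longrightarrow> x ** k \<in> M i"
    and M_scal: "\<And>i x a. i \<in> I \<Longrightarrow> x \<in> M i \<Longrightarrow> scal r a ** x \<in> M i"
begin

abbreviation "EA \<equiv> End_alg r K I M"
abbreviation "DS \<equiv> dsum I M"

lemma DS_iff: "u \<in> DS \<longleftrightarrow> u \<in> extensional I \<and> (\<forall>i\<in>I. u i \<in> M i)"
  by (auto simp: dsum_def PiE_def)

lemma DS_H: "u \<in> DS \<Longrightarrow> i \<in> I \<Longrightarrow> u i \<in> carrier H"
  using M_H by (auto simp: DS_iff)

lemma DS_M: "u \<in> DS \<Longrightarrow> i \<in> I \<Longrightarrow> u i \<in> M i"
  by (auto simp: DS_iff)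

lemma DS_eqI: "u \<in> DS \<Longrightarrow> v \<in> DS \<Longrightarrow> (\<And>i. i \<in> I \<Longrightarrow> u i = v i) \<Longrightarrow> u = v"
  by (auto simp: DS_iff intro: extensionalityI)

lemma DS_restrict: "(\<And>i. i \<in> I \<Longrightarrow> f i \<in> M i) \<Longrightarrow> (\<lambda>i\<in>I. f i) \<in> DS"
  by (auto simp: DS_iff)

lemma DS_add: "u \<in> DS \<Longrightarrow> v \<in> DS \<Longrightarrow> (\<lambda>i\<in>I. u i \<boxplus> v i) \<in> DS"
  using M_add by (intro DS_restrict) (auto simp: DS_M)

lemma DS_mult: "u \<in> DS \<Longrightarrow> k \<in> K \<Longrightarrow> (\<lambda>i\<in>I. u i ** k) \<in> DS"
  using M_mult by (intro DS_restrict) (auto simp: DS_M)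

lemma dinj_DS: "m \<in> M i \<Longrightarrow> i \<in> I \<Longrightarrow> dinj r I i m \<in> DS"
  unfolding dinj_def using M_zero by (intro DS_restrict) auto

lemma dinj_apply: "j \<in> I \<Longrightarrow> dinj r I i m j = (if j = i then m else \<^bold>0)"
  by (simp add: dinj_def)

lemma EA_iff: "\<phi> \<in> carrier EA \<longleftrightarrow> \<phi> \<in> extensional DS \<and> (\<forall>u\<in>DS. \<phi> u \<in> DS) \<and>
   (\<forall>u\<in>DS. \<forall>v\<in>DS. \<phi> (\<lambda>i\<in>I. u i \<boxplus> v i) = (\<lambda>i\<in>I. \<phi> u i \<boxplus> \<phi> v i)) \<and>
   (\<forall>u\<in>DS. \<forall>k\<in>K. \<phi> (\<lambda>i\<in>I. u i ** k) = (\<lambda>i\<in>I. \<phi> u i ** k))"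
  by (auto simp: End_alg_def PiE_def)

lemma EA_DS: "\<phi> \<in> carrier EA \<Longrightarrow> u \<in> DS \<Longrightarrow> \<phi> u \<in> DS"
  by (auto simp: EA_iff)

lemma EA_add: "\<phi> \<in> carrier EA \<Longrightarrow> u \<in> DS \<Longrightarrow> v \<in> DS \<Longrightarrow> \<phi> (\<lambda>i\<in>I. u i \<boxplus> v i) = (\<lambda>i\<in>I. \<phi> u i \<boxplus> \<phi> v i)"
  by (auto simp: EA_iff)

lemma EA_eqI: "\<phi> \<in> carrier EA \<Longrightarrow> \<psi> \<in> carrier EA \<Longrightarrow> (\<And>u. u \<in> DS \<Longrightarrow> \<phi> u = \<psi> u) \<Longrightarrow> \<phi> = \<psi>"
  by (auto simp: EA_iff intro: extensionalityI)

text \<open>The identity map is the sum of the injections of the finitely many summands.\<close>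

lemma EA_generators:
  assumes \<phi>: "\<phi> \<in> carrier EA" and \<psi>: "\<psi> \<in> carrier EA"
    and eq: "\<And>k m. k \<in> I \<Longrightarrow> m \<in> M k \<Longrightarrow> \<phi> (dinj r I k m) = \<psi> (dinj r I k m)"
  shows "\<phi> = \<psi>"
proof (rule EA_eqI[OF \<phi> \<psi>])
  fix u assume u: "u \<in> DS"
  define R where "R S = (\<lambda>i\<in>I. if i \<in> S then u i else \<^bold>0)" for S
  have RD: "R S \<in> DS" for S unfolding R_def using u M_zero by (intro DS_restrict) (auto simp: DS_M)
  have zero: "\<chi> (R {}) i = \<^bold>0" if "\<chi> \<in> carrier EA" "i \<in> I" for \<chi> i
  proof -
    have "(\<lambda>i\<in>I. R {} i \<boxplus> R {} i) = R {}" by (auto simp: R_def fun_eq_iff)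
    then have eq: "\<chi> (R {}) = (\<lambda>i\<in>I. \<chi> (R {}) i \<boxplus> \<chi> (R {}) i)" using EA_add[OF that(1) RD RD, of "{}" "{}"] by simp
    have "\<chi> (R {}) i = \<chi> (R {}) i \<boxplus> \<chi> (R {}) i" by (rule trans[OF fun_cong[OF eq] restrict_apply'[OF that(2)]])
    then show ?thesis using H.add.l_cancel_one' DS_H[OF EA_DS[OF that(1) RD] that(2)] by metis
  qed
  have "\<phi> (R S) = \<psi> (R S)" if "finite S" "S \<subseteq> I" for S
    using that
  proof (induction S)
    case empty
    show ?case using zero[OF \<phi>] zero[OF \<psi>] EA_DS[OF \<phi> RD] EA_DS[OF \<psi> RD] by (intro DS_eqI) auto
  next
    case (insert k S)
    have k: "k \<in> I" "k \<notin> S" using insert by auto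
    have d: "dinj r I k (u k) \<in> DS" using dinj_DS DS_M[OF u] k by blast
    have e: "R (insert k S) = (\<lambda>i\<in>I. R S i \<boxplus> dinj r I k (u k) i)"
      using k DS_H[OF u] by (auto simp: R_def dinj_apply fun_eq_iff)
    show ?case unfolding e EA_add[OF \<phi> RD d] EA_add[OF \<psi> RD d]
      using insert eq[OF k(1) DS_M[OF u k(1)]] by simp
  qed
  moreover have "R I = u" using u by (auto simp: R_def fun_eq_iff DS_iff extensional_def)
  ultimately show "\<phi> u = \<psi> u" using finI by (metis order_refl)
qed

definition Phi :: "hecke \<Rightarrow> 'i \<Rightarrow> 'i \<Rightarrow> ('i \<Rightarrow> hecke) \<Rightarrow> 'i \<Rightarrow> hecke" where
  "Phi z i j = (\<lambda>u\<in>DS. dinj r I i (z ** u j))"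

lemma Phi_apply: "u \<in> DS \<Longrightarrow> Phi z i j u = dinj r I i (z ** u j)"
  by (simp add: Phi_def)

lemma Phi_closed:
  assumes z: "z \<in> carrier H" and ij: "i \<in> I" "j \<in> I" and M: "\<And>m. m \<in> M j \<Longrightarrow> z ** m \<in> M i"
  shows "Phi z i j \<in> carrier EA"
proof -
  have KH: "k \<in> carrier H" if "k \<in> K" for k using K_H that by blast
  show ?thesis unfolding EA_iff
  proof (intro conjI ballI)
    show "Phi z i j \<in> extensional DS" by (simp add: Phi_def)
    show "Phi z i j u \<in> DS" if "u \<in> DS" for u
      unfolding Phi_apply[OF that] by (intro dinj_DS M DS_M that ij)
    show "Phi z i j (\<lambda>i\<in>I. u i \<boxplus> v i) = (\<lambda>k\<in>I. Phi z i j u k \<boxplus> Phi z i j v k)" if "u \<in> DS" "v \<in> DS" for u v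
      using that ij z DS_H[OF that(1) ij(2)] DS_H[OF that(2) ij(2)] DS_add[OF that]
      by (simp add: Phi_apply fun_eq_iff dinj_def H.r_distr)
    show "Phi z i j (\<lambda>i\<in>I. u i ** k) = (\<lambda>l\<in>I. Phi z i j u l ** k)" if "u \<in> DS" "k \<in> K" for u k
      using that ij z DS_H[OF that(1) ij(2)] DS_mult[OF that] KH[OF that(2)]
      by (simp add: Phi_apply fun_eq_iff dinj_def H.m_assoc)
  qed
qed

lemma EA_abelian_monoid: "abelian_monoid EA"
proof (rule abelian_monoidI)
  have sel: "add EA = (\<lambda>\<phi> \<psi>. \<lambda>u\<in>DS. \<lambda>i\<in>I. \<phi> u i \<boxplus> \<psi> u i)" "zero EA = (\<lambda>u\<in>DS. \<lambda>i\<in>I. \<^bold>0)"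
    by (simp_all add: End_alg_def)
  have zeroD: "(\<lambda>i\<in>I. \<^bold>0) \<in> DS" using M_zero by (intro DS_restrict)
  have KH: "k \<in> carrier H" if "k \<in> K" for k using K_H that by blast
  have vH: "\<phi> u i \<in> carrier H" if "\<phi> \<in> carrier EA" "u \<in> DS" "i \<in> I" for \<phi> u i using DS_H[OF EA_DS] that by blast
  show closed: "\<phi> \<oplus>\<^bsub>EA\<^esub> \<psi> \<in> carrier EA" if p: "\<phi> \<in> carrier EA" "\<psi> \<in> carrier EA" for \<phi> \<psi>
    unfolding EA_iff
  proof (intro conjI ballI)
    show "\<phi> \<oplus>\<^bsub>EA\<^esub> \<psi> \<in> extensional DS" by (simp add: sel)
    show "(\<phi> \<oplus>\<^bsub>EA\<^esub> \<psi>) u \<in> DS" if "u \<in> DS" for u using DS_add EA_DS p that by (simp add: sel)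
    show "(\<phi> \<oplus>\<^bsub>EA\<^esub> \<psi>) (\<lambda>i\<in>I. u i \<boxplus> v i) = (\<lambda>i\<in>I. (\<phi> \<oplus>\<^bsub>EA\<^esub> \<psi>) u i \<boxplus> (\<phi> \<oplus>\<^bsub>EA\<^esub> \<psi>) v i)" if u: "u \<in> DS" "v \<in> DS" for u v
      using DS_add[OF u] u p EA_add[OF p(1) u] EA_add[OF p(2) u] vH[OF p(1)] vH[OF p(2)]
      by (simp add: sel fun_eq_iff H.add.m_ac)
    show "(\<phi> \<oplus>\<^bsub>EA\<^esub> \<psi>) (\<lambda>i\<in>I. u i ** k) = (\<lambda>i\<in>I. (\<phi> \<oplus>\<^bsub>EA\<^esub> \<psi>) u i ** k)" if u: "u \<in> DS" "k \<in> K" for u k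
    proof -
      have "\<phi> (\<lambda>i\<in>I. u i ** k) = (\<lambda>i\<in>I. \<phi> u i ** k)" "\<psi> (\<lambda>i\<in>I. u i ** k) = (\<lambda>i\<in>I. \<psi> u i ** k)" using p u by (auto simp: EA_iff)
      then show ?thesis using DS_mult[OF u] u vH[OF p(1)] vH[OF p(2)] KH by (simp add: sel fun_eq_iff H.l_distr)
    qed
  qed
  show "\<zero>\<^bsub>EA\<^esub> \<in> carrier EA"
    unfolding EA_iff using zeroD DS_add DS_mult KH by (auto simp: sel fun_eq_iff)
  fix \<phi> \<psi> \<chi> assume p: "\<phi> \<in> carrier EA" "\<psi> \<in> carrier EA"
  show "\<phi> \<oplus>\<^bsub>EA\<^esub> \<psi> = \<psi> \<oplus>\<^bsub>EA\<^esub> \<phi>" using p vH[OF p(1)] vH[OF p(2)]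
    by (simp add: sel fun_eq_iff H.add.m_comm restrict_def)
  show "\<zero>\<^bsub>EA\<^esub> \<oplus>\<^bsub>EA\<^esub> \<phi> = \<phi>"
  proof (rule EA_eqI[OF _ p(1)])
    show "\<zero>\<^bsub>EA\<^esub> \<oplus>\<^bsub>EA\<^esub> \<phi> \<in> carrier EA"
      using closed[OF \<open>\<zero>\<^bsub>EA\<^esub> \<in> carrier EA\<close> p(1)] .
    fix u assume u: "u \<in> DS"
    show "(\<zero>\<^bsub>EA\<^esub> \<oplus>\<^bsub>EA\<^esub> \<phi>) u = \<phi> u"
    proof (rule DS_eqI)
      show "(\<zero>\<^bsub>EA\<^esub> \<oplus>\<^bsub>EA\<^esub> \<phi>) u \<in> DS" using DS_add[OF zeroD EA_DS[OF p(1) u]] u by (simp add: sel)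
    qed (use u p vH[OF p(1)] EA_DS[OF p(1)] in \<open>auto simp: sel\<close>)
  qed
  assume c: "\<chi> \<in> carrier EA"
  show "(\<phi> \<oplus>\<^bsub>EA\<^esub> \<psi>) \<oplus>\<^bsub>EA\<^esub> \<chi> = \<phi> \<oplus>\<^bsub>EA\<^esub> (\<psi> \<oplus>\<^bsub>EA\<^esub> \<chi>)"
    using vH[OF p(1)] vH[OF p(2)] vH[OF c] by (simp add: sel fun_eq_iff H.add.m_assoc restrict_def)
qed

lemma EA_smult: assumes \<phi>: "\<phi> \<in> carrier EA" shows "a \<odot>\<^bsub>EA\<^esub> \<phi> \<in> carrier EA"
    "u \<in> DS \<Longrightarrow> i \<in> I \<Longrightarrow> (a \<odot>\<^bsub>EA\<^esub> \<phi>) u i = scal r a ** \<phi> u i"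
proof -
  have sel: "module.smult EA = (\<lambda>a \<phi>. \<lambda>u\<in>DS. \<lambda>i\<in>I. scal r a ** \<phi> u i)" by (simp add: End_alg_def)
  have scalD: "(\<lambda>i\<in>I. scal r a ** u i) \<in> DS" if "u \<in> DS" for u using that M_scal by (intro DS_restrict) (auto simp: DS_M)
  have KH: "k \<in> carrier H" if "k \<in> K" for k using K_H that by blast
  have vH: "\<phi> u i \<in> carrier H" if "u \<in> DS" "i \<in> I" for u i using DS_H[OF EA_DS[OF \<phi>]] that by blast
  show "a \<odot>\<^bsub>EA\<^esub> \<phi> \<in> carrier EA"
    unfolding EA_iff
  proof (intro conjI ballI)
    show "a \<odot>\<^bsub>EA\<^esub> \<phi> \<in> extensional DS" by (simp add: sel)
    show "(a \<odot>\<^bsub>EA\<^esub> \<phi>) u \<in> DS" if "u \<in> DS" for u using scalD[OF EA_DS[OF \<phi> that]] that by (simp add: sel)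
    show "(a \<odot>\<^bsub>EA\<^esub> \<phi>) (\<lambda>i\<in>I. u i \<boxplus> v i) = (\<lambda>i\<in>I. (a \<odot>\<^bsub>EA\<^esub> \<phi>) u i \<boxplus> (a \<odot>\<^bsub>EA\<^esub> \<phi>) v i)" if u: "u \<in> DS" "v \<in> DS" for u v
      using DS_add[OF u] u EA_add[OF \<phi> u] vH by (simp add: sel fun_eq_iff H.r_distr)
    show "(a \<odot>\<^bsub>EA\<^esub> \<phi>) (\<lambda>i\<in>I. u i ** k) = (\<lambda>i\<in>I. (a \<odot>\<^bsub>EA\<^esub> \<phi>) u i ** k)" if u: "u \<in> DS" "k \<in> K" for u k
    proof -
      have "\<phi> (\<lambda>i\<in>I. u i ** k) = (\<lambda>i\<in>I. \<phi> u i ** k)" using \<phi> u by (auto simp: EA_iff)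
      then show ?thesis using DS_mult[OF u] u vH KH by (simp add: sel fun_eq_iff H.m_assoc)
    qed
  qed
  show "u \<in> DS \<Longrightarrow> i \<in> I \<Longrightarrow> (a \<odot>\<^bsub>EA\<^esub> \<phi>) u i = scal r a ** \<phi> u i" by (simp add: sel)
qed

lemma EA_finsum:
  assumes "finite P" "\<And>p. p \<in> P \<Longrightarrow> f p \<in> carrier EA"
  shows "(\<Oplus>\<^bsub>EA\<^esub>p\<in>P. f p) \<in> carrier EA"
    "\<And>u i. u \<in> DS \<Longrightarrow> i \<in> I \<Longrightarrow> (\<Oplus>\<^bsub>EA\<^esub>p\<in>P. f p) u i = (\<Oplus>\<^bsub>H\<^esub>p\<in>P. f p u i)"
proof -
  interpret E: abelian_monoid EA by (rule EA_abelian_monoid)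
  show "(\<Oplus>\<^bsub>EA\<^esub>p\<in>P. f p) \<in> carrier EA" using assms(2) by (intro E.finsum_closed) auto
  fix u i assume u: "u \<in> DS" "i \<in> I"
  show "(\<Oplus>\<^bsub>EA\<^esub>p\<in>P. f p) u i = (\<Oplus>\<^bsub>H\<^esub>p\<in>P. f p u i)"
    using assms
  proof (induction P)
    case empty
    have "\<zero>\<^bsub>EA\<^esub> u i = \<^bold>0" using u by (simp add: End_alg_def)
    then show ?case by (simp only: E.finsum_empty H.finsum_empty)
  next
    case (insert p P)
    have c: "f q u i \<in> carrier H" if "q \<in> insert p P" for q using DS_H[OF EA_DS[OF insert.prems[OF that] u(1)] u(2)] .
    have "(\<Oplus>\<^bsub>EA\<^esub>q\<in>insert p P. f q) = f p \<oplus>\<^bsub>EA\<^esub> (\<Oplus>\<^bsub>EA\<^esub>q\<in>P. f q)"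
      using insert by (intro E.finsum_insert) auto
    moreover have "(\<Oplus>\<^bsub>H\<^esub>q\<in>insert p P. f q u i) = f p u i \<boxplus> (\<Oplus>\<^bsub>H\<^esub>q\<in>P. f q u i)"
      using insert c by (intro H.finsum_insert) auto
    moreover have "(f p \<oplus>\<^bsub>EA\<^esub> (\<Oplus>\<^bsub>EA\<^esub>q\<in>P. f q)) u i = f p u i \<boxplus> (\<Oplus>\<^bsub>EA\<^esub>q\<in>P. f q) u i"
      using u by (simp add: End_alg_def)
    ultimately show ?case using insert by simp
  qed
qed

lemma EA_lincomb:
  assumes "finite P" "\<And>p. p \<in> P \<Longrightarrow> f p \<in> carrier EA" "u \<in> DS" "i \<in> I"
  shows "(\<Oplus>\<^bsub>EA\<^esub>p\<in>P. c p \<odot>\<^bsub>EA\<^esub> f p) u i = (\<Oplus>\<^bsub>H\<^esub>p\<in>P. scal r (c p) ** f p u i)"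
proof -
  have "(\<Oplus>\<^bsub>EA\<^esub>p\<in>P. c p \<odot>\<^bsub>EA\<^esub> f p) u i = (\<Oplus>\<^bsub>H\<^esub>p\<in>P. (c p \<odot>\<^bsub>EA\<^esub> f p) u i)"
    using assms EA_smult by (intro EA_finsum(2)) auto
  also have "\<dots> = (\<Oplus>\<^bsub>H\<^esub>p\<in>P. scal r (c p) ** f p u i)"
    using assms EA_smult DS_H[OF EA_DS] by (intro H.finsum_cong') (simp_all add: Pi_iff)
  finally show ?thesis .
qed

lemma EA_lincomb_closed:
  assumes "finite P" "\<And>p. p \<in> P \<Longrightarrow> f p \<in> carrier EA"
  shows "(\<Oplus>\<^bsub>EA\<^esub>p\<in>P. c p \<odot>\<^bsub>EA\<^esub> f p) \<in> carrier EA"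
  using assms EA_smult by (intro EA_finsum(1)) auto

lemma EA_mult: "\<phi> \<in> carrier EA \<Longrightarrow> \<psi> \<in> carrier EA \<Longrightarrow> u \<in> DS \<Longrightarrow> (\<phi> \<otimes>\<^bsub>EA\<^esub> \<psi>) u = \<phi> (\<psi> u)"
  by (simp add: End_alg_def compose_def)

lemma EA_mult_closed: assumes "\<phi> \<in> carrier EA" "\<psi> \<in> carrier EA" shows "\<phi> \<otimes>\<^bsub>EA\<^esub> \<psi> \<in> carrier EA"
proof -
  have sel: "\<phi> \<otimes>\<^bsub>EA\<^esub> \<psi> = compose DS \<phi> \<psi>" by (simp add: End_alg_def)
  show ?thesis unfolding EA_iff sel
    using assms DS_add DS_mult by (auto simp: EA_iff compose_eq)
qed

end

text \<open>The description by generators has a solution, left multiplication by \<open>z\<close>, and at most one.\<close>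

lemma (in type_B) basis_hom_Phi:
  fixes K :: "hecke set" and I :: "'i set" and x :: "'i \<Rightarrow> hecke"
  assumes E: "hecke_endo r K I (\<lambda>k. rmod r K (x k))"
    and x: "\<And>k. k \<in> I \<Longrightarrow> x k \<in> carrier H" and one: "\<^bold>1 \<in> K" and ij: "i \<in> I" "j \<in> I"
    and z: "z \<in> carrier H" "z ** x j = Tsum r D" and z': "z' \<in> K" "Tsum r D = x i ** z'"
    and Kmult: "\<And>a b. a \<in> K \<Longrightarrow> b \<in> K \<Longrightarrow> a ** b \<in> K"
  shows "basis_hom r K I x i D j = hecke_endo.Phi r I (\<lambda>k. rmod r K (x k)) z i j"
    "hecke_endo.Phi r I (\<lambda>k. rmod r K (x k)) z i j \<in> carrier (End_alg r K I (\<lambda>k. rmod r K (x k)))"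
proof -
  interpret E: hecke_endo r K I "\<lambda>k. rmod r K (x k)" by (rule E)
  have KH: "k \<in> carrier H" if "k \<in> K" for k using E.K_H that by blast
  have zm: "z ** m \<in> rmod r K (x i)" if m: "m \<in> rmod r K (x j)" for m
  proof -
    obtain k where k: "k \<in> K" "m = x j ** k" using m by (auto simp: rmod_def)
    have "z ** m = (z ** x j) ** k" using k z(1) x ij KH by (simp add: H.m_assoc)
    also have "\<dots> = x i ** (z' ** k)" unfolding z(2) z'(2) using x ij KH k z' by (simp add: H.m_assoc)
    finally show ?thesis using Kmult[OF z'(1) k(1)] by (auto simp: rmod_def)
  qed
  show Phi: "E.Phi z i j \<in> carrier E.EA" by (rule E.Phi_closed[OF z(1) ij zm])
  have mem: "x k ** a \<in> rmod r K (x k)" if "a \<in> K" for k a using that by (auto simp: rmod_def)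
  have val: "E.Phi z i j (dinj r I k (x k ** a)) = dinj r I i (if k = j then Tsum r D ** a else \<^bold>0)"
    if k: "k \<in> I" "a \<in> K" for k a
  proof -
    have "E.Phi z i j (dinj r I k (x k ** a)) = dinj r I i (z ** dinj r I k (x k ** a) j)"
      by (rule E.Phi_apply[OF E.dinj_DS[OF mem[OF k(2)] k(1)]])
    moreover have "z ** (x j ** a) = Tsum r D ** a" unfolding z(2)[symmetric] using z(1) x ij KH k by (simp add: H.m_assoc)
    ultimately show ?thesis using ij z(1) by (simp add: E.dinj_apply)
  qed
  show "basis_hom r K I x i D j = E.Phi z i j"
    unfolding basis_hom_def
  proof (rule the_equality)
    show "E.Phi z i j \<in> carrier E.EA \<and> (\<forall>k\<in>I. \<forall>a\<in>K. E.Phi z i j (dinj r I k (x k ** a)) = dinj r I i (if k = j then Tsum r D ** a else \<^bold>0))"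
      using Phi val by blast
    fix \<phi> assume \<phi>: "\<phi> \<in> carrier E.EA \<and> (\<forall>k\<in>I. \<forall>a\<in>K. \<phi> (dinj r I k (x k ** a)) = dinj r I i (if k = j then Tsum r D ** a else \<^bold>0))"
    show "\<phi> = E.Phi z i j"
    proof (rule E.EA_generators)
      fix k m assume km: "k \<in> I" "m \<in> rmod r K (x k)"
      then obtain a where "a \<in> K" "m = x k ** a" by (auto simp: rmod_def)
      then show "\<phi> (dinj r I k m) = E.Phi z i j (dinj r I k m)" using \<phi> val[OF km(1)] km by simp
    qed (use \<phi> Phi in auto)
  qed
qed

lemma (in type_B) hecke_endo_rmod:
  fixes K L :: "hecke set" and I :: "'i set" and x :: "'i \<Rightarrow> hecke"
  assumes "finite I" "K \<subseteq> carrier H" "L \<subseteq> carrier H" "K \<subseteq> L" "\<And>k. k \<in> I \<Longrightarrow> x k \<in> carrier H" "\<^bold>0 \<in> L"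
    "\<And>a b. a \<in> L \<Longrightarrow> b \<in> L \<Longrightarrow> a \<boxplus> b \<in> L" "\<And>a b. a \<in> L \<Longrightarrow> b \<in> L \<Longrightarrow> a ** b \<in> L" "\<And>a. scal r a \<in> L"
  shows "hecke_endo r K I (\<lambda>k. rmod r L (x k))"
proof unfold_locales
  have LH: "k \<in> carrier H" if "k \<in> L" for k using assms(3) that by blast
  fix i assume i: "i \<in> I"
  note xi = assms(5)[OF i]
  show "rmod r L (x i) \<subseteq> carrier H" using xi LH by (auto simp: rmod_def)
  show "\<^bold>0 \<in> rmod r L (x i)" unfolding rmod_def by (rule image_eqI[of _ _ "\<^bold>0"]) (use xi assms in auto)
  fix m assume "m \<in> rmod r L (x i)"
  then obtain a where a: "a \<in> L" "m = x i ** a" by (auto simp: rmod_def)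
  show "scal r c ** m \<in> rmod r L (x i)" for c
  proof -
    have "scal r c ** m = x i ** (scal r c ** a)" using a xi LH by (simp add: scal_left_comm)
    then show ?thesis using assms(8)[OF assms(9) a(1)] by (auto simp: rmod_def)
  qed
  show "m ** k \<in> rmod r L (x i)" if "k \<in> K" for k
  proof -
    have k: "k \<in> L" using that assms by blast
    have "m ** k = x i ** (a ** k)" using a xi LH k by (simp add: H.m_assoc)
    then show ?thesis using assms(8)[OF a(1) k] by (auto simp: rmod_def)
  qed
  fix m' assume "m' \<in> rmod r L (x i)"
  then obtain b where b: "b \<in> L" "m' = x i ** b" by (auto simp: rmod_def)
  have "m \<boxplus> m' = x i ** (a \<boxplus> b)" using a b xi LH by (simp add: H.r_distr)
  then show "m \<boxplus> m' \<in> rmod r L (x i)" using assms(7)[OF a(1) b(1)] by (auto simp: rmod_def)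
qed (use assms in auto)

context type_B_schur
begin

section \<open>Double cosets in type D\<close>

abbreviation "is_sign e \<equiv> e = (1::int) \<or> e = - 1"
abbreviation "ss e \<equiv> s_sign r e"
abbreviation "tw e f w \<equiv> ss e o  w o ss f"

lemma ss_one [simp]: "ss 1 = id" and ss_minus [simp]: "ss (- 1) = sg"
  by (simp_all add: s_sign_def)

lemma ss_W [simp]: "ss e \<in> W"
  by (simp add: s_sign_def WB_id)

lemma ss_ss [simp]: "ss e (ss e k) = k" "ss e o ss e = id"
  by (simp_all add: s_sign_def)

lemma par_ss: "is_sign e \<Longrightarrow> par (ss e) = e"
  by auto

lemma tw_W: "w \<in> W \<Longrightarrow> ss e o w o ss f \<in> W"
  by (intro WB_comp ss_W)

lemma tw_tw [simp]: "tw e f (tw e f w) = w"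
  by (simp add: fun_eq_iff)

lemma par_tw: assumes "w \<in> W" "is_sign e" "is_sign f" shows "par (tw e f w) = e * par w * f"
  using par_comp[OF ss_W WB_comp[OF ss_W[of e] assms(1)], of f] par_comp[OF assms(1) ss_W, of e] par_ss[OF assms(2)] par_ss[OF assms(3)] by simp

text \<open>The three kinds of parabolic subgroups of type D at once. With a central block the sign \<open>e\<close> is
  irrelevant because \<open>HP lam\<close> is normalized by \<open>s\<^sub>r\<close>; this freedom is used
  to give neighbouring factors of a product the same sign.\<close>

lemma WparD_bracket:
  assumes lam: "lam \<in> Lam n r" and e: "is_sign e"
  shows "WparD n r (bracket n lam e) = (\<lambda>w. tw e e w) ` HP lam"
proof (cases "lam (n + 1) = 0")
  case True
  then have "PB lam = HP lam" using PB_noncentral[OF lam] cen_r_iff(1)[OF lam] by blast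
  then show ?thesis using True e Wpar_PB[OF lam] by (auto simp: bracket_def)
next
  case False
  then have J: "r \<in> Jset lam" using cen_r_iff(1)[OF lam] by blast
  have "(\<lambda>w. cj w) ` HP lam = HP lam"
  proof (intro Set.set_eqI iffI)
    fix w assume "w \<in> HP lam"
    then have "cj w \<in> HP lam" by (rule HP_conj[OF lam J])
    moreover have "w = cj (cj w)" by (simp add: fun_eq_iff)
    ultimately show "w \<in> (\<lambda>w. cj w) ` HP lam" by blast
  qed (use HP_conj[OF lam J] in auto)
  then show ?thesis using False e HP_Wpar[OF lam] by (auto simp: bracket_def)
qed

lemma LamD_bracket: "lam \<in> Lam n r \<Longrightarrow> is_sign e \<Longrightarrow> bracket n lam e \<in> LamD n r"
  by (auto simp: LamD_def bracket_def)

lemma LamD_cases: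
  assumes "a \<in> LamD n r" obtains lam e where "lam \<in> Lam n r" "is_sign e" "a = bracket n lam e"
proof (cases a)
  case (Bul lam)
  then have "lam \<in> Lam n r" "a = bracket n lam 1" using assms by (simp_all add: LamD_def bracket_def)
  then show thesis using that by blast
next
  case (Sg e lam)
  then have "lam \<in> Lam n r" "is_sign e" "a = bracket n lam e" using assms by (simp_all add: LamD_def bracket_def)
  then show thesis using that by blast
qed

lemma bracket_eq: "bracket n lam e = bracket n mu f \<longleftrightarrow> lam = mu \<and> (e = f \<or> lam (n + 1) \<noteq> 0)"
  by (auto simp: bracket_def)

abbreviation "DD a w b \<equiv> double_coset r (WparD n r a) w (WparD n r b)"

text \<open>Twisting by \<open>s\<^sub>r\<close> on both sides reduces the double cosets of type D to those of the
  groups \<open>HP\<close>.\<close>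

lemma DD_bracket:
  assumes lam: "lam \<in> Lam n r" "is_sign e" and mu: "mu \<in> Lam n r" "is_sign f"
  shows "y \<in> DD (bracket n lam e) w (bracket n mu f) \<longleftrightarrow> ss e o y o ss f \<in> DHat lam (tw e f w) mu"
proof
  assume "y \<in> DD (bracket n lam e) w (bracket n mu f)"
  then obtain p q where pq: "p \<in> HP lam" "q \<in> HP mu" "y = (tw e e p) o w o (tw f f q)"
    unfolding WparD_bracket[OF lam] WparD_bracket[OF mu] by (auto elim!: dcE)
  have "tw e f y = p o (tw e f w) o q" unfolding pq(3) by (simp add: fun_eq_iff)
  then show "tw e f y \<in> DHat lam (tw e f w) mu" using dcI[OF pq(1,2)] by simp
next
  assume "tw e f y \<in> DHat lam (tw e f w) mu"
  then obtain p q where pq: "p \<in> HP lam" "q \<in> HP mu" "tw e f y = p o (tw e f w) o q" by (rule dcE)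
  have "y = tw e f (tw e f y)" by (simp add: fun_eq_iff)
  also have "\<dots> = (tw e e p) o w o (tw f f q)" unfolding pq(3) by (simp add: fun_eq_iff)
  finally show "y \<in> DD (bracket n lam e) w (bracket n mu f)"
    unfolding WparD_bracket[OF lam] WparD_bracket[OF mu] using dcI[OF imageI[OF pq(1)] imageI[OF pq(2)]] by simp
qed

lemma DD_image:
  assumes lam: "lam \<in> Lam n r" "is_sign e" and mu: "mu \<in> Lam n r" "is_sign f"
  shows "DD (bracket n lam e) w (bracket n mu f) = (\<lambda>y. tw e f y) ` DHat lam (tw e f w) mu"
proof (intro Set.set_eqI iffI)
  fix y assume "y \<in> DD (bracket n lam e) w (bracket n mu f)"
  then have "tw e f y \<in> DHat lam (tw e f w) mu" unfolding DD_bracket[OF assms] .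
  moreover have "y = tw e f (tw e f y)" by simp
  ultimately show "y \<in> (\<lambda>y. tw e f y) ` DHat lam (tw e f w) mu" by blast
next
  fix y assume "y \<in> (\<lambda>y. tw e f y) ` DHat lam (tw e f w) mu"
  then obtain v where v: "v \<in> DHat lam (tw e f w) mu" "y = tw e f v" by blast
  then show "y \<in> DD (bracket n lam e) w (bracket n mu f)" unfolding DD_bracket[OF assms] by simp
qed

lemma DD_W:
  assumes a: "a \<in> LamD n r" and b: "b \<in> LamD n r" and w: "w \<in> W"
  shows "DD a w b \<subseteq> W" "y \<in> DD a w b \<Longrightarrow> par y = par w" "w \<in> DD a w b" "y \<in> DD a w b \<Longrightarrow> DD a y b = DD a w b"
proof -
  obtain lam e where l: "lam \<in> Lam n r" "is_sign e" "a = bracket n lam e" using a by (rule LamD_cases)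
  obtain mu f where m: "mu \<in> Lam n r" "is_sign f" "b = bracket n mu f" using b by (rule LamD_cases)
  note im = DD_image[OF l(1,2) m(1,2), folded l(3) m(3)] and iff = DD_bracket[OF l(1,2) m(1,2), folded l(3) m(3)]
  have sub: "DHat lam (tw e f w) mu \<subseteq> W" by (rule DHat_W[OF tw_W[OF w]])
  show W: "DD a w b \<subseteq> W" unfolding im using sub tw_W by blast
  show "w \<in> DD a w b" unfolding iff by (rule DHat_self)
  show "par y = par w" if y: "y \<in> DD a w b"
  proof -
    have "par (tw e f y) = par (tw e f w)" by (rule DHat_par[OF tw_W[OF w]]) (use y iff in blast)
    then show ?thesis using par_tw[OF w l(2) m(2)] par_tw[OF subsetD[OF W y] l(2) m(2)] l(2) m(2) by auto
  qed
  show "DD a y b = DD a w b" if y: "y \<in> DD a w b"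
    using DHat_eq[of "tw e f y" lam "tw e f w" mu] y iff by (intro Set.set_eqI) simp
qed

subsection \<open>The data attached to a signed matrix\<close>

fun la :: "dmatrix \<Rightarrow> dweight" where
  "la (Dot A) = Bul (rowW A)"
| "la (Signed e A e') = bracket n (rowW A) e"

fun ra :: "dmatrix \<Rightarrow> dweight" where
  "ra (Dot A) = Bul (colW A)"
| "ra (Signed e A e') = bracket n (colW A) e'"

fun rep :: "dmatrix \<Rightarrow> nat \<Rightarrow> nat" where
  "rep (Dot A) = (if dm A \<in> weylD r then dm A else sg o dm A)"
| "rep (Signed e A e') = ss e o dm A o ss e'"

abbreviation "TZ Z \<equiv> DD (la Z) (rep Z) (ra Z)"

lemma phi_mat_TZ: "phi_mat n r Z = basis_hom r (Hcheck r) (LamD n r) (xD n r) (la Z) (DD (la Z) (min_repD n r (la Z) (rep Z) (ra Z)) (ra Z)) (ra Z)"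
  by (cases Z) (simp_all add: phiD_def Let_def)

lemma central_weights:
  assumes A: "A \<in> Xi n r" and c: "A (n + 1) (n + 1) \<noteq> 0"
  shows "rowW A (n + 1) \<noteq> 0" "colW A (n + 1) \<noteq> 0"
proof -
  have pos: "0 < A (n + 1) (n + 1)" using XiD(1)[OF A, of "n + 1" "n + 1"] c by simp
  have mem: "n + 1 \<in> {1..2*n + 1}" by simp
  have "A (n + 1) (n + 1) \<le> ro n A (n + 1)" unfolding ro_def
    by (rule member_le_sum[OF mem]) (simp_all add: XiD(1)[OF A])
  then show "rowW A (n + 1) \<noteq> 0" using ro_hat[OF A mem] pos by (auto simp: hat_def)
  have "A (n + 1) (n + 1) \<le> co n A (n + 1)" unfolding co_def
    by (rule member_le_sum[OF mem, where f = "\<lambda>i. A i (n + 1)"]) (simp_all add: XiD(1)[OF A])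
  then show "colW A (n + 1) \<noteq> 0" using co_hat[OF A mem] pos by (auto simp: hat_def)
qed

lemma dmat_W: "A \<in> Xi n r \<Longrightarrow> dm A \<in> W"
  using mat_triple_props min_repsB_Inc(1) by blast

lemma XiD_cases:
  assumes "Z \<in> XiD n r"
  obtains A where "Z = Dot A" "A \<in> Xi n r" "A (n + 1) (n + 1) \<noteq> 0"
  | e A e' where "Z = Signed e A e'" "A \<in> Xi n r" "A (n + 1) (n + 1) = 0" "is_sign e" "is_sign e'" "e * e' = sgn_mat n A"
  using assms by (auto simp: XiD_def)

lemma XiD_data:
  assumes Z: "Z \<in> XiD n r"
  shows "underlying Z \<in> Xi n r" "la Z \<in> LamD n r" "ra Z \<in> LamD n r" "rep Z \<in> W" "par (rep Z) = 1"
    "\<exists>e f. is_sign e \<and> is_sign f \<and> la Z = bracket n (rowW (underlying Z)) e \<and> ra Z = bracket n (colW (underlying Z)) f \<and>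
       rep Z = ss e o dm (underlying Z) o ss f"
proof -
  show X: "underlying Z \<in> Xi n r" using Z by (cases rule: XiD_cases) auto
  note d = dmat_W[OF X] and m = mat_triple_props(1,2)[OF X]
  show ex: "\<exists>e f. is_sign e \<and> is_sign f \<and> la Z = bracket n (rowW (underlying Z)) e \<and> ra Z = bracket n (colW (underlying Z)) f \<and>
       rep Z = ss e o dm (underlying Z) o ss f"
    using Z
  proof (cases rule: XiD_cases)
    case (1 A)
    note c = central_weights[OF 1(2,3)]
    show ?thesis
    proof (cases "dm A \<in> weylD r")
      case True
      then show ?thesis using 1 c by (intro exI[of _ 1]) (auto simp: bracket_def)
    next
      case False
      then show ?thesis using 1 c by (intro exI[of _ "- 1"] exI[of _ 1]) (auto simp: bracket_def)
    qed
  qed auto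
  then obtain e f where ef: "is_sign e" "is_sign f" "la Z = bracket n (rowW (underlying Z)) e"
    "ra Z = bracket n (colW (underlying Z)) f" "rep Z = ss e o dm (underlying Z) o ss f" by blast
  show "la Z \<in> LamD n r" unfolding ef(3) by (rule LamD_bracket[OF m(1) ef(1)])
  show "ra Z \<in> LamD n r" unfolding ef(4) by (rule LamD_bracket[OF m(2) ef(2)])
  show "rep Z \<in> W" unfolding ef(5) by (rule tw_W[OF d])
  show "par (rep Z) = 1" using Z
  proof (cases rule: XiD_cases)
    case (1 A)
    have dA: "dm A \<in> W" using dmat_W 1 by blast
    show ?thesis using 1 par_sg_comp(1)[OF dA] par_cases[of "dm A"] dA by (auto simp: weylD_par)
  next
    case (2 e A e')
    have "par (rep Z) = e * par (dm A) * e'" using par_tw[OF dmat_W[OF 2(2)] 2(4,5)] 2(1) by simp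
    also have "\<dots> = e * (e * e') * e'" using par_dmat[OF 2(2)] 2(6) by simp
    also have "\<dots> = 1" using 2(4,5) by auto
    finally show ?thesis .
  qed
qed

lemma TZ_props:
  assumes Z: "Z \<in> XiD n r"
  shows "TZ Z \<subseteq> W" "y \<in> TZ Z \<Longrightarrow> par y = 1" "rep Z \<in> TZ Z"
proof -
  note D = DD_W[OF XiD_data(2-4)[OF Z]]
  show "TZ Z \<subseteq> W" "rep Z \<in> TZ Z" by (rule D(1), rule D(3))
  show "y \<in> TZ Z \<Longrightarrow> par y = 1" using D(2)[of y] XiD_data(5)[OF Z] by simp
qed

lemma finite_DD: assumes "Z \<in> XiD n r" shows "finite (TZ Z)"
  using finite_subset[OF TZ_props(1)[OF assms] finite_WB] .

text \<open>Every element of the double coset represents it, whatever length function selects the representative.\<close>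

lemma DD_min_rep:
  assumes Z: "Z \<in> XiD n r"
  shows "DD (la Z) (min_repD n r (la Z) (rep Z) (ra Z)) (ra Z) = TZ Z"
proof -
  have "min_repD n r (la Z) (rep Z) (ra Z) \<in> TZ Z"
    unfolding min_repD_def by (rule arg_min_if_finite(1)[OF finite_DD[OF Z]]) (use TZ_props(3)[OF Z] in blast)
  then show ?thesis by (rule DD_W(4)[OF XiD_data(2-4)[OF Z]])
qed

lemma phi_mat_basis_hom: "Z \<in> XiD n r \<Longrightarrow> phi_mat n r Z = basis_hom r (Hcheck r) (LamD n r) (xD n r) (la Z) (TZ Z) (ra Z)"
  unfolding phi_mat_TZ by (simp only: DD_min_rep)

subsection \<open>The cosets of signed matrices partition the Weyl group of type D\<close>

text \<open>The half turn of the matrix comes from the symmetry of the permutation and of both partitions.\<close>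

lemma wmat_Xi:
  assumes lam: "lam \<in> Lam n r" and mu: "mu \<in> Lam n r" and w: "w \<in> W"
  shows "(\<lambda>i j. int (wmat lam w mu i j)) \<in> Xi n r"
proof -
  have out: "wmat lam w mu i j = 0" if "i \<notin> {1..2*n + 1} \<or> j \<notin> {1..2*n + 1}" for i j
    using wmat_outside[OF lam mu w that] .
  have sym: "wmat lam w mu (2*n + 2 - i) (2*n + 2 - j) = wmat lam w mu i j" if ij: "i \<in> {1..2*n + 1}" "j \<in> {1..2*n + 1}" for i j
    unfolding wmat_def
  proof (rule bij_betw_same_card[where f = "mir r"], rule bij_betw_imageI)
    show "inj_on (mir r) {k \<in> {1..2*r}. blk n mu k = 2*n + 2 - j \<and> blk n lam (w k) = 2*n + 2 - i}"
      by (rule inj_onI) (simp, arith)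
    have b: "blk n mu (mir r k) = 2*n + 2 - blk n mu k \<and> blk n lam (w (mir r k)) = 2*n + 2 - blk n lam (w k)" if "k \<in> {1..2*r}" for k
      using blk_mir[OF mu, of k] WB_mir[OF w, of k] blk_mir[OF lam, of "w k"] WB_range[OF w, of k] that by simp
    have ii: "2*n + 2 - (2*n + 2 - i) = i" "2*n + 2 - (2*n + 2 - j) = j" using ij by auto
    have rng: "blk n mu k \<in> {1..2*n + 1} \<and> blk n lam (w k) \<in> {1..2*n + 1}" if "k \<in> {1..2*r}" for k
      using blk_range[OF mu, of k] blk_range[OF lam, of "w k"] WB_range[OF w, of k] that by simp
    show "mir r ` {k \<in> {1..2*r}. blk n mu k = 2*n + 2 - j \<and> blk n lam (w k) = 2*n + 2 - i} =
        {k \<in> {1..2*r}. blk n mu k = j \<and> blk n lam (w k) = i}"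
    proof (intro Set.set_eqI iffI)
      fix k assume "k \<in> mir r ` {k \<in> {1..2*r}. blk n mu k = 2*n + 2 - j \<and> blk n lam (w k) = 2*n + 2 - i}"
      then show "k \<in> {k \<in> {1..2*r}. blk n mu k = j \<and> blk n lam (w k) = i}" using b ii by auto
    next
      fix k assume k: "k \<in> {k \<in> {1..2*r}. blk n mu k = j \<and> blk n lam (w k) = i}"
      then have "mir r k \<in> {k \<in> {1..2*r}. blk n mu k = 2*n + 2 - j \<and> blk n lam (w k) = 2*n + 2 - i}" using b by auto
      moreover have "k = mir r (mir r k)" using k by simp
      ultimately show "k \<in> mir r ` {k \<in> {1..2*r}. blk n mu k = 2*n + 2 - j \<and> blk n lam (w k) = 2*n + 2 - i}" by blast
    qed
  qed
  have "(\<Sum>i=1..2*n + 1. \<Sum>j=1..2*n + 1. wmat lam w mu i j) = (\<Sum>i=1..2*n + 1. hat n lam i)"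
    using wmat_row_sum[OF lam mu w] by (intro sum.cong) auto
  also have "\<dots> = 2*r" using psum_total[OF lam] by (simp only: psum_def)
  finally have "(\<Sum>i=1..2*n + 1. \<Sum>j=1..2*n + 1. int (wmat lam w mu i j)) = 2 * int r" by (simp flip: of_nat_sum)
  moreover have "int (wmat lam w mu i j) = int (wmat lam w mu (2*n + 2 - i) (2*n + 2 - j))"
    if "i \<in> {1..2*n + 1}" "j \<in> {1..2*n + 1}" for i j using sym[OF that] by simp
  ultimately show ?thesis unfolding Xi_def using out by fastforce
qed

lemma Xi_wmat_eq:
  assumes A: "A \<in> Xi n r" and y: "y \<in> DFull (rowW A) (dm A) (colW A)"
  shows "A = (\<lambda>i j. int (wmat (rowW A) y (colW A) i j))"
proof -
  note m = mat_triple_props[OF A]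
  obtain p q where pq: "p \<in> PB (rowW A)" "q \<in> PB (colW A)" "y = p o dm A o q" using y by (rule dcE)
  show ?thesis unfolding pq(3) wmat_double_coset[OF m(1,2) dmat_W[OF A] pq(1,2)] using m(4) by (intro ext) blast
qed

lemma Xi_of_coset:
  assumes lam: "lam \<in> Lam n r" and mu: "mu \<in> Lam n r" and w: "w \<in> W"
  shows "\<exists>A\<in>Xi n r. rowW A = lam \<and> colW A = mu \<and> w \<in> DFull lam (dm A) mu"
proof -
  obtain d p q where d: "d \<in> min_repsB n r lam mu" "p \<in> PB lam" "q \<in> PB mu" "d = p o w o q"
    using min_repsB_exists[OF assms] by blast
  have dW: "d \<in> W" using min_repsB_Inc[OF lam mu d(1)] by blast
  define A where "A = triple_mat n (lam, d, mu)"
  have "A = (\<lambda>i j. int (wmat lam d mu i j))" unfolding A_def by (intro ext triple_mat_wmat'[OF lam mu dW])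
  then have AX: "A \<in> Xi n r" using wmat_Xi[OF lam mu dW] by simp
  have t: "(lam, d, mu) \<in> triples n r" using lam mu d by (simp add: triples_def)
  have "mat_triple n r A = (lam, d, mu)" unfolding mat_triple_def A_def by (rule the_inv_into_f_f[OF triple_mat_inj t])
  then have "rowW A = lam" "colW A = mu" "dm A = d" by (simp_all add: row_wt_def col_wt_def dmat_def)
  moreover have "w \<in> DFull lam d mu"
  proof (rule DFull_sym)
    show "d \<in> DFull lam w mu" unfolding d(4) using d(2,3) by (rule dcI)
  qed
  ultimately show ?thesis using AX by blast
qed

lemma Ssg_DHat:
  assumes lam: "lam \<in> Lam n r" and mu: "mu \<in> Lam n r" and st: "s \<in> Ssg lam" "t \<in> Ssg mu" and d: "d \<in> DHat lam w mu"
  shows "s o d o t \<in> DHat lam (s o w o t) mu"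
proof -
  obtain p q where pq: "p \<in> HP lam" "q \<in> HP mu" "d = p o w o q" using d by (rule dcE)
  have inv: "s o s = id" "t o t = id" using Ssg_cases[OF st(1)] Ssg_cases[OF st(2)] by auto
  have "s o p o s \<in> HP lam" using Ssg_cases[OF st(1)] HP_conj[OF lam _ pq(1)] pq(1) by auto
  moreover have "t o q o t \<in> HP mu" using Ssg_cases[OF st(2)] HP_conj[OF mu _ pq(2)] pq(2) by auto
  moreover have "s o d o t = (s o p o s) o (s o w o t) o (t o q o t)"
    unfolding pq(3) using inv by (simp add: fun_eq_iff)
  ultimately show ?thesis using dcI by simp
qed

lemma central_entry:
  assumes lam: "lam \<in> Lam n r" and mu: "mu \<in> Lam n r" and w: "w \<in> W"
  shows "wmat lam w mu (n + 1) (n + 1) \<noteq> 0 \<longleftrightarrow> (\<exists>k\<in>cen mu. w k \<in> cen lam)"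
proof -
  have "{k \<in> {1..2*r}. blk n mu k = n + 1 \<and> blk n lam (w k) = n + 1} = {k \<in> cen mu. w k \<in> cen lam}"
    using WB_range[OF w] by (auto simp: cen_def)
  then have "wmat lam w mu (n + 1) (n + 1) = card {k \<in> cen mu. w k \<in> cen lam}" by (simp add: wmat_def)
  moreover have "finite {k \<in> cen mu. w k \<in> cen lam}" by (simp add: cen_def)
  ultimately show ?thesis by auto
qed

text \<open>The matrix is the one of the full double coset of \<open>y\<close>. The signs of \<open>y\<close> relative
  to the distinguished representative either are the signs of the symbol, or, if the central entry is not
  zero, can be moved from one side to the other.\<close>

lemma TZ_exists:
  assumes a: "a \<in> LamD n r" and c: "c \<in> LamD n r" and y: "y \<in> W" "par y = 1"
  shows "\<exists>Z\<in>XiD n r. la Z = a \<and> ra Z = c \<and> y \<in> TZ Z"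
proof -
  obtain lam e where l: "lam \<in> Lam n r" "is_sign e" "a = bracket n lam e" using a by (rule LamD_cases)
  obtain mu f where m: "mu \<in> Lam n r" "is_sign f" "c = bracket n mu f" using c by (rule LamD_cases)
  define v where "v = tw e f y"
  have v: "v \<in> W" "par v = e * f" unfolding v_def using tw_W par_tw[OF y(1) l(2) m(2)] y by auto
  obtain A where A: "A \<in> Xi n r" "rowW A = lam" "colW A = mu" "v \<in> DFull lam (dm A) mu"
    using Xi_of_coset[OF l(1) m(1) v(1)] by blast
  define d where "d = dm A"
  have dW: "d \<in> W" using dmat_W[OF A(1)] by (simp add: d_def)
  obtain s t d' where st: "s \<in> Ssg lam" "t \<in> Ssg mu" "d' \<in> DHat lam d mu" "v = s o d' o t"
    using DFull_cases[OF l(1) m(1) A(4)] by (auto simp: d_def)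
  have vD: "v \<in> DHat lam (s o d o t) mu" unfolding st(4) by (rule Ssg_DHat[OF l(1) m(1) st(1-3)])
  have sgn: "is_sign (par s)" "is_sign (par t)" using par_cases by auto
  have stW: "s \<in> W" "t \<in> W" using Ssg_cases[OF st(1)] Ssg_cases[OF st(2)] WB_id by auto
  have pars: "e * f = par s * par d * par t"
    using DHat_par[OF WB_comp[OF WB_comp[OF stW(1) dW] stW(2)] vD] par_sandwich[OF l(1) m(1) st(1,2) dW] v(2) by simp
  show ?thesis
  proof (cases "A (n + 1) (n + 1) = 0")
    case True
    define Z where "Z = Signed (e * par s) A (f * par t)"
    have sg2: "is_sign (e * par s)" "is_sign (f * par t)" using sgn l(2) m(2) by auto
    have "(e * par s) * (f * par t) = (e * f) * (par s * par t)" by (simp add: algebra_simps)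
    also have "\<dots> = par d" unfolding pars using sgn by auto
    finally have Z: "Z \<in> XiD n r" using True A(1) sg2 par_dmat[OF A(1)] by (auto simp: XiD_def Z_def d_def)
    have es: "e * par s = e \<or> lam (n + 1) \<noteq> 0" "f * par t = f \<or> mu (n + 1) \<noteq> 0"
      using Ssg_cases[OF st(1)] Ssg_cases[OF st(2)] cen_r_iff(1)[OF l(1)] cen_r_iff(1)[OF m(1)] by auto
    have "ss e o ss (e * par s) = s" "ss (f * par t) o ss f = t"
      using Ssg_cases[OF st(1)] Ssg_cases[OF st(2)] l(2) m(2) by auto
    then have "tw e f (ss (e * par s) o d o ss (f * par t)) = s o d o t" by (metis comp_assoc)
    then have "v \<in> DHat lam (tw e f (ss (e * par s) o d o ss (f * par t))) mu" using vD by simp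
    then have "y \<in> DD a (ss (e * par s) o d o ss (f * par t)) c"
      unfolding l(3) m(3) DD_bracket[OF l(1,2) m(1,2)] v_def .
    moreover have "la Z = a" "ra Z = c" using A es l m by (auto simp: Z_def bracket_eq)
    moreover have "rep Z = ss (e * par s) o d o ss (f * par t)" by (simp add: Z_def d_def)
    ultimately show ?thesis using Z by (intro bexI[of _ Z]) simp_all
  next
    case False
    note cw = central_weights[OF A(1) False, unfolded A(2,3)]
    have J: "r \<in> Jset lam" "r \<in> Jset mu" using cen_r_iff(1)[OF l(1)] cen_r_iff(1)[OF m(1)] cw by auto
    define Z where "Z = Dot A"
    have Z: "Z \<in> XiD n r" "la Z = a" "ra Z = c" using False A l(3) m(3) cw by (auto simp: XiD_def Z_def bracket_def)
    have b: "a = bracket n lam 1" "c = bracket n mu 1" using l(3) m(3) cw by (auto simp: bracket_def)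
    have "wmat lam d mu (n + 1) (n + 1) \<noteq> 0" using False mat_triple_props(4)[OF A(1), of "n + 1" "n + 1"] A(2,3) by (auto simp: d_def)
    then obtain k where k: "k \<in> cen mu" "d k \<in> cen lam" using central_entry[OF l(1) m(1) dW] by blast
    have os: "cj d \<in> DHat lam d mu" by (rule odd_stabiliser[OF l(1) m(1) dW k])
    have S: "sg \<in> Ssg lam" "id \<in> Ssg mu" "id \<in> Ssg lam" "sg \<in> Ssg mu" using J by (auto simp: Ssg_def)
    have os2: "d o sg \<in> DHat lam (sg o d) mu"
      using Ssg_DHat[OF l(1) m(1) S(1,2) os] by (simp add: o_assoc)
    \<comment> \<open>The twist by the signs of the given symbols is absorbed by the parabolic subgroups.\<close>
    define s' t' where "s' = ss e o s" and "t' = t o ss f"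
    have st': "s' = id \<or> s' = sg" "t' = id \<or> t' = sg" using Ssg_cases[OF st(1)] Ssg_cases[OF st(2)] l(2) m(2) by (auto simp: s'_def t'_def)
    have eS: "ss e \<in> Ssg lam" "ss f \<in> Ssg mu" using J l(2) m(2) by (auto simp: Ssg_def)
    have y': "y \<in> DHat lam (s' o d o t') mu"
    proof -
      have "tw e f v \<in> DHat lam (tw e f (s o d o t)) mu" by (rule Ssg_DHat[OF l(1) m(1) eS vD])
      moreover have "tw e f v = y" unfolding v_def by simp
      ultimately show ?thesis unfolding s'_def t'_def by (simp add: o_assoc)
    qed
    have s'W: "s' \<in> W" "t' \<in> W" using st' WB_id by auto
    have st'S: "s' \<in> Ssg lam" "t' \<in> Ssg mu" using st' J by (auto simp: Ssg_def)
    have par': "par s' * par d * par t' = 1"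
      using DHat_par[OF WB_comp[OF WB_comp[OF s'W(1) dW] s'W(2)] y'] par_sandwich[OF l(1) m(1) st'S dW] y(2) by simp
    have "DHat lam (s' o d o t') mu = DHat lam (rep Z) mu"
    proof (cases "par d = 1")
      case True
      then have rz: "rep Z = d" using dW by (simp add: Z_def weylD_par flip: d_def)
      have "(s' = id \<and> t' = id) \<or> (s' = sg \<and> t' = sg)" using par' True st' by auto
      then show ?thesis unfolding rz by (elim disjE conjE) (simp_all only: DHat_eq[OF os] o_id id_o)
    next
      case False
      then have rz: "rep Z = sg o d" by (simp add: Z_def weylD_par flip: d_def)
      have "(s' = sg \<and> t' = id) \<or> (s' = id \<and> t' = sg)" using par' par_cases[of d] False st' by auto
      then show ?thesis unfolding rz by (elim disjE conjE) (simp_all only: DHat_eq[OF os2] o_id id_o)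
    qed
    then have "y \<in> DHat lam (rep Z) mu" using y' by simp
    then have "y \<in> DD a (rep Z) c" unfolding b using DD_bracket[OF l(1) _ m(1), of 1 1] by simp
    then show ?thesis using Z by (intro bexI[of _ Z]) simp_all
  qed
qed

text \<open>The matrix is determined by \<open>y\<close>. If the central entry is zero and both weights have a central
  block, the two choices of signs give different double cosets: \<open>sgnS\<close> on the central block of
  the columns tells them apart.\<close>

lemma TZ_unique:
  assumes Z: "Z \<in> XiD n r" and Z': "Z' \<in> XiD n r" and eq: "la Z = la Z'" "ra Z = ra Z'" and y: "y \<in> TZ Z" "y \<in> TZ Z'"
  shows "Z = Z'"
proof -
  note d = XiD_data[OF Z] and d' = XiD_data[OF Z']
  obtain e f where ef: "is_sign e" "is_sign f" "la Z = bracket n (rowW (underlying Z)) e"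
    "ra Z = bracket n (colW (underlying Z)) f" "rep Z = ss e o dm (underlying Z) o ss f" using d(6) by blast
  obtain e' f' where ef': "is_sign e'" "is_sign f'" "la Z' = bracket n (rowW (underlying Z')) e'"
    "ra Z' = bracket n (colW (underlying Z')) f'" "rep Z' = ss e' o dm (underlying Z') o ss f'" using d'(6) by blast
  define lam mu where "lam = rowW (underlying Z)" and "mu = colW (underlying Z)"
  have lm: "lam \<in> Lam n r" "mu \<in> Lam n r" using mat_triple_props(1,2)[OF d(1)] by (auto simp: lam_def mu_def)
  have le: "rowW (underlying Z') = lam" "e' = e \<or> lam (n + 1) \<noteq> 0" using eq(1) ef(3) ef'(3) by (auto simp: bracket_eq lam_def)
  have me: "colW (underlying Z') = mu" "f' = f \<or> mu (n + 1) \<noteq> 0" using eq(2) ef(4) ef'(4) by (auto simp: bracket_eq mu_def)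
  have b: "la Z = bracket n lam e" "ra Z = bracket n mu f" "la Z' = bracket n lam e'" "ra Z' = bracket n mu f'"
    using ef ef' le me by (auto simp: lam_def mu_def)
  have y1: "tw e f y \<in> DHat lam (dm (underlying Z)) mu"
    using y(1) unfolding b DD_bracket[OF lm(1) ef(1) lm(2) ef(2)] ef(5) by simp
  have y2: "tw e' f' y \<in> DHat lam (dm (underlying Z')) mu"
    using y(2) unfolding b DD_bracket[OF lm(1) ef'(1) lm(2) ef'(2)] ef'(5) by simp
  have yW: "y \<in> W" using y(1) TZ_props(1)[OF Z] by blast
  have A: "underlying Z = (\<lambda>i j. int (wmat lam (tw e f y) mu i j))"
    using Xi_wmat_eq[OF d(1)] DHat_DFull[OF y1] unfolding lam_def mu_def by blast
  have "ss e o ss e' \<in> PB lam"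
  proof (cases "e' = e")
    case False
    then have "r \<in> Jset lam" using le(2) cen_r_iff(1)[OF lm(1)] by blast
    then show ?thesis using sg_PB[OF lm(1)] ef(1) ef'(1) False by auto
  qed simp
  moreover have "ss f' o ss f \<in> PB mu"
  proof (cases "f' = f")
    case False
    then have "r \<in> Jset mu" using me(2) cen_r_iff(1)[OF lm(2)] by blast
    then show ?thesis using sg_PB[OF lm(2)] ef(2) ef'(2) False by auto
  qed simp
  ultimately have "wmat lam ((ss e o ss e') o (tw e' f' y) o (ss f' o ss f)) mu = wmat lam (tw e' f' y) mu"
    by (rule wmat_double_coset[OF lm tw_W[OF yW]])
  moreover have "(ss e o ss e') o (tw e' f' y) o (ss f' o ss f) = tw e f y" by (simp add: fun_eq_iff)
  ultimately have "underlying Z = (\<lambda>i j. int (wmat lam (tw e' f' y) mu i j))" using A by simp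
  then have und: "underlying Z = underlying Z'"
    using Xi_wmat_eq[OF d'(1)] DHat_DFull[OF y2] unfolding le(1) me(1) by simp
  show ?thesis using Z
  proof (cases rule: XiD_cases)
    case (1 A)
    show ?thesis using Z' by (cases rule: XiD_cases) (use 1 und in auto)
  next
    case Z1: (2 g A g')
    show ?thesis using Z'
    proof (cases rule: XiD_cases)
      case (1 A')
      then show ?thesis using Z1 und by auto
    next
      case Z2: (2 h A' h')
      have AA: "A' = A" using und Z1(1) Z2(1) by simp
      show ?thesis
      proof (rule ccontr)
        assume ne: "Z \<noteq> Z'"
        have hg: "h = - g" "h' = - g'" using ne Z1(1,4-6) Z2(1,4-6) AA by auto
        have lm': "lam = rowW A" "mu = colW A" by (auto simp: lam_def mu_def Z1(1))
        have "lam (n + 1) \<noteq> 0" "mu (n + 1) \<noteq> 0"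
          using eq hg Z1(1,4,5) unfolding Z1(1) Z2(1) AA by (auto simp: bracket_eq lm')
        then have J: "r \<in> Jset lam" "r \<in> Jset mu" and bb: "la Z = bracket n lam 1" "ra Z = bracket n mu 1" "la Z' = bracket n lam 1" "ra Z' = bracket n mu 1"
          using cen_r_iff(1)[OF lm(1)] cen_r_iff(1)[OF lm(2)] by (auto simp: bracket_def Z1(1) Z2(1) AA lm')
        define v where "v = rep Z"
        have vW: "v \<in> W" using d(4) by (simp add: v_def)
        have rZ': "rep Z' = cj v"
          unfolding v_def Z1(1) Z2(1) AA hg using Z1(4,5) by (auto simp: fun_eq_iff)
        have "y \<in> DHat lam v mu" using y(1) unfolding bb DD_bracket[OF lm(1) _ lm(2), of 1 1, simplified] v_def by simp
        moreover have "y \<in> DHat lam (cj v) mu" using y(2) rZ' unfolding bb DD_bracket[OF lm(1) _ lm(2), of 1 1, simplified] by simp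
        ultimately have "v \<in> DHat lam (cj v) mu" using DHat_eq DHat_self by metis
        then obtain p q where pq: "p \<in> HP lam" "q \<in> HP mu" "v = p o (cj v) o q" by (rule dcE)
        have P: "p o sg \<in> PB lam" and Q: "sg o q \<in> PB mu"
          using PB_comp HP_PB pq sg_PB[OF lm(1) J(1)] sg_PB[OF lm(2) J(2)] by auto
        have sp: "ss g \<in> PB lam" "ss g' \<in> PB mu" using Z1(4,5) sg_PB[OF lm(1) J(1)] sg_PB[OF lm(2) J(2)] by auto
        have "wmat lam v mu = wmat lam (dm A) mu"
          unfolding v_def Z1(1) rep.simps by (rule wmat_double_coset[OF lm dmat_W[OF Z1(2)] sp])
        then have "wmat lam v mu (n + 1) (n + 1) = 0" using mat_triple_props(4)[OF Z1(2), of "n + 1" "n + 1"] Z1(3) lm' by simp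
        then have no: "v k \<notin> cen lam" if "k \<in> cen mu" for k using central_entry[OF lm vW] that by blast
        have vqW: "v o (sg o q) \<in> W" using WB_comp vW PB_W[OF Q] by blast
        have no2: "(v o (sg o q)) k \<notin> cen lam" if "k \<in> cen mu" for k
          using no PB_cen[OF Q, of k] that by auto
        have "sgnS (cen mu) v = sgnS (cen mu) ((p o sg) o (v o (sg o q)))"
          using arg_cong[OF pq(3), of "sgnS (cen mu)"] by (simp only: o_assoc)
        also have "\<dots> = sgnS (cen mu) (v o (sg o q))" by (rule csg_left[OF lm(1) P vqW no2])
        also have "\<dots> = sgnS (cen mu) v * par (sg o q)" by (rule csg_right[OF lm(2) Q vW])
        also have "par (sg o q) = - 1" using par_sg_comp(1)[OF HP_W[OF pq(2)]] HP_par[OF pq(2)] by simp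
        finally show False using csg_nz[of mu v] by simp
      qed
    qed
  qed
qed

section \<open>The Schur algebras and the structure constants\<close>

text \<open>The element by which the twist with the sign \<open>e\<close> is realized.\<close>

definition tau :: "int \<Rightarrow> hecke" where
  "tau e = (if e = 1 then \<^bold>1 else Tr)"

lemma tau_closed [simp]: "tau e \<in> carrier H"
  by (simp add: tau_def)

lemma tau_tau [simp]: "tau e ** tau e = \<^bold>1"
  by (simp add: tau_def)

lemma tau_cancel: "x \<in> carrier H \<Longrightarrow> tau e ** (tau e ** x) = x"
  by (simp flip: H.m_assoc)

lemma cf_tau_left: "x \<in> carrier H \<Longrightarrow> w \<in> W \<Longrightarrow> cf (tau e ** x) w = cf x (ss e o w)"
  by (simp add: tau_def s_sign_def cf_Tr_left)

lemma cf_tau_right: "x \<in> carrier H \<Longrightarrow> w \<in> W \<Longrightarrow> cf (x ** tau e) w = cf x (w o ss e)"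
  by (simp add: tau_def s_sign_def cf_Tr_right)

lemma cf_tau: assumes "x \<in> carrier H" "w \<in> W" shows "cf (tau e ** x ** tau f) w = cf x (tw e f w)"
proof -
  have "cf (tau e ** x ** tau f) w = cf (tau e ** x) (w o ss f)" using assms by (intro cf_tau_right) auto
  also have "\<dots> = cf x (ss e o (w o ss f))" using assms WB_comp by (intro cf_tau_left) auto
  finally show ?thesis by (simp only: o_assoc)
qed

lemma Tsum_tw: assumes X: "X \<subseteq> W" shows "Tsum r ((\<lambda>w. tw e f w) ` X) = tau e ** Tsum r X ** tau f"
proof (rule cf_eqI)
  have XW: "(\<lambda>w. tw e f w) ` X \<subseteq> W" using X tw_W by blast
  then show "Tsum r ((\<lambda>w. tw e f w) ` X) \<in> carrier H" by simp
  fix v assume v: "v \<in> W"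
  have "v \<in> (\<lambda>w. tw e f w) ` X \<longleftrightarrow> ss e o v o ss f \<in> X"
  proof
    assume a: "tw e f v \<in> X"
    show "v \<in> (\<lambda>w. tw e f w) ` X"
    proof (rule image_eqI)
      show "v = tw e f (tw e f v)" by simp
    qed (rule a)
  next
    assume "v \<in> (\<lambda>w. tw e f w) ` X"
    then obtain x where x: "x \<in> X" "v = tw e f x" by blast
    show "tw e f v \<in> X" unfolding x(2) using x(1) by simp
  qed
  then show "cf (Tsum r ((\<lambda>w. tw e f w) ` X)) v = cf (tau e ** Tsum r X ** tau f) v"
    using v X XW by (simp add: cf_tau cf_Tsum)
qed (use X in auto)

lemma xD_bracket: "lam \<in> Lam n r \<Longrightarrow> is_sign e \<Longrightarrow> xD n r (bracket n lam e) = tau e ** Tsum r (HP lam) ** tau e"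
  unfolding xD_def using HP_subset by (simp only: WparD_bracket Tsum_tw)

lemma Tsum_DD:
  assumes "lam \<in> Lam n r" "is_sign e" "mu \<in> Lam n r" "is_sign f" "w \<in> W"
  shows "Tsum r (DD (bracket n lam e) w (bracket n mu f)) = tau e ** Tsum r (DHat lam (tw e f w) mu) ** tau f"
  unfolding DD_image[OF assms(1-4)] by (rule Tsum_tw[OF DHat_W[OF tw_W[OF assms(5)]]])

lemma HP_closed [simp]: "Tsum r (HP lam) \<in> carrier H" "Tsum r (PB lam) \<in> carrier H"
  using HP_subset by auto

text \<open>The twists contribute the parity \<open>e * f\<close>.\<close>

lemma tau_Kc:
  assumes z: "z \<in> carrier H" "\<And>u. cf z u \<noteq> 0 \<Longrightarrow> par u = e * f" and ef: "is_sign e" "is_sign f"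
  shows "tau e ** z ** tau f \<in> Kc"
proof -
  have "par w = 1" if nz: "cf (tau e ** z ** tau f) w \<noteq> 0" for w
  proof -
    have w: "w \<in> W" using nz cf_outside by blast
    have "e * par w * f = e * f" using z(2)[of "tw e f w"] nz unfolding cf_tau[OF z(1) w] par_tw[OF w ef] by blast
    then show ?thesis using ef by auto
  qed
  then show ?thesis using z(1) by (simp add: Kc_def)
qed

text \<open>The untwisted quotient is kept in the statement, since its support is needed for the comparison with type B.\<close>

lemma ex_quotD:
  assumes lam: "lam \<in> Lam n r" "is_sign e" and mu: "mu \<in> Lam n r" "is_sign f" and w: "w \<in> W" "par w = 1"
  shows "\<exists>z\<in>carrier H. z ** Tsum r (HP mu) = Tsum r (DHat lam (tw e f w) mu) \<and>
    (\<forall>u. cf z u \<noteq> 0 \<longrightarrow> u \<in> hInc mu \<and> u \<in> DHat lam (tw e f w) mu) \<and> tau e ** z ** tau f \<in> Kc \<and>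
    (tau e ** z ** tau f) ** xD n r (bracket n mu f) = Tsum r (DD (bracket n lam e) w (bracket n mu f))"
proof -
  have vW: "tw e f w \<in> W" by (rule tw_W[OF w(1)])
  obtain z where z: "z \<in> carrier H" "z ** Tsum r (HP mu) = Tsum r (DHat lam (tw e f w) mu)"
    "\<forall>u. cf z u \<noteq> 0 \<longrightarrow> u \<in> hInc mu \<and> u \<in> DHat lam (tw e f w) mu"
    using ex_quotient_hat[OF lam(1) mu(1) vW] by blast
  have "tau e ** z ** tau f \<in> Kc"
  proof (rule tau_Kc[OF z(1) _ lam(2) mu(2)])
    fix u assume "cf z u \<noteq> 0"
    then have "par u = par (tw e f w)" using z(3) DHat_par[OF vW] by blast
    then show "par u = e * f" using par_tw[OF w(1) lam(2) mu(2)] w(2) by simp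
  qed
  moreover have "(tau e ** z ** tau f) ** xD n r (bracket n mu f) = tau e ** (z ** Tsum r (HP mu)) ** tau f"
    unfolding xD_bracket[OF mu] using z(1) by (simp add: H.m_assoc tau_cancel)
  ultimately show ?thesis using z unfolding Tsum_DD[OF lam mu w(1)] by metis
qed

lemma ex_coquotD:
  assumes a: "a \<in> LamD n r" and b: "b \<in> LamD n r" and w: "w \<in> W" "par w = 1"
  shows "\<exists>z\<in>Kc. Tsum r (DD a w b) = xD n r a ** z"
proof -
  obtain lam e where lam: "lam \<in> Lam n r" "is_sign e" "a = bracket n lam e" using a by (rule LamD_cases)
  obtain mu f where mu: "mu \<in> Lam n r" "is_sign f" "b = bracket n mu f" using b by (rule LamD_cases)
  have vW: "tw e f w \<in> W" by (rule tw_W[OF w(1)])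
  obtain z where z: "z \<in> carrier H" "Tsum r (HP lam) ** z = Tsum r (DHat lam (tw e f w) mu)"
    "\<forall>u. cf z u \<noteq> 0 \<longrightarrow> u \<in> DHat lam (tw e f w) mu"
    using ex_coquotient_hat[OF lam(1) mu(1) vW] by blast
  have "tau e ** z ** tau f \<in> Kc"
  proof (rule tau_Kc[OF z(1) _ lam(2) mu(2)])
    fix u assume "cf z u \<noteq> 0"
    then have "par u = par (tw e f w)" using z(3) DHat_par[OF vW] by blast
    then show "par u = e * f" using par_tw[OF w(1) lam(2) mu(2)] w(2) by simp
  qed
  moreover have "xD n r a ** (tau e ** z ** tau f) = tau e ** (Tsum r (HP lam) ** z) ** tau f"
    unfolding lam(3) xD_bracket[OF lam(1,2)] using z(1) by (simp add: H.m_assoc tau_cancel)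
  ultimately show ?thesis unfolding z(2) using Tsum_DD[OF lam(1,2) mu(1,2) w(1)] lam(3) mu(3) by metis
qed

lemma Kc_Tsum: assumes "D \<subseteq> W" "\<And>d. d \<in> D \<Longrightarrow> par d = 1" shows "Tsum r D \<in> Kc"
  using assms by (auto simp: Kc_def cf_Tsum)

lemma xD_Kc: "a \<in> LamD n r \<Longrightarrow> xD n r a \<in> Kc"
proof -
  assume a: "a \<in> LamD n r"
  obtain lam e where lam: "lam \<in> Lam n r" "is_sign e" "a = bracket n lam e" using a by (rule LamD_cases)
  show ?thesis unfolding lam(3) xD_bracket[OF lam(1,2)]
  proof (rule tau_Kc[OF HP_closed(1) _ lam(2,2)])
    fix u assume "cf (Tsum r (HP lam)) u \<noteq> 0"
    then show "par u = e * e" using lam(2) HP_par HP_subset by (auto simp: cf_Tsum split: if_splits)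
  qed
qed

subsection \<open>Finiteness\<close>

lemma finite_Lam: "finite (Lam n r)"
proof (rule finite_subset)
  show "Lam n r \<subseteq> {f. \<forall>i. (i \<in> {1..n + 1} \<longrightarrow> f i \<in> {0..r}) \<and> (i \<notin> {1..n + 1} \<longrightarrow> f i = 0)}"
  proof
    fix lam assume lam: "lam \<in> Lam n r"
    have "lam i \<le> r" if "i \<in> {1..n + 1}" for i
    proof -
      have "lam i \<le> (\<Sum>i=1..n + 1. lam i)" using that by (intro member_le_sum) auto
      then show ?thesis using lam by (simp add: Lam_def)
    qed
    then show "lam \<in> {f. \<forall>i. (i \<in> {1..n + 1} \<longrightarrow> f i \<in> {0..r}) \<and> (i \<notin> {1..n + 1} \<longrightarrow> f i = 0)}"
      using lam by (simp add: Lam_def)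
  qed
qed (rule finite_set_of_finite_funs; simp)

lemma finite_LamD: "finite (LamD n r)"
proof (rule finite_subset)
  show "LamD n r \<subseteq> Bul ` Lam n r \<union> (\<lambda>(e, lam). Sg e lam) ` ({1, - 1} \<times> Lam n r)" by (auto simp: LamD_def)
qed (simp add: finite_Lam)

lemma finite_Xi: "finite (Xi n r)"
proof (rule finite_imageD)
  let ?f = "\<lambda>A. (rowW A, dm A, colW A)"
  show "finite (?f ` Xi n r)"
  proof (rule finite_subset)
    show "?f ` Xi n r \<subseteq> Lam n r \<times> W \<times> Lam n r" using mat_triple_props(1,2) dmat_W by auto
  qed (simp add: finite_Lam finite_WB)
  show "inj_on ?f (Xi n r)"
  proof (rule inj_onI)
    fix A B assume A: "A \<in> Xi n r" and B: "B \<in> Xi n r" and eq: "?f A = ?f B"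
    show "A = B" using eq mat_triple_props(4)[OF A] mat_triple_props(4)[OF B] by (intro ext) simp
  qed
qed

lemma finite_XiD: "finite (XiD n r)"
proof (rule finite_subset)
  show "XiD n r \<subseteq> Dot ` Xi n r \<union> (\<lambda>(e, A, e'). Signed e A e') ` ({1, - 1} \<times> Xi n r \<times> {1, - 1})"
  proof
    fix Z assume "Z \<in> XiD n r"
    then show "Z \<in> Dot ` Xi n r \<union> (\<lambda>(e, A, e'). Signed e A e') ` ({1, - 1} \<times> Xi n r \<times> {1, - 1})"
    proof (cases rule: XiD_cases)
      case (2 e A e')
      then have "(e, A, e') \<in> {1, - 1} \<times> Xi n r \<times> {1, - 1}" by auto
      then have "Z \<in> (\<lambda>(e, A, e'). Signed e A e') ` ({1, - 1} \<times> Xi n r \<times> {1, - 1})"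
        by (rule rev_image_eqI) (simp add: 2(1))
      then show ?thesis by blast
    qed auto
  qed
qed (simp add: finite_Xi)

subsection \<open>The three endomorphism algebras\<close>

lemma Kc_sub: "Kc \<subseteq> carrier H"
  by (auto simp: Kc_def)

lemma xB_closed: "lam \<in> Lam n r \<Longrightarrow> xB n r lam = Tsum r (PB lam)"
  by (simp add: xB_def Wpar_PB)

lemma endo_D: "hecke_endo r Kc (LamD n r) (\<lambda>a. rmod r Kc (xD n r a))"
  by (rule hecke_endo_rmod[OF finite_LamD Kc_sub Kc_sub order_refl Kc_H[OF xD_Kc] Kc_zero Kc_add Kc_mult Kc_scal])

lemma endo_K: "hecke_endo r Kc (Lam n r) (\<lambda>lam. rmod r (carrier H) (xB n r lam))"
  by (rule hecke_endo_rmod[OF finite_Lam Kc_sub order_refl Kc_sub]) (simp_all add: xB_closed)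

lemma endo_B: "hecke_endo r (carrier H) (Lam n r) (\<lambda>lam. rmod r (carrier H) (xB n r lam))"
  by (rule hecke_endo_rmod[OF finite_Lam order_refl order_refl order_refl]) (simp_all add: xB_closed)

end

sublocale type_B_schur \<subseteq> ED: hecke_endo r Kc "LamD n r" "\<lambda>a. rmod r Kc (xD n r a)" by (rule endo_D)
sublocale type_B_schur \<subseteq> EK: hecke_endo r Kc "Lam n r" "\<lambda>lam. rmod r (carrier (heckeB r)) (xB n r lam)" by (rule endo_K)
sublocale type_B_schur \<subseteq> EB: hecke_endo r "carrier (heckeB r)" "Lam n r" "\<lambda>lam. rmod r (carrier (heckeB r)) (xB n r lam)" by (rule endo_B)

context type_B_schur
begin

lemma phi_mat_Phi:
  assumes Z: "Z \<in> XiD n r" and z: "z \<in> carrier H" "z ** xD n r (ra Z) = Tsum r (TZ Z)"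
  shows "phi_mat n r Z = ED.Phi z (la Z) (ra Z)" "phi_mat n r Z \<in> carrier ED.EA"
proof -
  note d = XiD_data[OF Z]
  obtain z' where z': "z' \<in> Kc" "Tsum r (TZ Z) = xD n r (la Z) ** z'" using ex_coquotD[OF d(2-5)] by blast
  note b = basis_hom_Phi[OF endo_D Kc_H[OF xD_Kc] Kc_one d(2,3) z z' Kc_mult]
  show "phi_mat n r Z = ED.Phi z (la Z) (ra Z)" unfolding phi_mat_basis_hom[OF Z] Hcheck_Kc by (rule b(1))
  then show "phi_mat n r Z \<in> carrier ED.EA" using b(2) by simp
qed

lemma ex_zD:
  assumes Z: "Z \<in> XiD n r" shows "\<exists>z\<in>Kc. z ** xD n r (ra Z) = Tsum r (TZ Z)"
proof -
  note d = XiD_data[OF Z]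
  obtain lam e where lam: "lam \<in> Lam n r" "is_sign e" "la Z = bracket n lam e" using d(2) by (rule LamD_cases)
  obtain mu f where mu: "mu \<in> Lam n r" "is_sign f" "ra Z = bracket n mu f" using d(3) by (rule LamD_cases)
  show ?thesis using ex_quotD[OF lam(1,2) mu(1,2) d(4,5)] unfolding lam(3) mu(3) by blast
qed

subsection \<open>The identification of the two modules\<close>

text \<open>Multiplication by \<open>T\<^sub>r\<close> interchanges the even and the odd part of the algebra.\<close>

lemma even_split: assumes h: "h \<in> carrier H" shows "\<exists>h0\<in>Kc. \<exists>h1\<in>Kc. h = h0 \<boxplus> (Tr ** h1)"
proof -
  define h0 where "h0 = mk (\<lambda>w. if par w = 1 then cf h w else 0)"
  define h1 where "h1 = mk (\<lambda>w. if par w = 1 then cf h (sg o w) else 0)"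
  have "h0 \<in> Kc" "h1 \<in> Kc" by (auto simp: Kc_def h0_def h1_def cf_mk split: if_splits)
  moreover have "h = h0 \<boxplus> (Tr ** h1)"
  proof (rule cf_eqI[OF h])
    fix w assume w: "w \<in> W"
    then show "cf h w = cf (h0 \<boxplus> (Tr ** h1)) w"
      using par_sg_comp(1)[OF w] par_cases[of w] WB_comp[OF sg_W w] by (auto simp: cf_add cf_Tr_left h0_def h1_def cf_mk)
  qed (simp add: h0_def h1_def)
  ultimately show ?thesis by blast
qed

lemma even_split_unique:
  assumes k: "u \<in> Kc" "v \<in> Kc" "u' \<in> Kc" "v' \<in> Kc" and eq: "u \<boxplus> (Tr ** v) = u' \<boxplus> (Tr ** v')"
  shows "u = u'" "v = v'"
proof -
  have odd: "cf x w = 0" if "x \<in> Kc" "par w \<noteq> 1" for x w using that by (auto simp: Kc_def)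
  have c: "cf u w + cf v (sg o w) = cf u' w + cf v' (sg o w)" if "w \<in> W" for w
    using arg_cong[OF eq, of "\<lambda>x. cf x w"] k that by (simp add: cf_add cf_Tr_left Kc_H)
  show "u = u'"
  proof (rule cf_eqI)
    fix w assume w: "w \<in> W"
    show "cf u w = cf u' w"
    proof (cases "par w = 1")
      case True
      then have "par (sg o w) \<noteq> 1" using par_sg_comp(1)[OF w] by simp
      then show ?thesis using c[OF w] odd k by simp
    qed (use odd k in simp)
  qed (use k Kc_H in auto)
  show "v = v'"
  proof (rule cf_eqI)
    fix w assume w: "w \<in> W"
    show "cf v w = cf v' w"
    proof (cases "par w = 1")
      case True
      then have "par (sg o w) \<noteq> 1" using par_sg_comp(1)[OF w] by simp
      moreover have "cf u (sg o w) + cf v (sg o (sg o w)) = cf u' (sg o w) + cf v' (sg o (sg o w))"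
        by (rule c[OF WB_comp[OF sg_W w]])
      ultimately show ?thesis using odd k by simp
    qed (use odd k in simp)
  qed (use k Kc_H in auto)
qed

abbreviation "ident' \<equiv> ident n r"

lemma noncentral_LamD: "lam \<in> Lam n r \<Longrightarrow> lam (n + 1) = 0 \<Longrightarrow> Sg 1 lam \<in> LamD n r \<and> Sg (- 1) lam \<in> LamD n r"
  and central_LamD: "lam \<in> Lam n r \<Longrightarrow> lam (n + 1) \<noteq> 0 \<Longrightarrow> Bul lam \<in> LamD n r"
  by (auto simp: LamD_def)

lemma xD_noncentral:
  assumes lam: "lam \<in> Lam n r" and c: "lam (n + 1) = 0"
  shows "xD n r (Sg 1 lam) = xB n r lam" "xD n r (Sg (- 1) lam) = Tr ** xB n r lam ** Tr"
proof -
  have "PB lam = HP lam" using PB_noncentral[OF lam] cen_r_iff(1)[OF lam] c by blast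
  then have x: "xB n r lam = Tsum r (HP lam)" using xB_closed[OF lam] by simp
  show "xD n r (Sg 1 lam) = xB n r lam" using xD_bracket[OF lam, of 1] c by (simp add: bracket_def x tau_def)
  show "xD n r (Sg (- 1) lam) = Tr ** xB n r lam ** Tr" using xD_bracket[OF lam, of "- 1"] c by (simp add: bracket_def x tau_def)
qed

lemma xD_central:
  assumes lam: "lam \<in> Lam n r" and c: "lam (n + 1) \<noteq> 0"
  shows "xB n r lam = (\<^bold>1 \<boxplus> Tr) ** xD n r (Bul lam)" "xB n r lam = xD n r (Bul lam) ** (\<^bold>1 \<boxplus> Tr)"
proof -
  have J: "r \<in> Jset lam" using cen_r_iff(1)[OF lam] c by blast
  have x: "xD n r (Bul lam) = Tsum r (HP lam)" using xD_bracket[OF lam, of 1] c by (simp add: bracket_def tau_def)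
  show "xB n r lam = (\<^bold>1 \<boxplus> Tr) ** xD n r (Bul lam)" unfolding x xB_closed[OF lam] by (rule xfull_hat(2)[OF lam J])
  show "xB n r lam = xD n r (Bul lam) ** (\<^bold>1 \<boxplus> Tr)" unfolding x xB_closed[OF lam] by (rule xfull_hat(1)[OF lam J])
qed

lemma xB_carrier [simp]: "lam \<in> Lam n r \<Longrightarrow> xB n r lam \<in> carrier H"
  by (simp add: xB_closed)

lemma Tr_cancel: "x \<in> carrier H \<Longrightarrow> Tr ** (Tr ** x) = x"
  by (simp flip: H.m_assoc)

lemma DS_Kc: assumes "u \<in> ED.DS" "a \<in> LamD n r" shows "u a \<in> Kc"
  using ED.DS_M[OF assms] Kc_mult[OF xD_Kc[OF assms(2)]] by (auto simp: rmod_def)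

lemma ident_DS: assumes u: "u \<in> ED.DS" shows "ident' u \<in> EK.DS"
  unfolding ident_def
proof (rule EK.DS_restrict)
  fix lam assume lam: "lam \<in> Lam n r"
  show "(if lam (n + 1) = 0 then u (Sg 1 lam) \<boxplus> (Tr ** u (Sg (-1) lam)) else (\<^bold>1 \<boxplus> Tr) ** u (Bul lam))
    \<in> rmod r (carrier H) (xB n r lam)"
  proof (cases "lam (n + 1) = 0")
    case True
    note a = noncentral_LamD[OF lam True]
    obtain k where k: "k \<in> Kc" "u (Sg 1 lam) = xB n r lam ** k"
      using ED.DS_M[OF u, of "Sg 1 lam"] a unfolding rmod_def xD_noncentral[OF lam True] by auto
    obtain k' where k': "k' \<in> Kc" "u (Sg (- 1) lam) = Tr ** xB n r lam ** Tr ** k'"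
      using ED.DS_M[OF u, of "Sg (- 1) lam"] a unfolding rmod_def xD_noncentral[OF lam True] by auto
    have "u (Sg 1 lam) \<boxplus> (Tr ** u (Sg (-1) lam)) = xB n r lam ** (k \<boxplus> (Tr ** k'))"
      unfolding k(2) k'(2) using k(1) k'(1) lam Kc_H by (simp add: H.m_assoc H.r_distr Tr_cancel)
    then show ?thesis using True k k' Kc_H by (auto simp: rmod_def)
  next
    case False
    note a = central_LamD[OF lam False]
    obtain k where k: "k \<in> Kc" "u (Bul lam) = xD n r (Bul lam) ** k"
      using ED.DS_M[OF u a] unfolding rmod_def by auto
    have "(\<^bold>1 \<boxplus> Tr) ** u (Bul lam) = xB n r lam ** k"
      unfolding xD_central(1)[OF lam False] k(2) using k(1) Kc_H xD_Kc[OF a] by (simp add: H.m_assoc)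
    then show ?thesis using False k Kc_H by (auto simp: rmod_def)
  qed
qed

lemma ident_apply:
  "lam \<in> Lam n r \<Longrightarrow> lam (n + 1) = 0 \<Longrightarrow> ident' u lam = u (Sg 1 lam) \<boxplus> (Tr ** u (Sg (-1) lam))"
  "lam \<in> Lam n r \<Longrightarrow> lam (n + 1) \<noteq> 0 \<Longrightarrow> ident' u lam = (\<^bold>1 \<boxplus> Tr) ** u (Bul lam)"
  by (simp_all add: ident_def)

text \<open>Even and odd parts can be separated; with a central block both parts of \<open>(1 + T\<^sub>r) u\<close>
  determine \<open>u\<close>.\<close>

lemma ident_inj: "inj_on ident' ED.DS"
proof (rule inj_onI)
  fix u v assume u: "u \<in> ED.DS" and v: "v \<in> ED.DS" and eq: "ident' u = ident' v"
  show "u = v"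
  proof (rule ED.DS_eqI[OF u v])
    fix a assume a: "a \<in> LamD n r"
    show "u a = v a"
    proof (cases a)
      case (Bul lam)
      then have lam: "lam \<in> Lam n r" "lam (n + 1) \<noteq> 0" using a by (auto simp: LamD_def)
      have c: "u a \<in> Kc" "v a \<in> Kc" using DS_Kc u v a by auto
      have "u a \<boxplus> (Tr ** u a) = v a \<boxplus> (Tr ** v a)"
        using fun_cong[OF eq, of lam] c Kc_H unfolding ident_apply(2)[OF lam] Bul by (simp add: H.l_distr)
      then show ?thesis using even_split_unique(1) c by blast
    next
      case (Sg e lam)
      then have lam: "lam \<in> Lam n r" "lam (n + 1) = 0" and e: "is_sign e" using a by (auto simp: LamD_def)
      have c: "u (Sg 1 lam) \<in> Kc" "v (Sg 1 lam) \<in> Kc" "u (Sg (-1) lam) \<in> Kc" "v (Sg (-1) lam) \<in> Kc"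
        using DS_Kc u v noncentral_LamD[OF lam] by auto
      have "u (Sg 1 lam) \<boxplus> (Tr ** u (Sg (-1) lam)) = v (Sg 1 lam) \<boxplus> (Tr ** v (Sg (-1) lam))"
        using fun_cong[OF eq, of lam] unfolding ident_apply(1)[OF lam] .
      then show ?thesis using even_split_unique[OF c(1,3,2,4)] e Sg by metis
    qed
  qed
qed

text \<open>With a central block \<open>(1 + T\<^sub>r) T\<^sub>r = 1 + T\<^sub>r\<close>, so that the odd part of the
  multiplier may be replaced by an even one.\<close>

lemma ident_surj: assumes m: "m \<in> EK.DS" shows "\<exists>u\<in>ED.DS. ident' u = m"
proof -
  have "\<exists>h0 h1. lam \<in> Lam n r \<longrightarrow> h0 \<in> Kc \<and> h1 \<in> Kc \<and> m lam = xB n r lam ** (h0 \<boxplus> (Tr ** h1))" for lam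
  proof (cases "lam \<in> Lam n r")
    case True
    then obtain h where "h \<in> carrier H" "m lam = xB n r lam ** h" using EK.DS_M[OF m True] by (auto simp: rmod_def)
    then show ?thesis using even_split by metis
  qed simp
  then obtain h0 h1 where h: "\<And>lam. lam \<in> Lam n r \<Longrightarrow> h0 lam \<in> Kc"
    "\<And>lam. lam \<in> Lam n r \<Longrightarrow> h1 lam \<in> Kc" "\<And>lam. lam \<in> Lam n r \<Longrightarrow> m lam = xB n r lam ** (h0 lam \<boxplus> (Tr ** h1 lam))"
    by metis
  define u where "u = (\<lambda>a\<in>LamD n r. case a of Bul lam \<Rightarrow> xD n r a ** (h0 lam \<boxplus> h1 lam) | Sg e lam \<Rightarrow> if e = 1 then xD n r a ** h0 lam else xD n r a ** h1 lam)"
  have uD: "u \<in> ED.DS" unfolding u_def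
  proof (rule ED.DS_restrict)
    fix a assume a: "a \<in> LamD n r"
    show "(case a of Bul lam \<Rightarrow> xD n r a ** (h0 lam \<boxplus> h1 lam) | Sg e lam \<Rightarrow> if e = 1 then xD n r a ** h0 lam else xD n r a ** h1 lam) \<in> rmod r Kc (xD n r a)"
    proof (cases a)
      case (Bul lam)
      then have "lam \<in> Lam n r" using a by (auto simp: LamD_def)
      then show ?thesis using Bul Kc_add h by (auto simp: rmod_def)
    next
      case (Sg e lam)
      then have "lam \<in> Lam n r" using a by (auto simp: LamD_def)
      then show ?thesis using Sg h by (auto simp: rmod_def)
    qed
  qed
  have "ident' u = m"
  proof (rule EK.DS_eqI[OF ident_DS[OF uD] m])
    fix lam assume lam: "lam \<in> Lam n r"
    have hc: "h0 lam \<in> carrier H" "h1 lam \<in> carrier H" using h lam Kc_H by auto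
    show "ident' u lam = m lam"
    proof (cases "lam (n + 1) = 0")
      case True
      note a = noncentral_LamD[OF lam True]
      have "ident' u lam = (xB n r lam ** h0 lam) \<boxplus> (Tr ** (Tr ** xB n r lam ** Tr ** h1 lam))"
        unfolding ident_apply(1)[OF lam True] using a by (simp add: u_def xD_noncentral[OF lam True])
      also have "\<dots> = m lam" unfolding h(3)[OF lam] using hc lam by (simp add: H.m_assoc H.r_distr Tr_cancel)
      finally show ?thesis .
    next
      case False
      note a = central_LamD[OF lam False]
      have x: "xD n r (Bul lam) \<in> carrier H" using Kc_H[OF xD_Kc[OF a]] .
      have "(\<^bold>1 \<boxplus> Tr) ** (Tr ** h1 lam) = (\<^bold>1 \<boxplus> Tr) ** h1 lam"
        using hc by (simp add: H.l_distr Tr_cancel H.a_comm)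
      then have e: "(\<^bold>1 \<boxplus> Tr) ** (h0 lam \<boxplus> (Tr ** h1 lam)) = (\<^bold>1 \<boxplus> Tr) ** (h0 lam \<boxplus> h1 lam)"
        using hc by (simp add: H.r_distr)
      have "ident' u lam = (\<^bold>1 \<boxplus> Tr) ** (xD n r (Bul lam) ** (h0 lam \<boxplus> h1 lam))"
        unfolding ident_apply(2)[OF lam False] using a by (simp add: u_def)
      also have "\<dots> = xB n r lam ** (h0 lam \<boxplus> h1 lam)" unfolding xD_central(1)[OF lam False] using x hc by (simp only: H.m_assoc onep_closed H.a_closed)
      also have "\<dots> = xD n r (Bul lam) ** ((\<^bold>1 \<boxplus> Tr) ** (h0 lam \<boxplus> h1 lam))" unfolding xD_central(2)[OF lam False] using x hc by (simp only: H.m_assoc onep_closed H.a_closed)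
      also have "\<dots> = xB n r lam ** (h0 lam \<boxplus> (Tr ** h1 lam))"
        unfolding e[symmetric] xD_central(2)[OF lam False] using x hc by (simp only: H.m_assoc onep_closed H.a_closed H.m_closed Tr_closed)
      finally show ?thesis unfolding h(3)[OF lam] .
    qed
  qed
  then show ?thesis using uD by blast
qed

lemma ident_add:
  assumes u: "u \<in> ED.DS" and v: "v \<in> ED.DS"
  shows "ident' (\<lambda>a\<in>LamD n r. u a \<boxplus> v a) = (\<lambda>lam\<in>Lam n r. ident' u lam \<boxplus> ident' v lam)"
proof
  fix lam
  show "ident' (\<lambda>a\<in>LamD n r. u a \<boxplus> v a) lam = (\<lambda>lam\<in>Lam n r. ident' u lam \<boxplus> ident' v lam) lam"
  proof (cases "lam \<in> Lam n r")
    case lam: True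
    show ?thesis
    proof (cases "lam (n + 1) = 0")
      case True
      note a = noncentral_LamD[OF lam True]
      show ?thesis using a lam ED.DS_H[OF u] ED.DS_H[OF v] by (simp add: ident_apply(1)[OF lam True] H.r_distr H.add.m_ac)
    next
      case False
      note a = central_LamD[OF lam False]
      show ?thesis using a lam ED.DS_H[OF u] ED.DS_H[OF v] by (simp add: ident_apply(2)[OF lam False] H.r_distr)
    qed
  qed (simp add: ident_def)
qed

lemma ident_mult:
  assumes u: "u \<in> ED.DS" and k: "k \<in> Kc"
  shows "ident' (\<lambda>a\<in>LamD n r. u a ** k) = (\<lambda>lam\<in>Lam n r. ident' u lam ** k)"
proof
  fix lam
  show "ident' (\<lambda>a\<in>LamD n r. u a ** k) lam = (\<lambda>lam\<in>Lam n r. ident' u lam ** k) lam"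
  proof (cases "lam \<in> Lam n r")
    case lam: True
    show ?thesis
    proof (cases "lam (n + 1) = 0")
      case True
      note a = noncentral_LamD[OF lam True]
      show ?thesis using a lam ED.DS_H[OF u] Kc_H[OF k] by (simp add: ident_apply(1)[OF lam True] H.l_distr H.m_assoc)
    next
      case False
      note a = central_LamD[OF lam False]
      show ?thesis using a lam ED.DS_H[OF u] Kc_H[OF k] by (simp add: ident_apply(2)[OF lam False] H.m_assoc)
    qed
  qed (simp add: ident_def)
qed

lemma ident_lincomb:
  assumes P: "finite P" and U: "\<And>Z. Z \<in> P \<Longrightarrow> U Z \<in> ED.DS"
  shows "ident' (\<lambda>a\<in>LamD n r. \<Oplus>\<^bsub>H\<^esub>Z\<in>P. scal r (c Z) ** U Z a) = (\<lambda>lam\<in>Lam n r. \<Oplus>\<^bsub>H\<^esub>Z\<in>P. scal r (c Z) ** ident' (U Z) lam)"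
proof
  fix lam
  have UH: "U Z a \<in> carrier H" if "Z \<in> P" "a \<in> LamD n r" for Z a using ED.DS_H[OF U[OF that(1)] that(2)] .
  show "ident' (\<lambda>a\<in>LamD n r. \<Oplus>\<^bsub>H\<^esub>Z\<in>P. scal r (c Z) ** U Z a) lam = (\<lambda>lam\<in>Lam n r. \<Oplus>\<^bsub>H\<^esub>Z\<in>P. scal r (c Z) ** ident' (U Z) lam) lam"
  proof (cases "lam \<in> Lam n r")
    case lam: True
    have left: "x ** (\<Oplus>\<^bsub>H\<^esub>Z\<in>P. scal r (c Z) ** U Z a) = (\<Oplus>\<^bsub>H\<^esub>Z\<in>P. scal r (c Z) ** (x ** U Z a))"
      if x: "x \<in> carrier H" and a: "a \<in> LamD n r" for x a
    proof -
      have "x ** (\<Oplus>\<^bsub>H\<^esub>Z\<in>P. scal r (c Z) ** U Z a) = (\<Oplus>\<^bsub>H\<^esub>Z\<in>P. x ** (scal r (c Z) ** U Z a))"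
        using x UH a by (intro H.finsum_rdistr[OF P]) auto
      also have "\<dots> = (\<Oplus>\<^bsub>H\<^esub>Z\<in>P. scal r (c Z) ** (x ** U Z a))"
        using x UH a by (intro H.finsum_cong') (simp_all add: Pi_iff scal_left_comm)
      finally show ?thesis .
    qed
    show ?thesis
    proof (cases "lam (n + 1) = 0")
      case True
      note a = noncentral_LamD[OF lam True]
      have "(\<Oplus>\<^bsub>H\<^esub>Z\<in>P. scal r (c Z) ** ident' (U Z) lam)
          = (\<Oplus>\<^bsub>H\<^esub>Z\<in>P. (scal r (c Z) ** U Z (Sg 1 lam)) \<boxplus> (scal r (c Z) ** (Tr ** U Z (Sg (- 1) lam))))"
        using a UH by (intro H.finsum_cong') (simp_all add: Pi_iff ident_apply(1)[OF lam True] H.r_distr)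
      also have "\<dots> = (\<Oplus>\<^bsub>H\<^esub>Z\<in>P. scal r (c Z) ** U Z (Sg 1 lam)) \<boxplus> (\<Oplus>\<^bsub>H\<^esub>Z\<in>P. scal r (c Z) ** (Tr ** U Z (Sg (- 1) lam)))"
        using a UH by (intro H.finsum_addf) auto
      finally show ?thesis using lam a left[OF Tr_closed] by (simp add: ident_apply(1)[OF lam True])
    next
      case False
      note a = central_LamD[OF lam False]
      have "ident' (\<lambda>a\<in>LamD n r. \<Oplus>\<^bsub>H\<^esub>Z\<in>P. scal r (c Z) ** U Z a) lam = (\<^bold>1 \<boxplus> Tr) ** (\<Oplus>\<^bsub>H\<^esub>Z\<in>P. scal r (c Z) ** U Z (Bul lam))"
        unfolding ident_apply(2)[OF lam False] using a by simp
      also have "\<dots> = (\<Oplus>\<^bsub>H\<^esub>Z\<in>P. scal r (c Z) ** ((\<^bold>1 \<boxplus> Tr) ** U Z (Bul lam)))" by (rule left[OF onep_closed a])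
      finally show ?thesis using lam by (simp add: ident_apply(2)[OF lam False])
    qed
  qed (simp add: ident_def)
qed

lemma schurK_EA: "schurK n r = EK.EA"
  by (simp add: schurK_def Hcheck_Kc)

lemma phi_mat_closed: "Z \<in> XiD n r \<Longrightarrow> phi_mat n r Z \<in> carrier ED.EA"
  using ex_zD phi_mat_Phi(2) Kc_H by blast

lemma phiK_ident: assumes u: "u \<in> ED.DS" shows "phiK n r Z (ident' u) = ident' (phi_mat n r Z u)"
  unfolding phiK_def Hcheck_Kc restrict_apply'[OF ident_DS[OF u]] the_inv_into_f_f[OF ident_inj u] ..

lemma phiK_closed: assumes Z: "Z \<in> XiD n r" shows "phiK n r Z \<in> carrier EK.EA"
  unfolding EK.EA_iff
proof (intro conjI ballI)
  note p = phi_mat_closed[OF Z]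
  show "phiK n r Z \<in> extensional EK.DS" by (simp add: phiK_def)
  fix m assume "m \<in> EK.DS"
  then obtain u where u: "u \<in> ED.DS" "m = ident' u" using ident_surj by blast
  note pu = ED.EA_DS[OF p u(1)]
  show "phiK n r Z m \<in> EK.DS" unfolding u(2) phiK_ident[OF u(1)] by (rule ident_DS[OF pu])
  show "phiK n r Z (\<lambda>i\<in>Lam n r. m i ** k) = (\<lambda>i\<in>Lam n r. phiK n r Z m i ** k)" if k: "k \<in> Kc" for k
  proof -
    have D: "(\<lambda>a\<in>LamD n r. u a ** k) \<in> ED.DS" using ED.DS_M[OF u(1)] ED.M_mult k by (intro ED.DS_restrict) auto
    have e: "phi_mat n r Z (\<lambda>a\<in>LamD n r. u a ** k) = (\<lambda>a\<in>LamD n r. phi_mat n r Z u a ** k)" using p u(1) k unfolding ED.EA_iff by blast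
    show ?thesis unfolding u(2) ident_mult[OF u(1) k, symmetric] phiK_ident[OF D] phiK_ident[OF u(1)] e by (rule ident_mult[OF pu k])
  qed
  fix m' assume "m' \<in> EK.DS"
  then obtain v where v: "v \<in> ED.DS" "m' = ident' v" using ident_surj by blast
  note pv = ED.EA_DS[OF p v(1)]
  have D: "(\<lambda>a\<in>LamD n r. u a \<boxplus> v a) \<in> ED.DS" using ED.DS_M[OF u(1)] ED.DS_M[OF v(1)] ED.M_add by (intro ED.DS_restrict) auto
  show "phiK n r Z (\<lambda>i\<in>Lam n r. m i \<boxplus> m' i) = (\<lambda>i\<in>Lam n r. phiK n r Z m i \<boxplus> phiK n r Z m' i)"
    unfolding u(2) v(2) ident_add[OF u(1) v(1), symmetric] phiK_ident[OF D] phiK_ident[OF u(1)] phiK_ident[OF v(1)] ED.EA_add[OF p u(1) v(1)]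
    by (rule ident_add[OF pu pv])
qed

abbreviation "combD c \<equiv> (\<Oplus>\<^bsub>ED.EA\<^esub>Z\<in>XiD n r. c Z \<odot>\<^bsub>ED.EA\<^esub> phi_mat n r Z)"
abbreviation "combK c \<equiv> (\<Oplus>\<^bsub>EK.EA\<^esub>Z\<in>XiD n r. c Z \<odot>\<^bsub>EK.EA\<^esub> phiK n r Z)"

lemma combD_closed: "combD c \<in> carrier ED.EA"
  by (rule ED.EA_lincomb_closed[OF finite_XiD phi_mat_closed])

lemma combD_apply: "u \<in> ED.DS \<Longrightarrow> a \<in> LamD n r \<Longrightarrow> combD c u a = (\<Oplus>\<^bsub>H\<^esub>Z\<in>XiD n r. scal r (c Z) ** phi_mat n r Z u a)"
  by (rule ED.EA_lincomb[OF finite_XiD phi_mat_closed])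

lemma combK_ident: assumes u: "u \<in> ED.DS" shows "combK c (ident' u) = ident' (combD c u)"
proof (rule EK.DS_eqI)
  show "combK c (ident' u) \<in> EK.DS"
    by (rule EK.EA_DS[OF EK.EA_lincomb_closed[OF finite_XiD phiK_closed] ident_DS[OF u]])
  show "ident' (combD c u) \<in> EK.DS" by (rule ident_DS[OF ED.EA_DS[OF combD_closed u]])
  fix lam assume lam: "lam \<in> Lam n r"
  have "combD c u = (\<lambda>a\<in>LamD n r. \<Oplus>\<^bsub>H\<^esub>Z\<in>XiD n r. scal r (c Z) ** phi_mat n r Z u a)"
  proof (rule extensionalityI)
    show "combD c u \<in> extensional (LamD n r)" using ED.EA_DS[OF combD_closed u] unfolding ED.DS_iff by blast
  qed (simp_all add: combD_apply[OF u])
  then have "ident' (combD c u) lam = (\<Oplus>\<^bsub>H\<^esub>Z\<in>XiD n r. scal r (c Z) ** ident' (phi_mat n r Z u) lam)"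
    using lam ident_lincomb[OF finite_XiD ED.EA_DS[OF phi_mat_closed u], where c = c] by simp
  moreover have "combK c (ident' u) lam = (\<Oplus>\<^bsub>H\<^esub>Z\<in>XiD n r. scal r (c Z) ** phiK n r Z (ident' u) lam)"
    by (rule EK.EA_lincomb[OF finite_XiD phiK_closed ident_DS[OF u] lam])
  ultimately show "combK c (ident' u) lam = ident' (combD c u) lam" unfolding phiK_ident[OF u] by simp
qed

text \<open>Transport along the identification of the two modules.\<close>

lemma product_iff:
  assumes X: "X \<in> XiD n r" and Y: "Y \<in> XiD n r"
  shows "phiK n r X \<otimes>\<^bsub>EK.EA\<^esub> phiK n r Y = combK c \<longleftrightarrow> (\<forall>u\<in>ED.DS. phi_mat n r X (phi_mat n r Y u) = combD c u)"
proof -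
  note px = phi_mat_closed[OF X] and py = phi_mat_closed[OF Y]
  have val: "(phiK n r X \<otimes>\<^bsub>EK.EA\<^esub> phiK n r Y) (ident' u) = ident' (phi_mat n r X (phi_mat n r Y u))" if u: "u \<in> ED.DS" for u
    unfolding EK.EA_mult[OF phiK_closed[OF X] phiK_closed[OF Y] ident_DS[OF u]] phiK_ident[OF u] phiK_ident[OF ED.EA_DS[OF py u]] ..
  show ?thesis
  proof
    assume eq: "phiK n r X \<otimes>\<^bsub>EK.EA\<^esub> phiK n r Y = combK c"
    show "\<forall>u\<in>ED.DS. phi_mat n r X (phi_mat n r Y u) = combD c u"
    proof
      fix u assume u: "u \<in> ED.DS"
      have "ident' (phi_mat n r X (phi_mat n r Y u)) = ident' (combD c u)"
        unfolding val[OF u, symmetric] combK_ident[OF u, symmetric] eq ..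
      then show "phi_mat n r X (phi_mat n r Y u) = combD c u"
        by (rule inj_onD[OF ident_inj _ ED.EA_DS[OF px ED.EA_DS[OF py u]] ED.EA_DS[OF combD_closed u]])
    qed
  next
    assume eq: "\<forall>u\<in>ED.DS. phi_mat n r X (phi_mat n r Y u) = combD c u"
    show "phiK n r X \<otimes>\<^bsub>EK.EA\<^esub> phiK n r Y = combK c"
    proof (rule EK.EA_eqI[OF EK.EA_mult_closed[OF phiK_closed[OF X] phiK_closed[OF Y]] EK.EA_lincomb_closed[OF finite_XiD phiK_closed]])
      fix m assume "m \<in> EK.DS"
      then obtain u where u: "u \<in> ED.DS" "m = ident' u" using ident_surj by blast
      show "(phiK n r X \<otimes>\<^bsub>EK.EA\<^esub> phiK n r Y) m = combK c m"
        unfolding u(2) val[OF u(1)] combK_ident[OF u(1)] using eq u(1) by simp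
    qed
  qed
qed

lemma phi_mat_apply:
  assumes Z: "Z \<in> XiD n r" and z: "z \<in> carrier H" "z ** xD n r (ra Z) = Tsum r (TZ Z)" and u: "u \<in> ED.DS" and a: "a \<in> LamD n r"
  shows "phi_mat n r Z u a = (if a = la Z then z ** u (ra Z) else \<^bold>0)"
  unfolding phi_mat_Phi(1)[OF Z z] ED.Phi_apply[OF u] ED.dinj_apply[OF a] ..

lemma phi_mat_apply_gen:
  assumes Z: "Z \<in> XiD n r" and u: "u \<in> ED.DS" and a: "a \<in> LamD n r" and k: "k \<in> carrier H" "u (ra Z) = xD n r (ra Z) ** k"
  shows "phi_mat n r Z u a = (if a = la Z then Tsum r (TZ Z) ** k else \<^bold>0)"
proof -
  obtain z where z: "z \<in> Kc" "z ** xD n r (ra Z) = Tsum r (TZ Z)" using ex_zD[OF Z] by blast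
  have "z ** u (ra Z) = Tsum r (TZ Z) ** k"
    unfolding k(2) z(2)[symmetric] using Kc_H[OF z(1)] Kc_H[OF xD_Kc[OF XiD_data(3)[OF Z]]] k(1) by (simp add: H.m_assoc)
  then show ?thesis unfolding phi_mat_apply[OF Z Kc_H[OF z(1)] z(2) u a] by simp
qed

text \<open>After the twist both factorizations become factorizations through sums over the groups \<open>HP\<close>.\<close>

lemma DD_invariant:
  assumes a: "a \<in> LamD n r" and c: "c \<in> LamD n r" and f: "f \<in> carrier H" and f1: "k1 \<in> carrier H" "f = xD n r a ** k1"
    and f2: "k2 \<in> carrier H" "f = k2 ** xD n r c" and w: "w \<in> W" and y: "y \<in> DD a w c"
  shows "cf f y = cf f w"
proof -
  obtain lam e where lam: "lam \<in> Lam n r" "is_sign e" "a = bracket n lam e" using a by (rule LamD_cases)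
  obtain mu g where mu: "mu \<in> Lam n r" "is_sign g" "c = bracket n mu g" using c by (rule LamD_cases)
  define f' where "f' = tau e ** f ** tau g"
  have e1: "f' = Tsum r (HP lam) ** (tau e ** k1 ** tau g)"
    unfolding f'_def f1(2) lam(3) xD_bracket[OF lam(1,2)] using f1(1) by (simp add: H.m_assoc tau_cancel)
  have e2: "f' = (tau e ** k2 ** tau g) ** Tsum r (HP mu)"
    unfolding f'_def f2(2) mu(3) xD_bracket[OF mu(1,2)] using f2(1) by (simp add: H.m_assoc)
  have yW: "y \<in> W" using y DD_W(1)[OF a c w] by blast
  have val: "cf f v = cf f' (tw e g v)" if v: "v \<in> W" for v
    unfolding f'_def cf_tau[OF f tw_W[OF v]] tw_tw ..
  have "tw e g y \<in> DHat lam (tw e g w) mu"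
    using y unfolding lam(3) mu(3) DD_bracket[OF lam(1,2) mu(1,2)] .
  then obtain p q where pq: "p \<in> HP lam" "q \<in> HP mu" "tw e g y = p o (tw e g w) o q" by (rule dcE)
  have twW: "tw e g w \<in> W" by (rule tw_W[OF w])
  have "cf f' (p o (tw e g w) o q) = cf f' (p o (tw e g w))"
    unfolding e2 using f2(1) by (intro right_invariant[OF mu(1) _ pq(2) WB_comp[OF HP_W[OF pq(1)] twW]]) simp
  also have "\<dots> = cf f' (tw e g w)"
    unfolding e1 using f1(1) by (intro left_invariant[OF lam(1) _ pq(1) twW]) simp
  finally show ?thesis unfolding val[OF yW] val[OF w] pq(3) .
qed

definition TM :: "dweight \<Rightarrow> dweight \<Rightarrow> dmatrix \<Rightarrow> hecke" where
  "TM a b Z = (if la Z = a \<and> ra Z = b then Tsum r (TZ Z) else \<^bold>0)"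

lemma TM_eq: "la Z = a \<Longrightarrow> ra Z = b \<Longrightarrow> TM a b Z = Tsum r (TZ Z)" and TM_neq: "\<not> (la Z = a \<and> ra Z = b) \<Longrightarrow> TM a b Z = \<^bold>0"
  by (simp_all only: TM_def simp_thms if_True if_False)

lemma TM_closed: assumes "Z \<in> XiD n r" shows "TM a b Z \<in> carrier H"
proof (cases "la Z = a \<and> ra Z = b")
  case True
  then have "TM a b Z = Tsum r (TZ Z)" using TM_eq by blast
  then show ?thesis using Tsum_closed[OF TZ_props(1)[OF assms]] by (simp only:)
next
  case False
  then show ?thesis using TM_neq[OF False] by (simp only: H.zero_closed)
qed

lemma cf_TM: assumes Z: "Z \<in> XiD n r" shows "cf (TM a b Z) w = (if la Z = a \<and> ra Z = b \<and> w \<in> TZ Z then 1 else 0)"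
proof (cases "la Z = a \<and> ra Z = b")
  case True
  then have "TM a b Z = Tsum r (TZ Z)" using TM_eq by blast
  then show ?thesis using True cf_Tsum[OF TZ_props(1)[OF Z], of w] by auto
next
  case False
  then show ?thesis using TM_neq[OF False] by auto
qed

lemma cf_comb:
  assumes a: "a \<in> LamD n r" and b: "b \<in> LamD n r"
  shows "cf (\<Oplus>\<^bsub>H\<^esub>Z\<in>XiD n r. scal r (c Z) ** TM a b Z) w =
    (\<Sum>Z\<in>{Z \<in> XiD n r. la Z = a \<and> ra Z = b \<and> w \<in> TZ Z}. c Z)"
proof -
  have "cf (\<Oplus>\<^bsub>H\<^esub>Z\<in>XiD n r. scal r (c Z) ** TM a b Z) w = (\<Sum>Z\<in>XiD n r. cf (scal r (c Z) ** TM a b Z) w)"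
    using TM_closed by (intro cf_finsum[OF finite_XiD]) simp
  also have "\<dots> = (\<Sum>Z\<in>XiD n r. c Z * cf (TM a b Z) w)"
    using TM_closed by (intro sum.cong refl cf_scal)
  also have "\<dots> = (\<Sum>Z\<in>XiD n r. if la Z = a \<and> ra Z = b \<and> w \<in> TZ Z then c Z else 0)"
    by (intro sum.cong refl) (simp only: cf_TM if_distrib[of "(*) _"] mult_1_right mult_zero_right)
  also have "\<dots> = (\<Sum>Z\<in>{Z \<in> XiD n r. la Z = a \<and> ra Z = b \<and> w \<in> TZ Z}. c Z)"
    by (rule sum.inter_filter[OF finite_XiD, symmetric])
  finally show ?thesis .
qed

lemma coset_index: assumes "Z \<in> XiD n r" "w \<in> TZ Z" shows "{Z' \<in> XiD n r. la Z' = la Z \<and> ra Z' = ra Z \<and> w \<in> TZ Z'} = {Z}"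
  using TZ_unique[OF _ assms(1)] assms by auto

text \<open>The product of the two maps is multiplication by an even element whose coefficients are constant on the
  double cosets of type D, so it is the combination of their sums with these coefficients.\<close>

lemma structure_const_value:
  assumes X: "X \<in> XiD n r" and Y: "Y \<in> XiD n r" and Z: "Z \<in> XiD n r"
    and z: "z \<in> Kc" "z ** xD n r (ra X) = Tsum r (TZ X)"
  shows "structure_constK n r X Y Z = (if ra X = la Y \<and> la Z = la X \<and> ra Z = ra Y then cf (z ** Tsum r (TZ Y)) (rep Z) else 0)"
proof -
  define f where "f = z ** Tsum r (TZ Y)"
  define c0 where "c0 = (\<lambda>Z\<in>XiD n r. if ra X = la Y \<and> la Z = la X \<and> ra Z = ra Y then cf f (rep Z) else 0)"
  note dX = XiD_data[OF X] and dY = XiD_data[OF Y]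
  have zH: "z \<in> carrier H" by (rule Kc_H[OF z(1)])
  have TYc: "Tsum r (TZ Y) \<in> Kc" by (rule Kc_Tsum[OF TZ_props(1,2)[OF Y]])
  have fK: "f \<in> Kc" unfolding f_def by (rule Kc_mult[OF z(1) TYc])
  obtain y where y: "y \<in> Kc" "y ** xD n r (ra Y) = Tsum r (TZ Y)" using ex_zD[OF Y] by blast
  obtain y' where y': "y' \<in> Kc" "Tsum r (TZ Y) = xD n r (la Y) ** y'" using ex_coquotD[OF dY(2-5)] by blast
  obtain x' where x': "x' \<in> Kc" "Tsum r (TZ X) = xD n r (la X) ** x'" using ex_coquotD[OF dX(2-5)] by blast
  note xc = Kc_H[OF xD_Kc[OF dX(2)]] Kc_H[OF xD_Kc[OF dX(3)]] Kc_H[OF xD_Kc[OF dY(2)]] Kc_H[OF xD_Kc[OF dY(3)]]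
  note KH = Kc_H[OF y(1)] Kc_H[OF y'(1)] Kc_H[OF x'(1)]
  have expand: "f = (\<Oplus>\<^bsub>H\<^esub>Z\<in>XiD n r. scal r (c0 Z) ** TM (la X) (ra Y) Z)"
    if mid: "ra X = la Y"
  proof (rule cf_eqI[OF Kc_H[OF fK]])
    have f1: "f = xD n r (la X) ** (x' ** y')"
    proof -
      have "f = (z ** xD n r (ra X)) ** y'" unfolding f_def y'(2) mid using zH KH xc by (simp add: H.m_assoc)
      then show ?thesis unfolding z(2) x'(2) using KH xc by (simp add: H.m_assoc)
    qed
    have f2: "f = (z ** y) ** xD n r (ra Y)" unfolding f_def y(2)[symmetric] using zH KH xc by (simp add: H.m_assoc)
    fix w assume w: "w \<in> W"
    show "cf f w = cf (\<Oplus>\<^bsub>H\<^esub>Z\<in>XiD n r. scal r (c0 Z) ** TM (la X) (ra Y) Z) w"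
      unfolding cf_comb[OF dX(2) dY(3)]
    proof (cases "par w = 1")
      case True
      obtain Z0 where Z0: "Z0 \<in> XiD n r" "la Z0 = la X" "ra Z0 = ra Y" "w \<in> TZ Z0"
        using TZ_exists[OF dX(2) dY(3) w True] by blast
      have "cf f w = cf f (rep Z0)"
        using Z0(4) DD_invariant[OF dX(2) dY(3) Kc_H[OF fK] _ f1 _ f2 XiD_data(4)[OF Z0(1)]] zH KH unfolding Z0(2,3) by simp
      moreover have "{Z \<in> XiD n r. la Z = la X \<and> ra Z = ra Y \<and> w \<in> TZ Z} = {Z0}"
        using coset_index[OF Z0(1,4)] unfolding Z0(2,3) .
      ultimately show "cf f w = (\<Sum>Z\<in>{Z \<in> XiD n r. la Z = la X \<and> ra Z = ra Y \<and> w \<in> TZ Z}. c0 Z)"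
        using Z0 mid by (simp add: c0_def)
    next
      case False
      then have "{Z \<in> XiD n r. la Z = la X \<and> ra Z = ra Y \<and> w \<in> TZ Z} = {}" using TZ_props(2) by blast
      moreover have "cf f w = 0" using False fK by (auto simp: Kc_def)
      ultimately show "cf f w = (\<Sum>Z\<in>{Z \<in> XiD n r. la Z = la X \<and> ra Z = ra Y \<and> w \<in> TZ Z}. c0 Z)"
        by (simp only: sum.empty)
    qed
  qed (use TM_closed in simp)
  have prod: "phi_mat n r X (phi_mat n r Y u) = combD c0 u" if u: "u \<in> ED.DS" for u
  proof (rule ED.DS_eqI)
    note pyu = ED.EA_DS[OF phi_mat_closed[OF Y] u]
    show "phi_mat n r X (phi_mat n r Y u) \<in> ED.DS" by (rule ED.EA_DS[OF phi_mat_closed[OF X] pyu])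
    show "combD c0 u \<in> ED.DS" by (rule ED.EA_DS[OF combD_closed u])
    fix a assume a: "a \<in> LamD n r"
    obtain k where k: "k \<in> Kc" "u (ra Y) = xD n r (ra Y) ** k" using ED.DS_M[OF u dY(3)] by (auto simp: rmod_def)
    have kH: "k \<in> carrier H" by (rule Kc_H[OF k(1)])
    have lhs: "phi_mat n r X (phi_mat n r Y u) a = (if a = la X \<and> ra X = la Y then f ** k else \<^bold>0)"
      unfolding phi_mat_apply[OF X zH z(2) pyu a] phi_mat_apply_gen[OF Y u dX(3) kH k(2)]
      using zH kH Kc_H[OF TYc] by (simp add: f_def H.m_assoc)
    have summand: "scal r (c0 Z) ** phi_mat n r Z u a =
        (scal r (c0 Z) ** TM (la X) (ra Y) Z) ** (if a = la X then k else \<^bold>0)"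
      if Z: "Z \<in> XiD n r" for Z
    proof (cases "la Z = la X \<and> ra Z = ra Y")
      case True
      have "phi_mat n r Z u a = (if a = la Z then Tsum r (TZ Z) ** k else \<^bold>0)"
        by (rule phi_mat_apply_gen[OF Z u a kH]) (use True k(2) in simp)
      then show ?thesis using True kH TM_eq[of Z "la X" "ra Y"] TM_closed[OF Z, of "la X" "ra Y"] by (simp add: H.m_assoc)
    next
      case False
      then have "c0 Z = 0" using Z by (auto simp: c0_def)
      then show ?thesis using kH ED.DS_H[OF ED.EA_DS[OF phi_mat_closed[OF Z] u] a] TM_closed[OF Z] by simp
    qed
    have "combD c0 u a = (\<Oplus>\<^bsub>H\<^esub>Z\<in>XiD n r. (scal r (c0 Z) ** TM (la X) (ra Y) Z) ** (if a = la X then k else \<^bold>0))"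
      unfolding combD_apply[OF u a] using TM_closed kH by (intro H.finsum_cong') (simp_all add: Pi_iff summand)
    also have "\<dots> = (\<Oplus>\<^bsub>H\<^esub>Z\<in>XiD n r. scal r (c0 Z) ** TM (la X) (ra Y) Z) ** (if a = la X then k else \<^bold>0)"
      using TM_closed kH by (intro H.finsum_ldistr[OF finite_XiD, symmetric]) auto
    also have "\<dots> = (if a = la X \<and> ra X = la Y then f ** k else \<^bold>0)"
    proof (cases "ra X = la Y")
      case True
      then show ?thesis unfolding expand[OF True, symmetric] using Kc_H[OF fK] by simp
    next
      case False
      have "(\<Oplus>\<^bsub>H\<^esub>Z\<in>XiD n r. scal r (c0 Z) ** TM (la X) (ra Y) Z) = \<^bold>0"
        using False TM_closed by (intro H.add.finprod_one_eqI) (simp add: c0_def)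
      then show ?thesis using False kH by simp
    qed
    finally show "phi_mat n r X (phi_mat n r Y u) a = combD c0 u a" unfolding lhs by simp
  qed
  \<comment> \<open>The coefficients are recovered by evaluating at a generator.\<close>
  have uniq: "c Z = cf (phi_mat n r X (phi_mat n r Y (dinj r (LamD n r) (ra Z) (xD n r (ra Z)))) (la Z)) (rep Z)"
    if eq: "\<forall>u\<in>ED.DS. phi_mat n r X (phi_mat n r Y u) = combD c u" and Z: "Z \<in> XiD n r" for c Z
  proof -
    note dZ = XiD_data[OF Z]
    define u where "u = dinj r (LamD n r) (ra Z) (xD n r (ra Z))"
    have xH: "xD n r a \<in> carrier H" if "a \<in> LamD n r" for a using Kc_H[OF xD_Kc[OF that]] .
    have "xD n r (ra Z) \<in> rmod r Kc (xD n r (ra Z))"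
      unfolding rmod_def using Kc_one xH[OF dZ(3)] by (intro image_eqI[of _ _ "\<^bold>1"]) simp_all
    then have u: "u \<in> ED.DS" unfolding u_def by (rule ED.dinj_DS[OF _ dZ(3)])
    have "phi_mat n r Z' u (la Z) = TM (la Z) (ra Z) Z'" if Z': "Z' \<in> XiD n r" for Z'
    proof -
      have r': "ra Z' \<in> LamD n r" using XiD_data(3)[OF Z'] .
      have "u (ra Z') = xD n r (ra Z') ** (if ra Z' = ra Z then \<^bold>1 else \<^bold>0)"
        unfolding u_def ED.dinj_apply[OF r'] using xH[OF r'] xH[OF dZ(3)] by (cases "ra Z' = ra Z") simp_all
      then have "phi_mat n r Z' u (la Z) = (if la Z = la Z' then Tsum r (TZ Z') ** (if ra Z' = ra Z then \<^bold>1 else \<^bold>0) else \<^bold>0)"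
        by (intro phi_mat_apply_gen[OF Z' u dZ(2)]) simp_all
      moreover have "Tsum r (TZ Z') \<in> carrier H" by (rule Tsum_closed[OF TZ_props(1)[OF Z']])
      ultimately show ?thesis using TM_eq[of Z' "la Z" "ra Z"] TM_neq[of Z' "la Z" "ra Z"]
        by (cases "la Z' = la Z"; cases "ra Z' = ra Z") (simp_all del: Tsum_closed)
    qed
    then have "combD c u (la Z) = (\<Oplus>\<^bsub>H\<^esub>Z'\<in>XiD n r. scal r (c Z') ** TM (la Z) (ra Z) Z')"
      unfolding combD_apply[OF u dZ(2)] using TM_closed by (intro H.finsum_cong') (simp_all add: Pi_iff)
    then have "cf (combD c u (la Z)) (rep Z) = (\<Sum>Z'\<in>{Z' \<in> XiD n r. la Z' = la Z \<and> ra Z' = ra Z \<and> rep Z \<in> TZ Z'}. c Z')"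
      using cf_comb[OF dZ(2,3)] by simp
    also have "\<dots> = c Z" unfolding coset_index[OF Z TZ_props(3)[OF Z]] by simp
    finally show ?thesis using eq u unfolding u_def by simp
  qed
  have "structure_constK n r X Y = c0"
    unfolding structure_constK_def schurK_EA
  proof (rule the_equality)
    show "c0 \<in> extensional (XiD n r) \<and> phiK n r X \<otimes>\<^bsub>EK.EA\<^esub> phiK n r Y = combK c0"
      using prod product_iff[OF X Y, of c0] by (simp add: c0_def)
    fix c assume "c \<in> extensional (XiD n r) \<and> phiK n r X \<otimes>\<^bsub>EK.EA\<^esub> phiK n r Y = combK c"
    then have c: "c \<in> extensional (XiD n r)" "\<forall>u\<in>ED.DS. phi_mat n r X (phi_mat n r Y u) = combD c u"
      using product_iff[OF X Y, of c] by auto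
    show "c = c0"
    proof (rule extensionalityI[OF c(1)])
      show "c0 \<in> extensional (XiD n r)" by (simp add: c0_def)
      fix Z assume Z: "Z \<in> XiD n r"
      have "\<forall>u\<in>ED.DS. phi_mat n r X (phi_mat n r Y u) = combD c0 u" using prod by blast
      then show "c Z = c0 Z" using uniq[OF c(2) Z] uniq[of c0, OF _ Z] by simp
    qed
  qed
  then show ?thesis using Z by (simp add: c0_def f_def)
qed

subsection \<open>Comparison of the structure constants\<close>

text \<open>As the representative is the identity, both sides of the matrix can be given the same sign.\<close>

lemma unit_signs:
  assumes X: "X \<in> XiD n r" and B: "dm (underlying X) = id" "sgn_mat n (underlying X) = 1"
  obtains e where "is_sign e" "la X = bracket n (rowW (underlying X)) e" "ra X = bracket n (colW (underlying X)) e" "rep X = id"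
proof (rule XiD_cases[OF X])
  fix A assume A: "X = Dot A" "A \<in> Xi n r" "A (n + 1) (n + 1) \<noteq> 0"
  have "id \<in> weylD r" using WB_id by (simp add: weylD_par)
  then show thesis using that[of 1] A B central_weights[OF A(2,3)] by (simp add: bracket_def)
next
  fix e A e' assume A: "X = Signed e A e'" "A \<in> Xi n r" "A (n + 1) (n + 1) = 0" "is_sign e" "is_sign e'" "e * e' = sgn_mat n A"
  then have "e' = e" using B by auto
  then show thesis using that[of e] A B by simp
qed

text \<open>After the twist the constant is a coefficient of \<open>z \<star> \<Sum>T\<^sub>w\<close> over a double
  coset of the groups \<open>HP\<close>, whose representative differs from the one of \<open>A\<close> by an
  element of \<open>W\<^sub>\<lambda>\<close>; hence the full double coset is the one of \<open>A\<close>.\<close>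

lemma structure_const_B:
  assumes X: "X \<in> XiD n r" and Y: "Y \<in> XiD n r" and Z: "Z \<in> XiD n r"
    and B: "dm (underlying X) = id" "sgn_mat n (underlying X) = 1" and nz: "structure_constK n r X Y Z \<noteq> 0"
  defines "al \<equiv> rowW (underlying X)" and "lam \<equiv> colW (underlying X)" and "ga \<equiv> colW (underlying Y)"
  shows "rowW (underlying Y) = lam"
    "\<exists>v\<in>W. \<forall>zB\<in>carrier H. zB ** Tsum r (PB lam) = Tsum r (DFull al id lam) \<longrightarrow>
      cf (zB ** Tsum r (DFull lam (dm (underlying Y)) ga)) v = structure_constK n r X Y Z \<or>
      (\<not> cen al \<subseteq> cen lam \<and> cf (zB ** Tsum r (DFull lam (dm (underlying Y)) ga)) v = 2 * structure_constK n r X Y Z)"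
proof -
  note dX = XiD_data[OF X] and dY = XiD_data[OF Y] and dZ = XiD_data[OF Z]
  have L: "al \<in> Lam n r" "lam \<in> Lam n r" "ga \<in> Lam n r"
    using mat_triple_props(1,2)[OF dX(1)] mat_triple_props(2)[OF dY(1)] by (auto simp: al_def lam_def ga_def)
  obtain e where e: "is_sign e" "la X = bracket n al e" "ra X = bracket n lam e" "rep X = id"
    using unit_signs[OF X B] unfolding al_def lam_def by blast
  have id1: "tw e e id = id" by simp
  obtain z where z: "z \<in> carrier H" "z ** Tsum r (HP lam) = Tsum r (DHat al id lam)" "\<forall>u. cf z u \<noteq> 0 \<longrightarrow> u \<in> hInc lam \<and> u \<in> DHat al id lam"
    "tau e ** z ** tau e \<in> Kc" "(tau e ** z ** tau e) ** xD n r (ra X) = Tsum r (TZ X)"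
    using ex_quotD[OF L(1) e(1) L(2) e(1) WB_id par_id] unfolding id1 e(2-4) by blast
  note val = structure_const_value[OF X Y Z z(4,5)]
  have cond: "ra X = la Y" and s: "structure_constK n r X Y Z = cf (tau e ** z ** tau e ** Tsum r (TZ Y)) (rep Z)"
    using nz val by (auto split: if_splits)
  obtain e2 g where Yd: "is_sign e2" "is_sign g" "la Y = bracket n (rowW (underlying Y)) e2" "ra Y = bracket n ga g"
    "rep Y = ss e2 o dm (underlying Y) o ss g" using dY(6) unfolding ga_def by blast
  show row: "rowW (underlying Y) = lam" using cond unfolding e(3) Yd(3) bracket_eq by simp
  define d where "d = dm (underlying Y)"
  define kap where "kap = ss e o ss e2"
  have dW: "d \<in> W" using dmat_W[OF dY(1)] by (simp add: d_def)
  have kapP: "kap \<in> PB lam"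
  proof (cases "e = e2")
    case False
    then have "r \<in> Jset lam" using cond cen_r_iff(1)[OF L(2)] unfolding e(3) Yd(3) bracket_eq by auto
    then show ?thesis using sg_PB[OF L(2)] e(1) Yd(1) False by (auto simp: kap_def)
  qed (simp add: kap_def)
  have w: "ss e o rep Y o ss g = kap o d" unfolding Yd(5) kap_def d_def by (simp add: fun_eq_iff)
  have wW: "kap o d \<in> W" using WB_comp[OF PB_W[OF kapP] dW] .
  have TY: "Tsum r (TZ Y) = tau e ** Tsum r (DHat lam (kap o d) ga) ** tau g"
    unfolding cond[symmetric] e(3) Yd(4) Tsum_DD[OF L(2) e(1) L(3) Yd(2) dY(4)] w ..
  have DHc: "Tsum r (DHat lam (kap o d) ga) \<in> carrier H" using DHat_W[OF wW] by simp
  define v where "v = ss e o rep Z o ss g"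
  have vW: "v \<in> W" unfolding v_def by (rule tw_W[OF dZ(4)])
  have "tau e ** z ** tau e ** Tsum r (TZ Y) = tau e ** (z ** Tsum r (DHat lam (kap o d) ga)) ** tau g"
    unfolding TY using z(1) DHc by (simp add: H.m_assoc tau_cancel)
  then have s': "structure_constK n r X Y Z = cf (z ** Tsum r (DHat lam (kap o d) ga)) v"
    unfolding s v_def using cf_tau[OF _ dZ(4)] z(1) DHc by simp
  have supp: "u \<in> HP al" if "cf z u \<noteq> 0" for u
    using z(3) that hInc_in_product[OF L(1,2)] by blast
  have "id \<in> PB ga" by simp
  then have "kap o d o id \<in> DFull lam d ga" by (rule dcI[OF kapP])
  then have DF: "DFull lam (kap o d) ga = DFull lam d ga" using DFull_eq by simp
  have "cf (zB ** Tsum r (DFull lam d ga)) v = structure_constK n r X Y Z \<or>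
      (\<not> cen al \<subseteq> cen lam \<and> cf (zB ** Tsum r (DFull lam d ga)) v = 2 * structure_constK n r X Y Z)"
    if zB: "zB \<in> carrier H" "zB ** Tsum r (PB lam) = Tsum r (DFull al id lam)" for zB
    using compare_coefficients[OF L wW z(1,2) supp zB, of v] nz unfolding s' DF by blast
  then show "\<exists>v\<in>W. \<forall>zB\<in>carrier H. zB ** Tsum r (PB lam) = Tsum r (DFull al id lam) \<longrightarrow>
      cf (zB ** Tsum r (DFull lam (dm (underlying Y)) ga)) v = structure_constK n r X Y Z \<or>
      (\<not> cen al \<subseteq> cen lam \<and> cf (zB ** Tsum r (DFull lam (dm (underlying Y)) ga)) v = 2 * structure_constK n r X Y Z)"
    unfolding d_def using vW by blast
qed

lemma schurB_EA: "schurB n r = EB.EA"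
  by (simp add: schurB_def)

lemma eB_Phi:
  assumes A: "A \<in> Xi n r" and z: "z \<in> carrier H" "z ** Tsum r (PB (colW A)) = Tsum r (DFull (rowW A) (dm A) (colW A))"
  shows "eB n r A = EB.Phi z (rowW A) (colW A)" "eB n r A \<in> carrier EB.EA"
proof -
  note m = mat_triple_props(1,2)[OF A]
  obtain z' where z': "z' \<in> carrier H" "Tsum r (PB (rowW A)) ** z' = Tsum r (DFull (rowW A) (dm A) (colW A))"
    using ex_coquotient_full[OF m dmat_W[OF A]] by blast
  have z2: "z ** xB n r (colW A) = Tsum r (DFull (rowW A) (dm A) (colW A))"
    using z(2) xB_closed[OF m(2)] by simp
  have z2': "Tsum r (DFull (rowW A) (dm A) (colW A)) = xB n r (rowW A) ** z'"
    using z'(2) xB_closed[OF m(1)] by simp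
  note b = basis_hom_Phi[where K = "carrier H" and I = "Lam n r" and x = "xB n r", OF endo_B xB_carrier H.one_closed m z(1) z2 z'(1) z2' H.m_closed]
  show "eB n r A = EB.Phi z (rowW A) (colW A)"
    unfolding eB_def using A b(1) by (simp add: Wpar_PB m)
  then show "eB n r A \<in> carrier EB.EA" using b(2) by simp
qed

lemma eB_closed: "eB n r A \<in> carrier EB.EA"
proof (cases "A \<in> Xi n r")
  case True
  note m = mat_triple_props(1,2)[OF True]
  show ?thesis using ex_quotient_full[OF m dmat_W[OF True]] eB_Phi(2)[OF True] by blast
next
  case False
  interpret E: abelian_monoid EB.EA by (rule EB.EA_abelian_monoid)
  show ?thesis using False E.zero_closed by (simp add: eB_def schurB_EA)
qed

lemma xB_dinj: assumes "ga \<in> Lam n r" shows "dinj r (Lam n r) ga (xB n r ga) \<in> EB.DS"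
proof (rule EB.dinj_DS[OF _ assms])
  show "xB n r ga \<in> rmod r (carrier H) (xB n r ga)"
    unfolding rmod_def using assms by (intro image_eqI[of _ _ "\<^bold>1"]) simp_all
qed

lemma eB_apply:
  assumes al: "al \<in> Lam n r" and ga: "ga \<in> Lam n r"
  shows "eB n r M (dinj r (Lam n r) ga (xB n r ga)) al =
    (if M \<in> Xi n r \<and> rowW M = al \<and> colW M = ga then Tsum r (DFull al (dm M) ga) else \<^bold>0)"
proof (cases "M \<in> Xi n r")
  case True
  note m = mat_triple_props(1,2)[OF True]
  obtain z where z: "z \<in> carrier H" "z ** Tsum r (PB (colW M)) = Tsum r (DFull (rowW M) (dm M) (colW M))"
    using ex_quotient_full[OF m dmat_W[OF True]] by blast
  have e: "eB n r M (dinj r (Lam n r) ga (xB n r ga)) al =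
      (if al = rowW M then z ** (if colW M = ga then xB n r ga else \<^bold>0) else \<^bold>0)"
    unfolding eB_Phi(1)[OF True z] EB.Phi_apply[OF xB_dinj[OF ga]] EB.dinj_apply[OF al] EB.dinj_apply[OF m(2)] ..
  show ?thesis
  proof (cases "rowW M = al \<and> colW M = ga")
    case eq: True
    have "eB n r M (dinj r (Lam n r) ga (xB n r ga)) al = z ** Tsum r (PB ga)" using e eq xB_closed[OF ga] by simp
    also have "\<dots> = Tsum r (DFull al (dm M) ga)" using z(2) eq by simp
    finally show ?thesis using eq True by simp
  next
    case ne: False
    then have "eB n r M (dinj r (Lam n r) ga (xB n r ga)) al = \<^bold>0" using e z(1) by (cases "al = rowW M") simp_all
    moreover have "\<not> (M \<in> Xi n r \<and> rowW M = al \<and> colW M = ga)" using ne by blast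
    ultimately show ?thesis by (simp only: if_False)
  qed
next
  case False
  then show ?thesis using al xB_dinj[OF ga] by (simp add: eB_def schurB_EA End_alg_def)
qed

text \<open>The hypothesis is evaluated at the generator \<open>x\<^sub>\<gamma>\<close>, and the coefficient at
  \<open>v\<close> is singled out: at most one double coset contains \<open>v\<close>.\<close>

lemma B_constants:
  assumes A: "A \<in> Xi n r" and B: "B \<in> Xi n r" and mid: "colW B = rowW A" and id: "dm B = id"
    and zB: "zB \<in> carrier H" "zB ** Tsum r (PB (colW B)) = Tsum r (DFull (rowW B) id (colW B))"
    and prod: "eB n r B \<otimes>\<^bsub>schurB n r\<^esub> eB n r A = (\<Oplus>\<^bsub>schurB n r\<^esub>p\<in>P. g p \<odot>\<^bsub>schurB n r\<^esub> eB n r (M p))"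
    and P: "finite P" "inj_on M P" and v: "v \<in> W"
  shows "cf (zB ** Tsum r (DFull (colW B) (dm A) (colW A))) v \<in> insert 0 (g ` P)"
proof -
  define al ga where "al = rowW B" and "ga = colW A"
  have L: "al \<in> Lam n r" "ga \<in> Lam n r" and LB: "colW B \<in> Lam n r"
    using mat_triple_props(1,2)[OF A] mat_triple_props(1,2)[OF B] by (auto simp: al_def ga_def)
  define u where "u = dinj r (Lam n r) ga (xB n r ga)"
  have u: "u \<in> EB.DS" unfolding u_def by (rule xB_dinj[OF L(2)])
  have uA: "eB n r A u (colW B) = Tsum r (DFull (colW B) (dm A) ga)"
    unfolding u_def eB_apply[OF LB L(2)] using A mid by (simp add: ga_def)
  have "eB n r B (eB n r A u) al = zB ** eB n r A u (colW B)"
    unfolding eB_Phi(1)[OF B zB[folded id]] EB.Phi_apply[OF EB.EA_DS[OF eB_closed u]] using L by (simp add: EB.dinj_apply al_def)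
  then have lhs: "(eB n r B \<otimes>\<^bsub>EB.EA\<^esub> eB n r A) u al = zB ** Tsum r (DFull (colW B) (dm A) ga)"
    unfolding EB.EA_mult[OF eB_closed eB_closed u] uA .
  define Q where "Q = {p \<in> P. M p \<in> Xi n r \<and> rowW (M p) = al \<and> colW (M p) = ga \<and> v \<in> DFull al (dm (M p)) ga}"
  have Tc: "eB n r N u al \<in> carrier H" for N by (rule EB.DS_H[OF EB.EA_DS[OF eB_closed u] L(1)])
  have "(\<Oplus>\<^bsub>EB.EA\<^esub>p\<in>P. g p \<odot>\<^bsub>EB.EA\<^esub> eB n r (M p)) u al = (\<Oplus>\<^bsub>H\<^esub>p\<in>P. scal r (g p) ** eB n r (M p) u al)"
    by (rule EB.EA_lincomb[OF P(1) eB_closed u L(1)])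
  then have "cf (zB ** Tsum r (DFull (colW B) (dm A) ga)) v = (\<Sum>p\<in>P. cf (scal r (g p) ** eB n r (M p) u al) v)"
    using prod lhs cf_finsum[OF P(1), of "\<lambda>p. scal r (g p) ** eB n r (M p) u al" v] Tc unfolding schurB_EA by simp
  also have "\<dots> = (\<Sum>p\<in>P. if p \<in> Q then g p else 0)"
  proof (rule sum.cong[OF refl])
    fix p assume p: "p \<in> P"
    have "cf (eB n r (M p) u al) v = (if p \<in> Q then 1 else 0)"
    proof (cases "M p \<in> Xi n r")
      case True
      then show ?thesis unfolding u_def eB_apply[OF L] using p DFull_W[OF dmat_W[OF True]] by (auto simp: Q_def cf_Tsum)
    qed (simp add: u_def eB_apply[OF L] Q_def)
    then show "cf (scal r (g p) ** eB n r (M p) u al) v = (if p \<in> Q then g p else 0)" using cf_scal[OF Tc] by simp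
  qed
  also have "\<dots> = (\<Sum>p\<in>Q. g p)"
  proof -
    have "{p \<in> P. p \<in> Q} = Q" by (auto simp: Q_def)
    then show ?thesis using sum.inter_filter[OF P(1), of g "\<lambda>p. p \<in> Q"] by simp
  qed
  finally have val: "cf (zB ** Tsum r (DFull (colW B) (dm A) ga)) v = (\<Sum>p\<in>Q. g p)" .
  have Mp: "M p = (\<lambda>i j. int (wmat al v ga i j))" if "p \<in> Q" for p
    using Xi_wmat_eq[of "M p" v] that by (auto simp: Q_def)
  have one: "p = q" if "p \<in> Q" "q \<in> Q" for p q
    by (rule inj_onD[OF P(2) trans[OF Mp[OF that(1)] Mp[OF that(2), symmetric]]]) (use that in \<open>simp_all add: Q_def\<close>)
  show ?thesis
  proof (cases "Q = {}")
    case False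
    then obtain p where p: "p \<in> Q" by blast
    then have "Q = {p}" using one by blast
    moreover have "p \<in> P" using p by (simp add: Q_def)
    ultimately show ?thesis using val by (simp add: ga_def)
  qed (use val in \<open>simp add: ga_def\<close>)
qed

lemma Eth_value: "h \<in> {1..n} \<Longrightarrow> Eth n h q h p = (if q = p then 1 else 0)" "h \<in> {1..n} \<Longrightarrow> Eth n (h + 1) q h p = 0"
proof -
  assume h: "h \<in> {1..n}"
  have "2*n + 2 - h \<noteq> h" "2*n + 2 - (h + 1) \<noteq> h" using h by auto
  then show "Eth n h q h p = (if q = p then 1 else 0)" "Eth n (h + 1) q h p = 0"
    by (auto simp: Eth_def Eunit_def)
qed

lemma upper_inj: "h \<in> {1..n} \<Longrightarrow> inj_on (upper n h A) P" and lower_inj: "h \<in> {1..n} \<Longrightarrow> inj_on (lower n h A) P"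
proof -
  assume h: "h \<in> {1..n}"
  show "inj_on (upper n h A) P"
  proof (rule inj_onI)
    fix p q assume "upper n h A p = upper n h A q"
    then have "upper n h A p h p = upper n h A q h p" by simp
    then show "p = q" unfolding upper_def Eth_value[OF h] by (simp split: if_splits)
  qed
  show "inj_on (lower n h A) P"
  proof (rule inj_onI)
    fix p q assume "lower n h A p = lower n h A q"
    then have "lower n h A p h p = lower n h A q h p" by simp
    then show "p = q" unfolding lower_def Eth_value[OF h] by (simp split: if_splits)
  qed
qed

lemma structure_const_bound:
  assumes A: "A \<in> Xi n r" and B: "B \<in> Xi n r" "dm B = id" "sgn_mat n B = 1"
    and X: "associated n r X B" and Y: "associated n r Y A" and Z: "Z \<in> XiD n r"
    and prod: "co n B = ro n A \<Longrightarrow> eB n r B \<otimes>\<^bsub>schurB n r\<^esub> eB n r A = (\<Oplus>\<^bsub>schurB n r\<^esub>p\<in>P. g p \<odot>\<^bsub>schurB n r\<^esub> eB n r (M p))"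
    and P: "finite P" "inj_on M P" and nz: "structure_constK n r X Y Z \<noteq> 0"
  shows "\<exists>p\<in>P. structure_constK n r X Y Z = g p \<or> (\<not> cen (rowW B) \<subseteq> cen (colW B) \<and> 2 * structure_constK n r X Y Z = g p)"
proof -
  have XY: "X \<in> XiD n r" "underlying X = B" "Y \<in> XiD n r" "underlying Y = A" using X Y by (auto simp: associated_def)
  note s = structure_const_B[OF XY(1,3) Z, unfolded XY(2,4), OF B(2,3) nz]
  have mid: "colW B = rowW A" using s(1) by simp
  then have "co n B = ro n A" using co_ro_iff[OF A B(1)] by blast
  note prod' = prod[OF this]
  obtain zB where zB: "zB \<in> carrier H" "zB ** Tsum r (PB (colW B)) = Tsum r (DFull (rowW B) id (colW B))"
    using ex_quotient_full[OF mat_triple_props(1,2)[OF B(1)] WB_id] by blast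
  obtain v where v: "v \<in> W" "cf (zB ** Tsum r (DFull (colW B) (dm A) (colW A))) v = structure_constK n r X Y Z \<or>
      (\<not> cen (rowW B) \<subseteq> cen (colW B) \<and> cf (zB ** Tsum r (DFull (colW B) (dm A) (colW A))) v = 2 * structure_constK n r X Y Z)"
    using s(2) zB by blast
  have "cf (zB ** Tsum r (DFull (colW B) (dm A) (colW A))) v \<in> insert 0 (g ` P)"
    by (rule B_constants[OF A B(1) mid B(2) zB prod' P v(1)])
  then show ?thesis using v(2) nz by (auto simp: image_iff)
qed

end

theorem theorem1p1:
  fixes n r h :: nat
    and A B C :: mat
    and g g' :: "nat \<Rightarrow> int poly"
    and A' B' C' :: dmatrix
  assumes "n \<ge> 1" and "r \<ge> 4" and "h \<in> {1..n}"
    and "A \<in> Xi n r" and "B \<in> Xi n r" and "C \<in> Xi n r"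
    and "diag_mat (\<lambda>i j. B i j - Eth n h (h + 1) i j)"
    and "diag_mat (\<lambda>i j. C i j - Eth n (h + 1) h i j)"
    and "eB n r B \<otimes>\<^bsub>schurB n r\<^esub> eB n r A =
           (if co n B = ro n A
            then \<Oplus>\<^bsub>schurB n r\<^esub>p\<in>{1..2*n + 1}. g p \<odot>\<^bsub>schurB n r\<^esub> eB n r (upper n h A p)
            else \<zero>\<^bsub>schurB n r\<^esub>)"
    and "eB n r C \<otimes>\<^bsub>schurB n r\<^esub> eB n r A =
           (if co n C = ro n A
            then \<Oplus>\<^bsub>schurB n r\<^esub>p\<in>{1..2*n + 1}. g' p \<odot>\<^bsub>schurB n r\<^esub> eB n r (lower n h A p)
            else \<zero>\<^bsub>schurB n r\<^esub>)"
    and "associated n r A' A" and "associated n r B' B" and "associated n r C' C"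
  shows "(\<forall>X\<in>XiD n r. structure_constK n r B' A' X \<noteq> 0 \<longrightarrow>
            (\<exists>p\<in>{1..2*n + 1}. structure_constK n r B' A' X = g p)) \<and>
         (\<forall>X\<in>XiD n r. structure_constK n r C' A' X \<noteq> 0 \<longrightarrow>
            (\<exists>p\<in>{1..2*n + 1}. structure_constK n r C' A' X = g' p \<or>
                              2 * structure_constK n r C' A' X = g' p))"
proof -
  interpret type_B_schur r n using assms(1,2) by unfold_locales auto
  note B = dmat_upper_diag[OF assms(5,3,7)] and C = dmat_lower_diag[OF assms(6,3,8)]
  have prodB: "eB n r B \<otimes>\<^bsub>schurB n r\<^esub> eB n r A = (\<Oplus>\<^bsub>schurB n r\<^esub>p\<in>{1..2*n + 1}. g p \<odot>\<^bsub>schurB n r\<^esub> eB n r (upper n h A p))"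
    if "co n B = ro n A" using assms(9) unfolding if_P[OF that] .
  have prodC: "eB n r C \<otimes>\<^bsub>schurB n r\<^esub> eB n r A = (\<Oplus>\<^bsub>schurB n r\<^esub>p\<in>{1..2*n + 1}. g' p \<odot>\<^bsub>schurB n r\<^esub> eB n r (lower n h A p))"
    if "co n C = ro n A" using assms(10) unfolding if_P[OF that] .
  note fin = finite_atLeastAtMost[of 1 "2*n + 1"]
  show ?thesis
  proof (intro conjI ballI impI)
    fix X assume X: "X \<in> XiD n r" "structure_constK n r B' A' X \<noteq> 0"
    show "\<exists>p\<in>{1..2*n + 1}. structure_constK n r B' A' X = g p"
      using structure_const_bound[OF assms(4,5) B(1,3) assms(12,11) X(1) prodB fin upper_inj[OF assms(3)] X(2)] B(2) by blast
  next
    fix X assume X: "X \<in> XiD n r" "structure_constK n r C' A' X \<noteq> 0"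
    show "\<exists>p\<in>{1..2*n + 1}. structure_constK n r C' A' X = g' p \<or> 2 * structure_constK n r C' A' X = g' p"
      using structure_const_bound[OF assms(4,6) C assms(13,11) X(1) prodC fin lower_inj[OF assms(3)] X(2)] by blast
  qed
qed

end
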